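(* Let $N$ be a compact connected orientable smooth 2-manifold with trivial tangent bundle and finitely many (possibly zero) boundary circles labelled by $\ell$, with fixed base point $\bar x$, fixed boundary families $\alpha_{\ell,\phi}$, and a fixed finite set $\Upsilon_0$ of primitive loops. Let the physical state space be the kernel of the quantum constraint operators, i.e. the set of wave functionals $\Psi[\omega_i,u]$ with $$\mathbf H[n]\,\Psi[\omega_i,u]=0,\qquad \mathbf L[\lambda]\,\Psi[\omega_i,u]=0$$ for all smooth $\mathfrak{sl}(2)$-valued functions $n,\lambda$ on $N$ (operators defined in the context). Say that $(\omega_i,u)$ satisfies condition (Q) if there are a smooth normalized quasiperiodic function $\tilde g:\widetilde N\to\widetilde{\mathsf{SL}}(2)$ and elements $b_\ell\in\mathsf{SL}(2)$, one for each boundary $\ell$, with $$\omega_i(x)=g^{-1}\partial_ig(\alpha_x)\quad(\pi(\alpha_x)=x),\qquad u(\phi)=b_\ell^{-1}g(\alpha_{\ell,\phi});$$ in this case put $\tilde g_\lambda=\tilde g(\lambda)$ for loops $\lambda\in\Upsilon$. (1) If $N$ has at least one boundary, choose one and call it $\ell=\mathrm o$. Then the physical state space is given by the set of wave functionals $$\Psi[\omega_i,u]=\begin{cases}\mathcal F\big(\{\tilde g_{\mathrm o,\lambda}\,|\,\lambda\in\Upsilon_0\},\{b_{\mathrm o,\ell}\,|\,\ell\neq\mathrm o\}\big)&\text{if (Q) holds},\\0&\text{otherwise},\end{cases}$$ where $\tilde g_{\mathrm o,\lambda}=b_{\mathrm o}^{-1}\tilde g_\lambda b_{\mathrm o}\in\widetilde{\mathsf{SL}}(2)$,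 $b_{\mathrm o,\ell}=b_{\mathrm o}^{-1}b_\ell\in\mathsf{SL}(2)$, and $\mathcal F$ is an arbitrary complex valued function of these variables. (2) If $N$ has no boundary, the general solution of the constraint equations is $$\Psi[\omega_i]=\begin{cases}\mathcal F\big(\{\tilde g_\lambda\,|\,\lambda\in\Upsilon_0\}\big)&\text{if (Q) holds},\\0&\text{otherwise},\end{cases}$$ where $\mathcal F$ is a complex valued function subject to the relation $$\mathcal F(\{\tilde g_\lambda\})=\mathcal F(\{h_0^{-1}\tilde g_\lambda h_0\})\quad\text{for any }h_0\in\mathsf{SL}(2),$$ and the support of $\mathcal F$ is restricted by the relations present between the primitive loops, i.e. $\mathcal F$ lives on those families $\{\tilde g_\lambda\}_{\lambda\in\Upsilon_0}$ in $\widetilde{\mathsf{SL}}(2)$ which satisfy the corresponding relations.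
   Context: Groups. $\mathsf{SL}(2)=\mathsf{SL}(2,\mathbb R)$ with Lie algebra $\mathfrak{sl}(2)$. $\widetilde{\mathsf{SL}}(2)$ is the universal covering group of $\mathsf{SL}(2)$; dropping the tilde denotes the projection $\tilde g\mapsto g\in\mathsf{SL}(2)$. For $h\in\mathsf{SL}(2)$ and $\tilde g\in\widetilde{\mathsf{SL}}(2)$, $h^{-1}\tilde gh:=\tilde h^{-1}\tilde g\tilde h$ for any $\tilde h\in\widetilde{\mathsf{SL}}(2)$ projecting to $h$ (independent of the choice of $\tilde h$). Covering manifold. $\widetilde N$ is the set of homotopy classes (with fixed end points) of paths $\alpha:[0,1]\to N$ with $\alpha(0)=\bar x$, i.e. the universal cover, with projection $\pi(\alpha)=\alpha(1)$, locally carrying the same coordinates as $N$. $\alpha\bullet\beta$ denotes $\alpha$ followed by $\beta$. The loop group $\Upsilon=\pi^{-1}(\bar x)\subset\widetilde N$ is the group of classes of loops at $\bar x$ with product $\bullet$. A set of primitive loops is a finite set $\Upsilon_0\subset\Upsilon$ such that every element of $\Upsilon$ is a finite product of elements of $\Upsilon_0$ and their inverses; $\Upsilon$ is then the free group on $\Upsilon_0$ modulo relations. Quasiperiodic functions. A map $\tilde g:\widetilde N\to\widetilde{\mathsf{SL}}(2)$ is normalized quasiperiodic if $\tilde g(\lambda\bullet\alpha)=\tilde g(\lambda)\,\tilde g(\alpha)$ for all $\lambda\in\Upsilon$, $\alpha\in\widetilde N$. Boundary family. Each boundary circle $\ell$ carries an angular coordinate $\phi$ of period $2\pi$; the boundary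 family is a fixed continuous map $\mathbb R\to\widetilde N$, $\phi\mapsto\alpha_{\ell,\phi}$, such that $\pi(\alpha_{\ell,\phi})$ is the point of the circle with coordinate $\phi$ (mod $2\pi$). Configuration variables. $\omega_i$ is a smooth $\mathfrak{sl}(2)$-valued one-form on $N$; $u$ stands for a collection of smooth functions $u:\mathbb R\to\mathsf{SL}(2)$ of $\phi$, one for each boundary circle $\ell$, with $u(\phi+2\pi)=u_\ell u(\phi)$ for some constant $u_\ell\in\mathsf{SL}(2)$ (no $u$ is present if $N$ has no boundary). If (Q) holds for $(\omega_i,u)$, then $\tilde g$ and the $b_\ell$ are uniquely determined by $(\omega_i,u)$. Constraint operators. They act on complex valued functionals $\Psi[\omega_i,u]$; $n,\lambda:N\to\mathfrak{sl}(2)$ are smooth up to the boundary, $F_{ij}=\partial_i\omega_j-\partial_j\omega_i+[\omega_i,\omega_j]$, $D_i\lambda=\partial_i\lambda+[\omega_i,\lambda]$, $\varepsilon^{ij}$ is the Levi-Civita density on $N$, $\omega_\phi$ is the component of $\omega$ tangent to the boundary, and in boundary terms $n,\lambda$ are evaluated at the boundary point with coordinate $\phi$. The Hamilton constraint is the multiplication operator $$\mathbf H[n]=\frac{i}{\hbar}\int_N d^2x\,\tfrac12\varepsilon^{ij}\,\mathrm{Tr}(nF_{ij})+\frac{i}{\hbar}\sum_\ell\oint d\phi\,\mathrm{Tr}\big(n\,(u^{-1}\partial_\phi u-\omega_\phi)\big).$$ The Lorentz constraint is the first order homogeneous functional differential operator $$\mathbf L[\lambda]=\int_N d^2x\,\mathrm{Tr}\Big(D_i\lambda\,\frac{\delta}{\delta\omega_i}\Big)+\sum_\ell\int_{-\infty}^{\infty}d\phi\,\mathrm{Tr}\Big(u\lambda\,\frac{\delta}{\delta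 u}\Big),$$ so that $\mathbf L[\lambda]\omega_i=D_i\lambda$, $\mathbf L[\lambda]u=u\lambda$ and the Leibniz rule holds. Thus $\mathbf L[\lambda]\Psi$ is the derivative of $\Psi$ along the infinitesimal local Lorentz rotation $\delta\omega_i=D_i\lambda$, $\delta u=u\lambda$, that is, the derivative at $s=0$ of $\Psi[h_s^{-1}\partial_ih_s+h_s^{-1}\omega_ih_s,\,uh_s]$ with $h_s=\exp(s\lambda)$. No other differentiability or continuity of $\Psi$ is assumed. *)

theory Defs
  imports "HOL-Analysis.Analysis" "HOL-Algebra.Generated_Groups"
begin

section \<open>Smooth functions and surfaces with boundary\<close>

primrec Ck_on :: "nat \<Rightarrow> 'a::real_normed_vector set \<Rightarrow> ('a \<Rightarrow> 'b::real_normed_vector) \<Rightarrow> bool" where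
  "Ck_on 0 S f \<longleftrightarrow> continuous_on S f"
| "Ck_on (Suc k) S f \<longleftrightarrow> (\<forall>x\<in>S. f differentiable (at x)) \<and>
     (\<forall>v. Ck_on k S (\<lambda>x. frechet_derivative f (at x) v))"

text \<open>Intended for open \<open>S\<close>.\<close>
definition smooth_on :: "'a::real_normed_vector set \<Rightarrow> ('a \<Rightarrow> 'b::real_normed_vector) \<Rightarrow> bool" where
  "smooth_on S f \<longleftrightarrow> (\<forall>k. Ck_on k S f)"

text \<open>Smoothness up to the boundary, for relatively open subsets of the half plane.\<close>
definition smooth_upto :: "(real^2) set \<Rightarrow> (real^2 \<Rightarrow> 'b::real_normed_vector) \<Rightarrow> bool" where
  "smooth_upto S f \<longleftrightarrow>
     (\<forall>p\<in>S. \<exists>V g. open V \<and> p \<in> V \<and> smooth_on V g \<and> (\<forall>q\<in>V \<inter> S. g q = f q))"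

definition half_plane :: "(real^2) set" where
  "half_plane = {p. 0 \<le> p $ 2}"

text \<open>A chart is a pair of its domain and its coordinate map. Only the values of the coordinate
  map on the domain matter.\<close>
type_synonym 'a chart = "'a set \<times> ('a \<Rightarrow> real^2)"

definition in_coords :: "'a chart \<Rightarrow> ('a \<Rightarrow> 'b) \<Rightarrow> real^2 \<Rightarrow> 'b" where
  "in_coords k f = f \<circ> inv_into (fst k) (snd k)"

definition smooth_wrt :: "'a chart set \<Rightarrow> ('a \<Rightarrow> 'b::real_normed_vector) \<Rightarrow> bool" where
  "smooth_wrt C f \<longleftrightarrow> (\<forall>k\<in>C. smooth_upto (snd k ` fst k) (in_coords k f))"

text \<open>Coordinate partial derivative of \<open>f\<close> at the point \<open>q\<close>; one-sided at boundary points.\<close>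
definition partial :: "'a chart \<Rightarrow> 2 \<Rightarrow> ('a \<Rightarrow> 'b::real_normed_vector) \<Rightarrow> 'a \<Rightarrow> 'b" where
  "partial k i f q =
     frechet_derivative (in_coords k f) (at (snd k q) within snd k ` fst k) (axis i 1)"

text \<open>The entry \<open>$ j $ i\<close> is the derivative of the \<open>j\<close>-th coordinate of \<open>k'\<close> by the \<open>i\<close>-th
  coordinate of \<open>k\<close>.\<close>
definition jacobian :: "'a chart \<Rightarrow> 'a chart \<Rightarrow> 'a \<Rightarrow> real^2^2" where
  "jacobian k k' q =
     matrix (frechet_derivative (in_coords k (snd k')) (at (snd k q) within snd k ` (fst k \<inter> fst k')))"

text \<open>The boundary circles are part of the data: \<open>circle S l \<phi>\<close> is the point with angular
  coordinate \<open>\<phi>\<close> on the circle labelled \<open>l\<close>.\<close>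
record ('a, 'l) surface =
  points :: "'a set"
  charts :: "'a chart set"
  labels :: "'l set"
  circle :: "'l \<Rightarrow> real \<Rightarrow> 'a"

definition chart_of :: "'a::topological_space set \<Rightarrow> 'a chart \<Rightarrow> bool" where
  "chart_of N k \<longleftrightarrow>
     openin (top_of_set N) (fst k) \<and>
     openin (top_of_set half_plane) (snd k ` fst k) \<and>
     homeomorphism (fst k) (snd k ` fst k) (snd k) (inv_into (fst k) (snd k))"

definition smooth_surface :: "('a::topological_space, 'l) surface \<Rightarrow> bool" where
  "smooth_surface S \<longleftrightarrow>
     (\<forall>k\<in>charts S. chart_of (points S) k) \<and>
     (\<Union>k\<in>charts S. fst k) = points S \<and>
     (\<forall>k\<in>charts S. \<forall>k'\<in>charts S.
        smooth_upto (snd k ` (fst k \<inter> fst k')) (in_coords k (snd k')))"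

text \<open>The orientation enters through the Levi-Civita density in the Hamilton constraint. It is
  given by the choice of an atlas with positive Jacobians. In dimension 2 every orientable smooth
  surface has such an atlas with values in the half plane.\<close>
definition oriented_surface :: "('a::topological_space, 'l) surface \<Rightarrow> bool" where
  "oriented_surface S \<longleftrightarrow>
     (\<forall>k\<in>charts S. \<forall>k'\<in>charts S. \<forall>q\<in>fst k \<inter> fst k'. 0 < det (jacobian k k' q))"

text \<open>A global smooth frame: the columns of \<open>E k q\<close> are the components of two vector fields
  in the chart \<open>k\<close>.\<close>
definition trivial_tangent_bundle :: "('a, 'l) surface \<Rightarrow> bool" where
  "trivial_tangent_bundle S \<longleftrightarrow>
     (\<exists>E :: 'a chart \<Rightarrow> 'a \<Rightarrow> real^2^2.
        (\<forall>k\<in>charts S. smooth_upto (snd k ` fst k) (in_coords k (E k)) \<and>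
           (\<forall>q\<in>fst k. invertible (E k q))) \<and>
        (\<forall>k\<in>charts S. \<forall>k'\<in>charts S. \<forall>q\<in>fst k \<inter> fst k'. E k' q = jacobian k k' q ** E k q))"

definition boundary_points :: "('a, 'l) surface \<Rightarrow> 'a set" where
  "boundary_points S = {q. \<exists>k\<in>charts S. q \<in> fst k \<and> snd k q $ 2 = 0}"

definition boundary_circles :: "('a::topological_space, 'l) surface \<Rightarrow> bool" where
  "boundary_circles S \<longleftrightarrow>
     finite (labels S) \<and>
     (\<forall>l\<in>labels S.
        continuous_on UNIV (circle S l) \<and>
        (\<forall>\<phi>. circle S l (\<phi> + 2 * pi) = circle S l \<phi>) \<and>
        inj_on (circle S l) {0..<2 * pi} \<and>
        (\<forall>k\<in>charts S. smooth_on (circle S l -` fst k) (snd k \<circ> circle S l) \<and>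
           (\<forall>\<phi>\<in>circle S l -` fst k. vector_derivative (snd k \<circ> circle S l) (at \<phi>) \<noteq> 0))) \<and>
     disjoint_family_on (\<lambda>l. range (circle S l)) (labels S) \<and>
     (\<Union>l\<in>labels S. range (circle S l)) = boundary_points S"


section \<open>Homotopy classes of paths and universal covers\<close>

definition path_class :: "'a::topological_space set \<Rightarrow> (real \<Rightarrow> 'a) \<Rightarrow> (real \<Rightarrow> 'a) set" where
  "path_class X p = {q. homotopic_paths X p q}"

definition ucover :: "'a::topological_space set \<Rightarrow> 'a \<Rightarrow> (real \<Rightarrow> 'a) set set" where
  "ucover X a = {path_class X p | p. path p \<and> path_image p \<subseteq> X \<and> pathstart p = a}"

definition cover_proj :: "(real \<Rightarrow> 'a::topological_space) set \<Rightarrow> 'a" where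
  "cover_proj c = pathfinish (SOME p. p \<in> c)"

definition class_join ::
  "'a::topological_space set \<Rightarrow> (real \<Rightarrow> 'a) set \<Rightarrow> (real \<Rightarrow> 'a) set \<Rightarrow> (real \<Rightarrow> 'a) set" where
  "class_join X c d = {r. \<exists>p\<in>c. \<exists>q\<in>d. homotopic_paths X (p +++ q) r}"

text \<open>All prolongations of \<open>c\<close> by a path that stays in \<open>U\<close>. For \<open>X\<close> connected and locally simply
  connected, these sets generate the usual topology of the universal cover.\<close>
definition prolongations ::
  "'a::topological_space set \<Rightarrow> (real \<Rightarrow> 'a) set \<Rightarrow> 'a set \<Rightarrow> (real \<Rightarrow> 'a) set set" where
  "prolongations X c U =
     {class_join X c (path_class X q) | q. path q \<and> path_image q \<subseteq> X \<inter> U \<and> pathstart q = cover_proj c}"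

definition ucover_topology :: "'a::topological_space set \<Rightarrow> 'a \<Rightarrow> (real \<Rightarrow> 'a) set topology" where
  "ucover_topology X a = topology_generated_by {prolongations X c U | c U. c \<in> ucover X a \<and> open U}"

definition sheet_over :: "'a::topological_space set \<Rightarrow> 'a \<Rightarrow> 'a set \<Rightarrow> (real \<Rightarrow> 'a) set set \<Rightarrow> bool" where
  "sheet_over X a U W \<longleftrightarrow>
     openin (ucover_topology X a) W \<and> inj_on cover_proj W \<and> cover_proj ` W \<subseteq> U"

definition lift_chart :: "'a::topological_space chart \<Rightarrow> (real \<Rightarrow> 'a) set set \<Rightarrow> (real \<Rightarrow> 'a) set chart" where
  "lift_chart k W = (W, snd k \<circ> cover_proj)"

definition cover_charts ::
  "('a::topological_space, 'l) surface \<Rightarrow> 'a \<Rightarrow> (real \<Rightarrow> 'a) set chart set" where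
  "cover_charts S a = {lift_chart k W | k W. k \<in> charts S \<and> sheet_over (points S) a (fst k) W}"

definition loop_group :: "'a::topological_space set \<Rightarrow> 'a \<Rightarrow> (real \<Rightarrow> 'a) set monoid" where
  "loop_group X a =
     \<lparr>carrier = {c \<in> ucover X a. cover_proj c = a}, mult = class_join X, one = path_class X (\<lambda>t. a)\<rparr>"

definition primitive_loops ::
  "('a::topological_space, 'l) surface \<Rightarrow> 'a \<Rightarrow> (real \<Rightarrow> 'a) set set \<Rightarrow> bool" where
  "primitive_loops S a Y \<longleftrightarrow>
     finite Y \<and> Y \<subseteq> carrier (loop_group (points S) a) \<and>
     generate (loop_group (points S) a) Y = carrier (loop_group (points S) a)"

definition boundary_families ::
  "('a::topological_space, 'l) surface \<Rightarrow> 'a \<Rightarrow> ('l \<Rightarrow> real \<Rightarrow> (real \<Rightarrow> 'a) set) \<Rightarrow> bool" where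
  "boundary_families S a \<alpha> \<longleftrightarrow>
     (\<forall>l\<in>labels S. continuous_map euclideanreal (ucover_topology (points S) a) (\<alpha> l) \<and>
        (\<forall>\<phi>. cover_proj (\<alpha> l \<phi>) = circle S l \<phi>))"


section \<open>The group \<open>SL(2)\<close> and its universal covering group\<close>

definition SL2 :: "(real^2^2) set" where
  "SL2 = {A. det A = 1}"

definition sl2 :: "(real^2^2) set" where
  "sl2 = {A. trace A = 0}"

primrec mpow :: "real^'n^'n \<Rightarrow> nat \<Rightarrow> real^'n^'n" where
  "mpow A 0 = mat 1"
| "mpow A (Suc k) = A ** mpow A k"

definition mexp :: "real^'n^'n \<Rightarrow> real^'n^'n" where
  "mexp A = (\<Sum>k. mpow A k /\<^sub>R fact k)"

abbreviation SL2_ucover_topology :: "(real \<Rightarrow> real^2^2) set topology" where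
  "SL2_ucover_topology \<equiv> ucover_topology SL2 (mat 1)"

text \<open>The product is induced by the pointwise product of paths.\<close>
definition SL2_cover :: "(real \<Rightarrow> real^2^2) set monoid" where
  "SL2_cover =
     \<lparr>carrier = ucover SL2 (mat 1),
      mult = \<lambda>c d. {r. \<exists>p\<in>c. \<exists>q\<in>d. homotopic_paths SL2 (\<lambda>t. p t ** q t) r},
      one = path_class SL2 (\<lambda>t. mat 1)\<rparr>"

text \<open>\<open>conj_by h g\<close> is \<open>h\<inverse> g h\<close> for \<open>h\<close> in \<open>SL(2)\<close> and \<open>g\<close> in the covering group.\<close>
definition conj_by :: "real^2^2 \<Rightarrow> (real \<Rightarrow> real^2^2) set \<Rightarrow> (real \<Rightarrow> real^2^2) set" where
  "conj_by h g =
     (let k = SOME k. k \<in> carrier SL2_cover \<and> cover_proj k = h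
      in (inv\<^bsub>SL2_cover\<^esub> k) \<otimes>\<^bsub>SL2_cover\<^esub> g \<otimes>\<^bsub>SL2_cover\<^esub> k)"

text \<open>Since the projection to \<open>SL(2)\<close> is a local diffeomorphism, a map into the covering group is
  smooth iff it is continuous and its projection is smooth.\<close>
definition smooth_to_SL2_cover ::
  "('a::topological_space, 'l) surface \<Rightarrow> 'a \<Rightarrow> ((real \<Rightarrow> 'a) set \<Rightarrow> (real \<Rightarrow> real^2^2) set) \<Rightarrow> bool" where
  "smooth_to_SL2_cover S a g \<longleftrightarrow>
     continuous_map (ucover_topology (points S) a) SL2_ucover_topology g \<and>
     smooth_wrt (cover_charts S a) (\<lambda>c. cover_proj (g c))"

definition normalized_quasiperiodic ::
  "('a::topological_space, 'l) surface \<Rightarrow> 'a \<Rightarrow> ((real \<Rightarrow> 'a) set \<Rightarrow> (real \<Rightarrow> real^2^2) set) \<Rightarrow> bool" where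
  "normalized_quasiperiodic S a g \<longleftrightarrow>
     (\<forall>c\<in>carrier (loop_group (points S) a). \<forall>d\<in>ucover (points S) a.
        g (class_join (points S) c d) = g c \<otimes>\<^bsub>SL2_cover\<^esub> g d)"

text \<open>A word is a list of letters; the flag \<open>False\<close> marks an inverse letter.\<close>
definition word_value :: "'g monoid \<Rightarrow> ('y \<Rightarrow> 'g) \<Rightarrow> ('y \<times> bool) list \<Rightarrow> 'g" where
  "word_value G f w =
     foldr (\<lambda>(y, e) z. (if e then f y else inv\<^bsub>G\<^esub> (f y)) \<otimes>\<^bsub>G\<^esub> z) w \<one>\<^bsub>G\<^esub>"

definition satisfies_relations ::
  "('a::topological_space, 'l) surface \<Rightarrow> 'a \<Rightarrow> (real \<Rightarrow> 'a) set set \<Rightarrow>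
     ((real \<Rightarrow> 'a) set \<Rightarrow> (real \<Rightarrow> real^2^2) set) \<Rightarrow> bool" where
  "satisfies_relations S a Y f \<longleftrightarrow>
     (\<forall>w\<in>lists (Y \<times> UNIV).
        word_value (loop_group (points S) a) (\<lambda>y. y) w = \<one>\<^bsub>loop_group (points S) a\<^esub> \<longrightarrow>
        word_value SL2_cover f w = \<one>\<^bsub>SL2_cover\<^esub>)"


section \<open>Configuration variables\<close>

text \<open>A one-form is given by its components in every chart of the atlas. Components outside the
  atlas or outside the domain of the chart are set to zero, so that equal one-forms are equal
  functions; likewise \<open>u\<close> is only defined on the boundary labels.\<close>
type_synonym 'a form = "'a chart \<Rightarrow> 'a \<Rightarrow> 2 \<Rightarrow> real^2^2"
type_synonym ('a, 'l) config = "'a form \<times> ('l \<Rightarrow> real \<Rightarrow> real^2^2)"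

definition sl2_forms :: "('a, 'l) surface \<Rightarrow> 'a form set" where
  "sl2_forms S = {\<omega>.
     (\<forall>k q i. \<not> (k \<in> charts S \<and> q \<in> fst k) \<longrightarrow> \<omega> k q i = 0) \<and>
     (\<forall>k\<in>charts S. \<forall>i. smooth_upto (snd k ` fst k) (in_coords k (\<lambda>q. \<omega> k q i)) \<and>
        (\<forall>q\<in>fst k. \<omega> k q i \<in> sl2)) \<and>
     (\<forall>k\<in>charts S. \<forall>k'\<in>charts S. \<forall>q\<in>fst k \<inter> fst k'. \<forall>i.
        \<omega> k q i = (\<Sum>j\<in>UNIV. jacobian k k' q $ j $ i *\<^sub>R \<omega> k' q j))}"

definition boundary_variables :: "('a, 'l) surface \<Rightarrow> ('l \<Rightarrow> real \<Rightarrow> real^2^2) set" where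
  "boundary_variables S = {u \<in> extensional (labels S). \<forall>l\<in>labels S.
     smooth_on UNIV (u l) \<and> range (u l) \<subseteq> SL2 \<and>
     (\<exists>m\<in>SL2. \<forall>\<phi>. u l (\<phi> + 2 * pi) = m ** u l \<phi>)}"

definition configs :: "('a, 'l) surface \<Rightarrow> ('a, 'l) config set" where
  "configs S = sl2_forms S \<times> boundary_variables S"

definition sl2_functions :: "('a, 'l) surface \<Rightarrow> ('a \<Rightarrow> real^2^2) set" where
  "sl2_functions S = {n. smooth_wrt (charts S) n \<and> (\<forall>q\<in>points S. n q \<in> sl2)}"


section \<open>Constraint operators\<close>

definition levi_civita :: "2 \<Rightarrow> 2 \<Rightarrow> real" where
  "levi_civita i j = (if i = 1 \<and> j = 2 then 1 else if i = 2 \<and> j = 1 then -1 else 0)"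

definition curvature :: "'a form \<Rightarrow> 'a chart \<Rightarrow> 'a \<Rightarrow> 2 \<Rightarrow> 2 \<Rightarrow> real^2^2" where
  "curvature \<omega> k q i j =
     partial k i (\<lambda>q. \<omega> k q j) q - partial k j (\<lambda>q. \<omega> k q i) q +
     (\<omega> k q i ** \<omega> k q j - \<omega> k q j ** \<omega> k q i)"

definition partition_of_unity ::
  "('a::topological_space, 'l) surface \<Rightarrow> 'a chart set \<Rightarrow> ('a chart \<Rightarrow> 'a \<Rightarrow> real) \<Rightarrow> bool" where
  "partition_of_unity S K \<rho> \<longleftrightarrow>
     finite K \<and> K \<subseteq> charts S \<and>
     (\<forall>k\<in>K. continuous_on (points S) (\<rho> k) \<and> (\<forall>q\<in>points S. 0 \<le> \<rho> k q) \<and>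
        points S \<inter> closure {q \<in> points S. \<rho> k q \<noteq> 0} \<subseteq> fst k) \<and>
     (\<forall>q\<in>points S. (\<Sum>k\<in>K. \<rho> k q) = 1)"

text \<open>Integral of a density, given by its component in every chart; it does not depend on the
  chosen partition of unity.\<close>
definition surface_integral ::
  "('a::topological_space, 'l) surface \<Rightarrow> ('a chart \<Rightarrow> 'a \<Rightarrow> real) \<Rightarrow> real" where
  "surface_integral S \<mu> =
     (let (K, \<rho>) = (SOME (K, \<rho>). partition_of_unity S K \<rho>)
      in \<Sum>k\<in>K. LINT p:snd k ` fst k|lborel. in_coords k (\<lambda>q. \<rho> k q * \<mu> k q) p)"

text \<open>The component of \<open>\<omega>\<close> along the boundary does not depend on the chosen chart.\<close>
definition tangential :: "('a, 'l) surface \<Rightarrow> 'a form \<Rightarrow> 'l \<Rightarrow> real \<Rightarrow> real^2^2" where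
  "tangential S \<omega> l \<phi> =
     (let k = SOME k. k \<in> charts S \<and> circle S l \<phi> \<in> fst k
      in \<Sum>i\<in>UNIV. vector_derivative (snd k \<circ> circle S l) (at \<phi>) $ i *\<^sub>R \<omega> k (circle S l \<phi>) i)"

definition hamilton ::
  "real \<Rightarrow> ('a::topological_space, 'l) surface \<Rightarrow> ('a \<Rightarrow> real^2^2) \<Rightarrow> ('a, 'l) config \<Rightarrow> complex" where
  "hamilton hbar S n = (\<lambda>(\<omega>, u).
     \<i> / of_real hbar * of_real (surface_integral S
        (\<lambda>k q. \<Sum>i\<in>UNIV. \<Sum>j\<in>UNIV. 1 / 2 * levi_civita i j * trace (n q ** curvature \<omega> k q i j))) +
     \<i> / of_real hbar * of_real (\<Sum>l\<in>labels S. LINT \<phi>:{0..2 * pi}|lborel.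
        trace (n (circle S l \<phi>) **
          (matrix_inv (u l \<phi>) ** vector_derivative (u l) (at \<phi>) - tangential S \<omega> l \<phi>))))"

definition lorentz_rotation ::
  "('a, 'l) surface \<Rightarrow> ('a \<Rightarrow> real^2^2) \<Rightarrow> ('a, 'l) config \<Rightarrow> ('a, 'l) config" where
  "lorentz_rotation S h = (\<lambda>(\<omega>, u).
     (\<lambda>k q i. if k \<in> charts S \<and> q \<in> fst k
        then matrix_inv (h q) ** partial k i h q + matrix_inv (h q) ** \<omega> k q i ** h q else 0,
      \<lambda>l\<in>labels S. \<lambda>\<phi>. u l \<phi> ** h (circle S l \<phi>)))"

text \<open>\<open>lorentz_has S m \<Psi> X D\<close> states that the Lorentz constraint operator smeared with \<open>m\<close> can be
  applied to \<open>\<Psi>\<close> at \<open>X\<close> and that the result is \<open>D\<close>.\<close>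
definition lorentz_has ::
  "('a, 'l) surface \<Rightarrow> ('a \<Rightarrow> real^2^2) \<Rightarrow> (('a, 'l) config \<Rightarrow> complex) \<Rightarrow> ('a, 'l) config \<Rightarrow> complex \<Rightarrow> bool"
  where
  "lorentz_has S m \<Psi> X D \<longleftrightarrow>
     ((\<lambda>s. \<Psi> (lorentz_rotation S (\<lambda>q. mexp (s *\<^sub>R m q)) X)) has_vector_derivative D) (at 0)"

text \<open>Wave functionals are functionals on \<open>configs S\<close>; their values elsewhere are irrelevant.\<close>
definition physical_states ::
  "real \<Rightarrow> ('a::topological_space, 'l) surface \<Rightarrow> (('a, 'l) config \<Rightarrow> complex) set" where
  "physical_states hbar S = {\<Psi>. \<forall>X\<in>configs S.
     (\<forall>n\<in>sl2_functions S. hamilton hbar S n X * \<Psi> X = 0) \<and>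
     (\<forall>m\<in>sl2_functions S. lorentz_has S m \<Psi> X 0)}"


section \<open>Condition (Q)\<close>

definition condition_Q ::
  "('a::topological_space, 'l) surface \<Rightarrow> 'a \<Rightarrow> ('l \<Rightarrow> real \<Rightarrow> (real \<Rightarrow> 'a) set) \<Rightarrow> ('a, 'l) config \<Rightarrow>
     ((real \<Rightarrow> 'a) set \<Rightarrow> (real \<Rightarrow> real^2^2) set) \<Rightarrow> ('l \<Rightarrow> real^2^2) \<Rightarrow> bool" where
  "condition_Q S a \<alpha> = (\<lambda>(\<omega>, u) g b.
     smooth_to_SL2_cover S a g \<and> normalized_quasiperiodic S a g \<and>
     (\<forall>l\<in>labels S. b l \<in> SL2) \<and>
     (\<forall>k\<in>charts S. \<forall>W. sheet_over (points S) a (fst k) W \<longrightarrow>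
        (\<forall>c\<in>W. \<forall>i. \<omega> k (cover_proj c) i =
           matrix_inv (cover_proj (g c)) ** partial (lift_chart k W) i (\<lambda>d. cover_proj (g d)) c)) \<and>
     (\<forall>l\<in>labels S. \<forall>\<phi>. u l \<phi> = matrix_inv (b l) ** cover_proj (g (\<alpha> l \<phi>))))"

end

theory Submission
  imports Defs
begin

text \<open>The Hamilton constraint confines a state to the flat connections whose boundary values satisfy
  \<open>u\<inverse> \<partial>\<^sub>\<phi> u = \<omega>\<^sub>\<phi>\<close>, since test functions supported near a point detect a curvature or a boundary
  defect there. These are the configurations with (Q): the function \<open>g\<close> is the parallel
  transport from the base point, and radial transport in a chart gives the local horizontal sections.
  The Lorentz constraint makes a state constant along the flows of \<open>exp (s \<lambda>)\<close>. Two solutions of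
  (Q) with the same invariants differ by a gauge function that lifts to the covering group, and by
  the Iwasawa decomposition such a function is a product of three exponentials, so that the state
  takes the same value on both.\<close>

subsection \<open>Smooth functions\<close>

text \<open>Nothing is known of a state beyond a vanishing derivative along each orbit of
  \<open>exp (s \<lambda>)\<close>. These rotations form one-parameter groups, so it is constant on
  orbits, but this says nothing about gauge functions N -> SL(2) that are no products of
  exponentials; they may exist, since SL(2) contains a circle. Hence the invariants take values in
  the covering group: if the lifted holonomies of g and g' are conjugate by an element \<gamma>,
  then g^-1 \<gamma> g' does not change under loops and is a function on N with values in the
  covering group. There the first column of a matrix has a single valued logarithm, which supplies
  the Iwasawa angle. The kernel of the projection to SL(2) is central, so elements of SL(2) suffice
  for conjugation. A state determines F by its value at any configuration with the given invariants.
  At a boundary point a form extends smoothly across the edge of the half plane, but not flatly.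
  Transport along rays copes with this: only the curvature on the segment to p enters the derivative
  at p, and segments between points of a half disc stay in it.\<close>

abbreviation fderiv where "fderiv f x \<equiv> frechet_derivative f (at x)"

lemma Ck_on_cong:
  assumes "open S" "\<And>x. x \<in> S \<Longrightarrow> f x = g x" "Ck_on k S f"
  shows "Ck_on k S g"
  using assms(2,3)
proof (induction k arbitrary: f g)
  case 0
  then show ?case by (auto cong: continuous_on_cong)
next
  case (Suc k)
  have d: "(g has_derivative fderiv f x) (at x)" if "x \<in> S" for x
    using Suc.prems that assms(1)
    by (auto intro: has_derivative_transform_within_open[of f _ x UNIV S] simp: frechet_derivative_works)
  then have e: "fderiv g x = fderiv f x" if "x \<in> S" for x
    using that frechet_derivative_at by metis
  have "Ck_on k S (\<lambda>x. fderiv g x v)" for v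
    by (rule Suc.IH[of "\<lambda>x. fderiv f x v"]) (use e Suc.prems in auto)
  then show ?case using d by (auto simp: differentiable_def)
qed

lemma Ck_on_subset: "Ck_on k S f \<Longrightarrow> T \<subseteq> S \<Longrightarrow> Ck_on k T f"
  by (induction k arbitrary: f) (auto intro: continuous_on_subset)

lemma Ck_on_continuous: "Ck_on k S f \<Longrightarrow> continuous_on S f"
  by (cases k) (auto intro!: continuous_at_imp_continuous_on differentiable_imp_continuous_within)

lemma Ck_on_SucD: "Ck_on (Suc k) S f \<Longrightarrow> Ck_on k S f"
proof (induction k arbitrary: f)
  case 0 then show ?case by (auto intro!: continuous_at_imp_continuous_on differentiable_imp_continuous_within)
next
  case (Suc k) then show ?case by (metis Ck_on.simps(2))
qed

text \<open>Lets an explicit derivative take the place of \<open>frechet_derivative\<close>; the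
  inductions below then only have to bring a derivative formula into a form covered by the induction
  hypothesis.\<close>

lemma Ck_on_SucI:
  assumes "open S" "\<And>x. x \<in> S \<Longrightarrow> (f has_derivative f' x) (at x)" "\<And>v. Ck_on k S (\<lambda>x. f' x v)"
  shows "Ck_on (Suc k) S f"
proof -
  have "Ck_on k S (\<lambda>x. fderiv f x v)" for v
    by (rule Ck_on_cong[OF assms(1) _ assms(3)[of v]]) (use assms(2) frechet_derivative_at in metis)
  with assms(2) show ?thesis by (auto simp: differentiable_def)
qed

lemma Ck_on_has_derivative:
  "Ck_on (Suc k) S f \<Longrightarrow> x \<in> S \<Longrightarrow> (f has_derivative fderiv f x) (at x)"
  by (auto simp: frechet_derivative_works)

lemma Ck_on_const: "Ck_on k S (\<lambda>x. c)"
  by (induction k arbitrary: c) auto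

lemma Ck_on_bounded_linear:
  assumes "bounded_linear L" "open S"
  shows "Ck_on k S L"
proof (cases k)
  case 0 then show ?thesis by (simp add: assms linear_continuous_on)
next
  case (Suc j)
  show ?thesis unfolding Suc
    by (rule Ck_on_SucI[where f'="\<lambda>_. L"]) (auto simp: assms bounded_linear_imp_has_derivative Ck_on_const)
qed

lemma Ck_on_linear_comp:
  assumes "bounded_linear L" "open S" "Ck_on k S f"
  shows "Ck_on k S (\<lambda>x. L (f x))"
  using assms(3)
proof (induction k arbitrary: f)
  case 0 then show ?case using assms(1) by (auto intro: bounded_linear.continuous_on)
next
  case (Suc k)
  show ?case
    by (rule Ck_on_SucI[where f'="\<lambda>x v. L (fderiv f x v)"])
      (use Suc assms in \<open>auto intro!: bounded_linear.has_derivative[OF assms(1)] Ck_on_has_derivative\<close>)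
qed

lemma Ck_on_add:
  assumes "open S" "Ck_on k S f" "Ck_on k S g"
  shows "Ck_on k S (\<lambda>x. f x + g x)"
  using assms(2,3)
proof (induction k arbitrary: f g)
  case 0 then show ?case by (auto intro: continuous_on_add)
next
  case (Suc k)
  show ?case
    by (rule Ck_on_SucI[where f'="\<lambda>x v. fderiv f x v + fderiv g x v"])
      (use Suc assms in \<open>auto intro!: has_derivative_add Ck_on_has_derivative\<close>)
qed

lemma Ck_on_sum:
  assumes "open S" "\<And>i. i \<in> I \<Longrightarrow> Ck_on k S (f i)"
  shows "Ck_on k S (\<lambda>x. \<Sum>i\<in>I. f i x)"
  using assms(2) by (induction I rule: infinite_finite_induct) (auto intro: Ck_on_add Ck_on_const assms(1))

lemma Ck_on_bilinear:
  assumes "bounded_bilinear B" "open S" "Ck_on k S f" "Ck_on k S g"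
  shows "Ck_on k S (\<lambda>x. B (f x) (g x))"
  using assms(3,4)
proof (induction k arbitrary: f g)
  case 0 then show ?case using assms(1) by (auto intro: bounded_bilinear.continuous_on)
next
  case (Suc k)
  show ?case
  proof (rule Ck_on_SucI[where f'="\<lambda>x v. B (f x) (fderiv g x v) + B (fderiv f x v) (g x)"])
    fix x assume "x \<in> S"
    then show "((\<lambda>x. B (f x) (g x)) has_derivative (\<lambda>v. B (f x) (fderiv g x v) + B (fderiv f x v) (g x))) (at x)"
      using Suc.prems by (intro bounded_bilinear.FDERIV[OF assms(1)] Ck_on_has_derivative) auto
  next
    fix v show "Ck_on k S (\<lambda>x. B (f x) (fderiv g x v) + B (fderiv f x v) (g x))"
      using Suc.prems Ck_on_SucD[OF Suc.prems(1)] Ck_on_SucD[OF Suc.prems(2)] by (intro Ck_on_add assms Suc.IH) auto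
  qed (fact assms)
qed

lemma Ck_on_compose:
  fixes f :: "'a::real_normed_vector \<Rightarrow> 'b::euclidean_space"
  assumes "open S" "open T" "f ` S \<subseteq> T" "Ck_on k T g" "Ck_on k S f"
  shows "Ck_on k S (\<lambda>x. g (f x))"
  using assms(4,5)
proof (induction k arbitrary: g)
  case 0 then show ?case using assms(3) by (auto intro: continuous_on_compose2)
next
  case (Suc k)
  have lin: "linear (fderiv g (f x))" if "x \<in> S" for x
    using Ck_on_has_derivative[OF Suc.prems(1), of "f x"] that assms(3) has_derivative_linear by blast
  \<comment> \<open>The direction \<open>fderiv f x v\<close> varies with \<open>x\<close>, while
    \<open>Ck_on\<close> treats only fixed directions. Expanding it in the finite basis leaves
    products to which the induction hypothesis applies; this is why the intermediate space is
    Euclidean.\<close>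
  have Ck: "Ck_on k S (\<lambda>x. \<Sum>b\<in>Basis. (fderiv f x v \<bullet> b) *\<^sub>R fderiv g (f x) b)" for v
    by (intro Ck_on_sum assms Ck_on_bilinear[OF bounded_bilinear_scaleR] Ck_on_linear_comp[OF bounded_linear_inner_left] Suc.IH)
      (use Suc.prems Ck_on_SucD[OF Suc.prems(2)] in auto)
  show ?case
  proof (rule Ck_on_SucI[where f'="\<lambda>x v. fderiv g (f x) (fderiv f x v)"])
    fix x assume x: "x \<in> S"
    then show "((\<lambda>x. g (f x)) has_derivative (\<lambda>v. fderiv g (f x) (fderiv f x v))) (at x)"
      using assms(3) Suc.prems by (intro has_derivative_compose[of f _ x UNIV g] Ck_on_has_derivative[where S=S] Ck_on_has_derivative[where S=T]) auto
  next
    fix v show "Ck_on k S (\<lambda>x. fderiv g (f x) (fderiv f x v))"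
      apply (rule Ck_on_cong[OF assms(1) _ Ck[of v]])
      by (subst (2) euclidean_representation[of "frechet_derivative f _ v", symmetric])
        (simp add: linear_sum[OF lin] linear_scale[OF lin] del: euclidean_representation)
  qed (fact assms)
qed

lemma Ck_on_local:
  assumes "\<And>x. x \<in> S \<Longrightarrow> \<exists>V. open V \<and> x \<in> V \<and> Ck_on k V f"
  shows "Ck_on k S f"
  using assms
proof (induction k arbitrary: f)
  case 0
  have "continuous (at x) f" if "x \<in> S" for x
    using 0[OF that] continuous_on_eq_continuous_at by auto
  then show ?case by (auto intro: continuous_at_imp_continuous_on)
next
  case (Suc k)
  have "Ck_on k S (\<lambda>x. fderiv f x v)" for v
    by (rule Suc.IH) (metis Suc.prems Ck_on.simps(2))
  then show ?case using Suc.prems by (metis Ck_on.simps(2))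
qed

lemma smooth_on_cong:
  assumes "smooth_on S f" "open S" "\<And>x. x \<in> S \<Longrightarrow> g x = f x"
  shows "smooth_on S g"
  using assms Ck_on_cong[of S f g] unfolding smooth_on_def by metis

lemma smooth_on_subset: "smooth_on S f \<Longrightarrow> T \<subseteq> S \<Longrightarrow> smooth_on T f"
  unfolding smooth_on_def using Ck_on_subset by blast

lemma smooth_on_continuous: "smooth_on S f \<Longrightarrow> continuous_on S f"
  unfolding smooth_on_def using Ck_on_continuous by blast

lemma smooth_on_has_derivative:
  "smooth_on S f \<Longrightarrow> x \<in> S \<Longrightarrow> (f has_derivative fderiv f x) (at x)"
  unfolding smooth_on_def using Ck_on_has_derivative by blast

lemma smooth_on_frechet_derivative:
  "smooth_on S f \<Longrightarrow> smooth_on S (\<lambda>x. fderiv f x v)"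
  unfolding smooth_on_def by (metis Ck_on.simps(2))

text \<open>For functions whose derivative is expressed through the function itself: regularity of
  order \<open>k\<close> of \<open>f\<close> passes to \<open>f'\<close> and so gives order
  \<open>k + 1\<close> for \<open>f\<close>.\<close>

lemma smooth_on_bootstrap:
  assumes "open S" "\<And>x. x \<in> S \<Longrightarrow> (f has_derivative f' x) (at x)"
    and "\<And>k v. Ck_on k S f \<Longrightarrow> Ck_on k S (\<lambda>x. f' x v)"
  shows "smooth_on S f"
  unfolding smooth_on_def
proof
  fix k show "Ck_on k S f"
  proof (induction k)
    case 0
    have "f differentiable at x" if "x \<in> S" for x using assms(2)[OF that] by (auto simp: differentiable_def)
    then show ?case by (auto intro!: continuous_at_imp_continuous_on differentiable_imp_continuous_within)
  next
    case (Suc k) then show ?case by (intro Ck_on_SucI[where f'=f']) (use assms in auto)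
  qed
qed

lemma smooth_on_const [intro]: "smooth_on S (\<lambda>x. c)"
  by (simp add: smooth_on_def Ck_on_const)

lemma smooth_on_bounded_linear: "bounded_linear L \<Longrightarrow> open S \<Longrightarrow> smooth_on S L"
  by (simp add: smooth_on_def Ck_on_bounded_linear)

lemma smooth_on_linear_comp:
  "bounded_linear L \<Longrightarrow> open S \<Longrightarrow> smooth_on S f \<Longrightarrow> smooth_on S (\<lambda>x. L (f x))"
  by (simp add: smooth_on_def Ck_on_linear_comp)

lemma smooth_on_add:
  "open S \<Longrightarrow> smooth_on S f \<Longrightarrow> smooth_on S g \<Longrightarrow> smooth_on S (\<lambda>x. f x + g x)"
  by (simp add: smooth_on_def Ck_on_add)

lemma smooth_on_minus: "open S \<Longrightarrow> smooth_on S f \<Longrightarrow> smooth_on S (\<lambda>x. - f x)"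
  by (rule smooth_on_linear_comp[of uminus]) (auto intro: bounded_linear_minus bounded_linear_ident)

lemma smooth_on_diff:
  "open S \<Longrightarrow> smooth_on S f \<Longrightarrow> smooth_on S g \<Longrightarrow> smooth_on S (\<lambda>x. f x - g x)"
  using smooth_on_add[of S f "\<lambda>x. - g x"] smooth_on_minus by auto

lemma smooth_on_sum:
  "open S \<Longrightarrow> (\<And>i. i \<in> I \<Longrightarrow> smooth_on S (f i)) \<Longrightarrow> smooth_on S (\<lambda>x. \<Sum>i\<in>I. f i x)"
  by (simp add: smooth_on_def Ck_on_sum)

lemma smooth_on_bilinear:
  "bounded_bilinear B \<Longrightarrow> open S \<Longrightarrow> smooth_on S f \<Longrightarrow> smooth_on S g \<Longrightarrow> smooth_on S (\<lambda>x. B (f x) (g x))"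
  by (simp add: smooth_on_def Ck_on_bilinear)

lemmas smooth_on_scaleR = smooth_on_bilinear[OF bounded_bilinear_scaleR]

lemma smooth_on_mult:
  fixes f g :: "'a::real_normed_vector \<Rightarrow> real"
  shows "open S \<Longrightarrow> smooth_on S f \<Longrightarrow> smooth_on S g \<Longrightarrow> smooth_on S (\<lambda>x. f x * g x)"
  by (rule smooth_on_bilinear[OF bounded_bilinear_mult])

lemma smooth_on_compose:
  fixes f :: "'a::real_normed_vector \<Rightarrow> 'b::euclidean_space"
  shows "open S \<Longrightarrow> open T \<Longrightarrow> f ` S \<subseteq> T \<Longrightarrow> smooth_on T g \<Longrightarrow> smooth_on S f \<Longrightarrow> smooth_on S (\<lambda>x. g (f x))"
  unfolding smooth_on_def using Ck_on_compose by blast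

lemma smooth_on_local:
  assumes "\<And>x. x \<in> S \<Longrightarrow> \<exists>V. open V \<and> x \<in> V \<and> smooth_on V f"
  shows "smooth_on S f"
  using assms unfolding smooth_on_def by (metis Ck_on_local)

lemma smooth_on_component: "open S \<Longrightarrow> smooth_on S f \<Longrightarrow> smooth_on S (\<lambda>x. f x $ i)"
  by (rule smooth_on_linear_comp[OF bounded_linear_vec_nth])

section \<open>Smooth functions of one real variable and bump functions\<close>

lemma smooth_on_real_function:
  fixes f :: "real \<Rightarrow> real"
  assumes "open S" "\<And>x. x \<in> S \<Longrightarrow> (f has_real_derivative f' x) (at x)"
    and "\<And>k. Ck_on k S f \<Longrightarrow> Ck_on k S f'"
  shows "smooth_on S f"
proof (rule smooth_on_bootstrap[where f'="\<lambda>x v. f' x * v"])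
  fix k v assume "Ck_on k S f"
  then show "Ck_on k S (\<lambda>x. f' x * v)"
    by (intro Ck_on_linear_comp[OF bounded_linear_mult_left] assms)
qed (use assms in \<open>auto simp: has_field_derivative_def\<close>)

lemma smooth_on_inverse: "smooth_on (- {0}) (inverse :: real \<Rightarrow> real)"
proof (rule smooth_on_real_function[where f'="\<lambda>x. - (inverse x * inverse x)"])
  fix x :: real assume "x \<in> - {0}"
  then show "(inverse has_real_derivative - (inverse x * inverse x)) (at x)"
    by (auto intro!: derivative_eq_intros simp: power2_eq_square)
next
  fix k assume "Ck_on k (- {0}) (inverse :: real \<Rightarrow> real)"
  then show "Ck_on k (- {0}) (\<lambda>x::real. - (inverse x * inverse x))"
    by (intro Ck_on_linear_comp[of uminus] Ck_on_bilinear[OF bounded_bilinear_mult]) (auto intro: bounded_linear_minus bounded_linear_ident)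
qed auto

lemma smooth_on_exp: "smooth_on UNIV (exp :: real \<Rightarrow> real)"
  by (rule smooth_on_real_function[where f'=exp]) auto

lemma smooth_on_real_antiderivative:
  fixes f :: "real \<Rightarrow> real"
  assumes "open S" "\<And>x. x \<in> S \<Longrightarrow> (f has_real_derivative f' x) (at x)" "smooth_on S f'"
  shows "smooth_on S f"
  using assms smooth_on_real_function[of S f f'] by (auto simp: smooth_on_def)

lemma smooth_on_ln: "smooth_on {0<..} (ln :: real \<Rightarrow> real)"
  by (rule smooth_on_real_antiderivative[where f'=inverse])
    (auto intro!: derivative_eq_intros smooth_on_subset[OF smooth_on_inverse] simp: field_simps)

lemma smooth_on_arctan: "smooth_on UNIV arctan"
proof (rule smooth_on_real_antiderivative[where f'="\<lambda>x. inverse (1 + x * x)"])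
  have *: "1 + x * x \<noteq> 0" for x :: real using sum_squares_gt_zero_iff[of 1 x] by simp
  have "smooth_on UNIV (\<lambda>x::real. x)" by (rule smooth_on_bounded_linear) auto
  then show "smooth_on UNIV (\<lambda>x::real. inverse (1 + x * x))"
    by (intro smooth_on_compose[OF _ _ _ smooth_on_inverse] smooth_on_add smooth_on_mult) (auto simp: *)
qed (auto intro!: derivative_eq_intros simp: power2_eq_square)

text \<open>Termwise differentiation gives another everywhere convergent power series, so the
  induction on \<open>k\<close> runs over all coefficient sequences at once.\<close>

lemma smooth_on_powser:
  fixes c :: "nat \<Rightarrow> real"
  assumes "\<And>x. summable (\<lambda>n. c n * x ^ n)"
  shows "smooth_on UNIV (\<lambda>x. \<Sum>n. c n * x ^ n)"
  unfolding smooth_on_def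
proof
  fix k show "Ck_on k UNIV (\<lambda>x. \<Sum>n. c n * x ^ n)" using assms
  proof (induction k arbitrary: c)
    case 0
    have "isCont (\<lambda>x. \<Sum>n. c n * x ^ n) x" for x
      using termdiffs_strong_converges_everywhere[OF 0, of x] DERIV_isCont by blast
    then show ?case by (simp add: continuous_at_imp_continuous_on)
  next
    case (Suc k)
    have "Ck_on k UNIV (\<lambda>x. \<Sum>n. diffs c n * x ^ n)"
      using Suc.prems termdiff_converges_all[of c] by (intro Suc.IH) auto
    then have "Ck_on k UNIV (\<lambda>x. (\<Sum>n. diffs c n * x ^ n) * v)" for v
      by (intro Ck_on_linear_comp[OF bounded_linear_mult_left]) auto
    then show ?case
      using termdiffs_strong_converges_everywhere[OF Suc.prems]
      by (intro Ck_on_SucI[where f'="\<lambda>x v. (\<Sum>n. diffs c n * x ^ n) * v"]) (auto simp: has_field_derivative_def)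
  qed
qed

text \<open>The functions obtained from \<open>exp (- 1 / x)\<close> by repeated differentiation.\<close>
definition flat_fun :: "nat \<Rightarrow> real \<Rightarrow> real" where
  "flat_fun n x = (if x \<le> 0 then 0 else inverse x ^ n * exp (- inverse x))"

text \<open>The family is closed under differentiation up to linear combinations; one induction on
  the order then treats all \<open>n\<close> together.\<close>

lemma flat_fun_has_derivative:
  "(flat_fun n has_real_derivative (flat_fun (n + 2) x - n * flat_fun (n + 1) x)) (at x)"
proof -
  consider "x < 0" | "x > 0" | "x = 0" by linarith
  then show ?thesis
  proof cases
    case 1
    have "((\<lambda>x. 0::real) has_real_derivative 0) (at x)" by simp
    then have "(flat_fun n has_real_derivative 0) (at x)"
      by (rule has_field_derivative_transform_within_open[of _ _ _ "{..<0}"]) (use 1 in \<open>auto simp: flat_fun_def\<close>)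
    then show ?thesis using 1 by (simp add: flat_fun_def)
  next
    case 2
    have "((\<lambda>x. inverse x ^ n * exp (- inverse x)) has_real_derivative
      (flat_fun (n + 2) x - n * flat_fun (n + 1) x)) (at x)"
      using 2 apply (auto intro!: derivative_eq_intros simp: flat_fun_def power2_eq_square)
      by (cases n) (auto simp: field_simps)
    then show ?thesis
      by (rule has_field_derivative_transform_within_open[of _ _ _ "{0<..}"]) (use 2 in \<open>auto simp: flat_fun_def\<close>)
  next
    case 3
    \<comment> \<open>With \<open>u = inverse h\<close> the difference quotient at 0 from the right
      is \<open>u ^ (n + 1) / exp u\<close>; from the left it is 0.\<close>
    have "((\<lambda>u::real. u ^ (n + 1) / exp u) \<longlongrightarrow> 0) at_top" by (rule tendsto_power_div_exp_0)
    then have "((\<lambda>h::real. inverse h ^ (n + 1) / exp (inverse h)) \<longlongrightarrow> 0) (at_right 0)"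
      by (rule filterlim_compose) (rule filterlim_inverse_at_top_right)
    then have r: "((\<lambda>h. flat_fun n h / h) \<longlongrightarrow> 0) (at_right 0)"
      by (rule Lim_transform_eventually)
        (auto simp: eventually_at_filter flat_fun_def exp_minus divide_simps)
    have l: "((\<lambda>h. flat_fun n h / h) \<longlongrightarrow> 0) (at_left 0)"
      by (rule tendsto_eventually) (auto simp: eventually_at_filter flat_fun_def)
    have "((\<lambda>h. (flat_fun n (0 + h) - flat_fun n 0) / h) \<longlongrightarrow> 0) (at 0)"
      using filterlim_split_at[OF l r] by (simp add: flat_fun_def[of n 0])
    then show ?thesis using 3 by (simp add: flat_fun_def DERIV_def)
  qed
qed

lemma smooth_flat_fun: "smooth_on UNIV (flat_fun n)"
  unfolding smooth_on_def
proof
  fix k show "Ck_on k UNIV (flat_fun n)"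
  proof (induction k arbitrary: n)
    case 0
    then show ?case using flat_fun_has_derivative DERIV_isCont by (metis Ck_on.simps(1) continuous_at_imp_continuous_on)
  next
    case (Suc k)
    have *: "Ck_on k UNIV (\<lambda>x. (flat_fun (n + 2) x + (- real n) *\<^sub>R flat_fun (n + 1) x) * v)" for v
      by (intro Ck_on_linear_comp[OF bounded_linear_mult_left] Ck_on_add Ck_on_linear_comp[OF bounded_linear_scaleR_right] Suc.IH) auto
    show ?case
      apply (rule Ck_on_SucI[where f'="\<lambda>x v. (flat_fun (n + 2) x + (- real n) *\<^sub>R flat_fun (n + 1) x) * v"])
      using flat_fun_has_derivative[of n] * by (auto simp: has_field_derivative_def)
  qed
qed

text \<open>The standard bump function exp (-1 / (r^2 - |x - p|^2)) on the ball of radius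
  \<open>r\<close> about \<open>p\<close>, continued by 0.\<close>

definition bump :: "'a::real_inner \<Rightarrow> real \<Rightarrow> 'a \<Rightarrow> real" where
  "bump p r x = flat_fun 0 (r * r - (x - p) \<bullet> (x - p))"

lemma smooth_bump: "open S \<Longrightarrow> smooth_on S (bump p r)"
  unfolding bump_def[abs_def]
  by (intro smooth_on_compose[OF _ _ _ smooth_flat_fun] smooth_on_diff smooth_on_const
      smooth_on_bilinear[OF bounded_bilinear_inner] smooth_on_bounded_linear) auto

lemma bump_nonneg: "0 \<le> bump p r x"
  by (simp add: bump_def flat_fun_def)

lemma bump_pos_iff: "0 < r \<Longrightarrow> 0 < bump p r x \<longleftrightarrow> x \<in> ball p r"
proof -
  assume r: "0 < r"
  have "(x - p) \<bullet> (x - p) < r * r \<longleftrightarrow> norm (x - p) < r"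
    using r power2_less_imp_less[of "norm (x - p)" r] power_strict_mono[of "norm (x - p)" r 2]
    by (auto simp: dot_square_norm power2_eq_square)
  then show ?thesis by (auto simp: bump_def flat_fun_def dist_norm norm_minus_commute)
qed

lemma bump_eq_0_iff: "0 < r \<Longrightarrow> bump p r x = 0 \<longleftrightarrow> x \<notin> ball p r"
  using bump_pos_iff[of r p x] bump_nonneg[of p r x] by force

section \<open>Derivatives along lines and the symmetry of second derivatives\<close>

lemma smooth_on_vector_derivative:
  fixes f :: "real \<Rightarrow> 'b::real_normed_vector"
  assumes "smooth_on V f" "x \<in> V"
  shows "(f has_vector_derivative fderiv f x 1) (at x)"
proof -
  have d: "(f has_derivative fderiv f x) (at x)" by (rule smooth_on_has_derivative[OF assms])
  then have "linear (fderiv f x)" by (rule has_derivative_linear)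
  then have "fderiv f x = (\<lambda>t. t *\<^sub>R fderiv f x 1)"
    using linear_scale[of "fderiv f x" _ 1] by (simp add: linear_scale[symmetric])
  then show ?thesis using d unfolding has_vector_derivative_def by metis
qed

lemma frechet_derivative_line:
  assumes "smooth_on S f" "x + t *\<^sub>R v \<in> S"
  shows "((\<lambda>t. f (x + t *\<^sub>R v)) has_vector_derivative fderiv f (x + t *\<^sub>R v) v) (at t)"
proof -
  have "((\<lambda>t. f (x + t *\<^sub>R v)) has_derivative (\<lambda>h. fderiv f (x + t *\<^sub>R v) (h *\<^sub>R v))) (at t)"
    by (rule has_derivative_compose[of "\<lambda>t. x + t *\<^sub>R v" _ t UNIV f])
      (auto intro!: derivative_eq_intros smooth_on_has_derivative[OF assms])
  moreover have "linear (fderiv f (x + t *\<^sub>R v))"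
    using smooth_on_has_derivative[OF assms] has_derivative_linear by blast
  ultimately show ?thesis by (simp add: has_vector_derivative_def linear_scale)
qed

text \<open>The mean value theorem is applied twice, in the direction \<open>v\<close> to the
  difference in \<open>w\<close>, and then in the direction \<open>w\<close> to the derivative along
  \<open>v\<close>. The left side is symmetric in \<open>v\<close> and \<open>w\<close>, which is
  what forces the mixed derivatives to agree.\<close>

lemma second_difference_mvt:
  fixes f :: "'a::real_normed_vector \<Rightarrow> real"
  assumes f: "smooth_on S f" and s: "s > 0"
    and S: "\<And>a b. 0 \<le> a \<Longrightarrow> a \<le> s \<Longrightarrow> 0 \<le> b \<Longrightarrow> b \<le> s \<Longrightarrow> x + a *\<^sub>R v + b *\<^sub>R w \<in> S"
  shows "\<exists>a b. 0 \<le> a \<and> a \<le> s \<and> 0 \<le> b \<and> b \<le> s \<and>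
    f (x + s *\<^sub>R v + s *\<^sub>R w) - f (x + s *\<^sub>R v) - f (x + s *\<^sub>R w) + f x =
    s * s * fderiv (\<lambda>y. fderiv f y v) (x + a *\<^sub>R v + b *\<^sub>R w) w"
proof -
  let ?D = "\<lambda>y. fderiv f y v"
  have d1: "((\<lambda>t. f (x + s *\<^sub>R w + t *\<^sub>R v) - f (x + t *\<^sub>R v)) has_real_derivative
     ?D (x + s *\<^sub>R w + t *\<^sub>R v) - ?D (x + t *\<^sub>R v)) (at t)" if "0 \<le> t" "t \<le> s" for t
    unfolding has_real_derivative_iff_has_vector_derivative
    using S[of t s] S[of t 0] that s
    by (intro has_vector_derivative_diff frechet_derivative_line[OF f]) (auto simp: algebra_simps)
  obtain a where a: "0 < a" "a < s" and ea: "(f (x + s *\<^sub>R w + s *\<^sub>R v) - f (x + s *\<^sub>R v)) - (f (x + s *\<^sub>R w + 0 *\<^sub>R v) - f (x + 0 *\<^sub>R v))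
      = (s - 0) * (?D (x + s *\<^sub>R w + a *\<^sub>R v) - ?D (x + a *\<^sub>R v))"
    using MVT2[OF s, where f="\<lambda>t. f (x + s *\<^sub>R w + t *\<^sub>R v) - f (x + t *\<^sub>R v)", OF d1] by auto
  have d2: "((\<lambda>t. ?D (x + a *\<^sub>R v + t *\<^sub>R w)) has_real_derivative
     fderiv ?D (x + a *\<^sub>R v + t *\<^sub>R w) w) (at t)" if "0 \<le> t" "t \<le> s" for t
    unfolding has_real_derivative_iff_has_vector_derivative
    by (rule frechet_derivative_line[OF smooth_on_frechet_derivative[OF f]]) (use S[of a t] a that in auto)
  obtain b where b: "0 < b" "b < s" and eb: "?D (x + a *\<^sub>R v + s *\<^sub>R w) - ?D (x + a *\<^sub>R v + 0 *\<^sub>R w) =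
     (s - 0) * fderiv ?D (x + a *\<^sub>R v + b *\<^sub>R w) w"
    using MVT2[OF s, where f="\<lambda>t. ?D (x + a *\<^sub>R v + t *\<^sub>R w)", OF d2] by auto
  have "x + s *\<^sub>R w + a *\<^sub>R v = x + a *\<^sub>R v + s *\<^sub>R w" "x + s *\<^sub>R w + s *\<^sub>R v = x + s *\<^sub>R v + s *\<^sub>R w"
    by (simp_all add: algebra_simps)
  then show ?thesis using a b ea eb by (intro exI[of _ a] exI[of _ b]) (simp add: algebra_simps)
qed

lemma second_derivative_symmetric_real:
  fixes f :: "'a::real_normed_vector \<Rightarrow> real"
  assumes f: "smooth_on S f" and S: "open S" "x \<in> S"
  shows "fderiv (\<lambda>y. fderiv f y v) x w =
         fderiv (\<lambda>y. fderiv f y w) x v"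
proof (rule ccontr)
  define P where "P = (\<lambda>y. fderiv (\<lambda>y. fderiv f y v) y w)"
  define Q where "Q = (\<lambda>y. fderiv (\<lambda>y. fderiv f y w) y v)"
  assume "\<not> ?thesis"
  then have ne: "P x \<noteq> Q x" by (simp add: P_def Q_def)
  define e where "e = \<bar>P x - Q x\<bar> / 2"
  have e: "e > 0" using ne by (simp add: e_def)
  have "continuous_on S P" "continuous_on S Q"
    unfolding P_def Q_def by (intro smooth_on_continuous smooth_on_frechet_derivative f)+
  then have "isCont P x" "isCont Q x" using S by (auto simp: continuous_on_eq_continuous_at)
  then have "eventually (\<lambda>y. dist (P y) (P x) < e) (nhds x)" "eventually (\<lambda>y. dist (Q y) (Q x) < e) (nhds x)"
    using e by (auto simp: continuous_at tendsto_iff eventually_at_filter elim!: eventually_mono)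
  moreover have "eventually (\<lambda>y. y \<in> S) (nhds x)" using S by (rule eventually_nhds_in_open)
  ultimately have "eventually (\<lambda>y. dist (P y) (P x) < e \<and> dist (Q y) (Q x) < e \<and> y \<in> S) (nhds x)"
    by eventually_elim auto
  then obtain d where d: "d > 0" and D: "\<And>y. dist y x < d \<Longrightarrow> dist (P y) (P x) < e \<and> dist (Q y) (Q x) < e \<and> y \<in> S"
    unfolding eventually_nhds_metric by blast
  \<comment> \<open>Small enough for the parallelogram with sides \<open>s *\<^sub>R v\<close> and
    \<open>s *\<^sub>R w\<close> to stay within distance \<open>d\<close> of \<open>x\<close>; the
    summand 1 covers \<open>v = w = 0\<close>.\<close>
  define s where "s = d / (2 * (norm v + norm w + 1))"
  have s: "s > 0" using d by (auto simp: s_def intro!: divide_pos_pos add_nonneg_pos)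
  have near: "dist (x + a *\<^sub>R v + b *\<^sub>R w) x < d" if "0 \<le> a" "a \<le> s" "0 \<le> b" "b \<le> s" for a b
  proof -
    have "dist (x + a *\<^sub>R v + b *\<^sub>R w) x = norm (a *\<^sub>R v + b *\<^sub>R w)" by (simp add: dist_norm)
    also have "\<dots> \<le> norm (a *\<^sub>R v) + norm (b *\<^sub>R w)" by (rule norm_triangle_ineq)
    also have "\<dots> \<le> s * norm v + s * norm w" using that by (simp add: add_mono mult_right_mono)
    also have "\<dots> \<le> s * (norm v + norm w + 1)" using s by (simp add: algebra_simps)
    also have "\<dots> = d / 2"
    proof -
      have "norm v + norm w + 1 \<noteq> 0" using norm_ge_zero[of v] norm_ge_zero[of w] by linarith
      then show ?thesis unfolding s_def by (metis (no_types, lifting) divide_divide_eq_left nonzero_eq_divide_eq times_divide_eq_left)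
    qed
    finally show ?thesis using d by linarith
  qed
  obtain a b where ab: "0 \<le> a" "a \<le> s" "0 \<le> b" "b \<le> s" and
    1: "f (x + s *\<^sub>R v + s *\<^sub>R w) - f (x + s *\<^sub>R v) - f (x + s *\<^sub>R w) + f x = s * s * P (x + a *\<^sub>R v + b *\<^sub>R w)"
    using second_difference_mvt[OF f s, of x v w] near D unfolding P_def by blast
  have near': "dist (x + a *\<^sub>R w + b *\<^sub>R v) x < d" if "0 \<le> a" "a \<le> s" "0 \<le> b" "b \<le> s" for a b
    using near[of b a] that by (simp add: algebra_simps)
  obtain a' b' where ab': "0 \<le> a'" "a' \<le> s" "0 \<le> b'" "b' \<le> s" and
    2: "f (x + s *\<^sub>R w + s *\<^sub>R v) - f (x + s *\<^sub>R w) - f (x + s *\<^sub>R v) + f x = s * s * Q (x + a' *\<^sub>R w + b' *\<^sub>R v)"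
    using second_difference_mvt[OF f s, of x w v] near' D unfolding Q_def by blast
  have "s * s * P (x + a *\<^sub>R v + b *\<^sub>R w) = s * s * Q (x + a' *\<^sub>R w + b' *\<^sub>R v)"
    using 1 2 by (simp add: algebra_simps)
  then have "P (x + a *\<^sub>R v + b *\<^sub>R w) = Q (x + a' *\<^sub>R w + b' *\<^sub>R v)" using s by simp
  with D[OF near[OF ab]] D[OF near'[OF ab']] show False
    by (auto simp: dist_real_def e_def abs_if split: if_splits)
qed

lemma frechet_derivative_linear_comp:
  assumes "bounded_linear L" "f differentiable (at x)"
  shows "fderiv (\<lambda>y. L (f y)) x v = L (fderiv f x v)"
  using bounded_linear.has_derivative[OF assms(1)] assms(2)
  by (metis frechet_derivative_at frechet_derivative_works)

lemma second_derivative_symmetric: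
  fixes f :: "'a::real_normed_vector \<Rightarrow> 'b::euclidean_space"
  assumes f: "smooth_on S f" and S: "open S" "x \<in> S"
  shows "fderiv (\<lambda>y. fderiv f y v) x w =
         fderiv (\<lambda>y. fderiv f y w) x v"
proof (rule euclidean_eqI)
  fix b :: 'b assume "b \<in> Basis"
  have *: "fderiv (\<lambda>y. fderiv (\<lambda>z. f z \<bullet> b) y v) x w =
    fderiv (\<lambda>y. fderiv f y v) x w \<bullet> b" for v w
  proof -
    have d: "g differentiable (at y)" if "smooth_on S g" "y \<in> S" for g :: "'a \<Rightarrow> 'b" and y
      using smooth_on_has_derivative[OF that] by (auto simp: differentiable_def)
    have "((\<lambda>y. fderiv f y v \<bullet> b) has_derivative
       (\<lambda>w. fderiv (\<lambda>y. fderiv f y v) x w \<bullet> b)) (at x)"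
      using smooth_on_has_derivative[OF smooth_on_frechet_derivative[OF f] S(2)]
      by (rule bounded_linear.has_derivative[OF bounded_linear_inner_left])
    then have "((\<lambda>y. fderiv (\<lambda>z. f z \<bullet> b) y v) has_derivative
       (\<lambda>w. fderiv (\<lambda>y. fderiv f y v) x w \<bullet> b)) (at x)"
      by (rule has_derivative_transform_within_open[OF _ S])
        (simp add: frechet_derivative_linear_comp[OF bounded_linear_inner_left d[OF f]])
    then show ?thesis using frechet_derivative_at by metis
  qed
  have "smooth_on S (\<lambda>z. f z \<bullet> b)" by (rule smooth_on_linear_comp[OF bounded_linear_inner_left S(1) f])
  from second_derivative_symmetric_real[OF this S, of v w]
  show "fderiv (\<lambda>y. fderiv f y v) x w \<bullet> b =
     fderiv (\<lambda>y. fderiv f y w) x v \<bullet> b" by (simp add: *)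
qed

subsection \<open>Matrices of order two\<close>

lemma bilinear_mm:
  "bounded_bilinear ((**) :: real^'n^'m \<Rightarrow> real^'k^'n \<Rightarrow> real^'k^'m)"
  unfolding bilinear_conv_bounded_bilinear[symmetric] bilinear_def
  by (auto intro!: linearI simp: matrix_matrix_mult_def vec_eq_iff sum.distrib algebra_simps sum_distrib_left)

lemmas mm_left_distrib = bounded_bilinear.add_left[OF bilinear_mm]
  and mm_right_distrib = bounded_bilinear.add_right[OF bilinear_mm]
  and mm_diff_left = bounded_bilinear.diff_left[OF bilinear_mm]
  and mm_diff_right = bounded_bilinear.diff_right[OF bilinear_mm]
  and mm_scaleR_left [simp] = bounded_bilinear.scaleR_left[OF bilinear_mm]
  and mm_scaleR_right [simp] = bounded_bilinear.scaleR_right[OF bilinear_mm]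
  and mm_zero_left [simp] = bounded_bilinear.zero_left[OF bilinear_mm]
  and mm_zero_right [simp] = bounded_bilinear.zero_right[OF bilinear_mm]
  and mm_minus_left [simp] = bounded_bilinear.minus_left[OF bilinear_mm]
  and mm_minus_right [simp] = bounded_bilinear.minus_right[OF bilinear_mm]
  and mm_sum_left = bounded_bilinear.sum_left[OF bilinear_mm]
  and mm_sum_right = bounded_bilinear.sum_right[OF bilinear_mm]
  and mm_assoc = matrix_mul_assoc[symmetric]
  and continuous_on_mm [continuous_intros] = bounded_bilinear.continuous_on[OF bilinear_mm]
  and smooth_on_mm = smooth_on_bilinear[OF bilinear_mm]

lemmas mat_simps = vec_eq_iff forall_2 sum_2 matrix_matrix_mult_def mat_def trace_def det_2

text \<open>The adjugate. On \<open>SL2\<close> it is the inverse, and it is linear on all matrices,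
  so it can be differentiated without any condition on its argument. It stands for the inverse
  throughout.\<close>

definition adj2 :: "real^2^2 \<Rightarrow> real^2^2" where
  "adj2 A = trace A *\<^sub>R mat 1 - A"

lemma adj2_mult: "adj2 A ** A = det A *\<^sub>R mat 1" "A ** adj2 A = det A *\<^sub>R mat 1"
  by (simp_all add: adj2_def mat_simps algebra_simps)

lemma adj2_mm: "adj2 (A ** B) = adj2 B ** adj2 A"
  by (simp add: adj2_def mat_simps algebra_simps)

lemma det_adj2 [simp]: "det (adj2 A) = det A"
  by (simp add: adj2_def mat_simps algebra_simps)

lemma adj2_adj2 [simp]: "adj2 (adj2 A) = A"
  by (simp add: adj2_def mat_simps algebra_simps)

lemma adj2_mat_1 [simp]: "adj2 (mat 1) = mat 1"
  by (simp add: adj2_def mat_simps algebra_simps)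

lemma trace_scaleR: "trace (c *\<^sub>R A :: real^'n^'n) = c * trace A"
  by (simp add: trace_def sum_distrib_left)

lemma bounded_linear_trace: "bounded_linear (trace :: real^'n^'n \<Rightarrow> real)"
  unfolding linear_conv_bounded_linear[symmetric]
  by (rule linearI) (simp_all add: trace_def sum.distrib sum_distrib_left)

lemma bounded_linear_adj2: "bounded_linear adj2"
  unfolding linear_conv_bounded_linear[symmetric]
  by (rule linearI) (simp_all add: adj2_def mat_simps algebra_simps)

lemmas adj2_add = linear_add[OF bounded_linear.linear[OF bounded_linear_adj2]]
  and adj2_scaleR = linear_scale[OF bounded_linear.linear[OF bounded_linear_adj2]]
  and continuous_on_adj2 [continuous_intros] = bounded_linear.continuous_on[OF bounded_linear_adj2]
  and smooth_on_adj2 = smooth_on_linear_comp[OF bounded_linear_adj2]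

lemma adj2_traceless: "trace A = 0 \<Longrightarrow> adj2 A = - A"
  by (simp add: adj2_def)

lemma SL2_iff: "A \<in> SL2 \<longleftrightarrow> det A = 1"
  by (simp add: SL2_def)

lemma sl2_iff: "A \<in> sl2 \<longleftrightarrow> trace A = 0"
  by (simp add: sl2_def)

lemma SL2_simps [simp]: "mat 1 \<in> SL2" "A \<in> SL2 \<Longrightarrow> B \<in> SL2 \<Longrightarrow> A ** B \<in> SL2" "adj2 A \<in> SL2 \<longleftrightarrow> A \<in> SL2"
  by (auto simp: SL2_iff det_mul)

lemma SL2_adj2 [simp]:
  assumes "A \<in> SL2"
  shows "adj2 A ** A = mat 1" "A ** adj2 A = mat 1"
    "B ** adj2 A ** A = B" "B ** A ** adj2 A = B"
    "adj2 A ** (A ** B) = B" "A ** (adj2 A ** B) = B"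
proof -
  show 1: "adj2 A ** A = mat 1" "A ** adj2 A = mat 1" using assms by (simp_all add: SL2_iff adj2_mult)
  show "B ** adj2 A ** A = B" "B ** A ** adj2 A = B" using 1 by (metis matrix_mul_assoc matrix_mul_rid)+
  show "adj2 A ** (A ** B) = B" "A ** (adj2 A ** B) = B" using 1 by (metis matrix_mul_assoc matrix_mul_lid)+
qed

lemma matrix_inv_SL2 [simp]:
  assumes "A \<in> SL2"
  shows "matrix_inv A = adj2 A"
proof -
  have "A ** matrix_inv A = mat 1 \<and> matrix_inv A ** A = mat 1"
    unfolding matrix_inv_def by (rule someI[of _ "adj2 A"]) (simp add: assms)
  then show ?thesis using assms by (metis SL2_adj2(5) matrix_mul_rid)
qed

lemma smooth_on_det:
  fixes f :: "'a::real_normed_vector \<Rightarrow> real^2^2"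
  shows "open S \<Longrightarrow> smooth_on S f \<Longrightarrow> smooth_on S (\<lambda>x. det (f x))"
  unfolding det_2 by (intro smooth_on_diff smooth_on_mult smooth_on_component)

text \<open>Liouville's formula; a traceless coefficient therefore keeps the determinant
  constant.\<close>

lemma has_vector_derivative_det:
  fixes Y :: "real \<Rightarrow> real^2^2"
  assumes "(Y has_vector_derivative Y t ** B) (at t within T)"
  shows "((\<lambda>t. det (Y t)) has_real_derivative trace B * det (Y t)) (at t within T)"
proof -
  have c: "((\<lambda>t. Y t $ i $ j) has_real_derivative (Y t ** B) $ i $ j) (at t within T)" for i j
    unfolding has_real_derivative_iff_has_vector_derivative
    by (rule bounded_linear.has_vector_derivative[OF bounded_linear_vec_nth
        bounded_linear.has_vector_derivative[OF bounded_linear_vec_nth assms]])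
  show ?thesis unfolding det_2
    by (rule derivative_eq_intros c refl)+ (simp add: mat_simps algebra_simps)
qed

text \<open>The theorem of Cayley and Hamilton at trace zero. It reduces the exponential series to
  two scalar series in \<open>- det A\<close>.\<close>

lemma sl2_square: "A \<in> sl2 \<Longrightarrow> A ** A = (- det A) *\<^sub>R mat 1"
proof -
  assume "A \<in> sl2"
  then have "A $ 2 $ 2 = - A $ 1 $ 1" by (simp add: sl2_iff trace_def sum_2)
  then show ?thesis by (simp add: mat_simps algebra_simps)
qed

lemma transpose_sl2: "A \<in> sl2 \<Longrightarrow> transpose A \<in> sl2"
  by (simp add: sl2_iff trace_def transpose_def)

lemma sl2_add: "A \<in> sl2 \<Longrightarrow> B \<in> sl2 \<Longrightarrow> A + B \<in> sl2"
  and sl2_scaleR: "A \<in> sl2 \<Longrightarrow> c *\<^sub>R A \<in> sl2"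
  and sl2_diff: "A \<in> sl2 \<Longrightarrow> B \<in> sl2 \<Longrightarrow> A - B \<in> sl2"
  and sl2_zero: "0 \<in> sl2"
  by (auto simp: sl2_iff trace_add trace_scaleR trace_sub) (simp add: trace_def)

lemma sl2_sum: "(\<And>i. i \<in> I \<Longrightarrow> f i \<in> sl2) \<Longrightarrow> (\<Sum>i\<in>I. f i) \<in> sl2"
  by (induction I rule: infinite_finite_induct) (auto intro: sl2_add sl2_zero)

lemma sl2_conj: "A \<in> sl2 \<Longrightarrow> h \<in> SL2 \<Longrightarrow> adj2 h ** A ** h \<in> sl2"
  unfolding sl2_iff by (subst trace_mul_sym) simp

subsection \<open>The exponential function on \<open>sl2\<close>\<close>

text \<open>The power series with \<open>exp_even (x * x) = cosh x\<close> and
  \<open>x * exp_odd (x * x) = sinh x\<close>, and with cos and sin for negative arguments. They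
  treat the hyperbolic, elliptic and parabolic elements of \<open>sl2\<close> uniformly, with smooth
  coefficients.\<close>

definition exp_even :: "real \<Rightarrow> real" where "exp_even d = (\<Sum>n. inverse (fact (2 * n)) * d ^ n)"
definition exp_odd :: "real \<Rightarrow> real" where "exp_odd d = (\<Sum>n. inverse (fact (2 * n + 1)) * d ^ n)"

lemma exp_even_odd_summable:
  fixes d :: real
  shows "summable (\<lambda>n. inverse (fact (2 * n)) * d ^ n)" "summable (\<lambda>n. inverse (fact (2 * n + 1)) * d ^ n)"
proof -
  have s: "summable (\<lambda>n. inverse (fact n) * \<bar>d\<bar> ^ n)" by (rule summable_exp)
  have f: "fact n \<le> (fact (2 * n) :: real)" "fact n \<le> (fact (2 * n + 1) :: real)" for n
    by (intro fact_mono; simp)+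
  show "summable (\<lambda>n. inverse (fact (2 * n)) * d ^ n)"
    by (rule summable_comparison_test'[OF s])
      (use f in \<open>auto simp: abs_mult power_abs intro!: mult_right_mono le_imp_inverse_le\<close>)
  show "summable (\<lambda>n. inverse (fact (2 * n + 1)) * d ^ n)"
    by (rule summable_comparison_test'[OF s])
      (use f in \<open>auto simp: abs_mult power_abs simp del: fact_Suc intro!: mult_right_mono le_imp_inverse_le\<close>)
qed

lemma smooth_exp_even_odd: "smooth_on UNIV exp_even" "smooth_on UNIV exp_odd"
  unfolding exp_even_def[abs_def] exp_odd_def[abs_def]
  by (intro smooth_on_powser exp_even_odd_summable)+

lemma mpow_sl2:
  assumes "A \<in> sl2"
  shows "mpow A (2 * n) = (- det A) ^ n *\<^sub>R mat 1" "mpow A (2 * n + 1) = (- det A) ^ n *\<^sub>R A"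
proof -
  show "mpow A (2 * n) = (- det A) ^ n *\<^sub>R mat 1"
  proof (induction n)
    case (Suc n)
    have "mpow A (2 * Suc n) = A ** (A ** mpow A (2 * n))" by simp
    then show ?case by (simp only: Suc) (simp add: sl2_square[OF assms])
  qed simp
  then show "mpow A (2 * n + 1) = (- det A) ^ n *\<^sub>R A" by simp
qed

text \<open>The closed form of \<open>mexp\<close> on \<open>sl2\<close>. As a formula it is smooth
  on all matrices, so smoothness of the exponential can be stated on an open set although
  \<open>sl2\<close> is not open.\<close>

definition mexp_sl2 :: "real^2^2 \<Rightarrow> real^2^2" where
  "mexp_sl2 A = exp_even (- det A) *\<^sub>R mat 1 + exp_odd (- det A) *\<^sub>R A"

lemma mexp_eq:
  assumes A: "A \<in> sl2"
  shows "mexp A = mexp_sl2 A"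
proof -
  let ?f = "\<lambda>k. mpow A k /\<^sub>R fact k"
  obtain K where K: "norm (X ** Y) \<le> norm X * norm Y * K" "K > 0" for X Y :: "real^2^2"
    using bounded_bilinear.pos_bounded[OF bilinear_mm] by blast
  have n: "norm (mpow A k) \<le> norm (mat 1 :: real^2^2) * (norm A * K) ^ k" for k
  proof (induction k)
    case (Suc k)
    have "norm (mpow A (Suc k)) \<le> norm A * norm (mpow A k) * K" using K by simp
    also have "\<dots> \<le> norm A * (norm (mat 1 :: real^2^2) * (norm A * K) ^ k) * K"
      using Suc K by (intro mult_left_mono mult_right_mono) auto
    finally show ?case by (simp add: mult_ac)
  qed simp
  have "summable (\<lambda>k. norm (mat 1 :: real^2^2) * (inverse (fact k) * (norm A * K) ^ k))"
    by (intro summable_mult summable_exp)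
  then have "summable ?f"
    by (rule summable_comparison_test'[where N=0])
      (use n in \<open>auto simp: field_simps divide_right_mono\<close>)
  then have "?f sums mexp A" unfolding mexp_def by (rule summable_sums)
  \<comment> \<open>Each even power is grouped with the following odd one, which splits the series
    into its scalar part and its multiple of \<open>A\<close>.\<close>
  then have "(\<lambda>n. sum ?f {n * 2..<n * 2 + 2}) sums mexp A" by (rule sums_group) simp
  moreover have "sum ?f {n * 2..<n * 2 + 2} = (inverse (fact (2 * n)) * (- det A) ^ n) *\<^sub>R mat 1 +
     (inverse (fact (2 * n + 1)) * (- det A) ^ n) *\<^sub>R A" for n
  proof -
    have "sum ?f {n * 2..<n * 2 + 2} = ?f (2 * n) + ?f (2 * n + 1)"
      by (simp add: numeral_2_eq_2 mult.commute)
    then show ?thesis unfolding mpow_sl2[OF A] by simp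
  qed
  ultimately have 1: "(\<lambda>n. (inverse (fact (2 * n)) * (- det A) ^ n) *\<^sub>R mat 1 +
     (inverse (fact (2 * n + 1)) * (- det A) ^ n) *\<^sub>R A) sums mexp A" by simp
  have 2: "(\<lambda>n. (inverse (fact (2 * n)) * (- det A) ^ n) *\<^sub>R mat 1 +
     (inverse (fact (2 * n + 1)) * (- det A) ^ n) *\<^sub>R A) sums mexp_sl2 A"
    unfolding mexp_sl2_def exp_even_def exp_odd_def
    by (intro sums_add sums_scaleR_left summable_sums exp_even_odd_summable)
  show ?thesis using sums_unique2[OF 1 2] .
qed

lemma exp_even_odd_neg: "exp_even (- (x * x)) = cos x" "x * exp_odd (- (x * x)) = sin x"
proof -
  have p: "(- (x * x)) ^ n = (- 1) ^ n * x ^ (2 * n)" for n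
    by (simp add: power_mult power2_eq_square power_minus[of "x * x"])
  show "exp_even (- (x * x)) = cos x"
    unfolding exp_even_def by (rule sums_unique[symmetric]) (use cos_paired[of x] in \<open>simp add: p field_simps\<close>)
  have "(\<lambda>n. x * (inverse (fact (2 * n + 1)) * (- (x * x)) ^ n)) sums sin x"
    using sin_paired[of x] by (simp add: p field_simps)
  moreover have "(\<lambda>n. x * (inverse (fact (2 * n + 1)) * (- (x * x)) ^ n)) sums (x * exp_odd (- (x * x)))"
    unfolding exp_odd_def by (intro sums_mult summable_sums exp_even_odd_summable)
  ultimately show "x * exp_odd (- (x * x)) = sin x" by (metis sums_unique2)
qed

lemma exp_even_odd_pos: "exp_even (x * x) = cosh x" "x * exp_odd (x * x) = sinh x"
proof -
  have "(\<lambda>n. (\<lambda>n. if even n then x ^ n /\<^sub>R fact n else 0) (2 * n)) sums cosh x"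
    by (subst sums_mono_reindex) (auto simp: strict_mono_def cosh_converges elim!: evenE)
  then show "exp_even (x * x) = cosh x"
    unfolding exp_even_def by (intro sums_unique[symmetric]) (simp add: power_mult power2_eq_square field_simps)
  have "(\<lambda>n. (\<lambda>n. if even n then 0 else x ^ n /\<^sub>R fact n) (2 * n + 1)) sums sinh x"
    by (subst sums_mono_reindex) (auto simp: strict_mono_def sinh_converges elim!: oddE)
  moreover have e: "(x * x) ^ n = x ^ (2 * n)" for n by (simp add: power_mult power2_eq_square)
  ultimately have "(\<lambda>n. x * (inverse (fact (2 * n + 1)) * (x * x) ^ n)) sums sinh x"
    unfolding e by (simp add: field_simps del: fact_Suc)
  moreover have "(\<lambda>n. x * (inverse (fact (2 * n + 1)) * (x * x) ^ n)) sums (x * exp_odd (x * x))"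
    unfolding exp_odd_def by (intro sums_mult summable_sums exp_even_odd_summable)
  ultimately show "x * exp_odd (x * x) = sinh x" by (metis sums_unique2)
qed

lemma exp_even_odd_0 [simp]: "exp_even 0 = 1" "exp_odd 0 = 1"
  unfolding exp_even_def exp_odd_def by (subst powser_zero; simp)+

text \<open>Compares coefficients in exp ((s + t) A) = exp (s A) exp (t A), with \<open>d\<close> in
  the role of \<open>- det A\<close>. For positive \<open>d\<close> these are the addition theorems
  of cosh and sinh, for negative \<open>d\<close> those of cos and sin.\<close>

lemma exp_even_odd_add:
  "exp_even ((s + t) * (s + t) * d) = exp_even (s * s * d) * exp_even (t * t * d) + d * (s * exp_odd (s * s * d)) * (t * exp_odd (t * t * d))"
  "(s + t) * exp_odd ((s + t) * (s + t) * d) = (s * exp_odd (s * s * d)) * exp_even (t * t * d) + exp_even (s * s * d) * (t * exp_odd (t * t * d))"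
proof -
  consider "d = 0" | x where "x \<noteq> 0" "d = x * x" | x where "x \<noteq> 0" "d = - (x * x)"
  proof -
    assume *: "d = 0 \<Longrightarrow> thesis" "\<And>x. x \<noteq> 0 \<Longrightarrow> d = x * x \<Longrightarrow> thesis" "\<And>x. x \<noteq> 0 \<Longrightarrow> d = - (x * x) \<Longrightarrow> thesis"
    show thesis
      using *(1) *(2)[of "sqrt d"] *(3)[of "sqrt (- d)"]
      by (cases "d = 0"; cases "d > 0") (auto simp flip: power2_eq_square)
  qed
  then have "exp_even ((s + t) * (s + t) * d) = exp_even (s * s * d) * exp_even (t * t * d) + d * (s * exp_odd (s * s * d)) * (t * exp_odd (t * t * d)) \<and>
    (s + t) * exp_odd ((s + t) * (s + t) * d) = (s * exp_odd (s * s * d)) * exp_even (t * t * d) + exp_even (s * s * d) * (t * exp_odd (t * t * d))"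
  proof cases
    case 1 then show ?thesis by simp
  next
    case (2 x)
    have e: "exp_even (r * r * d) = cosh (r * x)" "r * exp_odd (r * r * d) = sinh (r * x) / x" for r
      using exp_even_odd_pos[of "r * x"] 2 by (auto simp: field_simps)
    show ?thesis unfolding e using 2 by (simp add: distrib_right cosh_add sinh_add field_simps)
  next
    case (3 x)
    have e: "exp_even (r * r * d) = cos (r * x)" "r * exp_odd (r * r * d) = sin (r * x) / x" for r
      using exp_even_odd_neg[of "r * x"] 3 by (auto simp: field_simps)
    show ?thesis unfolding e using 3 by (simp add: distrib_right cos_add sin_add field_simps)
  qed
  then show "exp_even ((s + t) * (s + t) * d) = exp_even (s * s * d) * exp_even (t * t * d) + d * (s * exp_odd (s * s * d)) * (t * exp_odd (t * t * d))"
  "(s + t) * exp_odd ((s + t) * (s + t) * d) = (s * exp_odd (s * s * d)) * exp_even (t * t * d) + exp_even (s * s * d) * (t * exp_odd (t * t * d))"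
    by blast+
qed

lemma det_scaleR_2: "det (c *\<^sub>R A :: real^2^2) = c * c * det A"
  by (simp add: det_2 algebra_simps)

lemma mexp_add:
  assumes "A \<in> sl2"
  shows "mexp ((s + t) *\<^sub>R A) = mexp (s *\<^sub>R A) ** mexp (t *\<^sub>R A)"
proof -
  have e: "mexp (r *\<^sub>R A) = exp_even (r * r * (- det A)) *\<^sub>R mat 1 + (r * exp_odd (r * r * (- det A))) *\<^sub>R A" for r
    unfolding mexp_eq[OF sl2_scaleR[OF assms]] mexp_sl2_def by (simp add: det_scaleR_2 mult.commute)
  show ?thesis unfolding e exp_even_odd_add
    by (simp add: mm_left_distrib mm_right_distrib sl2_square[OF assms] algebra_simps)
qed

lemma mexp_zero [simp]: "mexp (0::real^2^2) = mat 1"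
  by (simp add: mexp_eq sl2_zero mexp_sl2_def det_2)

lemma mexp_SL2: "A \<in> sl2 \<Longrightarrow> mexp A \<in> SL2"
proof -
  assume A: "A \<in> sl2"
  have "mexp A ** mexp (- A) = mat 1"
    using mexp_add[OF A, of 1 "-1"] by simp
  have 1: "exp_even d * exp_even d - d * exp_odd d * exp_odd d = 1" for d
    using exp_even_odd_add(1)[of 1 "-1" d] by simp
  have 2: "A $ 2 $ 2 = - A $ 1 $ 1" using A by (simp add: sl2_iff trace_def sum_2)
  have "det (mexp_sl2 A) = exp_even (- det A) * exp_even (- det A) - (- det A) * exp_odd (- det A) * exp_odd (- det A)"
    by (simp add: mexp_sl2_def det_2 mat_def 2 algebra_simps)
  then show ?thesis using A 1[of "- det A"] by (simp add: SL2_iff mexp_eq)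
qed

lemma smooth_mexp_sl2: "smooth_on UNIV mexp_sl2"
proof -
  have d: "smooth_on UNIV (\<lambda>A::real^2^2. - det A)"
    by (intro smooth_on_minus smooth_on_det smooth_on_bounded_linear) auto
  show ?thesis unfolding mexp_sl2_def[abs_def]
    by (intro smooth_on_add smooth_on_scaleR smooth_on_const smooth_on_bounded_linear
        smooth_on_compose[OF _ _ _ smooth_exp_even_odd(1) d] smooth_on_compose[OF _ _ _ smooth_exp_even_odd(2) d]) auto
qed

lemma continuous_on_mexp: "continuous_on sl2 mexp"
  using smooth_on_continuous[OF smooth_mexp_sl2] continuous_on_subset[of UNIV mexp_sl2 sl2]
  by (auto simp: mexp_eq cong: continuous_on_cong)

definition mk2 :: "real \<Rightarrow> real \<Rightarrow> real \<Rightarrow> real \<Rightarrow> real^2^2" where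
  "mk2 a b c d = vector [vector [a, b], vector [c, d]]"

lemma mk2_simps [simp]:
  "mk2 a b c d $ 1 $ 1 = a" "mk2 a b c d $ 1 $ 2 = b" "mk2 a b c d $ 2 $ 1 = c" "mk2 a b c d $ 2 $ 2 = d"
  by (simp_all add: mk2_def vector_def)

lemma mexp_rotation: "mexp (mk2 0 (- x) x 0) = mk2 (cos x) (- sin x) (sin x) (cos x)"
  and mexp_diagonal: "mexp (mk2 x 0 0 (- x)) = mk2 (exp x) 0 0 (exp (- x))"
  and mexp_unipotent: "mexp (mk2 0 x 0 0) = mk2 1 x 0 1"
  and mk2_sl2: "mk2 0 (- x) x 0 \<in> sl2" "mk2 x 0 0 (- x) \<in> sl2" "mk2 0 x 0 0 \<in> sl2"
proof -
  show s: "mk2 0 (- x) x 0 \<in> sl2" "mk2 x 0 0 (- x) \<in> sl2" "mk2 0 x 0 0 \<in> sl2"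
    by (simp_all add: sl2_iff trace_def sum_2)
  show "mexp (mk2 0 (- x) x 0) = mk2 (cos x) (- sin x) (sin x) (cos x)"
    unfolding mexp_eq[OF s(1)] mexp_sl2_def using exp_even_odd_neg[of x] by (simp add: mat_simps mult.commute)
  show "mexp (mk2 x 0 0 (- x)) = mk2 (exp x) 0 0 (exp (- x))"
    unfolding mexp_eq[OF s(2)] mexp_sl2_def using exp_even_odd_pos[of x] cosh_plus_sinh[of x] cosh_minus_sinh[of x]
    by (simp add: mat_simps mult.commute)
  show "mexp (mk2 0 x 0 0) = mk2 1 x 0 1"
    unfolding mexp_eq[OF s(3)] mexp_sl2_def by (simp add: mat_simps)
qed

text \<open>Rotation, dilation and shear. The hypothesis is the polar form of the first column; the
  shear parameter is the inner product of the two columns divided by the squared length of the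
  first. The angle \<theta> is an input because it is not determined by \<open>k\<close>; a single
  valued choice of it comes from the covering group.\<close>

lemma iwasawa:
  assumes k: "k \<in> SL2" and c: "k $ 1 $ 1 = exp \<rho> * cos \<theta>" "k $ 2 $ 1 = exp \<rho> * sin \<theta>"
  shows "k = mexp (mk2 0 (- \<theta>) \<theta> 0) ** mexp (mk2 \<rho> 0 0 (- \<rho>)) **
    mexp (mk2 0 (exp (- 2 * \<rho>) * (k $ 1 $ 1 * k $ 1 $ 2 + k $ 2 $ 1 * k $ 2 $ 2)) 0 0)"
proof -
  define r where "r = exp \<rho>"
  have r: "r \<noteq> 0" "exp (- \<rho>) = inverse r" "exp (- 2 * \<rho>) = inverse r * inverse r"
    by (auto simp: r_def exp_minus mult_exp_exp simp flip: exp_minus)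
  \<comment> \<open>The condition that the determinant is 1, with the first column in polar
    form.\<close>
  have d: "r * (cos \<theta> * k $ 2 $ 2 - sin \<theta> * k $ 1 $ 2) = 1"
    using k c by (simp add: SL2_iff det_2 r_def algebra_simps)
  have sc: "sin \<theta> * sin \<theta> + cos \<theta> * cos \<theta> = 1" using sin_cos_squared_add[of \<theta>] by (simp add: power2_eq_square)
  have i: "inverse r = cos \<theta> * k $ 2 $ 2 - sin \<theta> * k $ 1 $ 2" using d r by (metis inverse_unique)
  have a: "r * inverse r = 1" using r by simp
  have "r * cos \<theta> * (inverse r * inverse r * (r * cos \<theta> * k $ 1 $ 2 + r * sin \<theta> * k $ 2 $ 2)) - sin \<theta> * inverse r =
     (r * inverse r) * (r * inverse r) * (cos \<theta> * (cos \<theta> * k $ 1 $ 2 + sin \<theta> * k $ 2 $ 2)) - sin \<theta> * inverse r"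
    by (simp add: algebra_simps)
  also have "\<dots> = (sin \<theta> * sin \<theta> + cos \<theta> * cos \<theta>) * k $ 1 $ 2" unfolding a unfolding i by (simp add: algebra_simps del: sin_cos_squared_add3)
  finally have 1: "k $ 1 $ 2 = r * cos \<theta> * (inverse r * inverse r * (r * cos \<theta> * k $ 1 $ 2 + r * sin \<theta> * k $ 2 $ 2)) - sin \<theta> * inverse r"
    unfolding sc by simp
  have "r * sin \<theta> * (inverse r * inverse r * (r * cos \<theta> * k $ 1 $ 2 + r * sin \<theta> * k $ 2 $ 2)) + cos \<theta> * inverse r =
     (r * inverse r) * (r * inverse r) * (sin \<theta> * (cos \<theta> * k $ 1 $ 2 + sin \<theta> * k $ 2 $ 2)) + cos \<theta> * inverse r"
    by (simp add: algebra_simps)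
  also have "\<dots> = (sin \<theta> * sin \<theta> + cos \<theta> * cos \<theta>) * k $ 2 $ 2" unfolding a unfolding i by (simp add: algebra_simps del: sin_cos_squared_add3)
  finally have 2: "k $ 2 $ 2 = r * sin \<theta> * (inverse r * inverse r * (r * cos \<theta> * k $ 1 $ 2 + r * sin \<theta> * k $ 2 $ 2)) + cos \<theta> * inverse r"
    unfolding sc by simp
  show ?thesis
    unfolding mexp_rotation mexp_diagonal mexp_unipotent c r_def[symmetric] r(2,3)
    using 1 2 c unfolding r_def[symmetric]
    by (simp add: vec_eq_iff forall_2 matrix_matrix_mult_def sum_2 mult.commute)
qed

section \<open>Quadratic error bounds and differentiation under the integral\<close>

lemma has_derivative_if_quadratic:
  fixes f :: "'a::real_normed_vector \<Rightarrow> 'b::real_normed_vector"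
  assumes G: "bounded_linear G" and S: "open S" "x \<in> S"
    and q: "\<And>y. y \<in> S \<Longrightarrow> norm (f y - f x - G (y - x)) \<le> C * (norm (y - x))\<^sup>2"
  shows "(f has_derivative G) (at x)"
  unfolding has_derivative_at_alt
proof (intro conjI allI impI)
  fix e :: real assume e: "e > 0"
  obtain d where d: "d > 0" "ball x d \<subseteq> S" using S open_contains_ball by blast
  show "\<exists>d>0. \<forall>y. norm (y - x) < d \<longrightarrow> norm (f y - f x - G (y - x)) \<le> e * norm (y - x)"
  proof (intro exI[of _ "min d (e / (\<bar>C\<bar> + 1))"] conjI allI impI)
    show "0 < min d (e / (\<bar>C\<bar> + 1))" using d e by (auto intro!: divide_pos_pos)
    fix y assume y: "norm (y - x) < min d (e / (\<bar>C\<bar> + 1))"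
    then have "norm (y - x) * (\<bar>C\<bar> + 1) \<le> e" by (simp add: pos_less_divide_eq less_imp_le)
    then have "norm (y - x) * (norm (y - x) * (\<bar>C\<bar> + 1)) \<le> norm (y - x) * e" by (intro mult_left_mono) auto
    moreover have "C * (norm (y - x))\<^sup>2 \<le> (\<bar>C\<bar> + 1) * (norm (y - x))\<^sup>2" by (intro mult_right_mono) auto
    moreover have "y \<in> S" using y d by (auto simp: dist_norm norm_minus_commute)
    ultimately show "norm (f y - f x - G (y - x)) \<le> e * norm (y - x)"
      using q[of y] by (simp add: power2_eq_square algebra_simps)
  qed
qed (rule G)

lemma smooth_derivative_bound:
  fixes f :: "'a::euclidean_space \<Rightarrow> 'b::real_normed_vector"
  assumes f: "smooth_on U f" and U: "open U" and K: "compact K" "K \<subseteq> U"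
  shows "\<exists>C\<ge>0. \<forall>x\<in>K. \<forall>v. norm (fderiv f x v) \<le> C * norm v"
proof -
  have "\<exists>M\<ge>0. \<forall>x\<in>K. norm (fderiv f x b) \<le> M" for b
  proof -
    have "continuous_on K (\<lambda>x. fderiv f x b)"
      using smooth_on_continuous[OF smooth_on_frechet_derivative[OF f]] K continuous_on_subset by blast
    from compact_imp_bounded[OF compact_continuous_image[OF this K(1)]]
    obtain M where "\<forall>x\<in>K. norm (fderiv f x b) \<le> M" by (auto simp: bounded_iff)
    then show ?thesis by (intro exI[of _ "max 0 M"]) (auto intro: order_trans)
  qed
  then obtain M where M: "\<And>b. M b \<ge> 0" "\<And>b x. x \<in> K \<Longrightarrow> norm (fderiv f x b) \<le> M b" by metis
  show ?thesis
  proof (intro exI[of _ "\<Sum>b\<in>Basis. M b"] conjI ballI allI)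
    show "0 \<le> (\<Sum>b\<in>Basis. M b)" using M by (simp add: sum_nonneg)
    fix x v assume x: "x \<in> K"
    have lin: "linear (fderiv f x)"
      using smooth_on_has_derivative[OF f, of x] x K has_derivative_linear by blast
    have "fderiv f x v = fderiv f x (\<Sum>b\<in>Basis. (v \<bullet> b) *\<^sub>R b)"
      by (simp add: euclidean_representation)
    also have "\<dots> = (\<Sum>b\<in>Basis. (v \<bullet> b) *\<^sub>R fderiv f x b)"
      by (simp add: linear_sum[OF lin] linear_scale[OF lin] del: euclidean_representation)
    also have "norm \<dots> \<le> (\<Sum>b\<in>Basis. norm v * M b)"
      by (rule order_trans[OF norm_sum sum_mono]) (use M x in \<open>auto intro!: mult_mono Basis_le_norm\<close>)
    finally show "norm (fderiv f x v) \<le> (\<Sum>b\<in>Basis. M b) * norm v"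
      by (simp add: sum_distrib_left sum_distrib_right mult.commute)
  qed
qed

lemma smooth_lipschitz:
  fixes f :: "'a::euclidean_space \<Rightarrow> 'b::real_normed_vector"
  assumes f: "smooth_on U f" and U: "open U" and K: "compact K" "convex K" "K \<subseteq> U"
  shows "\<exists>C\<ge>0. \<forall>x\<in>K. \<forall>y\<in>K. norm (f y - f x) \<le> C * norm (y - x)"
proof -
  obtain C where C: "C \<ge> 0" "\<And>x v. x \<in> K \<Longrightarrow> norm (fderiv f x v) \<le> C * norm v"
    using smooth_derivative_bound[OF f U K(1,3)] by blast
  show ?thesis
  proof (intro exI[of _ C] conjI ballI C(1))
    fix x y assume "x \<in> K" "y \<in> K"
    show "norm (f y - f x) \<le> C * norm (y - x)"
    proof (rule differentiable_bound[of K f "\<lambda>x. fderiv f x"])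
      fix z assume z: "z \<in> K"
      show "(f has_derivative fderiv f z) (at z within K)"
        by (rule has_derivative_at_withinI, rule smooth_on_has_derivative[OF f]) (use z K in auto)
      show "onorm (fderiv f z) \<le> C" by (intro onorm_le C z)
    qed fact+
  qed
qed

lemma smooth_taylor:
  fixes f :: "'a::euclidean_space \<Rightarrow> 'b::real_normed_vector"
  assumes f: "smooth_on U f" and U: "open U" and K: "compact K" "convex K" "K \<subseteq> U"
  shows "\<exists>C\<ge>0. \<forall>x\<in>K. \<forall>y\<in>K. norm (f y - f x - fderiv f x (y - x)) \<le> C * (norm (y - x))\<^sup>2"
proof -
  let ?D = "\<lambda>x. fderiv f x"
  obtain M where M: "\<And>b. M b \<ge> 0" "\<And>b x y. x \<in> K \<Longrightarrow> y \<in> K \<Longrightarrow> norm (?D y b - ?D x b) \<le> M b * norm (y - x)"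
    using smooth_lipschitz[OF smooth_on_frechet_derivative[OF f] U K] by metis
  have lin: "linear (?D x)" if "x \<in> K" for x
    using smooth_on_has_derivative[OF f, of x] that K has_derivative_linear by blast
  have b: "norm (?D y v - ?D x v) \<le> ((\<Sum>b\<in>Basis. M b) * norm (y - x)) * norm v" if "x \<in> K" "y \<in> K" for x y v
  proof -
    have l: "linear (\<lambda>v. ?D y v - ?D x v)" using lin that by (intro linear_compose_sub) auto
    have "?D y v - ?D x v = (\<lambda>v. ?D y v - ?D x v) (\<Sum>b\<in>Basis. (v \<bullet> b) *\<^sub>R b)"
      by (simp add: euclidean_representation)
    also have "\<dots> = (\<Sum>b\<in>Basis. (v \<bullet> b) *\<^sub>R (?D y b - ?D x b))"
      unfolding linear_sum[OF l] linear_scale[OF l] ..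
    also have "norm \<dots> \<le> (\<Sum>b\<in>Basis. norm v * (M b * norm (y - x)))"
      by (rule order_trans[OF norm_sum sum_mono]) (use M that in \<open>auto intro!: mult_mono Basis_le_norm\<close>)
    finally show ?thesis by (simp add: sum_distrib_left sum_distrib_right mult_ac)
  qed
  show ?thesis
  proof (intro exI[of _ "\<Sum>b\<in>Basis. M b"] conjI ballI)
    show "0 \<le> (\<Sum>b\<in>Basis. M b)" using M by (simp add: sum_nonneg)
    fix x y assume xy: "x \<in> K" "y \<in> K"
    then have s: "closed_segment x y \<subseteq> K" using K closed_segment_subset by blast
    have "norm (f y - f x - ?D x (y - x)) \<le> norm (y - x) * ((\<Sum>b\<in>Basis. M b) * norm (y - x))"
    proof (rule differentiable_bound_linearization[where S="closed_segment x y" and f'="?D"])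
      fix t :: real assume "t \<in> {0..1}"
      then show "x + t *\<^sub>R (y - x) \<in> closed_segment x y"
        by (auto simp: in_segment algebra_simps intro!: exI[of _ t])
    next
      fix z assume z: "z \<in> closed_segment x y"
      then show "(f has_derivative ?D z) (at z within closed_segment x y)"
        using s K smooth_on_has_derivative[OF f] by (auto intro: has_derivative_at_withinI)
      have "norm (z - x) \<le> norm (y - x)" using segment_bound(1)[OF z] by (simp add: norm_minus_commute)
      then have "(\<Sum>b\<in>Basis. M b) * norm (z - x) \<le> (\<Sum>b\<in>Basis. M b) * norm (y - x)"
        using M by (intro mult_left_mono sum_nonneg) auto
      moreover have "norm (?D z v - ?D x v) \<le> (\<Sum>b\<in>Basis. M b) * norm (z - x) * norm v" for v
        by (rule b) (use xy z s in auto)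
      ultimately show "onorm (?D z - ?D x) \<le> (\<Sum>b\<in>Basis. M b) * norm (y - x)"
        by (intro onorm_le) (simp, meson mult_right_mono norm_ge_zero order_trans)
    qed auto
    then show "norm (f y - f x - ?D x (y - x)) \<le> (\<Sum>b\<in>Basis. M b) * (norm (y - x))\<^sup>2"
      by (simp add: power2_eq_square mult_ac)
  qed
qed

text \<open>Differentiation under the integral sign, one order at a time: the derivative in a fixed
  direction is again an integral of the same kind. The integrand lives on an open set of pairs
  because \<open>Ck_on\<close> differentiates in all variables, including the one that is
  integrated.\<close>

lemma Ck_on_integral:
  fixes f :: "'a::euclidean_space \<times> real \<Rightarrow> 'b::banach"
  assumes O: "open Om" and U: "open U" "convex U" and sub: "U \<times> {0..1} \<subseteq> Om" and f: "Ck_on k Om f"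
  shows "Ck_on k U (\<lambda>p. integral {0..1} (\<lambda>t. f (p, t)))"
  using f
proof (induction k arbitrary: f)
  case 0
  then have "continuous_on (U \<times> cbox 0 1) (\<lambda>(p, t). f (p, t))"
    using sub continuous_on_subset[of Om f] by (auto simp: case_prod_eta)
  from integral_continuous_on_param[OF this] show ?case by simp
next
  case (Suc k)
  let ?D = "\<lambda>z. fderiv f z"
  have D: "(f has_derivative ?D z) (at z)" if "z \<in> Om" for z using Ck_on_has_derivative[OF Suc.prems that] .
  have cD: "continuous_on Om (\<lambda>z. ?D z v)" for v
    using Suc.prems Ck_on_continuous by (metis Ck_on.simps(2))
  have bl: "bounded_linear (\<lambda>v. ?D (p, t) (v, 0))" if "p \<in> U" "t \<in> {0..1}" for p t
  proof -
    have "(p, t) \<in> Om" using that sub by auto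
    then show ?thesis
      using bounded_linear_compose[OF has_derivative_bounded_linear[OF D], of "(p, t)" "\<lambda>v. (v, 0)"]
      by (simp add: bounded_linear_Pair bounded_linear_ident bounded_linear_zero)
  qed
  \<comment> \<open>The derivative in \<open>p\<close> alone, as an element of the normed space of
    bounded linear maps, where it has to be continuous in both variables for Leibniz' rule.\<close>
  define fx where "fx = (\<lambda>p t. Blinfun (\<lambda>v. ?D (p, t) (v, 0)))"
  have fx: "blinfun_apply (fx p t) = (\<lambda>v. ?D (p, t) (v, 0))" if "p \<in> U" "t \<in> {0..1}" for p t
    unfolding fx_def using bl[OF that] by (rule bounded_linear_Blinfun_apply)
  have cfx: "continuous_on (U \<times> cbox 0 1) (\<lambda>(p, t). fx p t)"
  proof (rule continuous_on_blinfun_componentwise)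
    fix i :: 'a
    have "continuous_on (U \<times> cbox 0 1) (\<lambda>z. ?D z (i, 0))"
      using continuous_on_subset[OF cD] sub by simp
    then show "continuous_on (U \<times> cbox 0 1) (\<lambda>x. blinfun_apply (case x of (p, t) \<Rightarrow> fx p t) i)"
      by (rule continuous_on_eq) (auto simp: fx)
  qed
  have cf: "continuous_on {0..1} (\<lambda>t. f (p, t))" if "p \<in> U" for p
    by (rule continuous_on_compose2[OF Ck_on_continuous[OF Suc.prems]])
      (use sub that in \<open>auto intro!: continuous_intros\<close>)
  have cfxp: "continuous_on {0..1} (fx p)" if "p \<in> U" for p
    using continuous_on_compose2[OF cfx, of "{0..1}" "\<lambda>t. (p, t)"] that
    by (simp add: continuous_on_Pair continuous_on_const continuous_on_id image_subset_iff)
  have der: "((\<lambda>p. integral {0..1} (\<lambda>t. f (p, t))) has_derivative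
     (\<lambda>v. integral {0..1} (\<lambda>t. ?D (p, t) (v, 0)))) (at p)" if p: "p \<in> U" for p
  proof -
    have "((\<lambda>p. integral (cbox 0 1) (\<lambda>t. f (p, t))) has_derivative integral (cbox 0 1) (fx p)) (at p within U)"
    proof (rule leibniz_rule[OF _ _ cfx p U(2)])
      fix q t assume "q \<in> U" "t \<in> cbox 0 (1::real)"
      then have qt: "q \<in> U" "t \<in> {0..1}" "(q, t) \<in> Om" using sub by auto
      have "((\<lambda>q. f (q, t)) has_derivative (\<lambda>v. ?D (q, t) (v, 0))) (at q within U)"
        by (rule has_derivative_compose[of "\<lambda>q. (q, t)" _ q U f])
          (use D[of "(q, t)"] qt in \<open>auto intro!: derivative_eq_intros\<close>)
      then show "((\<lambda>q. f (q, t)) has_derivative blinfun_apply (fx q t)) (at q within U)" using fx qt by simp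
    qed (use cf in \<open>auto intro: integrable_continuous_real\<close>)
    moreover have "blinfun_apply (integral {0..1} (fx p)) v = integral {0..1} (\<lambda>t. ?D (p, t) (v, 0))" for v
      by (subst blinfun_apply_integral[OF integrable_continuous_real[OF cfxp[OF p]]])
        (auto intro!: integral_cong simp: fx p)
    then have "blinfun_apply (integral {0..1} (fx p)) = (\<lambda>v. integral {0..1} (\<lambda>t. ?D (p, t) (v, 0)))" by auto
    ultimately show ?thesis using at_within_open[OF p U(1)] by simp
  qed
  show ?case
    by (rule Ck_on_SucI[OF U(1) der]) (use Suc.IH[of "\<lambda>z. ?D z (_, 0)"] Suc.prems in auto)
qed

subsection \<open>Transport along rays\<close>

text \<open>Banach's fixed point theorem for the Picard operator; the hypothesis
  \<open>small\<close> makes it a contraction on the whole interval at once, so no continuation of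
  local solutions is needed.\<close>

lemma ode_exists:
  fixes B :: "real \<Rightarrow> real^2^2"
  assumes B: "continuous_on {0..1} B" and small: "\<And>(M::real^2^2) t. t \<in> {0..1} \<Longrightarrow> norm (M ** B t) \<le> norm M / 2"
  shows "\<exists>Y. Y 0 = mat 1 \<and> (\<forall>t\<in>{0..1}. (Y has_vector_derivative Y t ** B t) (at t within {0..1}))"
proof -
  \<comment> \<open>Clamps the time to the unit interval, so that the Picard operator acts on
    bounded continuous functions on the whole line, which form a complete space.\<close>
  define c :: "real \<Rightarrow> real" where "c = (\<lambda>t. max 0 (min 1 t))"
  have c: "c t \<in> {0..1}" "t \<in> {0..1} \<Longrightarrow> c t = t" for t by (auto simp: c_def)
  have cc: "continuous_on UNIV c" unfolding c_def by (intro continuous_intros)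
  define T :: "(real \<Rightarrow>\<^sub>C (real^2^2)) \<Rightarrow> (real \<Rightarrow>\<^sub>C (real^2^2))" where
    "T = (\<lambda>Y. Bcontfun (\<lambda>t. mat 1 + integral {0..c t} (\<lambda>s. apply_bcontfun Y s ** B s)))"
  have cY: "continuous_on {0..1} (\<lambda>s. apply_bcontfun Y s ** B s)" for Y :: "real \<Rightarrow>\<^sub>C (real^2^2)"
    by (intro continuous_intros B) auto
  have cY': "continuous_on {0..c t} (\<lambda>s. apply_bcontfun Y s ** B s)" for Y :: "real \<Rightarrow>\<^sub>C (real^2^2)" and t
    by (rule continuous_on_subset[OF cY]) (use c(1)[of t] in auto)
  have ib: "norm (integral {0..c t} (\<lambda>s. M s ** B s)) \<le> b / 2"
    if "continuous_on {0..c t} (\<lambda>s. M s ** B s)" "\<And>s. norm (M s) \<le> b" for M :: "real \<Rightarrow> real^2^2" and b t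
  proof -
    have b: "0 \<le> b" using that(2)[of 0] norm_ge_zero order_trans by blast
    have "norm (integral {0..c t} (\<lambda>s. M s ** B s)) \<le> (b / 2) * (c t - 0)"
    proof (rule integral_bound)
      fix s assume "s \<in> {0..c t}"
      then have "s \<in> {0..1}" using c(1)[of t] by auto
      from small[OF this, of "M s"] show "norm (M s ** B s) \<le> b / 2" using that(2)[of s] by simp
    qed (use c(1)[of t] that in auto)
    also have "\<dots> \<le> b / 2" using c(1)[of t] b mult_left_le[of "c t" "b / 2"] by auto
    finally show ?thesis .
  qed
  have T: "apply_bcontfun (T Y) t = mat 1 + integral {0..c t} (\<lambda>s. apply_bcontfun Y s ** B s)" for Y t
  proof -
    have "(\<lambda>t. mat 1 + integral {0..c t} (\<lambda>s. apply_bcontfun Y s ** B s)) \<in> bcontfun"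
    proof (rule bcontfun_normI)
      have "continuous_on {0..1} (\<lambda>t. integral {0..t} (\<lambda>s. apply_bcontfun Y s ** B s))"
        by (intro indefinite_integral_continuous_1 integrable_continuous_real cY)
      from continuous_on_compose2[OF this cc]
      show "continuous_on UNIV (\<lambda>t. mat 1 + integral {0..c t} (\<lambda>s. apply_bcontfun Y s ** B s))"
        using c by (intro continuous_on_add continuous_on_const) (auto simp: image_subset_iff)
    next
      fix t
      show "norm (mat 1 + integral {0..c t} (\<lambda>s. apply_bcontfun Y s ** B s)) \<le> norm (mat 1 :: real^2^2) + norm Y / 2"
        by (rule order_trans[OF norm_triangle_ineq]) (intro add_left_mono ib cY' norm_bounded)
    qed
    then show ?thesis unfolding T_def by (simp add: Bcontfun_inverse)
  qed
  have "\<exists>!Y. T Y = Y"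
  proof (rule banach_fix_type[of "1/2"])
    show "\<forall>Y Z. dist (T Y) (T Z) \<le> 1 / 2 * dist Y Z"
    proof (intro allI dist_bound)
      fix Y Z t
      have "apply_bcontfun (T Y) t - apply_bcontfun (T Z) t =
        integral {0..c t} (\<lambda>s. (apply_bcontfun Y s - apply_bcontfun Z s) ** B s)"
        unfolding T mm_diff_left by (subst integral_diff) (auto intro!: integrable_continuous_real cY')
      moreover have "norm (integral {0..c t} (\<lambda>s. (apply_bcontfun Y s - apply_bcontfun Z s) ** B s)) \<le> dist Y Z / 2"
      proof (rule ib)
        show "continuous_on {0..c t} (\<lambda>s. (apply_bcontfun Y s - apply_bcontfun Z s) ** B s)"
          unfolding mm_diff_left by (intro continuous_intros cY')
        show "norm (apply_bcontfun Y s - apply_bcontfun Z s) \<le> dist Y Z" for s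
          using dist_bounded[of Y s Z] by (simp add: dist_norm)
      qed
      ultimately show "dist (apply_bcontfun (T Y) t) (apply_bcontfun (T Z) t) \<le> 1 / 2 * dist Y Z"
        by (simp add: dist_norm)
    qed
  qed auto
  then obtain Y where Y: "T Y = Y" by blast
  have eq: "apply_bcontfun Y t = mat 1 + integral {0..t} (\<lambda>s. apply_bcontfun Y s ** B s)" if "t \<in> {0..1}" for t
    using T[of Y t] c(2)[OF that] Y by simp
  show ?thesis
  proof (intro exI[of _ "apply_bcontfun Y"] conjI ballI)
    show "apply_bcontfun Y 0 = mat 1" using eq[of 0] by simp
    fix t :: real assume t: "t \<in> {0..1}"
    have "((\<lambda>t. mat 1 + integral {0..t} (\<lambda>s. apply_bcontfun Y s ** B s)) has_vector_derivative
      0 + apply_bcontfun Y t ** B t) (at t within {0..1})"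
      by (intro has_vector_derivative_add has_vector_derivative_const integral_has_vector_derivative cY t)
    then show "(apply_bcontfun Y has_vector_derivative apply_bcontfun Y t ** B t) (at t within {0..1})"
      by (intro has_vector_derivative_transform[OF t eq]) auto
  qed
qed

locale ode =
  fixes B :: "real \<Rightarrow> real^2^2" and Y :: "real \<Rightarrow> real^2^2"
  assumes init: "Y 0 = mat 1"
    and deriv: "\<And>t. t \<in> {0..1} \<Longrightarrow> (Y has_vector_derivative Y t ** B t) (at t within {0..1})"
    and tr: "\<And>t. t \<in> {0..1} \<Longrightarrow> trace (B t) = 0"
begin

lemma SL2: "t \<in> {0..1} \<Longrightarrow> Y t \<in> SL2"
proof -
  assume t: "t \<in> {0..1}"
  have "((\<lambda>t. det (Y t)) has_vector_derivative 0) (at s within {0..1})" if "s \<in> {0..1}" for s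
    using has_vector_derivative_det[OF deriv[OF that]] tr[OF that]
    by (simp add: has_real_derivative_iff_has_vector_derivative)
  then obtain c where "\<And>s. s \<in> {0..1} \<Longrightarrow> det (Y s) = c"
    using has_vector_derivative_zero_constant[of "{0..1}" "\<lambda>t. det (Y t)"] by auto
  from this[OF t] this[of 0] show ?thesis by (simp add: init SL2_iff)
qed

lemma adj2_deriv: "t \<in> {0..1} \<Longrightarrow> ((\<lambda>t. adj2 (Y t)) has_vector_derivative - (B t ** adj2 (Y t))) (at t within {0..1})"
  using bounded_linear.has_vector_derivative[OF bounded_linear_adj2 deriv]
  by (simp add: adj2_mm adj2_traceless tr)

text \<open>Where the norm of \<open>Y\<close> is largest, the mean value inequality bounds the
  distance of \<open>Y\<close> from its initial value by half of that maximum, so the maximum is at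
  most twice the norm of the initial value.\<close>

lemma norm_bound:
  assumes small: "\<And>(M::real^2^2) t. t \<in> {0..1} \<Longrightarrow> norm (M ** B t) \<le> norm M / 2" and t: "t \<in> {0..1}"
  shows "norm (Y t) \<le> 2 * norm (mat 1 :: real^2^2)"
proof -
  have "continuous_on {0..1} Y"
    unfolding continuous_on_eq_continuous_within using deriv by (blast intro: has_vector_derivative_continuous)
  then have "continuous_on {0..1} (\<lambda>t. norm (Y t))" by (intro continuous_intros)
  then obtain m where m: "m \<in> {0..1}" "\<And>t. t \<in> {0..1} \<Longrightarrow> norm (Y t) \<le> norm (Y m)"
    using continuous_attains_sup[of "{0..1::real}" "\<lambda>t. norm (Y t)"] by auto
  have "norm (Y m - Y 0) \<le> norm (Y m) / 2 * norm (m - 0)"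
  proof (rule differentiable_bound[of "{0..1}" Y "\<lambda>t h. h *\<^sub>R (Y t ** B t)"])
    fix s :: real assume s: "s \<in> {0..1}"
    show "(Y has_derivative (\<lambda>h. h *\<^sub>R (Y s ** B s))) (at s within {0..1})"
      using deriv[OF s] by (simp add: has_vector_derivative_def)
    show "onorm (\<lambda>h. h *\<^sub>R (Y s ** B s)) \<le> norm (Y m) / 2"
    proof (rule onorm_le)
      fix h :: real
      have "norm (Y s ** B s) \<le> norm (Y m) / 2" using small[OF s, of "Y s"] m(2)[OF s] by linarith
      from mult_right_mono[OF this norm_ge_zero[of h]]
      show "norm (h *\<^sub>R (Y s ** B s)) \<le> norm (Y m) / 2 * norm h"
        by (simp add: mult.commute)
    qed
  qed (use m in auto)
  also have "\<dots> \<le> norm (Y m) / 2" using m(1) mult_left_le[of m "norm (Y m)"] by auto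
  finally have "norm (Y m - mat 1) \<le> norm (Y m) / 2" by (simp add: init)
  then have "norm (Y m) \<le> 2 * norm (mat 1 :: real^2^2)"
    using norm_triangle_ineq[of "Y m - mat 1" "mat 1"] by simp
  then show ?thesis using m(2)[OF t] by linarith
qed

end

text \<open>The quotient of two solutions moves only through the difference of the coefficients.
  Equal coefficients give uniqueness; close coefficients give the dependence on parameters.\<close>

lemma ode_quotient_deriv:
  assumes "ode B Y" "ode C Z" "t \<in> {0..1}"
  shows "((\<lambda>t. Y t ** adj2 (Z t)) has_vector_derivative Y t ** (B t - C t) ** adj2 (Z t)) (at t within {0..1})"
  using bounded_bilinear.has_vector_derivative[OF bilinear_mm ode.deriv[OF assms(1,3)] ode.adj2_deriv[OF assms(2,3)]]
  by (simp add: mm_diff_left mm_diff_right mm_assoc)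

lemma ode_unique:
  assumes "ode B Y" "ode B Z" "t \<in> {0..1}"
  shows "Y t = Z t"
proof -
  obtain c where c: "\<And>s. s \<in> {0..1} \<Longrightarrow> Y s ** adj2 (Z s) = c"
    using has_vector_derivative_zero_constant[of "{0..1}" "\<lambda>t. Y t ** adj2 (Z t)"] ode_quotient_deriv[OF assms(1,2)] by auto
  have "c = mat 1" using c[of 0] assms by (simp add: ode.init)
  then have "Y t ** adj2 (Z t) ** Z t = Z t" using c[OF assms(3)] by simp
  then show ?thesis using ode.SL2[OF assms(2,3)] by simp
qed

lemma norm_le_prod3:
  fixes X Y Z :: "real^2^2"
  assumes K: "\<And>(X::real^2^2) (Y::real^2^2). norm (X ** Y) \<le> norm X * norm Y * K" "K > 0"
    and b: "norm X \<le> x" "norm Y \<le> y" "norm Z \<le> z"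
  shows "norm (X ** Y ** Z) \<le> x * y * z * (K * K)"
proof -
  have p: "0 \<le> x" "0 \<le> y" "0 \<le> z" using b norm_ge_zero order_trans by blast+
  have "norm (X ** Y ** Z) \<le> norm (X ** Y) * norm Z * K" by (rule K)
  also have "\<dots> \<le> (norm X * norm Y * K) * norm Z * K"
    by (intro mult_right_mono K) (use K in auto)
  also have "\<dots> \<le> (x * y * K) * z * K"
    by (intro mult_right_mono mult_mono b) (use K p in auto)
  finally show ?thesis by (simp add: mult_ac)
qed

text \<open>\<open>H p\<close> is the parallel transport from \<open>0\<close> to \<open>p\<close> along the ray; the bound \<open>small\<close> makes the
  Picard iteration a contraction.\<close>
locale ray_transport =
  fixes a :: "2 \<Rightarrow> real^2 \<Rightarrow> real^2^2" and U :: "(real^2) set" and r :: real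
  assumes U: "open U" "cball 0 r \<subseteq> U" and r: "r > 0"
    and smooth: "\<And>i. smooth_on U (a i)"
    and traceless: "\<And>i p. p \<in> U \<Longrightarrow> trace (a i p) = 0"
    and small: "\<And>(M::real^2^2) p q. p \<in> cball 0 r \<Longrightarrow> q \<in> cball 0 r \<Longrightarrow> norm (M ** (\<Sum>i\<in>UNIV. q $ i *\<^sub>R a i p)) \<le> norm M / 2"
begin

definition A :: "real^2 \<Rightarrow> real^2 \<Rightarrow> real^2^2" where
  "A p v = (\<Sum>i\<in>UNIV. v $ i *\<^sub>R a i p)"

definition Da :: "2 \<Rightarrow> real^2 \<Rightarrow> real^2 \<Rightarrow> real^2^2" where
  "Da i p = fderiv (a i) p"

definition Y :: "real^2 \<Rightarrow> real \<Rightarrow> real^2^2" where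
  "Y p = (SOME Y. Y 0 = mat 1 \<and> (\<forall>t\<in>{0..1}. (Y has_vector_derivative Y t ** A (t *\<^sub>R p) p) (at t within {0..1})))"

definition H :: "real^2 \<Rightarrow> real^2^2" where "H p = Y p 1"

lemma scale_in: "p \<in> cball 0 r \<Longrightarrow> t \<in> {0..1} \<Longrightarrow> t *\<^sub>R p \<in> cball 0 r" for p :: "real^2"
  using mult_left_le_one_le[of "norm p" t] by auto

lemma scale_in_U: "p \<in> cball 0 r \<Longrightarrow> t \<in> {0..1} \<Longrightarrow> t *\<^sub>R p \<in> U"
  using scale_in U by blast

lemma Da: "p \<in> U \<Longrightarrow> (a i has_derivative Da i p) (at p)"
  unfolding Da_def by (rule smooth_on_has_derivative[OF smooth])

lemma Da_linear: "p \<in> U \<Longrightarrow> linear (Da i p)"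
  using Da has_derivative_linear by blast

lemma continuous_a_ray: "p \<in> cball 0 r \<Longrightarrow> continuous_on {0..1} (\<lambda>t. a i (t *\<^sub>R p))"
  by (rule continuous_on_compose2[OF smooth_on_continuous[OF smooth]])
    (auto intro!: continuous_intros scale_in_U)

lemma continuous_Da_ray: "p \<in> cball 0 r \<Longrightarrow> continuous_on {0..1} (\<lambda>t. Da i (t *\<^sub>R p) w)"
  unfolding Da_def
  by (rule continuous_on_compose2[OF smooth_on_continuous[OF smooth_on_frechet_derivative[OF smooth]]])
    (auto intro!: continuous_intros scale_in_U)

lemma ode_Y:
  assumes p: "p \<in> cball 0 r"
  shows "ode (\<lambda>t. A (t *\<^sub>R p) p) (Y p)"
proof -
  have "continuous_on {0..1} (\<lambda>t. A (t *\<^sub>R p) p)"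
    unfolding A_def by (intro continuous_intros continuous_a_ray p)
  from ode_exists[OF this] have "\<exists>Y. Y 0 = mat 1 \<and> (\<forall>t\<in>{0..1}. (Y has_vector_derivative Y t ** A (t *\<^sub>R p) p) (at t within {0..1}))"
    unfolding A_def using small[OF scale_in[OF p] p] by blast
  from someI_ex[OF this]
  have "Y p 0 = mat 1 \<and> (\<forall>t\<in>{0..1}. (Y p has_vector_derivative Y p t ** A (t *\<^sub>R p) p) (at t within {0..1}))"
    unfolding Y_def .
  moreover have "trace (A (t *\<^sub>R p) p) = 0" if "t \<in> {0..1}" for t
    unfolding A_def sum_2 using traceless[OF scale_in_U[OF p that]]
    by (simp add: trace_add trace_scaleR)
  ultimately show ?thesis by unfold_locales auto
qed

text \<open>Rescaling time by \<open>s\<close> turns the first part of the transport towards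
  \<open>p\<close> into the whole transport towards the point \<open>s *\<^sub>R p\<close>. So the
  transport at intermediate times is a value of \<open>H\<close> as well, which is what later closes
  the bootstrap.\<close>

lemma Y_eq_H:
  assumes p: "p \<in> cball 0 r" and s: "s \<in> {0..1}"
  shows "Y p s = H (s *\<^sub>R p)"
proof -
  have "ode (\<lambda>t. A (t *\<^sub>R s *\<^sub>R p) (s *\<^sub>R p)) (\<lambda>t. Y p (t * s))"
  proof
    fix t :: real assume t: "t \<in> {0..1}"
    have ts: "t * s \<in> {0..1}" using s t by (auto intro: mult_le_one)
    have "((\<lambda>t. Y p (t * s)) has_vector_derivative s *\<^sub>R (Y p (t * s) ** A ((t * s) *\<^sub>R p) p)) (at t within {0..1})"
    proof -
      have 1: "((\<lambda>t. t * s) has_vector_derivative s) (at t within {0..1})"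
        by (auto intro!: derivative_eq_intros)
      have 2: "(Y p has_vector_derivative Y p (t * s) ** A ((t * s) *\<^sub>R p) p) (at (t * s) within (\<lambda>t. t * s) ` {0..1})"
        by (rule has_vector_derivative_within_subset[OF ode.deriv[OF ode_Y[OF p] ts]])
          (use s in \<open>auto intro: mult_le_one\<close>)
      show ?thesis
        using vector_derivative_diff_chain_within[OF 1 2[unfolded has_vector_derivative_def]] by (simp add: o_def)
    qed
    moreover have "A q (s *\<^sub>R p) = s *\<^sub>R A q p" for q by (simp add: A_def scaleR_sum_right)
    ultimately show "((\<lambda>t. Y p (t * s)) has_vector_derivative Y p (t * s) ** A (t *\<^sub>R s *\<^sub>R p) (s *\<^sub>R p)) (at t within {0..1})"
      by simp
  next
    fix t :: real assume t: "t \<in> {0..1}"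
    show "trace (A (t *\<^sub>R s *\<^sub>R p) (s *\<^sub>R p)) = 0" by (rule ode.tr[OF ode_Y[OF scale_in[OF p s]] t])
  qed (simp add: ode.init[OF ode_Y[OF p]])
  from ode_unique[OF this ode_Y[OF scale_in[OF p s]], of 1] show ?thesis by (simp add: H_def)
qed

lemma H_SL2: "p \<in> cball 0 r \<Longrightarrow> H p \<in> SL2"
  unfolding H_def using ode.SL2[OF ode_Y, of p 1] by simp

lemma continuous_Y: "p \<in> cball 0 r \<Longrightarrow> continuous_on {0..1} (Y p)"
  unfolding continuous_on_eq_continuous_within
  using ode.deriv[OF ode_Y] by (blast intro: has_vector_derivative_continuous)

text \<open>The derivative of the coefficient \<open>A (t *\<^sub>R p) p\<close> with respect to
  \<open>p\<close> in the direction \<open>w\<close>.\<close>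

definition L :: "real^2 \<Rightarrow> real^2 \<Rightarrow> real \<Rightarrow> real^2^2" where
  "L p w t = (\<Sum>i\<in>UNIV. w $ i *\<^sub>R a i (t *\<^sub>R p) + (p $ i * t) *\<^sub>R Da i (t *\<^sub>R p) w)"

text \<open>Duhamel's formula for the derivative of \<open>H\<close> at \<open>p\<close> in the
  direction \<open>w\<close>, obtained by variation of constants.\<close>

definition G :: "real^2 \<Rightarrow> real^2 \<Rightarrow> real^2^2" where
  "G p w = integral {0..1} (\<lambda>t. Y p t ** L p w t ** adj2 (Y p t)) ** H p"

lemma continuous_L: "p \<in> cball 0 r \<Longrightarrow> continuous_on {0..1} (L p w)"
  unfolding L_def[abs_def] by (intro continuous_intros continuous_a_ray continuous_Da_ray)

lemma continuous_YLY: "p \<in> cball 0 r \<Longrightarrow> continuous_on {0..1} (\<lambda>t. Y p t ** L p w t ** adj2 (Y p t))"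
  by (intro continuous_intros continuous_Y continuous_L)

lemma bounded_linear_G:
  assumes p: "p \<in> cball 0 r"
  shows "bounded_linear (G p)"
proof -
  have lin: "linear (Da i (t *\<^sub>R p))" if "t \<in> {0..1}" for i t
    using Da_linear scale_in[OF p that] U by blast
  have i: "(\<lambda>t. Y p t ** L p w t ** adj2 (Y p t)) integrable_on {0..1}" for w
    by (intro integrable_continuous_real continuous_YLY p)
  have "linear (G p)"
  proof (rule linearI)
    fix v w
    have "L p (v + w) t = L p v t + L p w t" if "t \<in> {0..1}" for t
      using linear_add[OF lin[OF that]] by (simp add: L_def sum.distrib[symmetric] algebra_simps)
    then have "integral {0..1} (\<lambda>t. Y p t ** L p (v + w) t ** adj2 (Y p t)) =
      integral {0..1} (\<lambda>t. Y p t ** L p v t ** adj2 (Y p t) + Y p t ** L p w t ** adj2 (Y p t))"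
      by (intro integral_cong) (simp add: mm_left_distrib mm_right_distrib)
    then show "G p (v + w) = G p v + G p w"
      unfolding G_def by (simp add: integral_add i mm_left_distrib)
  next
    fix c v
    have "L p (c *\<^sub>R v) t = c *\<^sub>R L p v t" if "t \<in> {0..1}" for t
      using linear_scale[OF lin[OF that]] by (simp add: L_def scaleR_sum_right algebra_simps)
    then have "integral {0..1} (\<lambda>t. Y p t ** L p (c *\<^sub>R v) t ** adj2 (Y p t)) =
      integral {0..1} (\<lambda>t. c *\<^sub>R (Y p t ** L p v t ** adj2 (Y p t)))"
      by (intro integral_cong) simp
    then show "G p (c *\<^sub>R v) = c *\<^sub>R G p v" unfolding G_def by simp
  qed
  then show ?thesis by (simp add: linear_conv_bounded_linear)
qed

lemma a_bounds:
  "\<exists>C\<ge>0. \<forall>i. \<forall>x\<in>cball 0 r. \<forall>y\<in>cball 0 r. norm (a i x) \<le> C \<and> norm (a i y - a i x) \<le> C * norm (y - x) \<and>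
     norm (a i y - a i x - Da i x (y - x)) \<le> C * (norm (y - x))\<^sup>2"
proof -
  have c: "compact (cball 0 r :: (real^2) set)" "convex (cball 0 r :: (real^2) set)" by auto
  have "\<exists>M. \<forall>x\<in>cball 0 r. norm (a i x) \<le> M" for i
    using compact_imp_bounded[OF compact_continuous_image[OF continuous_on_subset[OF smooth_on_continuous[OF smooth] U(2)] c(1)], of i]
    by (auto simp: bounded_iff)
  then obtain M where M: "\<And>i x. x \<in> cball 0 r \<Longrightarrow> norm (a i x) \<le> M i" by metis
  obtain P where P: "\<And>i. P i \<ge> 0" "\<And>i x y. x \<in> cball 0 r \<Longrightarrow> y \<in> cball 0 r \<Longrightarrow> norm (a i y - a i x) \<le> P i * norm (y - x)"
    using smooth_lipschitz[OF smooth U(1) c U(2)] by metis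
  obtain Q where Q: "\<And>i. Q i \<ge> 0" "\<And>i x y. x \<in> cball 0 r \<Longrightarrow> y \<in> cball 0 r \<Longrightarrow> norm (a i y - a i x - Da i x (y - x)) \<le> Q i * (norm (y - x))\<^sup>2"
    using smooth_taylor[OF smooth U(1) c U(2)] unfolding Da_def by metis
  define C where "C = (\<Sum>i\<in>UNIV. \<bar>M i\<bar> + P i + Q i)"
  have C: "\<bar>M i\<bar> + P i + Q i \<le> C" for i
    unfolding C_def by (rule member_le_sum) (use P Q in auto)
  have C0: "C \<ge> 0" unfolding C_def by (intro sum_nonneg) (use P Q in auto)
  have "M i \<le> C" "P i \<le> C" "Q i \<le> C" for i using C[of i] P(1)[of i] Q(1)[of i] abs_ge_self[of "M i"] by linarith+
  then show ?thesis using M P Q C0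
    by (intro exI[of _ C]) (meson mult_right_mono norm_ge_zero order_trans zero_le_power2)
qed

text \<open>Differentiability is proved through an explicit second order bound. The quotient of the
  transports to \<open>q\<close> and \<open>p\<close> is compared with the integral of its
  linearized derivative, and all constants are uniform on the closed ball.\<close>

lemma H_quadratic:
  assumes p: "p \<in> cball 0 r"
  shows "\<exists>C. \<forall>q\<in>cball 0 r. norm (H q - H p - G p (q - p)) \<le> C * (norm (q - p))\<^sup>2"
proof -
  obtain C where C: "C \<ge> 0" "\<And>i x. x \<in> cball 0 r \<Longrightarrow> norm (a i x) \<le> C"
    "\<And>i x y. x \<in> cball 0 r \<Longrightarrow> y \<in> cball 0 r \<Longrightarrow> norm (a i y - a i x) \<le> C * norm (y - x)"
    "\<And>i x y. x \<in> cball 0 r \<Longrightarrow> y \<in> cball 0 r \<Longrightarrow> norm (a i y - a i x - Da i x (y - x)) \<le> C * (norm (y - x))\<^sup>2"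
    using a_bounds by metis
  obtain K where K: "\<And>(X::real^2^2) (Y::real^2^2). norm (X ** Y) \<le> norm X * norm Y * K" "K > 0"
    using bounded_bilinear.pos_bounded[OF bilinear_mm] by blast
  obtain Ka where Ka: "\<And>X. norm (adj2 X) \<le> norm X * Ka" "Ka > 0"
    using bounded_linear.pos_bounded[OF bounded_linear_adj2] by blast
  define N where "N = 2 * norm (mat 1 :: real^2^2)"
  have N: "norm (Y q t) \<le> N" if "q \<in> cball 0 r" "t \<in> {0..1}" for q t
    unfolding N_def using ode.norm_bound[OF ode_Y[OF that(1)] _ that(2)] small[OF scale_in[OF that(1)] that(1)]
    by (simp add: A_def)
  have N0: "N \<ge> 0" by (simp add: N_def)
  have Na: "norm (adj2 (Y q t)) \<le> N * Ka" if "q \<in> cball 0 r" "t \<in> {0..1}" for q t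
    using order_trans[OF Ka(1) mult_right_mono[OF N[OF that]]] Ka by simp
  define C1 where "C1 = 2 * (C + r * C)"
  have C1: "C1 \<ge> 0" using C r by (simp add: C1_def)
  define B where "B = (\<lambda>q t. A (t *\<^sub>R q) q)"
  have comp: "\<bar>x $ i\<bar> \<le> norm x" for x :: "real^2" and i by (rule component_le_norm_cart)
  have comp_r: "\<bar>p $ i\<bar> \<le> r" for i using comp[of p i] p by simp
  have sc: "norm (t *\<^sub>R q - t *\<^sub>R p) \<le> norm (q - p)" if "t \<in> {0..1}" for t q
    using that mult_left_le_one_le[of "norm (q - p)" t] by (simp flip: scaleR_diff_right)
  have B1: "norm (B q t - B p t) \<le> C1 * norm (q - p)" if q: "q \<in> cball 0 r" and t: "t \<in> {0..1}" for q t
  proof -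
    have tq: "t *\<^sub>R q \<in> cball 0 r" "t *\<^sub>R p \<in> cball 0 r" using scale_in p q t by blast+
    have "B q t - B p t = (\<Sum>i\<in>UNIV. (q - p) $ i *\<^sub>R a i (t *\<^sub>R q) + p $ i *\<^sub>R (a i (t *\<^sub>R q) - a i (t *\<^sub>R p)))"
      by (simp add: B_def A_def sum_2 algebra_simps)
    also have "norm \<dots> \<le> (\<Sum>i\<in>(UNIV::2 set). norm (q - p) * C + r * (C * norm (q - p)))"
    proof (intro order_trans[OF norm_sum sum_mono] order_trans[OF norm_triangle_ineq] add_mono)
      fix i
      show "norm ((q - p) $ i *\<^sub>R a i (t *\<^sub>R q)) \<le> norm (q - p) * C"
        unfolding norm_scaleR using comp[of "q - p" i] C(2)[OF tq(1)] by (intro mult_mono) auto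
      have "norm (a i (t *\<^sub>R q) - a i (t *\<^sub>R p)) \<le> C * norm (q - p)"
        using order_trans[OF C(3)[OF tq(2) tq(1)] mult_left_mono[OF sc[OF t] C(1)]] .
      then show "norm (p $ i *\<^sub>R (a i (t *\<^sub>R q) - a i (t *\<^sub>R p))) \<le> r * (C * norm (q - p))"
        unfolding norm_scaleR using comp_r[of i] r by (intro mult_mono) auto
    qed
    finally show ?thesis by (simp add: C1_def algebra_simps)
  qed
  have B2: "norm (B q t - B p t - L p (q - p) t) \<le> C1 * (norm (q - p))\<^sup>2" if q: "q \<in> cball 0 r" and t: "t \<in> {0..1}" for q t
  proof -
    have tq: "t *\<^sub>R q \<in> cball 0 r" "t *\<^sub>R p \<in> cball 0 r" using scale_in p q t by blast+
    have lin: "Da i (t *\<^sub>R p) (t *\<^sub>R q - t *\<^sub>R p) = t *\<^sub>R Da i (t *\<^sub>R p) (q - p)" for i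
      using linear_scale[OF Da_linear[OF scale_in_U[OF p t]], of i t "q - p"] by (simp add: scaleR_diff_right)
    have e: "B q t - B p t - L p (q - p) t = (\<Sum>i\<in>UNIV. (q - p) $ i *\<^sub>R (a i (t *\<^sub>R q) - a i (t *\<^sub>R p)) +
        p $ i *\<^sub>R (a i (t *\<^sub>R q) - a i (t *\<^sub>R p) - Da i (t *\<^sub>R p) (t *\<^sub>R q - t *\<^sub>R p)))"
      unfolding lin by (simp add: B_def A_def L_def sum_2 algebra_simps)
    have "norm (B q t - B p t - L p (q - p) t) \<le> (\<Sum>i\<in>(UNIV::2 set). norm (q - p) * (C * norm (q - p)) + r * (C * (norm (q - p))\<^sup>2))"
      unfolding e
    proof (intro order_trans[OF norm_sum sum_mono] order_trans[OF norm_triangle_ineq] add_mono)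
      fix i
      have "norm (a i (t *\<^sub>R q) - a i (t *\<^sub>R p)) \<le> C * norm (q - p)"
        using order_trans[OF C(3)[OF tq(2) tq(1)] mult_left_mono[OF sc[OF t] C(1)]] .
      then show "norm ((q - p) $ i *\<^sub>R (a i (t *\<^sub>R q) - a i (t *\<^sub>R p))) \<le> norm (q - p) * (C * norm (q - p))"
        unfolding norm_scaleR using comp[of "q - p" i] by (intro mult_mono) auto
      have "norm (a i (t *\<^sub>R q) - a i (t *\<^sub>R p) - Da i (t *\<^sub>R p) (t *\<^sub>R q - t *\<^sub>R p)) \<le> C * (norm (q - p))\<^sup>2"
        using order_trans[OF C(4)[OF tq(2) tq(1)] mult_left_mono[OF power_mono[OF sc[OF t] norm_ge_zero] C(1)]] .
      then show "norm (p $ i *\<^sub>R (a i (t *\<^sub>R q) - a i (t *\<^sub>R p) - Da i (t *\<^sub>R p) (t *\<^sub>R q - t *\<^sub>R p))) \<le> r * (C * (norm (q - p))\<^sup>2)"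
        unfolding norm_scaleR using comp_r[of i] r by (intro mult_mono) auto
    qed
    then show ?thesis by (simp add: C1_def algebra_simps power2_eq_square)
  qed
  note n3 = norm_le_prod3[OF K]
  define C2 where "C2 = N * C1 * (N * Ka) * (K * K)"
  have C2: "C2 \<ge> 0" using N0 C1 Ka K by (simp add: C2_def)
  have d: "((\<lambda>t. Y q t ** adj2 (Y p t)) has_vector_derivative Y q t ** (B q t - B p t) ** adj2 (Y p t)) (at t within {0..1})"
    if "q \<in> cball 0 r" "t \<in> {0..1}" for q t
    unfolding B_def by (rule ode_quotient_deriv[OF ode_Y[OF that(1)] ode_Y[OF p] that(2)])
  \<comment> \<open>A first order estimate. It is needed because the derivative of the quotient
    still contains \<open>Y q\<close>, which the linearization replaces by
    \<open>Y p\<close>.\<close>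
  have Lip: "norm (Y q t - Y p t) \<le> C2 * N * K * norm (q - p)" if q: "q \<in> cball 0 r" and t: "t \<in> {0..1}" for q t
  proof -
    have "norm (Y q t ** adj2 (Y p t) - Y q 0 ** adj2 (Y p 0)) \<le> (C2 * norm (q - p)) * norm (t - 0)"
    proof (rule differentiable_bound[of "{0..1}"])
      fix s :: real assume s: "s \<in> {0..1}"
      show "((\<lambda>t. Y q t ** adj2 (Y p t)) has_derivative (\<lambda>h. h *\<^sub>R (Y q s ** (B q s - B p s) ** adj2 (Y p s)))) (at s within {0..1})"
        using d[OF q s] by (simp add: has_vector_derivative_def)
      have "norm (Y q s ** (B q s - B p s) ** adj2 (Y p s)) \<le> N * (C1 * norm (q - p)) * (N * Ka) * (K * K)"
        by (intro n3 N Na B1 p q s)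
      then have "norm (Y q s ** (B q s - B p s) ** adj2 (Y p s)) \<le> C2 * norm (q - p)" by (simp add: C2_def mult_ac)
      then show "onorm (\<lambda>h. h *\<^sub>R (Y q s ** (B q s - B p s) ** adj2 (Y p s))) \<le> C2 * norm (q - p)"
        by (intro onorm_le) (simp add: mult.commute[of "C2 * _"] mult_left_mono)
    qed (use t in auto)
    also have "\<dots> \<le> C2 * norm (q - p)" using t C2 by (simp add: mult_left_le)
    finally have 1: "norm (Y q t ** adj2 (Y p t) - mat 1) \<le> C2 * norm (q - p)"
      using ode.init[OF ode_Y[OF p]] ode.init[OF ode_Y[OF q]] by simp
    have "Y q t - Y p t = (Y q t ** adj2 (Y p t) - mat 1) ** Y p t"
      using ode.SL2[OF ode_Y[OF p] t] by (simp add: mm_diff_left)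
    then have "norm (Y q t - Y p t) \<le> norm (Y q t ** adj2 (Y p t) - mat 1) * norm (Y p t) * K" using K by simp
    also have "\<dots> \<le> (C2 * norm (q - p)) * N * K"
      using 1 N[OF p t] C2 K by (intro mult_right_mono mult_mono) auto
    finally show ?thesis by (simp add: mult_ac)
  qed
  define C3 where "C3 = (C2 * N * K) * C1 * (N * Ka) * (K * K) + N * C1 * (N * Ka) * (K * K)"
  have C3: "C3 \<ge> 0" using N0 C1 C2 Ka K by (simp add: C3_def)
  have "norm (H q - H p - G p (q - p)) \<le> (C3 * N * K) * (norm (q - p))\<^sup>2" if q: "q \<in> cball 0 r" for q
  proof -
    let ?w = "q - p"
    let ?f = "\<lambda>t. Y p t ** L p ?w t ** adj2 (Y p t)"
    let ?E = "\<lambda>t. Y q t ** adj2 (Y p t) - integral {0..t} ?f"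
    have dE: "(?E has_vector_derivative Y q t ** (B q t - B p t) ** adj2 (Y p t) - ?f t) (at t within {0..1})" if "t \<in> {0..1}" for t
      by (intro has_vector_derivative_diff d q that integral_has_vector_derivative continuous_YLY p)
    have "norm (?E 1 - ?E 0) \<le> (C3 * (norm ?w)\<^sup>2) * norm (1 - 0::real)"
    proof (rule differentiable_bound[of "{0..1}"])
      fix s :: real assume s: "s \<in> {0..1}"
      show "(?E has_derivative (\<lambda>h. h *\<^sub>R (Y q s ** (B q s - B p s) ** adj2 (Y p s) - ?f s))) (at s within {0..1})"
        using dE[OF s] by (simp add: has_vector_derivative_def)
      \<comment> \<open>Replacing \<open>Y q\<close> by \<open>Y p\<close> costs a product of two
        first order terms, and replacing \<open>B q - B p\<close> by \<open>L\<close> costs a Taylor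
        remainder; both are quadratic in \<open>q - p\<close>.\<close>
      have "Y q s ** (B q s - B p s) ** adj2 (Y p s) - ?f s =
        (Y q s - Y p s) ** (B q s - B p s) ** adj2 (Y p s) + Y p s ** (B q s - B p s - L p ?w s) ** adj2 (Y p s)"
        by (simp add: mm_diff_left mm_diff_right)
      also have "norm \<dots> \<le> (C2 * N * K * norm ?w) * (C1 * norm ?w) * (N * Ka) * (K * K) + N * (C1 * (norm ?w)\<^sup>2) * (N * Ka) * (K * K)"
        by (intro order_trans[OF norm_triangle_ineq] add_mono n3 Lip N Na B1 B2 p q s)
      also have "\<dots> = C3 * (norm ?w)\<^sup>2" by (simp add: C3_def power2_eq_square algebra_simps)
      finally show "onorm (\<lambda>h. h *\<^sub>R (Y q s ** (B q s - B p s) ** adj2 (Y p s) - ?f s)) \<le> C3 * (norm ?w)\<^sup>2"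
        by (intro onorm_le) (simp add: mult.commute[of "C3 * _"] mult_left_mono)
    qed auto
    then have 1: "norm (H q ** adj2 (H p) - integral {0..1} ?f - mat 1) \<le> C3 * (norm ?w)\<^sup>2"
      using ode.init[OF ode_Y[OF p]] ode.init[OF ode_Y[OF q]] by (simp add: H_def)
    have "H q - H p - G p ?w = (H q ** adj2 (H p) - integral {0..1} ?f - mat 1) ** H p"
      using H_SL2[OF p] by (simp add: mm_diff_left G_def)
    then have "norm (H q - H p - G p ?w) \<le> norm (H q ** adj2 (H p) - integral {0..1} ?f - mat 1) * norm (H p) * K" using K by simp
    also have "\<dots> \<le> (C3 * (norm ?w)\<^sup>2) * N * K"
      using 1 N[OF p, of 1] C3 K unfolding H_def by (intro mult_right_mono mult_mono) auto
    finally show ?thesis by (simp add: mult_ac)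
  qed
  then show ?thesis by blast
qed

lemma H_has_derivative:
  assumes p: "p \<in> ball 0 r"
  shows "(H has_derivative G p) (at p)"
proof -
  have pc: "p \<in> cball 0 r" using p by auto
  obtain C where C: "\<And>q. q \<in> cball 0 r \<Longrightarrow> norm (H q - H p - G p (q - p)) \<le> C * (norm (q - p))\<^sup>2"
    using H_quadratic[OF pc] by blast
  show ?thesis
    by (rule has_derivative_if_quadratic[OF bounded_linear_G[OF pc] open_ball p C]) auto
qed

text \<open>By \<open>Y_eq_H\<close> the candidate derivative \<open>G p w\<close> is an integral
  over values of \<open>H\<close> and smooth data, so every order of regularity of \<open>H\<close>
  passes to \<open>G\<close>.\<close>

lemma smooth_H: "smooth_on (ball 0 r) H"
proof (rule smooth_on_bootstrap[OF open_ball H_has_derivative])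
  fix k w assume H: "Ck_on k (ball 0 r) H"
  let ?s = "\<lambda>z::(real^2) \<times> real. snd z *\<^sub>R fst z"
  \<comment> \<open>The pairs whose scaled point lies in the ball. This set is open and contains the
    ball times the closed unit interval, as required for differentiating under the integral.\<close>
  define Om where "Om = {z :: (real^2) \<times> real. ?s z \<in> ball 0 r}"
  have cs: "continuous_on UNIV ?s" by (intro continuous_intros)
  have "Om = ?s -` ball 0 r" by (auto simp: Om_def)
  then have O: "open Om" using open_vimage[OF open_ball cs, of 0 r] by (simp only: simp_thms)
  have sm: "smooth_on Om ?s"
    by (intro smooth_on_scaleR smooth_on_bounded_linear bounded_linear_snd bounded_linear_fst O)
  have inU: "?s ` Om \<subseteq> U" using U ball_subset_cball by (auto simp: Om_def)
  have inB: "?s ` Om \<subseteq> ball 0 r" by (auto simp: Om_def)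
  have HC: "Ck_on k Om (\<lambda>z. H (?s z))"
    by (rule Ck_on_compose[OF O open_ball inB H]) (use sm in \<open>simp add: smooth_on_def\<close>)
  have aC: "smooth_on Om (\<lambda>z. a i (?s z))" for i
    by (rule smooth_on_compose[OF O U(1) inU smooth sm])
  have DC: "smooth_on Om (\<lambda>z. Da i (?s z) w)" for i
    unfolding Da_def by (rule smooth_on_compose[OF O U(1) inU smooth_on_frechet_derivative[OF smooth] sm])
  have "smooth_on Om (\<lambda>z. L (fst z) w (snd z))"
    unfolding L_def
    by (intro smooth_on_sum smooth_on_add smooth_on_scaleR smooth_on_const aC DC O smooth_on_mult smooth_on_component
        smooth_on_bounded_linear bounded_linear_snd bounded_linear_fst)
  then have LC: "Ck_on k Om (\<lambda>z. L (fst z) w (snd z))" by (simp add: smooth_on_def)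
  have f: "Ck_on k Om (\<lambda>z. H (?s z) ** L (fst z) w (snd z) ** adj2 (H (?s z)))"
    by (intro Ck_on_bilinear[OF bilinear_mm] Ck_on_linear_comp[OF bounded_linear_adj2] HC LC O)
  have sub: "ball 0 r \<times> {0..1} \<subseteq> Om"
  proof clarify
    fix p :: "real^2" and t :: real assume "p \<in> ball 0 r" "t \<in> {0..1}"
    then show "(p, t) \<in> Om"
      using mult_left_le_one_le[of "norm p" t] by (auto simp: Om_def)
  qed
  have "Ck_on k (ball 0 r) (\<lambda>p. integral {0..1} (\<lambda>t. H (t *\<^sub>R p) ** L p w t ** adj2 (H (t *\<^sub>R p))))"
    using Ck_on_integral[OF O open_ball convex_ball sub f] unfolding fst_conv snd_conv .
  then have "Ck_on k (ball 0 r) (\<lambda>p. integral {0..1} (\<lambda>t. H (t *\<^sub>R p) ** L p w t ** adj2 (H (t *\<^sub>R p))) ** H p)"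
    by (intro Ck_on_bilinear[OF bilinear_mm] H open_ball)
  then show "Ck_on k (ball 0 r) (\<lambda>p. G p w)"
  proof (rule Ck_on_cong[OF open_ball, rotated])
    fix p :: "real^2" assume "p \<in> ball 0 r"
    then have pc: "p \<in> cball 0 r" by auto
    show "integral {0..1} (\<lambda>t. H (t *\<^sub>R p) ** L p w t ** adj2 (H (t *\<^sub>R p))) ** H p = G p w"
      unfolding G_def by (intro arg_cong[where f="\<lambda>x. x ** H p"] integral_cong) (simp add: Y_eq_H[OF pc])
  qed
qed

text \<open>When the curvature vanishes along the ray, the integrand of \<open>G\<close> has the
  primitive \<open>t *\<^sub>R (Y p t ** A (t *\<^sub>R p) w ** adj2 (Y p t))\<close>, and its value
  at 1 is the claim. Only points of the segment from 0 to \<open>p\<close> enter, which makes the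
  lemma applicable at boundary points.\<close>

lemma H_derivative_flat:
  assumes p: "p \<in> ball 0 r"
    and flat: "\<And>t. t \<in> {0..1} \<Longrightarrow> Da 2 (t *\<^sub>R p) (axis 1 1) - Da 1 (t *\<^sub>R p) (axis 2 1) +
       (a 1 (t *\<^sub>R p) ** a 2 (t *\<^sub>R p) - a 2 (t *\<^sub>R p) ** a 1 (t *\<^sub>R p)) = 0"
  shows "fderiv H p w = H p ** A p w"
proof -
  have pc: "p \<in> cball 0 r" using p by auto
  let ?f = "\<lambda>t. Y p t ** L p w t ** adj2 (Y p t)"
  let ?g = "\<lambda>t. t *\<^sub>R (Y p t ** A (t *\<^sub>R p) w ** adj2 (Y p t))"
  have d: "(?g has_vector_derivative ?f t) (at t within {0..1})" if t: "t \<in> {0..1}" for t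
  proof -
    let ?q = "t *\<^sub>R p"
    have q: "?q \<in> U" using scale_in[OF pc t] U by auto
    have da: "((\<lambda>t. a i (t *\<^sub>R p)) has_vector_derivative Da i ?q p) (at t within {0..1})" for i
    proof -
      have "((\<lambda>t. a i (0 + t *\<^sub>R p)) has_vector_derivative Da i (0 + t *\<^sub>R p) p) (at t)"
        unfolding Da_def by (rule frechet_derivative_line[OF smooth]) (use q in simp)
      then show ?thesis by (simp add: has_vector_derivative_at_within)
    qed
    have dA: "((\<lambda>t. A (t *\<^sub>R p) w) has_vector_derivative (\<Sum>i\<in>UNIV. w $ i *\<^sub>R Da i ?q p)) (at t within {0..1})"
      unfolding A_def by (intro has_vector_derivative_sum bounded_linear.has_vector_derivative[OF bounded_linear_scaleR_right] da)
    note bil = bounded_bilinear.has_vector_derivative[OF bilinear_mm]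
    have 1: "(?g has_vector_derivative t *\<^sub>R (Y p t ** A ?q w ** - (A ?q p ** adj2 (Y p t)) +
        (Y p t ** (\<Sum>i\<in>UNIV. w $ i *\<^sub>R Da i ?q p) + Y p t ** A ?q p ** A ?q w) ** adj2 (Y p t)) +
        1 *\<^sub>R (Y p t ** A ?q w ** adj2 (Y p t))) (at t within {0..1})"
      by (intro bounded_bilinear.has_vector_derivative[OF bounded_bilinear_scaleR] bil dA
          ode.deriv[OF ode_Y[OF pc] t] ode.adj2_deriv[OF ode_Y[OF pc] t]) (auto intro!: derivative_eq_intros)
    have lin: "Da i ?q v = (\<Sum>j\<in>UNIV. v $ j *\<^sub>R Da i ?q (axis j 1))" for i v
    proof -
      have "v = (\<Sum>j\<in>UNIV. v $ j *\<^sub>R axis j 1)" by (simp add: vec_eq_iff forall_2 sum_2 axis_def)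
      then have "Da i ?q v = Da i ?q (\<Sum>j\<in>UNIV. v $ j *\<^sub>R axis j 1)" by (rule arg_cong)
      then show ?thesis by (simp only: linear_sum[OF Da_linear[OF q]] linear_scale[OF Da_linear[OF q]])
    qed
    \<comment> \<open>Flatness removes one of the two mixed derivatives; what remains is an identity
      of matrix polynomials.\<close>
    have D: "Da 2 ?q (axis 1 1) = Da 1 ?q (axis 2 1) - a 1 ?q ** a 2 ?q + a 2 ?q ** a 1 ?q"
      using flat[OF t] by (simp add: algebra_simps)
    have "t *\<^sub>R ((\<Sum>i\<in>UNIV. w $ i *\<^sub>R Da i ?q p) + A ?q p ** A ?q w - A ?q w ** A ?q p) + A ?q w = L p w t"
      unfolding L_def A_def lin[of _ p] lin[of _ w] sum_2 D
      by (simp add: mm_left_distrib mm_right_distrib algebra_simps)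
    then have "?f t = Y p t ** (t *\<^sub>R ((\<Sum>i\<in>UNIV. w $ i *\<^sub>R Da i ?q p) + A ?q p ** A ?q w - A ?q w ** A ?q p) + A ?q w) ** adj2 (Y p t)"
      by simp
    also have "\<dots> = t *\<^sub>R (Y p t ** A ?q w ** - (A ?q p ** adj2 (Y p t)) +
        (Y p t ** (\<Sum>i\<in>UNIV. w $ i *\<^sub>R Da i ?q p) + Y p t ** A ?q p ** A ?q w) ** adj2 (Y p t)) +
        1 *\<^sub>R (Y p t ** A ?q w ** adj2 (Y p t))"
      by (simp add: mm_left_distrib mm_right_distrib mm_diff_left mm_diff_right mm_assoc algebra_simps)
    finally show ?thesis using 1 by simp
  qed
  have "(?f has_integral (?g 1 - ?g 0)) {0..1}"
    by (rule fundamental_theorem_of_calculus) (use d in auto)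
  then have "integral {0..1} ?f = H p ** A p w ** adj2 (H p)" by (simp add: H_def integral_unique)
  then have "G p w = H p ** A p w" using H_SL2[OF pc] by (simp add: G_def)
  then show ?thesis using frechet_derivative_at[OF H_has_derivative[OF p]] by simp
qed

end

section \<open>Homotopies of paths and the topology of the universal cover\<close>

lemma homotopic_paths_const_right:
  assumes "path p" "path_image p \<subseteq> S" "x = pathfinish p"
  shows "homotopic_paths S p (p +++ (\<lambda>t. x))"
proof (rule homotopic_paths_reparametrize[OF assms(1,2), of "\<lambda>t. min 1 (2 * t)"])
  fix t :: real
  consider "2 * t < 1" | "t = 1/2" | "2 * t > 1" by linarith
  then show "(p +++ (\<lambda>t. x)) t = p (min 1 (2 * t))"
  proof cases
    case 2 show ?thesis unfolding 2 by (simp add: joinpaths_def)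
  qed (auto simp: joinpaths_def assms(3) pathfinish_def min_def)
qed (auto intro!: continuous_intros)

lemma homotopic_paths_const_left:
  assumes "path p" "path_image p \<subseteq> S" "x = pathstart p"
  shows "homotopic_paths S p ((\<lambda>t. x) +++ p)"
proof (rule homotopic_paths_reparametrize[OF assms(1,2), of "\<lambda>t. max 0 (2 * t - 1)"])
  fix t :: real
  consider "2 * t < 1" | "t = 1/2" | "2 * t > 1" by linarith
  then show "((\<lambda>t. x) +++ p) t = p (max 0 (2 * t - 1))"
  proof cases
    case 2 show ?thesis unfolding 2 by (simp add: joinpaths_def assms(3) pathstart_def)
  qed (auto simp: joinpaths_def assms(3) pathstart_def max_def)
qed (auto intro!: continuous_intros)

text \<open>At stage \<open>s\<close> the path is followed only as far as the parameter
  \<open>1 - s\<close> and then run back.\<close>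

lemma homotopic_paths_right_inverse:
  assumes p: "path p" "path_image p \<subseteq> S"
  shows "homotopic_paths S (p +++ reversepath p) (\<lambda>t. pathstart p)"
  unfolding homotopic_paths
proof (intro exI conjI ballI)
  let ?f = "\<lambda>z::real \<times> real. (1 - fst z) * min (2 * snd z) (2 - 2 * snd z)"
  let ?h = "\<lambda>z. p (?f z)"
  have f: "?f z \<in> {0..1}" if "z \<in> {0..1} \<times> {0..1}" for z
  proof -
    have "0 \<le> min (2 * snd z) (2 - 2 * snd z)" "min (2 * snd z) (2 - 2 * snd z) \<le> 1" "0 \<le> 1 - fst z" "1 - fst z \<le> 1"
      using that by (auto simp: min_def)
    then show ?thesis by (auto intro: mult_nonneg_nonneg mult_le_one)
  qed
  show "continuous_on ({0..1} \<times> {0..1}) ?h"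
    by (rule continuous_on_compose2[of "{0..1}" p])
      (use p f in \<open>auto simp: path_def intro!: continuous_intros\<close>)
  show "?h \<in> {0..1} \<times> {0..1} \<rightarrow> S" using f p by (auto simp: path_image_def)
  fix t :: real assume "t \<in> {0..1}"
  then show "?h (0, t) = (p +++ reversepath p) t"
    by (auto simp: joinpaths_def reversepath_def min_def)
qed (auto simp: pathstart_def pathfinish_def joinpaths_def reversepath_def)

lemma path_const [simp]: "path (\<lambda>t. x)" "path_image (\<lambda>t::real. x) = {x}" "pathstart (\<lambda>t. x) = x" "pathfinish (\<lambda>t. x) = x"
  by (auto simp: path_def path_image_def pathstart_def pathfinish_def)

lemma homotopic_paths_left_inverse:
  assumes p: "path p" "path_image p \<subseteq> S"
  shows "homotopic_paths S (reversepath p +++ p) (\<lambda>t. pathfinish p)"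
  using homotopic_paths_right_inverse[of "reversepath p" S] p by simp

lemma path_class_eq:
  assumes "path p" "path_image p \<subseteq> X"
  shows "path_class X p = path_class X q \<longleftrightarrow> homotopic_paths X p q"
  using assms homotopic_paths_refl[of X p] homotopic_paths_sym homotopic_paths_trans
  unfolding path_class_def by (metis (no_types, lifting) Collect_cong mem_Collect_eq)

lemma path_class_cong: "homotopic_paths X p q \<Longrightarrow> path_class X p = path_class X q"
  using path_class_eq homotopic_paths_imp_path homotopic_paths_imp_subset by metis

lemma cover_proj_class:
  assumes "path p" "path_image p \<subseteq> X"
  shows "cover_proj (path_class X p) = pathfinish p"
proof -
  have "(SOME q. q \<in> path_class X p) \<in> path_class X p"
    by (rule someI[of _ p]) (simp add: path_class_def assms)
  then show ?thesis unfolding cover_proj_def by (simp add: path_class_def homotopic_paths_imp_pathfinish)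
qed

lemma class_join_class:
  assumes "path p" "path_image p \<subseteq> X" "path q" "path_image q \<subseteq> X" "pathfinish p = pathstart q"
  shows "class_join X (path_class X p) (path_class X q) = path_class X (p +++ q)"
proof -
  have "homotopic_paths X (p +++ q) r" if "homotopic_paths X p p'" "homotopic_paths X q q'" "homotopic_paths X (p' +++ q') r" for p' q' r
    using homotopic_paths_join[OF that(1,2) assms(5)] that(3) homotopic_paths_trans by blast
  moreover have "homotopic_paths X p p" "homotopic_paths X q q" using assms by auto
  ultimately show ?thesis unfolding class_join_def path_class_def by blast
qed

definition paths_from :: "'a::topological_space set \<Rightarrow> 'a \<Rightarrow> (real \<Rightarrow> 'a) set" where
  "paths_from X a = {p. path p \<and> path_image p \<subseteq> X \<and> pathstart p = a}"

lemma ucover_eq: "ucover X a = path_class X ` paths_from X a"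
  by (auto simp: ucover_def paths_from_def)

lemma ucoverE:
  assumes "c \<in> ucover X a"
  obtains p where "c = path_class X p" "p \<in> paths_from X a" "path p" "path_image p \<subseteq> X" "pathstart p = a" "cover_proj c = pathfinish p"
  using assms that by (auto simp: ucover_eq paths_from_def cover_proj_class)

lemma path_class_in_ucover:
  "path p \<Longrightarrow> path_image p \<subseteq> X \<Longrightarrow> pathstart p = a \<Longrightarrow> path_class X p \<in> ucover X a"
  by (auto simp: ucover_def)

lemma cover_proj_in: "c \<in> ucover X a \<Longrightarrow> cover_proj c \<in> X"
  by (metis pathfinish_in_path_image subsetD ucoverE)

text \<open>Paths act on classes from the right. Keeping \<open>q\<close> as a path rather than a
  class allows statements about where its image lies, and these are what describes
  neighbourhoods.\<close>

definition extend :: "'a::topological_space set \<Rightarrow> (real \<Rightarrow> 'a) set \<Rightarrow> (real \<Rightarrow> 'a) \<Rightarrow> (real \<Rightarrow> 'a) set" where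
  "extend X c q = class_join X c (path_class X q)"

lemma extend_class:
  assumes "path p" "path_image p \<subseteq> X" "q \<in> paths_from X (pathfinish p)"
  shows "extend X (path_class X p) q = path_class X (p +++ q)"
  unfolding extend_def using assms by (intro class_join_class) (auto simp: paths_from_def)

lemma extend_in:
  assumes "c \<in> ucover X a" "q \<in> paths_from X (cover_proj c)"
  shows "extend X c q \<in> ucover X a" "cover_proj (extend X c q) = pathfinish q"
proof -
  obtain p where p: "c = path_class X p" "path p" "path_image p \<subseteq> X" "pathstart p = a" "cover_proj c = pathfinish p"
    using ucoverE[OF assms(1)] .
  have q: "path q" "path_image q \<subseteq> X" "pathstart q = pathfinish p" using assms(2) p by (auto simp: paths_from_def)
  have j: "path (p +++ q)" "path_image (p +++ q) \<subseteq> X" using p q by (simp_all add: subset_path_image_join)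
  have e: "extend X c q = path_class X (p +++ q)" unfolding p(1) by (rule extend_class) (use p q in \<open>auto simp: paths_from_def\<close>)
  show "extend X c q \<in> ucover X a" unfolding e by (rule path_class_in_ucover) (use j p in auto)
  show "cover_proj (extend X c q) = pathfinish q" unfolding e using cover_proj_class[OF j] by simp
qed

lemma extend_extend:
  assumes "c \<in> ucover X a" "q \<in> paths_from X (cover_proj c)" "r \<in> paths_from X (pathfinish q)"
  shows "extend X (extend X c q) r = extend X c (q +++ r)"
proof -
  obtain p where p: "c = path_class X p" "path p" "path_image p \<subseteq> X" "pathstart p = a" "cover_proj c = pathfinish p"
    using ucoverE[OF assms(1)] .
  have q: "path q" "path_image q \<subseteq> X" "pathstart q = pathfinish p" using assms(2) p by (auto simp: paths_from_def)
  have r: "path r" "path_image r \<subseteq> X" "pathstart r = pathfinish q" using assms(3) by (auto simp: paths_from_def)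
  have "extend X (extend X c q) r = path_class X ((p +++ q) +++ r)"
    using p q r by (simp add: extend_class paths_from_def subset_path_image_join)
  also have "\<dots> = path_class X (p +++ (q +++ r))"
    by (rule path_class_cong[symmetric], rule homotopic_paths_assoc) (use p q r in auto)
  also have "\<dots> = extend X c (q +++ r)"
    using p q r by (simp add: extend_class paths_from_def subset_path_image_join)
  finally show ?thesis .
qed

lemma extend_const:
  assumes "c \<in> ucover X a"
  shows "extend X c (\<lambda>t. cover_proj c) = c"
proof -
  obtain p where p: "c = path_class X p" "path p" "path_image p \<subseteq> X" "cover_proj c = pathfinish p"
    using ucoverE[OF assms] .
  then have "extend X c (\<lambda>t. cover_proj c) = path_class X (p +++ (\<lambda>t. pathfinish p))"
    unfolding p(1) by (subst extend_class) (auto simp: paths_from_def cover_proj_class)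
  also have "\<dots> = c"
    unfolding p(1) by (rule path_class_cong[symmetric], rule homotopic_paths_const_right) (use p in auto)
  finally show ?thesis .
qed

lemma prolongations_eq:
  "prolongations X c U = extend X c ` {q \<in> paths_from X (cover_proj c). path_image q \<subseteq> U}"
  by (auto simp: prolongations_def extend_def paths_from_def)

lemma prolongations_subset: "c \<in> ucover X a \<Longrightarrow> prolongations X c U \<subseteq> ucover X a"
  using extend_in by (auto simp: prolongations_eq)

lemma prolongations_self: "c \<in> ucover X a \<Longrightarrow> cover_proj c \<in> U \<Longrightarrow> c \<in> prolongations X c U"
  unfolding prolongations_eq using extend_const[of c X a] cover_proj_in[of c X a]
  by (auto simp: paths_from_def image_iff intro!: exI[of _ "\<lambda>t. cover_proj c"])

lemma prolongations_mono: "U \<subseteq> V \<Longrightarrow> prolongations X c U \<subseteq> prolongations X c V"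
  by (auto simp: prolongations_eq)

text \<open>Makes each set of prolongations a neighbourhood of all of its elements, and not only of
  the class that is prolonged.\<close>

lemma prolongations_trans:
  assumes "c \<in> ucover X a" "d \<in> prolongations X c U"
  shows "prolongations X d U \<subseteq> prolongations X c U" "cover_proj d \<in> U"
proof -
  obtain q where q: "q \<in> paths_from X (cover_proj c)" "path_image q \<subseteq> U" "d = extend X c q"
    using assms(2) by (auto simp: prolongations_eq)
  have d: "cover_proj d = pathfinish q" using extend_in[OF assms(1) q(1)] q by simp
  then show "cover_proj d \<in> U" using q by (metis pathfinish_in_path_image subsetD)
  show "prolongations X d U \<subseteq> prolongations X c U"
  proof
    fix e assume "e \<in> prolongations X d U"
    then obtain r where r: "r \<in> paths_from X (pathfinish q)" "path_image r \<subseteq> U" "e = extend X d r"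
      by (auto simp: prolongations_eq d)
    then have "e = extend X c (q +++ r)" using extend_extend[OF assms(1) q(1)] q by simp
    moreover have "q +++ r \<in> paths_from X (cover_proj c)" "path_image (q +++ r) \<subseteq> U"
      using q r by (simp_all add: paths_from_def subset_path_image_join)
    ultimately show "e \<in> prolongations X c U" by (auto simp: prolongations_eq)
  qed
qed

text \<open>The generating sets form a basis: around each common element of two of them lie the
  prolongations inside the intersection of the two open sets. Openness thus has a pointwise
  description, which is used instead of the generating family.\<close>

lemma openin_ucover_topology:
  "openin (ucover_topology X a) W \<longleftrightarrow>
     W \<subseteq> ucover X a \<and> (\<forall>c\<in>W. \<exists>U. open U \<and> cover_proj c \<in> U \<and> prolongations X c U \<subseteq> W)"
proof
  assume "openin (ucover_topology X a) W"
  then have "generate_topology_on {prolongations X c U | c U. c \<in> ucover X a \<and> open U} W"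
    unfolding ucover_topology_def by (rule openin_topology_generated_by)
  then show "W \<subseteq> ucover X a \<and> (\<forall>c\<in>W. \<exists>U. open U \<and> cover_proj c \<in> U \<and> prolongations X c U \<subseteq> W)"
  proof (induction rule: generate_topology_on.induct)
    case (Int A B)
    have "\<exists>U. open U \<and> cover_proj c \<in> U \<and> prolongations X c U \<subseteq> A \<inter> B" if c: "c \<in> A \<inter> B" for c
    proof -
      obtain U V where "open U" "cover_proj c \<in> U" "prolongations X c U \<subseteq> A" "open V" "cover_proj c \<in> V" "prolongations X c V \<subseteq> B"
        using Int.IH c by blast
      then show ?thesis using prolongations_mono[of "U \<inter> V" U X c] prolongations_mono[of "U \<inter> V" V X c]
        by (intro exI[of _ "U \<inter> V"]) auto
    qed
    then show ?case using Int.IH by blast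
  next
    case (UN K)
    then show ?case by (fastforce intro: Sup_least)
  next
    case (Basis W)
    then obtain c U where W: "W = prolongations X c U" "c \<in> ucover X a" "open U" by blast
    have "\<exists>U. open U \<and> cover_proj d \<in> U \<and> prolongations X d U \<subseteq> W" if "d \<in> W" for d
      using prolongations_trans[OF W(2), of d U] that W by auto
    then show ?case using prolongations_subset[OF W(2)] W(1) by simp
  qed auto
next
  assume W: "W \<subseteq> ucover X a \<and> (\<forall>c\<in>W. \<exists>U. open U \<and> cover_proj c \<in> U \<and> prolongations X c U \<subseteq> W)"
  then obtain U where U: "\<And>c. c \<in> W \<Longrightarrow> open (U c) \<and> cover_proj c \<in> U c \<and> prolongations X c (U c) \<subseteq> W" by metis
  have "W = (\<Union>c\<in>W. prolongations X c (U c))"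
  proof (intro equalityI subsetI)
    fix c assume c: "c \<in> W"
    then have "c \<in> prolongations X c (U c)" using W U[OF c] by (intro prolongations_self[of c X a]) auto
    then show "c \<in> (\<Union>c\<in>W. prolongations X c (U c))" using c by blast
  qed (use U in auto)
  moreover have "openin (ucover_topology X a) (\<Union>c\<in>W. prolongations X c (U c))"
    unfolding ucover_topology_def
  proof (intro openin_Union)
    fix P assume "P \<in> (\<lambda>c. prolongations X c (U c)) ` W"
    then show "openin (topology_generated_by {prolongations X c U | c U. c \<in> ucover X a \<and> open U}) P"
      using W U by (intro topology_generated_by_Basis) blast
  qed
  ultimately show "openin (ucover_topology X a) W" by simp
qed

lemma topspace_ucover_topology [simp]: "topspace (ucover_topology X a) = ucover X a"
proof -
  have "openin (ucover_topology X a) (ucover X a)"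
    unfolding openin_ucover_topology by (auto intro!: exI[of _ UNIV] dest: prolongations_subset[THEN subsetD])
  moreover have "topspace (ucover_topology X a) \<subseteq> ucover X a"
    using openin_topspace[of "ucover_topology X a"] unfolding openin_ucover_topology by blast
  ultimately show ?thesis using openin_subset by blast
qed

lemma openin_prolongations: "c \<in> ucover X a \<Longrightarrow> open U \<Longrightarrow> openin (ucover_topology X a) (prolongations X c U)"
  unfolding openin_ucover_topology using prolongations_trans[of c X a _ U] prolongations_subset[of c X a U] by auto

text \<open>Continuity at \<open>x\<close> means that the value at each nearby point arises from
  \<open>f x\<close> by a path inside the given \<open>V\<close>. The later continuity proofs
  exhibit such a path.\<close>

lemma continuous_map_ucover_iff:
  "continuous_map T (ucover_topology Y b) f \<longleftrightarrow> f \<in> topspace T \<rightarrow> ucover Y b \<and>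
     (\<forall>x\<in>topspace T. \<forall>V. open V \<longrightarrow> cover_proj (f x) \<in> V \<longrightarrow>
        (\<exists>Om. openin T Om \<and> x \<in> Om \<and> f ` Om \<subseteq> prolongations Y (f x) V))" (is "?L \<longleftrightarrow> ?R")
proof
  assume L: ?L
  then have f: "f \<in> topspace T \<rightarrow> ucover Y b" by (simp add: continuous_map_def)
  moreover have "\<exists>Om. openin T Om \<and> x \<in> Om \<and> f ` Om \<subseteq> prolongations Y (f x) V"
    if "x \<in> topspace T" "open V" "cover_proj (f x) \<in> V" for x V
  proof (intro exI conjI)
    have fx: "f x \<in> ucover Y b" using f that by auto
    show "openin T {y \<in> topspace T. f y \<in> prolongations Y (f x) V}"
      using L openin_prolongations[OF fx that(2)] by (simp add: continuous_map_def)
  qed (use that f prolongations_self[of "f x" Y b V] in auto)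
  ultimately show ?R by blast
next
  assume R: ?R
  show ?L unfolding continuous_map_def
  proof (intro conjI allI impI)
    fix W assume "openin (ucover_topology Y b) W"
    then have W: "\<forall>c\<in>W. \<exists>U. open U \<and> cover_proj c \<in> U \<and> prolongations Y c U \<subseteq> W"
      by (simp add: openin_ucover_topology)
    show "openin T {x \<in> topspace T. f x \<in> W}"
    proof (subst openin_subopen, intro ballI)
      fix x assume x: "x \<in> {x \<in> topspace T. f x \<in> W}"
      then obtain U where U: "open U" "cover_proj (f x) \<in> U" "prolongations Y (f x) U \<subseteq> W" using W by auto
      then obtain Om where "openin T Om" "x \<in> Om" "f ` Om \<subseteq> prolongations Y (f x) U" using R x by blast
      then show "\<exists>Ta. openin T Ta \<and> x \<in> Ta \<and> Ta \<subseteq> {x \<in> topspace T. f x \<in> W}"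
        using U openin_subset[of T Om] by (intro exI[of _ Om]) auto
    qed
  qed (use R in simp)
qed

lemma continuous_map_cover_proj: "continuous_map (ucover_topology X a) (top_of_set X) cover_proj"
  unfolding continuous_map_def
proof (intro conjI allI impI)
  show "cover_proj \<in> topspace (ucover_topology X a) \<rightarrow> topspace (top_of_set X)" using cover_proj_in by auto
  fix U assume "openin (top_of_set X) U"
  then obtain V where V: "open V" "U = X \<inter> V" by (auto simp: openin_open)
  show "openin (ucover_topology X a) {c \<in> topspace (ucover_topology X a). cover_proj c \<in> U}"
    unfolding openin_ucover_topology
  proof (intro conjI ballI)
    fix c assume "c \<in> {c \<in> topspace (ucover_topology X a). cover_proj c \<in> U}"
    then have c: "c \<in> ucover X a" "cover_proj c \<in> V" using V by auto
    then show "\<exists>U'. open U' \<and> cover_proj c \<in> U' \<and> prolongations X c U' \<subseteq> {c \<in> topspace (ucover_topology X a). cover_proj c \<in> U}"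
      using V prolongations_subset[OF c(1)] prolongations_trans(2)[OF c(1)] cover_proj_in by (intro exI[of _ V]) fastforce
  qed auto
qed

subsection \<open>The group of loops\<close>

lemma loop_group_simps [simp]:
  "c \<in> carrier (loop_group X a) \<longleftrightarrow> c \<in> ucover X a \<and> cover_proj c = a"
  "mult (loop_group X a) = class_join X" "one (loop_group X a) = path_class X (\<lambda>t. a)"
  by (auto simp: loop_group_def)

lemma class_join_in:
  assumes "c \<in> ucover X a" "cover_proj c = a" "d \<in> ucover X a"
  shows "class_join X c d \<in> ucover X a" "cover_proj (class_join X c d) = cover_proj d"
proof -
  obtain p where p: "c = path_class X p" "path p" "path_image p \<subseteq> X" "pathstart p = a" "cover_proj c = pathfinish p"
    using ucoverE[OF assms(1)] .
  obtain q where q: "d = path_class X q" "q \<in> paths_from X a" "cover_proj d = pathfinish q"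
    using ucoverE[OF assms(3)] .
  have "class_join X c d = extend X c q" by (simp add: extend_def q)
  then show "class_join X c d \<in> ucover X a" "cover_proj (class_join X c d) = cover_proj d"
    using extend_in[OF assms(1), of q] q assms by auto
qed

lemma class_join_assoc:
  assumes "c \<in> ucover X a" "cover_proj c = a" "d \<in> ucover X a" "q \<in> paths_from X (cover_proj d)"
  shows "extend X (class_join X c d) q = class_join X c (extend X d q)"
proof -
  obtain r where r: "d = path_class X r" "r \<in> paths_from X a" "cover_proj d = pathfinish r"
    using ucoverE[OF assms(3)] .
  have "extend X d q = path_class X (r +++ q)"
    unfolding r(1) by (rule extend_class) (use r assms in \<open>auto simp: paths_from_def\<close>)
  then show ?thesis
    using extend_extend[OF assms(1), of r q] r assms by (simp add: extend_def)
qed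

lemma group_loop_group:
  assumes a: "a \<in> X"
  shows "group (loop_group X a)"
proof (rule groupI)
  fix c d assume cd: "c \<in> carrier (loop_group X a)" "d \<in> carrier (loop_group X a)"
  then show "c \<otimes>\<^bsub>loop_group X a\<^esub> d \<in> carrier (loop_group X a)" using class_join_in[of c X a d] by simp
  fix e assume e: "e \<in> carrier (loop_group X a)"
  then obtain q where q: "e = path_class X q" "q \<in> paths_from X a" using ucoverE[of e X a] by auto
  show "c \<otimes>\<^bsub>loop_group X a\<^esub> d \<otimes>\<^bsub>loop_group X a\<^esub> e = c \<otimes>\<^bsub>loop_group X a\<^esub> (d \<otimes>\<^bsub>loop_group X a\<^esub> e)"
    using class_join_assoc[of c X a d q] cd q by (simp add: extend_def)
next
  show "\<one>\<^bsub>loop_group X a\<^esub> \<in> carrier (loop_group X a)"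
    using a by (auto intro!: path_class_in_ucover simp: cover_proj_class)
next
  fix c assume c: "c \<in> carrier (loop_group X a)"
  then obtain p where p: "c = path_class X p" "path p" "path_image p \<subseteq> X" "pathstart p = a" "pathfinish p = a"
    using ucoverE[of c X a] by (metis loop_group_simps(1))
  show "\<one>\<^bsub>loop_group X a\<^esub> \<otimes>\<^bsub>loop_group X a\<^esub> c = c"
  proof -
    have "class_join X (path_class X (\<lambda>t. a)) (path_class X p) = path_class X ((\<lambda>t. a) +++ p)"
      by (rule class_join_class) (use p a in auto)
    also have "\<dots> = path_class X p"
      by (rule path_class_cong[symmetric], rule homotopic_paths_const_left) (use p in auto)
    finally show ?thesis by (simp add: p(1))
  qed
  show "\<exists>d\<in>carrier (loop_group X a). d \<otimes>\<^bsub>loop_group X a\<^esub> c = \<one>\<^bsub>loop_group X a\<^esub>"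
  proof (intro bexI)
    show "path_class X (reversepath p) \<otimes>\<^bsub>loop_group X a\<^esub> c = \<one>\<^bsub>loop_group X a\<^esub>"
      using p path_class_cong[OF homotopic_paths_left_inverse[OF p(2,3)]] by (simp add: class_join_class)
    show "path_class X (reversepath p) \<in> carrier (loop_group X a)"
      using p by (auto intro!: path_class_in_ucover simp: cover_proj_class)
  qed
qed

text \<open>Follow a representative of \<open>d\<close> and return along one of \<open>c\<close>:
  the loops act transitively on each fibre of the covering.\<close>

lemma loop_difference:
  assumes c: "c \<in> ucover X a" and d: "d \<in> ucover X a" and eq: "cover_proj c = cover_proj d"
  shows "\<exists>l\<in>carrier (loop_group X a). d = class_join X l c"
proof -
  obtain p where p: "c = path_class X p" "path p" "path_image p \<subseteq> X" "pathstart p = a" "cover_proj c = pathfinish p"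
    using ucoverE[OF c] .
  obtain q where q: "d = path_class X q" "path q" "path_image q \<subseteq> X" "pathstart q = a" "cover_proj d = pathfinish q"
    using ucoverE[OF d] .
  have e: "pathfinish q = pathfinish p" using p q eq by simp
  have l: "path (q +++ reversepath p)" "path_image (q +++ reversepath p) \<subseteq> X"
    using p q e subset_path_image_join[of q X "reversepath p"] by auto
  have "homotopic_paths X ((q +++ reversepath p) +++ p) (q +++ (reversepath p +++ p))"
    by (rule homotopic_paths_sym, rule homotopic_paths_assoc) (use p q e in auto)
  also have "homotopic_paths X (q +++ (reversepath p +++ p)) (q +++ (\<lambda>t. pathfinish p))"
    by (rule homotopic_paths_join[OF _ homotopic_paths_left_inverse]) (use p q e in auto)
  also have "homotopic_paths X (q +++ (\<lambda>t. pathfinish p)) q"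
    by (rule homotopic_paths_sym, rule homotopic_paths_const_right) (use p q e in auto)
  finally have "path_class X ((q +++ reversepath p) +++ p) = d" unfolding q(1) by (rule path_class_cong)
  then have "d = class_join X (path_class X (q +++ reversepath p)) c"
    unfolding p(1) using l p by (simp add: class_join_class)
  moreover have "path_class X (q +++ reversepath p) \<in> carrier (loop_group X a)"
    using l p q by (auto intro!: path_class_in_ucover simp: cover_proj_class)
  ultimately show ?thesis by blast
qed

subsection \<open>The universal covering group of \<open>SL(2)\<close>\<close>

abbreviation smul (infixl "\<odot>" 70) where "c \<odot> d \<equiv> c \<otimes>\<^bsub>SL2_cover\<^esub> d"
abbreviation sinv where "sinv c \<equiv> inv\<^bsub>SL2_cover\<^esub> c"

lemma homotopic_paths_mm:
  assumes "homotopic_paths SL2 p p'" "homotopic_paths SL2 q q'"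
  shows "homotopic_paths SL2 (\<lambda>t. p t ** q t) (\<lambda>t. p' t ** q' t)"
proof -
  obtain h where h: "continuous_on ({0..1} \<times> {0..1}) h" "h \<in> ({0..1} \<times> {0..1}) \<rightarrow> SL2"
    "\<forall>x \<in> {0..1}. h(0,x) = p x" "\<forall>x \<in> {0..1}. h(1,x) = p' x"
    "\<forall>t \<in> {0..1::real}. pathstart(h \<circ> Pair t) = pathstart p \<and> pathfinish(h \<circ> Pair t) = pathfinish p"
    using assms(1) unfolding homotopic_paths by blast
  obtain k where k: "continuous_on ({0..1} \<times> {0..1}) k" "k \<in> ({0..1} \<times> {0..1}) \<rightarrow> SL2"
    "\<forall>x \<in> {0..1}. k(0,x) = q x" "\<forall>x \<in> {0..1}. k(1,x) = q' x"
    "\<forall>t \<in> {0..1::real}. pathstart(k \<circ> Pair t) = pathstart q \<and> pathfinish(k \<circ> Pair t) = pathfinish q"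
    using assms(2) unfolding homotopic_paths by blast
  show ?thesis unfolding homotopic_paths
    by (rule exI[of _ "\<lambda>z. h z ** k z"])
      (use h k in \<open>auto intro!: continuous_intros SL2_simps simp: pathstart_def pathfinish_def Pi_iff\<close>)
qed

lemma path_mm:
  fixes p q :: "real \<Rightarrow> real^2^2"
  assumes "path p" "path q"
  shows "path (\<lambda>t. p t ** q t)"
  using assms unfolding path_def by (intro continuous_intros)

lemma path_image_mm:
  "path_image p \<subseteq> SL2 \<Longrightarrow> path_image q \<subseteq> SL2 \<Longrightarrow> path_image (\<lambda>t. p t ** q t) \<subseteq> SL2"
  by (auto simp: path_image_def image_subset_iff)

lemma path_adj2: "path p \<Longrightarrow> path (\<lambda>t. adj2 (p t))"
  unfolding path_def by (intro continuous_intros)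

lemma path_image_adj2: "path_image p \<subseteq> SL2 \<Longrightarrow> path_image (\<lambda>t. adj2 (p t)) \<subseteq> SL2"
  by (auto simp: path_image_def image_subset_iff)

lemma path_ends_mm [simp]:
  fixes p q :: "real \<Rightarrow> real^2^2"
  shows "pathstart (\<lambda>t. p t ** q t) = pathstart p ** pathstart q" "pathfinish (\<lambda>t. p t ** q t) = pathfinish p ** pathfinish q"
  "pathstart (\<lambda>t. adj2 (p t)) = adj2 (pathstart p)" "pathfinish (\<lambda>t. adj2 (p t)) = adj2 (pathfinish p)"
  by (auto simp: pathstart_def pathfinish_def)

lemma SL2_cover_simps:
  "carrier SL2_cover = ucover SL2 (mat 1)" "one SL2_cover = path_class SL2 (\<lambda>t. mat 1)"
  by (auto simp: SL2_cover_def)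

lemma SL2_cover_mult:
  assumes "path p" "path_image p \<subseteq> SL2" "path q" "path_image q \<subseteq> SL2"
  shows "path_class SL2 p \<odot> path_class SL2 q = path_class SL2 (\<lambda>t. p t ** q t)"
proof -
  have "(\<exists>p'. homotopic_paths SL2 p p' \<and> (\<exists>q'. homotopic_paths SL2 q q' \<and> homotopic_paths SL2 (\<lambda>t. p' t ** q' t) r)) \<longleftrightarrow>
      homotopic_paths SL2 (\<lambda>t. p t ** q t) r" for r
  proof
    assume "\<exists>p'. homotopic_paths SL2 p p' \<and> (\<exists>q'. homotopic_paths SL2 q q' \<and> homotopic_paths SL2 (\<lambda>t. p' t ** q' t) r)"
    then obtain p' q' where *: "homotopic_paths SL2 p p'" "homotopic_paths SL2 q q'" "homotopic_paths SL2 (\<lambda>t. p' t ** q' t) r"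
      by (elim exE conjE)
    from homotopic_paths_trans[OF homotopic_paths_mm[OF *(1,2)] *(3)]
    show "homotopic_paths SL2 (\<lambda>t. p t ** q t) r" .
  next
    assume "homotopic_paths SL2 (\<lambda>t. p t ** q t) r"
    then show "\<exists>p'. homotopic_paths SL2 p p' \<and> (\<exists>q'. homotopic_paths SL2 q q' \<and> homotopic_paths SL2 (\<lambda>t. p' t ** q' t) r)"
      using assms by (intro exI[of _ p] conjI exI[of _ q]) simp_all
  qed
  then show ?thesis unfolding SL2_cover_def path_class_def by simp
qed

lemma SL2_coverE:
  assumes "c \<in> carrier SL2_cover"
  obtains p where "c = path_class SL2 p" "path p" "path_image p \<subseteq> SL2" "pathstart p = mat 1" "cover_proj c = pathfinish p"
  using ucoverE[of c SL2 "mat 1"] assms by (metis SL2_cover_simps(1))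

lemma group_SL2_cover: "group SL2_cover"
proof (rule groupI)
  show "\<one>\<^bsub>SL2_cover\<^esub> \<in> carrier SL2_cover" by (auto simp: SL2_cover_simps intro!: path_class_in_ucover)
next
  fix c d assume "c \<in> carrier SL2_cover" "d \<in> carrier SL2_cover"
  then obtain p q where p: "c = path_class SL2 p" "path p" "path_image p \<subseteq> SL2" "pathstart p = mat 1"
    and q: "d = path_class SL2 q" "path q" "path_image q \<subseteq> SL2" "pathstart q = mat 1" by (metis SL2_coverE)
  show "c \<odot> d \<in> carrier SL2_cover"
    unfolding p(1) q(1) SL2_cover_mult[OF p(2,3) q(2,3)] SL2_cover_simps
    by (rule path_class_in_ucover) (use p q in \<open>auto intro: path_mm path_image_mm[THEN subsetD]\<close>)
  fix e assume "e \<in> carrier SL2_cover"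
  then obtain r where r: "e = path_class SL2 r" "path r" "path_image r \<subseteq> SL2" by (metis SL2_coverE)
  show "c \<odot> d \<odot> e = c \<odot> (d \<odot> e)"
    unfolding p(1) q(1) r(1) using p q r
    by (simp add: SL2_cover_mult path_mm path_image_mm matrix_mul_assoc)
next
  fix c assume "c \<in> carrier SL2_cover"
  then obtain p where p: "c = path_class SL2 p" "path p" "path_image p \<subseteq> SL2" "pathstart p = mat 1" by (metis SL2_coverE)
  show "\<one>\<^bsub>SL2_cover\<^esub> \<odot> c = c"
    using p by (simp add: SL2_cover_simps SL2_cover_mult)
  show "\<exists>d\<in>carrier SL2_cover. d \<odot> c = \<one>\<^bsub>SL2_cover\<^esub>"
  proof (intro bexI)
    have "homotopic_paths SL2 (\<lambda>t. adj2 (p t) ** p t) (\<lambda>t. mat 1)"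
      by (rule homotopic_paths_eq)
        (use p in \<open>auto intro: path_mm path_adj2 path_image_mm[THEN subsetD] path_image_adj2[THEN subsetD] simp: path_image_def image_subset_iff\<close>)
    then show "path_class SL2 (\<lambda>t. adj2 (p t)) \<odot> c = \<one>\<^bsub>SL2_cover\<^esub>"
      using p by (simp add: SL2_cover_simps SL2_cover_mult path_adj2 path_image_adj2 path_class_cong)
    show "path_class SL2 (\<lambda>t. adj2 (p t)) \<in> carrier SL2_cover"
      unfolding SL2_cover_simps by (rule path_class_in_ucover) (use p in \<open>auto intro: path_adj2 path_image_adj2[THEN subsetD]\<close>)
  qed
qed

interpretation G: group SL2_cover by (rule group_SL2_cover)

lemma SL2_cover_inv:
  assumes "path p" "path_image p \<subseteq> SL2" "pathstart p = mat 1"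
  shows "sinv (path_class SL2 p) = path_class SL2 (\<lambda>t. adj2 (p t))"
proof (rule G.inv_equality)
  have "homotopic_paths SL2 (\<lambda>t. adj2 (p t) ** p t) (\<lambda>t. mat 1)"
    by (rule homotopic_paths_eq)
      (use assms in \<open>auto intro: path_mm path_adj2 path_image_mm[THEN subsetD] path_image_adj2[THEN subsetD] simp: path_image_def image_subset_iff\<close>)
  then show "path_class SL2 (\<lambda>t. adj2 (p t)) \<odot> path_class SL2 p = \<one>\<^bsub>SL2_cover\<^esub>"
    using assms by (simp add: SL2_cover_simps SL2_cover_mult path_adj2 path_image_adj2 path_class_cong)
qed (use assms in \<open>simp_all add: SL2_cover_simps path_class_in_ucover path_adj2 path_image_adj2\<close>)

lemma cover_proj_SL2:
  assumes "c \<in> carrier SL2_cover"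
  shows "cover_proj c \<in> SL2"
    and "d \<in> carrier SL2_cover \<Longrightarrow> cover_proj (c \<odot> d) = cover_proj c ** cover_proj d"
    and "cover_proj (sinv c) = adj2 (cover_proj c)"
proof -
  obtain p where p: "c = path_class SL2 p" "path p" "path_image p \<subseteq> SL2" "pathstart p = mat 1" "cover_proj c = pathfinish p"
    using SL2_coverE[OF assms] .
  show "cover_proj c \<in> SL2" using cover_proj_in assms by (auto simp: SL2_cover_simps)
  show "cover_proj (sinv c) = adj2 (cover_proj c)"
    unfolding p(5) unfolding p(1) SL2_cover_inv[OF p(2-4)] by (subst cover_proj_class) (use p in \<open>auto intro: path_adj2 path_image_adj2[THEN subsetD]\<close>)
  assume "d \<in> carrier SL2_cover"
  then obtain q where q: "d = path_class SL2 q" "path q" "path_image q \<subseteq> SL2" "cover_proj d = pathfinish q"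
    using SL2_coverE by metis
  show "cover_proj (c \<odot> d) = cover_proj c ** cover_proj d"
    unfolding p(5) q(4) unfolding p(1) q(1) SL2_cover_mult[OF p(2,3) q(2,3)]
    by (subst cover_proj_class) (use p q in \<open>auto intro: path_mm path_image_mm[THEN subsetD]\<close>)
qed

lemma cover_proj_SL2_one [simp]: "cover_proj \<one>\<^bsub>SL2_cover\<^esub> = mat 1"
  by (simp add: SL2_cover_simps cover_proj_class)

lemma join_mm_join: "(\<lambda>t. (p +++ v) t ** (q +++ w) t) = (\<lambda>t. p t ** q t) +++ (\<lambda>t. v t ** w t)"
  by (auto simp: joinpaths_def)

text \<open>The Eckmann-Hilton argument.\<close>
lemma homotopic_mm_join:
  assumes "path p" "path_image p \<subseteq> SL2" "path q" "path_image q \<subseteq> SL2"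
  shows "homotopic_paths SL2 (\<lambda>t. p t ** q t) ((\<lambda>t. p t ** pathstart q) +++ (\<lambda>t. pathfinish p ** q t))"
    and "homotopic_paths SL2 (\<lambda>t. p t ** q t) ((\<lambda>t. pathstart p ** q t) +++ (\<lambda>t. p t ** pathfinish q))"
proof -
  show "homotopic_paths SL2 (\<lambda>t. p t ** q t) ((\<lambda>t. p t ** pathstart q) +++ (\<lambda>t. pathfinish p ** q t))"
    using homotopic_paths_mm[OF homotopic_paths_const_right[OF assms(1,2)] homotopic_paths_const_left[OF assms(3,4)]]
    by (simp add: join_mm_join)
  show "homotopic_paths SL2 (\<lambda>t. p t ** q t) ((\<lambda>t. pathstart p ** q t) +++ (\<lambda>t. p t ** pathfinish q))"
    using homotopic_paths_mm[OF homotopic_paths_const_left[OF assms(1,2)] homotopic_paths_const_right[OF assms(3,4)]]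
    by (simp add: join_mm_join)
qed

text \<open>For a loop \<open>p\<close> at the unit both products with \<open>q\<close> are
  homotopic to \<open>p +++ q\<close>, by the two orders in which a pointwise product can be
  unrolled. So the kernel of the projection is central.\<close>

lemma SL2_cover_central:
  assumes c: "c \<in> carrier SL2_cover" "cover_proj c = mat 1" and d: "d \<in> carrier SL2_cover"
  shows "c \<odot> d = d \<odot> c"
proof -
  obtain p where p: "c = path_class SL2 p" "path p" "path_image p \<subseteq> SL2" "pathstart p = mat 1" "pathfinish p = mat 1"
    using SL2_coverE[OF c(1)] c(2) by metis
  obtain q where q: "d = path_class SL2 q" "path q" "path_image q \<subseteq> SL2" "pathstart q = mat 1"
    using SL2_coverE[OF d] by metis
  have "homotopic_paths SL2 (\<lambda>t. p t ** q t) (p +++ q)" using homotopic_mm_join(1)[OF p(2,3) q(2,3)] p q by simp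
  moreover have "homotopic_paths SL2 (\<lambda>t. q t ** p t) (p +++ q)" using homotopic_mm_join(2)[OF q(2,3) p(2,3)] p q by simp
  ultimately show ?thesis unfolding p(1) q(1) SL2_cover_mult[OF p(2,3) q(2,3)] SL2_cover_mult[OF q(2,3) p(2,3)]
    by (simp add: path_class_cong)
qed

text \<open>The projection of the covering group is onto: scaling the three Iwasawa exponents of
  \<open>h\<close> by \<open>t\<close> gives a path from the unit to \<open>h\<close>.\<close>

lemma SL2_path_connected:
  assumes "h \<in> SL2"
  shows "\<exists>k\<in>carrier SL2_cover. cover_proj k = h"
proof -
  define r where "r = sqrt ((h $ 1 $ 1)\<^sup>2 + (h $ 2 $ 1)\<^sup>2)"
  have "h $ 1 $ 1 \<noteq> 0 \<or> h $ 2 $ 1 \<noteq> 0" using assms by (auto simp: SL2_iff det_2)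
  then have "(h $ 1 $ 1)\<^sup>2 + (h $ 2 $ 1)\<^sup>2 > 0" by (simp add: sum_power2_gt_zero_iff)
  then have r: "r > 0" "r\<^sup>2 = (h $ 1 $ 1)\<^sup>2 + (h $ 2 $ 1)\<^sup>2" by (auto simp: r_def)
  have "(h $ 1 $ 1 / r)\<^sup>2 + (h $ 2 $ 1 / r)\<^sup>2 = ((h $ 1 $ 1)\<^sup>2 + (h $ 2 $ 1)\<^sup>2) / r\<^sup>2"
    by (simp add: power_divide add_divide_distrib)
  also have "\<dots> = 1" using r(1) unfolding r(2)[symmetric] by simp
  finally have "(h $ 1 $ 1 / r)\<^sup>2 + (h $ 2 $ 1 / r)\<^sup>2 = 1" .
  then obtain \<theta> where \<theta>: "h $ 1 $ 1 / r = cos \<theta>" "h $ 2 $ 1 / r = sin \<theta>" using sincos_total_2pi by metis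
  define A where "A = mk2 0 (- \<theta>) \<theta> 0"
  define B where "B = mk2 (ln r) 0 0 (- ln r)"
  define C where "C = mk2 0 (exp (- 2 * ln r) * (h $ 1 $ 1 * h $ 1 $ 2 + h $ 2 $ 1 * h $ 2 $ 2)) 0 0"
  have s: "A \<in> sl2" "B \<in> sl2" "C \<in> sl2" by (simp_all add: A_def B_def C_def mk2_sl2)
  have h: "h = mexp A ** mexp B ** mexp C"
    unfolding A_def B_def C_def by (rule iwasawa[OF assms]) (use \<theta> r in \<open>auto simp: field_simps\<close>)
  define p where "p = (\<lambda>t::real. mexp (t *\<^sub>R A) ** mexp (t *\<^sub>R B) ** mexp (t *\<^sub>R C))"
  have c: "continuous_on {0..1} (\<lambda>t::real. mexp (t *\<^sub>R M))" if "M \<in> sl2" for M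
    by (rule continuous_on_compose2[OF continuous_on_mexp]) (use that in \<open>auto intro!: continuous_intros sl2_scaleR\<close>)
  have "path p" unfolding path_def p_def by (intro continuous_intros c s)
  moreover have "path_image p \<subseteq> SL2" by (auto simp: path_image_def p_def intro!: SL2_simps mexp_SL2 sl2_scaleR s)
  moreover have "pathstart p = mat 1" "pathfinish p = h" by (simp_all add: pathstart_def pathfinish_def p_def h)
  ultimately show ?thesis unfolding SL2_cover_simps
    by (intro bexI[of _ "path_class SL2 p"] path_class_in_ucover) (auto simp: cover_proj_class)
qed

text \<open>Two lifts of \<open>h\<close> differ by an element over the unit. It is central and
  cancels, so the choice in \<open>conj_by\<close> is immaterial.\<close>

lemma conj_by_eq:
  assumes k: "k \<in> carrier SL2_cover" "cover_proj k = h" and g: "g \<in> carrier SL2_cover"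
  shows "conj_by h g = sinv k \<odot> g \<odot> k"
proof -
  define k0 where "k0 = (SOME k. k \<in> carrier SL2_cover \<and> cover_proj k = h)"
  have k0: "k0 \<in> carrier SL2_cover" "cover_proj k0 = h"
    using someI[of "\<lambda>k. k \<in> carrier SL2_cover \<and> cover_proj k = h" k] k unfolding k0_def by auto
  define z where "z = sinv k0 \<odot> k"
  have z: "z \<in> carrier SL2_cover" unfolding z_def using k k0 by simp
  have "h \<in> SL2" using cover_proj_SL2(1)[OF k(1)] k by simp
  then have "cover_proj z = mat 1" unfolding z_def using k k0 by (simp add: cover_proj_SL2)
  note zc = SL2_cover_central[OF z this]
  have kz: "k = k0 \<odot> z" unfolding z_def using k k0 by (simp add: G.m_assoc[symmetric])
  define x where "x = sinv k0 \<odot> g \<odot> k0"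
  have x: "x \<in> carrier SL2_cover" unfolding x_def using g k0 by simp
  have "sinv k \<odot> g \<odot> k = sinv z \<odot> (x \<odot> z)"
    unfolding kz x_def using k0 z g by (simp add: G.inv_mult_group G.m_assoc)
  also have "\<dots> = x" unfolding zc[OF x, symmetric] using x z by (simp add: G.m_assoc[symmetric])
  finally show ?thesis by (simp add: conj_by_def Let_def k0_def[symmetric] x_def)
qed

subsection \<open>Continuity of the group operations\<close>

lemma paths_from_mm:
  assumes "v \<in> paths_from SL2 x" "w \<in> paths_from SL2 y"
  shows "(\<lambda>t. v t ** w t) \<in> paths_from SL2 (x ** y)"
  using assms by (auto simp: paths_from_def intro: path_mm path_image_mm[THEN subsetD])

text \<open>Concatenation and pointwise multiplication of paths interchange. Hence short
  prolongations of the factors yield a short prolongation of the product, which is the continuity of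
  multiplication.\<close>

lemma extend_mult:
  assumes "c \<in> carrier SL2_cover" "d \<in> carrier SL2_cover"
    and "v \<in> paths_from SL2 (cover_proj c)" "w \<in> paths_from SL2 (cover_proj d)"
  shows "extend SL2 c v \<odot> extend SL2 d w = extend SL2 (c \<odot> d) (\<lambda>t. v t ** w t)"
proof -
  obtain p where p: "c = path_class SL2 p" "path p" "path_image p \<subseteq> SL2" "cover_proj c = pathfinish p"
    using SL2_coverE[OF assms(1)] .
  obtain q where q: "d = path_class SL2 q" "path q" "path_image q \<subseteq> SL2" "cover_proj d = pathfinish q"
    using SL2_coverE[OF assms(2)] .
  have v: "v \<in> paths_from SL2 (pathfinish p)" "path (p +++ v)" "path_image (p +++ v) \<subseteq> SL2"
    and w: "w \<in> paths_from SL2 (pathfinish q)" "path (q +++ w)" "path_image (q +++ w) \<subseteq> SL2"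
    using assms p q subset_path_image_join[of _ SL2] by (auto simp: paths_from_def intro: subsetD)
  show ?thesis
    unfolding p(1) q(1) extend_class[OF p(2,3) v(1)] extend_class[OF q(2,3) w(1)] SL2_cover_mult[OF v(2,3) w(2,3)] join_mm_join
      SL2_cover_mult[OF p(2,3) q(2,3)]
    by (rule extend_class[symmetric]) (use p q paths_from_mm[OF v(1) w(1)] in \<open>auto intro: path_mm path_image_mm[THEN subsetD]\<close>)
qed

lemma extend_inv:
  assumes "c \<in> carrier SL2_cover" and "v \<in> paths_from SL2 (cover_proj c)"
  shows "sinv (extend SL2 c v) = extend SL2 (sinv c) (\<lambda>t. adj2 (v t))"
proof -
  obtain p where p: "c = path_class SL2 p" "path p" "path_image p \<subseteq> SL2" "pathstart p = mat 1" "cover_proj c = pathfinish p"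
    using SL2_coverE[OF assms(1)] .
  have v: "v \<in> paths_from SL2 (pathfinish p)" "path (p +++ v)" "path_image (p +++ v) \<subseteq> SL2" "pathstart (p +++ v) = mat 1"
    using assms p subset_path_image_join[of _ SL2] by (auto simp: paths_from_def intro: subsetD)
  have j: "(\<lambda>t. adj2 ((p +++ v) t)) = (\<lambda>t. adj2 (p t)) +++ (\<lambda>t. adj2 (v t))" by (auto simp: joinpaths_def)
  show ?thesis
    unfolding p(1) extend_class[OF p(2,3) v(1)] SL2_cover_inv[OF v(2-4)] SL2_cover_inv[OF p(2-4)] j
    by (rule extend_class[symmetric])
      (use p v in \<open>auto simp: paths_from_def intro: path_adj2 path_image_adj2[THEN subsetD]\<close>)
qed

lemma continuous_map_SL2_mult:
  assumes f: "continuous_map T SL2_ucover_topology f" and g: "continuous_map T SL2_ucover_topology g"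
  shows "continuous_map T SL2_ucover_topology (\<lambda>x. f x \<odot> g x)"
  unfolding continuous_map_ucover_iff
proof (intro conjI ballI allI impI)
  have fg: "f x \<in> carrier SL2_cover" "g x \<in> carrier SL2_cover" if "x \<in> topspace T" for x
    using f g that by (auto simp: continuous_map_def SL2_cover_simps)
  then show "(\<lambda>x. f x \<odot> g x) \<in> topspace T \<rightarrow> ucover SL2 (mat 1)"
    unfolding SL2_cover_simps(1)[symmetric] by auto
  fix x V assume x: "x \<in> topspace T" and V: "open V" "cover_proj (f x \<odot> g x) \<in> V"
  let ?m = "\<lambda>z::(real^2^2) \<times> (real^2^2). fst z ** snd z"
  have "continuous_on UNIV ?m" by (intro continuous_intros)
  then have "open (?m -` V)" using V(1) open_vimage by blast
  moreover have "(cover_proj (f x), cover_proj (g x)) \<in> ?m -` V"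
    using V(2) fg[OF x] by (simp add: cover_proj_SL2)
  ultimately obtain A B where AB: "open A" "open B" "(cover_proj (f x), cover_proj (g x)) \<in> A \<times> B" "A \<times> B \<subseteq> ?m -` V"
    by (rule open_prod_elim)
  obtain P where P: "openin T P" "x \<in> P" "f ` P \<subseteq> prolongations SL2 (f x) A"
    using f x AB unfolding continuous_map_ucover_iff by blast
  obtain Q where Q: "openin T Q" "x \<in> Q" "g ` Q \<subseteq> prolongations SL2 (g x) B"
    using g x AB unfolding continuous_map_ucover_iff by blast
  show "\<exists>Om. openin T Om \<and> x \<in> Om \<and> (\<lambda>x. f x \<odot> g x) ` Om \<subseteq> prolongations SL2 (f x \<odot> g x) V"
  proof (intro exI[of _ "P \<inter> Q"] conjI subsetI)
    fix z assume "z \<in> (\<lambda>x. f x \<odot> g x) ` (P \<inter> Q)"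
    then obtain y where y: "y \<in> P" "y \<in> Q" "z = f y \<odot> g y" by auto
    obtain v where v: "v \<in> paths_from SL2 (cover_proj (f x))" "path_image v \<subseteq> A" "f y = extend SL2 (f x) v"
      using P y by (auto simp: prolongations_eq)
    obtain w where w: "w \<in> paths_from SL2 (cover_proj (g x))" "path_image w \<subseteq> B" "g y = extend SL2 (g x) w"
      using Q y by (auto simp: prolongations_eq)
    have "z = extend SL2 (f x \<odot> g x) (\<lambda>t. v t ** w t)"
      unfolding y(3) v(3) w(3) by (rule extend_mult) (use fg[OF x] v w in auto)
    moreover have "(\<lambda>t. v t ** w t) \<in> paths_from SL2 (cover_proj (f x \<odot> g x))"
      using paths_from_mm[OF v(1) w(1)] fg[OF x] by (simp add: cover_proj_SL2)
    moreover have "path_image (\<lambda>t. v t ** w t) \<subseteq> V" using AB(4) v(2) w(2) by (fastforce simp: path_image_def)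
    ultimately show "z \<in> prolongations SL2 (f x \<odot> g x) V" by (auto simp: prolongations_eq)
  qed (use P Q in auto)
qed

lemma continuous_map_SL2_inv:
  assumes f: "continuous_map T SL2_ucover_topology f"
  shows "continuous_map T SL2_ucover_topology (\<lambda>x. sinv (f x))"
  unfolding continuous_map_ucover_iff
proof (intro conjI ballI allI impI)
  have fg: "f x \<in> carrier SL2_cover" if "x \<in> topspace T" for x
    using f that by (auto simp: continuous_map_def SL2_cover_simps)
  then show "(\<lambda>x. sinv (f x)) \<in> topspace T \<rightarrow> ucover SL2 (mat 1)"
    unfolding SL2_cover_simps(1)[symmetric] by auto
  fix x V assume x: "x \<in> topspace T" and V: "open V" "cover_proj (sinv (f x)) \<in> V"
  have A: "open (adj2 -` V)"
    by (rule open_vimage[OF V(1)]) (intro continuous_intros)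
  have "cover_proj (f x) \<in> adj2 -` V" using V(2) fg[OF x] by (simp add: cover_proj_SL2)
  then obtain P where P: "openin T P" "x \<in> P" "f ` P \<subseteq> prolongations SL2 (f x) (adj2 -` V)"
    using f x A unfolding continuous_map_ucover_iff by blast
  show "\<exists>Om. openin T Om \<and> x \<in> Om \<and> (\<lambda>x. sinv (f x)) ` Om \<subseteq> prolongations SL2 (sinv (f x)) V"
  proof (intro exI[of _ P] conjI subsetI)
    fix z assume "z \<in> (\<lambda>x. sinv (f x)) ` P"
    then obtain y where y: "y \<in> P" "z = sinv (f y)" by auto
    obtain v where v: "v \<in> paths_from SL2 (cover_proj (f x))" "path_image v \<subseteq> adj2 -` V" "f y = extend SL2 (f x) v"
      using P y by (auto simp: prolongations_eq)
    have "z = extend SL2 (sinv (f x)) (\<lambda>t. adj2 (v t))"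
      unfolding y(2) v(3) by (rule extend_inv) (use fg[OF x] v in auto)
    moreover have "(\<lambda>t. adj2 (v t)) \<in> paths_from SL2 (cover_proj (sinv (f x)))"
      using v(1) fg[OF x] by (auto simp: cover_proj_SL2 paths_from_def intro: path_adj2 path_image_adj2[THEN subsetD])
    moreover have "path_image (\<lambda>t. adj2 (v t)) \<subseteq> V" using v(2) by (fastforce simp: path_image_def)
    ultimately show "z \<in> prolongations SL2 (sinv (f x)) V" by (auto simp: prolongations_eq)
  qed (use P in auto)
qed

subsection \<open>Derivatives within the half plane\<close>

abbreviation hopen :: "(real^2) set \<Rightarrow> bool" where "hopen D \<equiv> openin (top_of_set half_plane) D"

lemma hopenE: "hopen D \<Longrightarrow> (\<And>T. open T \<Longrightarrow> D = half_plane \<inter> T \<Longrightarrow> thesis) \<Longrightarrow> thesis"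
  by (auto simp: openin_open)

text \<open>From any point of a relatively open subset of the half plane, even from its edge, a
  short step in each positive coordinate direction is possible; this determines a linear map. The
  one-sided derivatives are therefore well defined.\<close>

lemma half_plane_derivative_unique:
  fixes f :: "real^2 \<Rightarrow> 'b::real_normed_vector"
  assumes D: "hopen D" "p \<in> D" and f: "(f has_derivative f1) (at p within D)" "(f has_derivative f2) (at p within D)"
  shows "f1 = f2"
proof (rule frechet_derivative_unique_within[OF f])
  fix i :: "real^2" and e :: real assume i: "i \<in> Basis" and e: "0 < e"
  obtain T where T: "open T" "D = half_plane \<inter> T" using hopenE[OF D(1)] .
  then obtain d where d: "d > 0" "ball p d \<subseteq> T" using D(2) open_contains_ball by blast
  define s where "s = min (e / 2) (d / 2)"
  have s: "0 < s" "s < e" "s < d" using e d by (auto simp: s_def)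
  obtain j where j: "i = axis j 1" using i by (auto simp: Basis_vec_def)
  have "p + s *\<^sub>R i \<in> ball p d" using s i by (simp add: dist_norm)
  moreover have "p + s *\<^sub>R i \<in> half_plane"
    using D(2) T s by (auto simp: half_plane_def j axis_def)
  ultimately show "\<exists>d. 0 < \<bar>d\<bar> \<and> \<bar>d\<bar> < e \<and> p + d *\<^sub>R i \<in> D" using s d T by (intro exI[of _ s]) auto
qed

lemma half_plane_frechet_derivative:
  fixes f g :: "real^2 \<Rightarrow> 'b::real_normed_vector"
  assumes D: "hopen D" "p \<in> D" and V: "open V" "p \<in> V" "smooth_on V g" and eq: "\<And>p'. p' \<in> D \<Longrightarrow> p' \<in> V \<Longrightarrow> f p' = g p'"
  shows "frechet_derivative f (at p within D) = fderiv g p"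
proof -
  have g: "(g has_derivative fderiv g p) (at p within D)"
    by (rule has_derivative_at_withinI, rule smooth_on_has_derivative[OF V(3,2)])
  obtain d where d: "d > 0" "ball p d \<subseteq> V" using V open_contains_ball by blast
  have "(f has_derivative fderiv g p) (at p within D)"
    by (rule has_derivative_transform_within[OF g d(1) D(2)])
      (use eq d in \<open>auto simp: subset_iff dist_commute\<close>)
  then show ?thesis
    using half_plane_derivative_unique[OF D] unfolding frechet_derivative_def by (metis someI_ex)
qed

text \<open>A witness of smoothness up to the boundary. The function \<open>g\<close> lives on an
  open set of the whole plane, so its two-sided derivatives replace the one-sided ones of
  \<open>f\<close>.\<close>

definition ext :: "'a chart \<Rightarrow> (real^2) set \<Rightarrow> (real^2 \<Rightarrow> 'b::real_normed_vector) \<Rightarrow> ('a \<Rightarrow> 'b) \<Rightarrow> bool" where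
  "ext k V g f \<longleftrightarrow> open V \<and> smooth_on V g \<and> (\<forall>q\<in>fst k. snd k q \<in> V \<longrightarrow> f q = g (snd k q))"

definition sm_at :: "'a chart \<Rightarrow> ('a \<Rightarrow> 'b::real_normed_vector) \<Rightarrow> 'a \<Rightarrow> bool" where
  "sm_at k f q \<longleftrightarrow> (\<exists>V g. snd k q \<in> V \<and> ext k V g f)"

lemma sm_atI: "snd k q \<in> V \<Longrightarrow> ext k V g f \<Longrightarrow> sm_at k f q"
  unfolding sm_at_def by (intro exI conjI)

text \<open>The properties of a chart that calculus needs. Charts of the surface and lifted charts
  of the covering manifold both have them, so one set of rules serves for both.\<close>

definition gchart :: "'a chart \<Rightarrow> bool" where
  "gchart k \<longleftrightarrow> inj_on (snd k) (fst k) \<and> hopen (snd k ` fst k)"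

lemma smooth_upto_iff:
  assumes "inj_on (snd k) (fst k)" "A \<subseteq> fst k"
  shows "smooth_upto (snd k ` A) (in_coords k f) \<longleftrightarrow>
    (\<forall>q\<in>A. \<exists>V g. open V \<and> snd k q \<in> V \<and> smooth_on V g \<and> (\<forall>q'\<in>A. snd k q' \<in> V \<longrightarrow> f q' = g (snd k q')))"
proof -
  have e: "in_coords k f (snd k q) = f q" if "q \<in> A" for q
    using that assms by (simp add: in_coords_def subset_iff)
  have 1: "(\<forall>q\<in>V \<inter> snd k ` A. g q = in_coords k f q) \<longleftrightarrow> (\<forall>q'\<in>A. snd k q' \<in> V \<longrightarrow> f q' = g (snd k q'))" for V g
    using e by fastforce
  show ?thesis unfolding smooth_upto_def 1 by simp
qed

lemma smooth_upto_sm_at: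
  assumes "inj_on (snd k) (fst k)"
  shows "smooth_upto (snd k ` fst k) (in_coords k f) \<longleftrightarrow> (\<forall>q\<in>fst k. sm_at k f q)"
  unfolding smooth_upto_iff[OF assms subset_refl] sm_at_def ext_def by (intro ball_cong refl) blast

lemma partial_ext:
  assumes k: "gchart k" and e: "ext k V g f" and q: "q \<in> fst k" "snd k q \<in> V"
  shows "partial k i f q = fderiv g (snd k q) (axis i 1)"
proof -
  have "frechet_derivative (in_coords k f) (at (snd k q) within snd k ` fst k) = fderiv g (snd k q)"
    by (rule half_plane_frechet_derivative[where V=V])
      (use k e q in \<open>auto simp: gchart_def ext_def in_coords_def\<close>)
  then show ?thesis by (simp add: partial_def)
qed

lemma ext_derivative:
  assumes "ext k V g f" "snd k q \<in> V"
  shows "(g has_derivative fderiv g (snd k q)) (at (snd k q))"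
  using assms by (auto simp: ext_def intro: smooth_on_has_derivative)

lemma vec2_basis: "(v::real^2) = (\<Sum>i\<in>UNIV. v $ i *\<^sub>R axis i 1)"
  by (simp add: vec_eq_iff forall_2 sum_2 axis_def)

lemma partial_ext_vec:
  assumes k: "gchart k" and e: "ext k V g f" and q: "q \<in> fst k" "snd k q \<in> V"
  shows "fderiv g (snd k q) v = (\<Sum>i\<in>UNIV. v $ i *\<^sub>R partial k i f q)"
proof -
  have lin: "linear (fderiv g (snd k q))" using ext_derivative[OF e q(2)] has_derivative_linear by blast
  have "fderiv g (snd k q) v = fderiv g (snd k q) (\<Sum>i\<in>UNIV. v $ i *\<^sub>R axis i 1)"
    using vec2_basis by (rule arg_cong)
  then show ?thesis unfolding linear_sum[OF lin] linear_scale[OF lin] partial_ext[OF k e q] .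
qed

lemma partial_eqI:
  assumes k: "gchart k" and e: "ext k V g f" and q: "q \<in> fst k" "snd k q \<in> V"
    and d: "(g has_derivative g') (at (snd k q))"
  shows "partial k i f q = g' (axis i 1)"
  using partial_ext[OF k e q] frechet_derivative_at[OF d] by simp

lemma sm_at_cong:
  assumes "sm_at k f q" "open V" "snd k q \<in> V" "\<And>q'. q' \<in> fst k \<Longrightarrow> snd k q' \<in> V \<Longrightarrow> f q' = f' q'"
  shows "sm_at k f' q"
proof -
  obtain U g where "snd k q \<in> U" "ext k U g f" using assms(1) by (auto simp: sm_at_def)
  then have "snd k q \<in> U \<inter> V \<and> ext k (U \<inter> V) g f'"
    using assms by (auto simp: ext_def intro: smooth_on_subset)
  then show ?thesis by (auto simp: sm_at_def)
qed

lemma partial_cong: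
  assumes k: "gchart k" and q: "q \<in> fst k" and f: "sm_at k f q" and V: "open V" "snd k q \<in> V"
    "\<And>q'. q' \<in> fst k \<Longrightarrow> snd k q' \<in> V \<Longrightarrow> f q' = f' q'"
  shows "partial k i f' q = partial k i f q"
proof -
  obtain U g where g: "snd k q \<in> U" "ext k U g f" using f by (auto simp: sm_at_def)
  then have "ext k (U \<inter> V) g f'" using V by (auto simp: ext_def intro: smooth_on_subset)
  from partial_ext[OF k this q] partial_ext[OF k g(2) q g(1)] g V show ?thesis by simp
qed

lemma sm_at_const [simp]: "sm_at k (\<lambda>q. c) q"
  unfolding sm_at_def ext_def by (intro exI[of _ UNIV] exI[of _ "\<lambda>p. c"]) auto

lemma partial_const [simp]:
  assumes k: "gchart k" and q: "q \<in> fst k"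
  shows "partial k i (\<lambda>q. c) q = 0"
proof -
  have "ext k UNIV (\<lambda>p. c) (\<lambda>q. c)" by (auto simp: ext_def)
  from partial_eqI[OF k this q UNIV_I has_derivative_const] show ?thesis .
qed

lemma sm_at_coord: "sm_at k (snd k) q"
  unfolding sm_at_def ext_def by (intro exI[of _ UNIV] exI[of _ "\<lambda>p. p"]) (auto intro: smooth_on_bounded_linear)

lemma sm_at_bilinear:
  assumes B: "bounded_bilinear B" and f: "sm_at k f q" and h: "sm_at k h q"
  shows "sm_at k (\<lambda>q. B (f q) (h q)) q"
    and "gchart k \<Longrightarrow> q \<in> fst k \<Longrightarrow> partial k i (\<lambda>q. B (f q) (h q)) q = B (f q) (partial k i h q) + B (partial k i f q) (h q)"
proof -
  obtain U u where u: "snd k q \<in> U" "ext k U u f" using f by (auto simp: sm_at_def)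
  obtain W w where w: "snd k q \<in> W" "ext k W w h" using h by (auto simp: sm_at_def)
  have e: "ext k (U \<inter> W) (\<lambda>p. B (u p) (w p)) (\<lambda>q. B (f q) (h q))" and q: "snd k q \<in> U \<inter> W"
    using u w by (auto simp: ext_def intro!: smooth_on_bilinear[OF B] intro: smooth_on_subset)
  then show "sm_at k (\<lambda>q. B (f q) (h q)) q" by (blast intro: sm_atI)
  assume k: "gchart k" and qk: "q \<in> fst k"
  have "f q = u (snd k q)" "h q = w (snd k q)" using u w qk by (auto simp: ext_def)
  then show "partial k i (\<lambda>q. B (f q) (h q)) q = B (f q) (partial k i h q) + B (partial k i f q) (h q)"
    using partial_eqI[OF k e qk q bounded_bilinear.FDERIV[OF B ext_derivative[OF u(2,1)] ext_derivative[OF w(2,1)]]]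
      partial_ext[OF k u(2) qk u(1)] partial_ext[OF k w(2) qk w(1)] by simp
qed

lemmas sm_at_mm = sm_at_bilinear(1)[OF bilinear_mm]
  and partial_mm = sm_at_bilinear(2)[OF bilinear_mm]
  and sm_at_scaleR = sm_at_bilinear(1)[OF bounded_bilinear_scaleR]

lemma sm_at_linear:
  assumes L: "bounded_linear L" and f: "sm_at k f q"
  shows "sm_at k (\<lambda>q. L (f q)) q"
    and "gchart k \<Longrightarrow> q \<in> fst k \<Longrightarrow> partial k i (\<lambda>q. L (f q)) q = L (partial k i f q)"
proof -
  obtain U u where u: "snd k q \<in> U" "ext k U u f" using f by (auto simp: sm_at_def)
  have e: "ext k U (\<lambda>p. L (u p)) (\<lambda>q. L (f q))"
    using u by (auto simp: ext_def intro!: smooth_on_linear_comp[OF L])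
  then show "sm_at k (\<lambda>q. L (f q)) q" using u by (blast intro: sm_atI)
  assume k: "gchart k" and qk: "q \<in> fst k"
  show "partial k i (\<lambda>q. L (f q)) q = L (partial k i f q)"
    using partial_eqI[OF k e qk u(1) bounded_linear.has_derivative[OF L ext_derivative[OF u(2,1)]]]
      partial_ext[OF k u(2) qk u(1)] by simp
qed

lemmas sm_at_adj2 = sm_at_linear(1)[OF bounded_linear_adj2] and partial_adj2 = sm_at_linear(2)[OF bounded_linear_adj2]
  and sm_at_component = sm_at_linear(1)[OF bounded_linear_vec_nth]

lemma sm_at_add:
  assumes f: "sm_at k f q" and h: "sm_at k h q"
  shows "sm_at k (\<lambda>q. f q + h q) q"
proof -
  obtain U u where u: "snd k q \<in> U" "ext k U u f" using f by (auto simp: sm_at_def)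
  obtain W w where w: "snd k q \<in> W" "ext k W w h" using h by (auto simp: sm_at_def)
  have "ext k (U \<inter> W) (\<lambda>p. u p + w p) (\<lambda>q. f q + h q)" "snd k q \<in> U \<inter> W"
    using u w by (auto simp: ext_def intro!: smooth_on_add intro: smooth_on_subset)
  then show ?thesis by (blast intro: sm_atI)
qed

lemma sm_at_mult:
  fixes f h :: "'a \<Rightarrow> real"
  shows "sm_at k f q \<Longrightarrow> sm_at k h q \<Longrightarrow> sm_at k (\<lambda>q. f q * h q) q"
  by (rule sm_at_bilinear(1)[OF bounded_bilinear_mult])

lemma sm_at_minus: "sm_at k f q \<Longrightarrow> sm_at k (\<lambda>q. - f q) q"
  by (rule sm_at_linear(1)[of uminus]) (auto intro: bounded_linear_minus bounded_linear_ident)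

lemma sm_at_diff: "sm_at k f q \<Longrightarrow> sm_at k h q \<Longrightarrow> sm_at k (\<lambda>q. f q - h q) q"
  using sm_at_add[of k f q "\<lambda>q. - h q"] sm_at_minus[of k h q] by simp

lemma sm_at_compose:
  fixes f :: "'a \<Rightarrow> 'b::euclidean_space"
  assumes F: "smooth_on T F" "open T" and f: "sm_at k f q" and q: "q \<in> fst k" "f q \<in> T"
  shows "sm_at k (\<lambda>q. F (f q)) q"
proof -
  obtain U u where u: "snd k q \<in> U" "ext k U u f" using f by (auto simp: sm_at_def)
  have c: "continuous_on U u" "open U" using u by (auto simp: ext_def smooth_on_continuous)
  have o: "open (U \<inter> u -` T)" using continuous_open_preimage[OF c F(2)] .
  have "ext k (U \<inter> u -` T) (\<lambda>p. F (u p)) (\<lambda>q. F (f q))"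
    using u o unfolding ext_def
    by (auto intro!: smooth_on_compose[OF _ F(2) _ F(1)] intro: smooth_on_subset)
  moreover have "snd k q \<in> U \<inter> u -` T" using u q by (auto simp: ext_def)
  ultimately show ?thesis by (rule sm_atI[rotated])
qed

text \<open>Differentiating \<open>adj2 h ** h = mat 1\<close> gives \<open>X + adj2 X = 0\<close>
  for X = h^-1 dh, and \<open>X + adj2 X\<close> is \<open>trace X\<close> times the unit
  matrix.\<close>

lemma partial_SL2_traceless:
  assumes k: "gchart k" and q: "q \<in> fst k" and h: "sm_at k h q" and V: "open V" "snd k q \<in> V"
    "\<And>q'. q' \<in> fst k \<Longrightarrow> snd k q' \<in> V \<Longrightarrow> h q' \<in> SL2"
  shows "adj2 (h q) ** partial k i h q \<in> sl2"
proof -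
  have s: "sm_at k (\<lambda>q. adj2 (h q) ** h q) q" by (intro sm_at_mm sm_at_adj2 h)
  have "partial k i (\<lambda>q. adj2 (h q) ** h q) q = adj2 (h q) ** partial k i h q + adj2 (partial k i h q) ** h q"
    using partial_mm[OF sm_at_adj2[OF h] h k q] partial_adj2[OF h k q] by simp
  moreover have "partial k i (\<lambda>q. adj2 (h q) ** h q) q = partial k i (\<lambda>q. mat 1) q"
    by (rule partial_cong[OF k q _ V(1,2)]) (use V in auto)
  moreover have "adj2 (partial k i h q) ** h q = adj2 (adj2 (h q) ** partial k i h q)" by (simp add: adj2_mm)
  ultimately have "trace (adj2 (h q) ** partial k i h q) *\<^sub>R mat 1 = (0 :: real^2^2)"
    using k q by (simp add: adj2_def)
  from arg_cong[OF this, of "\<lambda>M. M $ 1 $ 1"] show ?thesis by (simp add: sl2_iff mat_def)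
qed

section \<open>Charts, transition maps and forms on the surface\<close>

locale surf =
  fixes S :: "('a::t2_space, 'l) surface" and xbar :: 'a
  assumes smooth: "smooth_surface S" and oriented: "oriented_surface S"
    and compact: "compact (points S)" and connected: "connected (points S)"
    and circles: "boundary_circles S" and xbar: "xbar \<in> points S"
begin

abbreviation N where "N \<equiv> points S"

lemma chart: "k \<in> charts S \<Longrightarrow> chart_of N k"
  using smooth by (auto simp: smooth_surface_def)

lemma charts_cover: "q \<in> N \<Longrightarrow> \<exists>k\<in>charts S. q \<in> fst k"
  using smooth by (auto simp: smooth_surface_def)

lemma chart_subset: "k \<in> charts S \<Longrightarrow> fst k \<subseteq> N"
  using smooth by (auto simp: smooth_surface_def)

lemma chart_inj: "k \<in> charts S \<Longrightarrow> inj_on (snd k) (fst k)"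
  using chart[of k] by (auto simp: chart_of_def homeomorphism_def intro: inj_on_inverseI)

lemma chart_gchart: "k \<in> charts S \<Longrightarrow> gchart k"
  using chart[of k] chart_inj by (auto simp: gchart_def chart_of_def)

lemma chart_continuous: "k \<in> charts S \<Longrightarrow> continuous_on (fst k) (snd k)"
  using chart[of k] by (auto simp: chart_of_def homeomorphism_def)

lemma chart_inv_continuous: "k \<in> charts S \<Longrightarrow> continuous_on (snd k ` fst k) (inv_into (fst k) (snd k))"
  using chart[of k] by (auto simp: chart_of_def homeomorphism_def)

lemma openin_chart_preimage:
  assumes k: "k \<in> charts S" and V: "open V"
  shows "openin (top_of_set N) {q \<in> fst k. snd k q \<in> V}"
proof -
  have o: "openin (top_of_set N) (fst k)" using chart[OF k] by (simp add: chart_of_def)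
  have "openin (top_of_set (fst k)) (fst k \<inter> snd k -` V)"
    using continuous_openin_preimage_gen[OF chart_continuous[OF k] V] .
  then have "openin (top_of_set N) (fst k \<inter> snd k -` V)" using o openin_trans by blast
  then show ?thesis by (simp add: vimage_def Int_def)
qed

lemma chart_nbhd:
  assumes k: "k \<in> charts S" and U: "openin (top_of_set N) U" and q: "q \<in> fst k" "q \<in> U"
  shows "\<exists>V. open V \<and> snd k q \<in> V \<and> (\<forall>q'\<in>fst k. snd k q' \<in> V \<longrightarrow> q' \<in> U)"
proof -
  obtain O' where O': "open O'" "U = N \<inter> O'" using U by (auto simp: openin_open)
  have "openin (top_of_set (snd k ` fst k)) (snd k ` fst k \<inter> inv_into (fst k) (snd k) -` O')"
    using continuous_openin_preimage_gen[OF chart_inv_continuous[OF k] O'(1)] .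
  then obtain V where V: "open V" "snd k ` fst k \<inter> inv_into (fst k) (snd k) -` O' = snd k ` fst k \<inter> V"
    by (auto simp: openin_open)
  have e: "snd k q' \<in> V \<longleftrightarrow> q' \<in> O'" if "q' \<in> fst k" for q'
  proof -
    have "snd k q' \<in> snd k ` fst k \<inter> inv_into (fst k) (snd k) -` O' \<longleftrightarrow> snd k q' \<in> snd k ` fst k \<inter> V"
      using V(2) by simp
    then show ?thesis using that chart_inj[OF k] by simp
  qed
  then show ?thesis using V O' q chart_subset[OF k] by (intro exI[of _ V]) auto
qed

lemma transition:
  assumes k: "k \<in> charts S" "k' \<in> charts S" and q: "q \<in> fst k" "q \<in> fst k'"
  obtains V T where "open V" "snd k q \<in> V" "smooth_on V T"
    "\<And>q'. q' \<in> fst k \<Longrightarrow> snd k q' \<in> V \<Longrightarrow> q' \<in> fst k'"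
    "\<And>q'. q' \<in> fst k \<Longrightarrow> snd k q' \<in> V \<Longrightarrow> snd k' q' = T (snd k q')"
    "\<And>q' i j. q' \<in> fst k \<Longrightarrow> snd k q' \<in> V \<Longrightarrow> jacobian k k' q' $ j $ i = fderiv T (snd k q') (axis i 1) $ j"
proof -
  have o: "openin (top_of_set N) (fst k \<inter> fst k')" "openin (top_of_set N) (fst k')"
    using chart[OF k(1)] chart[OF k(2)] by (auto simp: chart_of_def)
  obtain V0 where V0: "open V0" "snd k q \<in> V0" "\<And>q'. q' \<in> fst k \<Longrightarrow> snd k q' \<in> V0 \<Longrightarrow> q' \<in> fst k'"
    using chart_nbhd[OF k(1) o(2) q] by blast
  have "smooth_upto (snd k ` (fst k \<inter> fst k')) (in_coords k (snd k'))"
    using smooth k by (auto simp: smooth_surface_def)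
  from bspec[OF this[unfolded smooth_upto_iff[OF chart_inj[OF k(1)] Int_lower1]], of q]
  obtain V1 T where T: "open V1" "snd k q \<in> V1" "smooth_on V1 T"
    "\<And>q'. q' \<in> fst k \<inter> fst k' \<Longrightarrow> snd k q' \<in> V1 \<Longrightarrow> snd k' q' = T (snd k q')"
    using q by auto
  define V where "V = V0 \<inter> V1"
  have V: "open V" "snd k q \<in> V" "smooth_on V T" using V0 T smooth_on_subset[of V1 T V] by (auto simp: V_def)
  have D: "hopen (snd k ` fst k \<inter> V)" using chart_gchart[OF k(1)] V(1) by (auto simp: gchart_def intro: openin_Int_open)
  \<comment> \<open>The Jacobian is a derivative within the image of the overlap; that image has to
    be relatively open for the derivative to be unique.\<close>
  have hD: "hopen (snd k ` (fst k \<inter> fst k'))"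
  proof (subst openin_subopen, clarify)
    fix x assume x: "x \<in> fst k" "x \<in> fst k'"
    obtain W where W: "open W" "snd k x \<in> W" "\<forall>q'\<in>fst k. snd k q' \<in> W \<longrightarrow> q' \<in> fst k'"
      using chart_nbhd[OF k(1) o(2) x] by blast
    have "hopen (snd k ` fst k \<inter> W)" using chart_gchart[OF k(1)] W(1) by (auto simp: gchart_def intro: openin_Int_open)
    then show "\<exists>Ta. hopen Ta \<and> snd k x \<in> Ta \<and> Ta \<subseteq> snd k ` (fst k \<inter> fst k')"
      using x W by (intro exI[of _ "snd k ` fst k \<inter> W"]) auto
  qed
  have J: "jacobian k k' q' $ j $ i = fderiv T (snd k q') (axis i 1) $ j"
    if q': "q' \<in> fst k" "snd k q' \<in> V" for q' i j
  proof -
    have "q' \<in> fst k'" using V0 q' by (auto simp: V_def)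
    then have "frechet_derivative (in_coords k (snd k')) (at (snd k q') within snd k ` (fst k \<inter> fst k')) = fderiv T (snd k q')"
      by (intro half_plane_frechet_derivative[OF hD _ V(1) q'(2) V(3)])
        (use q' T chart_inj[OF k(1)] in \<open>auto simp: in_coords_def V_def\<close>)
    then show ?thesis by (simp add: jacobian_def matrix_def)
  qed
  show thesis by (rule that[OF V]) (use V0 T J in \<open>auto simp: V_def\<close>)
qed

lemma chart_change:
  assumes k: "k \<in> charts S" "k' \<in> charts S" and q: "q \<in> fst k" "q \<in> fst k'" and f: "sm_at k' f q"
  shows "sm_at k f q" "partial k i f q = (\<Sum>j\<in>UNIV. jacobian k k' q $ j $ i *\<^sub>R partial k' j f q)"
proof -
  obtain V T where T: "open V" "snd k q \<in> V" "smooth_on V T"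
    "\<And>q'. q' \<in> fst k \<Longrightarrow> snd k q' \<in> V \<Longrightarrow> q' \<in> fst k'"
    "\<And>q'. q' \<in> fst k \<Longrightarrow> snd k q' \<in> V \<Longrightarrow> snd k' q' = T (snd k q')"
    "\<And>q' i j. q' \<in> fst k \<Longrightarrow> snd k q' \<in> V \<Longrightarrow> jacobian k k' q' $ j $ i = fderiv T (snd k q') (axis i 1) $ j"
    using transition[OF k q] by blast
  obtain U u where u: "snd k' q \<in> U" "ext k' U u f" using f by (auto simp: sm_at_def)
  have U: "open U" "smooth_on U u" using u by (auto simp: ext_def)
  have o: "open (V \<inter> T -` U)" using continuous_open_preimage[OF smooth_on_continuous[OF T(3)] T(1) U(1)] .
  have e: "ext k (V \<inter> T -` U) (\<lambda>p. u (T p)) f"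
    unfolding ext_def
  proof (intro conjI ballI impI o)
    show "smooth_on (V \<inter> T -` U) (\<lambda>p. u (T p))"
      by (rule smooth_on_compose[OF o U(1) _ U(2)]) (auto intro: smooth_on_subset[OF T(3)])
    fix q' assume "q' \<in> fst k" "snd k q' \<in> V \<inter> T -` U"
    then show "f q' = u (T (snd k q'))" using T(4,5)[of q'] u by (auto simp: ext_def)
  qed
  have qV: "snd k q \<in> V \<inter> T -` U" using T q u by auto
  then show "sm_at k f q" using e by (rule sm_atI)
  have d: "((\<lambda>p. u (T p)) has_derivative (\<lambda>v. fderiv u (snd k' q) (fderiv T (snd k q) v))) (at (snd k q))"
    by (rule has_derivative_compose[OF smooth_on_has_derivative[OF T(3,2)]])
      (use ext_derivative[OF u(2,1)] T q in auto)
  show "partial k i f q = (\<Sum>j\<in>UNIV. jacobian k k' q $ j $ i *\<^sub>R partial k' j f q)"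
    unfolding partial_eqI[OF chart_gchart[OF k(1)] e q(1) qV d] partial_ext_vec[OF chart_gchart[OF k(2)] u(2) q(2) u(1)]
    using T(6) q T(2) by simp
qed

lemma smooth_wrt_iff: "smooth_wrt (charts S) f \<longleftrightarrow> (\<forall>k\<in>charts S. \<forall>q\<in>fst k. sm_at k f q)"
  unfolding smooth_wrt_def using smooth_upto_sm_at[OF chart_inj] by blast

lemma smooth_wrtI:
  assumes "\<And>q. q \<in> N \<Longrightarrow> \<exists>k\<in>charts S. q \<in> fst k \<and> sm_at k f q"
  shows "smooth_wrt (charts S) f"
  unfolding smooth_wrt_iff
proof (intro ballI)
  fix k q assume k: "k \<in> charts S" "q \<in> fst k"
  then obtain k' where "k' \<in> charts S" "q \<in> fst k'" "sm_at k' f q" using assms[of q] chart_subset by blast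
  then show "sm_at k f q" using chart_change(1) k by blast
qed

lemma form_smooth: "\<omega> \<in> sl2_forms S \<Longrightarrow> k \<in> charts S \<Longrightarrow> q \<in> fst k \<Longrightarrow> sm_at k (\<lambda>q. \<omega> k q i) q"
  unfolding sl2_forms_def using smooth_upto_sm_at[OF chart_inj] by blast

lemma form_change:
  "\<omega> \<in> sl2_forms S \<Longrightarrow> k \<in> charts S \<Longrightarrow> k' \<in> charts S \<Longrightarrow> q \<in> fst k \<Longrightarrow> q \<in> fst k' \<Longrightarrow>
     \<omega> k q i = (\<Sum>j\<in>UNIV. jacobian k k' q $ j $ i *\<^sub>R \<omega> k' q j)"
  unfolding sl2_forms_def by blast

lemma form_sl2: "\<omega> \<in> sl2_forms S \<Longrightarrow> k \<in> charts S \<Longrightarrow> q \<in> fst k \<Longrightarrow> \<omega> k q i \<in> sl2"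
  unfolding sl2_forms_def by blast

text \<open>The curvature is a 2-form. The terms with second derivatives of the transition map
  cancel by symmetry, and the rest collects into the Jacobian determinant.\<close>

lemma curvature_change:
  assumes \<omega>: "\<omega> \<in> sl2_forms S" and k: "k \<in> charts S" "k' \<in> charts S" and q: "q \<in> fst k" "q \<in> fst k'"
  shows "curvature \<omega> k q 1 2 = det (jacobian k k' q) *\<^sub>R curvature \<omega> k' q 1 2"
proof -
  obtain V T where T: "open V" "snd k q \<in> V" "smooth_on V T"
    "\<And>q'. q' \<in> fst k \<Longrightarrow> snd k q' \<in> V \<Longrightarrow> q' \<in> fst k'"
    "\<And>q'. q' \<in> fst k \<Longrightarrow> snd k q' \<in> V \<Longrightarrow> snd k' q' = T (snd k q')"
    "\<And>q' i j. q' \<in> fst k \<Longrightarrow> snd k q' \<in> V \<Longrightarrow> jacobian k k' q' $ j $ i = fderiv T (snd k q') (axis i 1) $ j"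
    using transition[OF k q] by blast
  have "\<exists>U u. snd k' q \<in> U \<and> ext k' U u (\<lambda>q. \<omega> k' q j)" for j
    using form_smooth[OF \<omega> k(2) q(2)] by (auto simp: sm_at_def)
  then obtain U u where u: "\<And>j. snd k' q \<in> U j" "\<And>j. ext k' (U j) (u j) (\<lambda>q. \<omega> k' q j)" by metis
  have U: "open (U j)" "smooth_on (U j) (u j)" for j using u by (auto simp: ext_def)
  define W where "W = V \<inter> T -` (U 1 \<inter> U 2)"
  have oW: "open W" unfolding W_def
    using continuous_open_preimage[OF smooth_on_continuous[OF T(3)] T(1)] U by blast
  have qW: "snd k q \<in> W" using T q u by (auto simp: W_def)
  let ?p = "snd k q"
  let ?DT = "\<lambda>p. fderiv T p"
  define F where "F = (\<lambda>i p. \<Sum>j\<in>UNIV. ?DT p (axis i 1) $ j *\<^sub>R u j (T p))"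
  have sT: "smooth_on W T" by (rule smooth_on_subset[OF T(3)]) (auto simp: W_def)
  have UW: "T ` W \<subseteq> U j" for j using exhaust_2[of j] by (auto simp: W_def)
  have suT: "smooth_on W (\<lambda>p. u j (T p))" for j
    by (rule smooth_on_compose[OF oW U(1) UW U(2) sT])
  have e: "ext k W (F i) (\<lambda>q. \<omega> k q i)" for i
    unfolding ext_def
  proof (intro conjI ballI impI oW)
    show "smooth_on W (F i)" unfolding F_def
      by (intro smooth_on_sum smooth_on_scaleR smooth_on_component smooth_on_frechet_derivative sT suT oW)
    fix q' assume q': "q' \<in> fst k" "snd k q' \<in> W"
    then have 1: "snd k q' \<in> V" "T (snd k q') \<in> U j" for j using UW by (auto simp: W_def)
    have 2: "q' \<in> fst k'" "snd k' q' = T (snd k q')" using T(4,5)[OF q'(1) 1(1)] by auto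
    have "\<omega> k' q' j = u j (T (snd k q'))" for j using u(2)[of j] 1 2 by (auto simp: ext_def)
    then show "\<omega> k q' i = F i (snd k q')"
      unfolding F_def form_change[OF \<omega> k q'(1) 2(1)] T(6)[OF q'(1) 1(1)] by simp
  qed
  have gk: "gchart k" "gchart k'" using chart_gchart k by auto
  have d: "(F i has_derivative (\<lambda>v. \<Sum>j\<in>UNIV. ?DT ?p (axis i 1) $ j *\<^sub>R fderiv (u j) (snd k' q) (?DT ?p v) +
      fderiv (\<lambda>p. ?DT p (axis i 1)) (?p) v $ j *\<^sub>R u j (T ?p))) (at ?p)" for i
    unfolding F_def
  proof (intro has_derivative_sum bounded_bilinear.FDERIV[OF bounded_bilinear_scaleR] bounded_linear.has_derivative[OF bounded_linear_vec_nth])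
    show "((\<lambda>p. ?DT p (axis i 1)) has_derivative fderiv (\<lambda>p. ?DT p (axis i 1)) (?p)) (at ?p)"
      by (rule smooth_on_has_derivative[OF smooth_on_frechet_derivative[OF T(3)] T(2)])
    show "((\<lambda>p. u j (T p)) has_derivative (\<lambda>v. fderiv (u j) (snd k' q) (?DT ?p v))) (at ?p)" for j
      by (rule has_derivative_compose[OF smooth_on_has_derivative[OF T(3,2)]])
        (use ext_derivative[OF u(2) u(1)] T(5)[OF q(1) T(2)] in simp)
  qed
  have sym: "fderiv (\<lambda>p. ?DT p (axis 2 1)) (?p) (axis 1 1) = fderiv (\<lambda>p. ?DT p (axis 1 1)) (?p) (axis 2 1)"
    by (rule second_derivative_symmetric[OF T(3,1,2)])
  have J: "?DT ?p (axis i 1) $ j = jacobian k k' q $ j $ i" for i j using T(6)[OF q(1) T(2)] by simp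
  have w: "\<omega> k q i = (\<Sum>j\<in>UNIV. jacobian k k' q $ j $ i *\<^sub>R \<omega> k' q j)" for i by (rule form_change[OF \<omega> k q])
  show ?thesis
    unfolding curvature_def partial_eqI[OF gk(1) e q(1) qW d] partial_ext_vec[OF gk(2) u(2) q(2) u(1)] sym J w sum_2 det_2
    by (simp add: mm_left_distrib mm_right_distrib algebra_simps)
qed

lemma jacobian_det_pos: "k \<in> charts S \<Longrightarrow> k' \<in> charts S \<Longrightarrow> q \<in> fst k \<Longrightarrow> q \<in> fst k' \<Longrightarrow> 0 < det (jacobian k k' q)"
  using oriented by (auto simp: oriented_surface_def)

lemma curvature_antisym:
  "curvature \<omega> k q i j = - curvature \<omega> k q j i" "curvature \<omega> k q i i = 0"
  by (simp_all add: curvature_def)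

lemma half_ball:
  assumes k: "k \<in> charts S" and q: "q \<in> fst k"
  shows "\<exists>r>0. ball (snd k q) r \<inter> half_plane \<subseteq> snd k ` fst k"
proof -
  obtain T where T: "open T" "snd k ` fst k = half_plane \<inter> T" using chart_gchart[OF k] hopenE by (auto simp: gchart_def)
  then have "snd k q \<in> T" using q by blast
  then obtain r where "r > 0" "ball (snd k q) r \<subseteq> T" using T open_contains_ball by blast
  then show ?thesis using T by (intro exI[of _ r]) auto
qed

end

lemma convex_half_plane: "convex half_plane"
  by (rule convexI) (auto simp: half_plane_def)

lemma closed_half_plane: "closed half_plane"
proof -
  have "half_plane = (\<lambda>p. p $ 2) -` {0..}" by (auto simp: half_plane_def)
  then show ?thesis using closed_vimage[of "{0::real..}" "\<lambda>p::real^2. p $ 2"] linear_continuous_on[OF bounded_linear_vec_nth]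
    by (metis closed_atLeast)
qed

subsection \<open>Parallel transport along continuous paths\<close>

text \<open>A flat connection seen through its local horizontal sections \<open>h\<close>: two of them differ by a
  locally constant left factor, so the transport \<open>adj2 (h x) ** h y\<close> is locally well defined.\<close>
locale frames =
  fixes N :: "'a::topological_space set" and Fr :: "'a set \<Rightarrow> ('a \<Rightarrow> real^2^2) \<Rightarrow> bool"
  assumes Fr_open: "Fr U h \<Longrightarrow> openin (top_of_set N) U"
    and Fr_SL2: "Fr U h \<Longrightarrow> x \<in> U \<Longrightarrow> h x \<in> SL2"
    and Fr_cont: "Fr U h \<Longrightarrow> continuous_on U h"
    and Fr_compat: "Fr U h \<Longrightarrow> Fr U' h' \<Longrightarrow> x \<in> U \<Longrightarrow> x \<in> U' \<Longrightarrow>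
      \<exists>V. openin (top_of_set N) V \<and> x \<in> V \<and> V \<subseteq> U \<inter> U' \<and> (\<forall>y\<in>V. adj2 (h' x) ** h' y = adj2 (h x) ** h y)"
    and Fr_cover: "x \<in> N \<Longrightarrow> \<exists>U h. Fr U h \<and> x \<in> U"
begin

lemma near:
  fixes p :: "'b::metric_space \<Rightarrow> 'a"
  assumes "continuous_on T p" "p ` T \<subseteq> N" "openin (top_of_set N) U" "t \<in> T" "p t \<in> U"
  shows "\<exists>d>0. \<forall>s\<in>T. dist s t < d \<longrightarrow> p s \<in> U"
proof -
  have "openin (top_of_set T) (T \<inter> p -` U)"
    by (rule continuous_openin_preimage[OF assms(1)]) (use assms in auto)
  then obtain d where "d > 0" "\<forall>s\<in>T. dist s t < d \<longrightarrow> s \<in> T \<inter> p -` U"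
    unfolding openin_euclidean_subtopology_iff using assms(4,5) by blast
  then show ?thesis by auto
qed

text \<open>\<open>G\<close> is a horizontal lift of \<open>p\<close>. As \<open>p\<close> is merely
  continuous, there is no differential equation along it; instead \<open>G\<close> is near each time
  a constant multiple of a horizontal section read along \<open>p\<close>.\<close>

definition par :: "(real \<Rightarrow> 'a) \<Rightarrow> real \<Rightarrow> real \<Rightarrow> (real \<Rightarrow> real^2^2) \<Rightarrow> bool" where
  "par p a b G \<longleftrightarrow> (\<forall>t\<in>{a..b}. G t \<in> SL2) \<and> (\<forall>t\<in>{a..b}. \<forall>U h. Fr U h \<longrightarrow> p t \<in> U \<longrightarrow>
     (\<exists>d>0. \<forall>s\<in>{a..b}. dist s t < d \<longrightarrow> p s \<in> U \<and> G s = G t ** adj2 (h (p t)) ** h (p s)))"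

definition ppath :: "(real \<Rightarrow> 'a) \<Rightarrow> real \<Rightarrow> real \<Rightarrow> bool" where
  "ppath p a b \<longleftrightarrow> continuous_on {a..b} p \<and> p ` {a..b} \<subseteq> N"

lemma ppath_sub: "ppath p a b \<Longrightarrow> a \<le> c \<Longrightarrow> d \<le> b \<Longrightarrow> ppath p c d"
  unfolding ppath_def by (meson atLeastatMost_subset_iff continuous_on_subset image_mono order_trans)

lemma par_sub: "par p a b G \<Longrightarrow> a \<le> c \<Longrightarrow> d \<le> b \<Longrightarrow> par p c d G"
  unfolding par_def by (smt (verit) atLeastAtMost_iff)

text \<open>One frame at each time is enough, because \<open>Fr_compat\<close> carries the condition
  to every other frame there.\<close>

lemma par_one:
  assumes p: "ppath p a b" and SL: "\<forall>t\<in>{a..b}. G t \<in> SL2"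
    and ex: "\<And>t. t \<in> {a..b} \<Longrightarrow> \<exists>U h. Fr U h \<and> p t \<in> U \<and>
     (\<exists>d>0. \<forall>s\<in>{a..b}. dist s t < d \<longrightarrow> p s \<in> U \<longrightarrow> G s = G t ** adj2 (h (p t)) ** h (p s))"
  shows "par p a b G"
  unfolding par_def
proof (intro conjI SL ballI allI impI)
  fix t U' h' assume t: "t \<in> {a..b}" and F': "Fr U' h'" "p t \<in> U'"
  obtain U h d where F: "Fr U h" "p t \<in> U" and d: "d > 0"
    "\<And>s. s \<in> {a..b} \<Longrightarrow> dist s t < d \<Longrightarrow> p s \<in> U \<Longrightarrow> G s = G t ** adj2 (h (p t)) ** h (p s)"
    using ex[OF t] by blast
  obtain V where V: "openin (top_of_set N) V" "p t \<in> V" "V \<subseteq> U \<inter> U'" "\<forall>y\<in>V. adj2 (h' (p t)) ** h' y = adj2 (h (p t)) ** h y"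
    using Fr_compat[OF F(1) F'(1) F(2) F'(2)] by blast
  obtain e where e: "e > 0" "\<forall>s\<in>{a..b}. dist s t < e \<longrightarrow> p s \<in> V"
    using near[of "{a..b}" p V t] p V t unfolding ppath_def by blast
  show "\<exists>d>0. \<forall>s\<in>{a..b}. dist s t < d \<longrightarrow> p s \<in> U' \<and> G s = G t ** adj2 (h' (p t)) ** h' (p s)"
  proof (intro exI[of _ "min d e"] conjI ballI impI)
    fix s assume s: "s \<in> {a..b}" "dist s t < min d e"
    then have "p s \<in> V" using e by auto
    then show "p s \<in> U'" "G s = G t ** adj2 (h' (p t)) ** h' (p s)"
      using V d(2)[OF s(1)] s by (auto simp: mm_assoc)
  qed (use d e in auto)
qed

lemma par_frame:
  assumes p: "ppath p a b" and F: "Fr U h" "p ` {a..b} \<subseteq> U" and g: "g \<in> SL2"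
  shows "par p a b (\<lambda>s. g ** h (p s))"
proof (rule par_one[OF p])
  show "\<forall>t\<in>{a..b}. g ** h (p t) \<in> SL2" using F g Fr_SL2 by auto
  fix t assume t: "t \<in> {a..b}"
  then have "p t \<in> U" using F by auto
  moreover have "g ** h (p t) ** adj2 (h (p t)) = g" using Fr_SL2[OF F(1) calculation] by simp
  ultimately show "\<exists>U h'. Fr U h' \<and> p t \<in> U \<and>
     (\<exists>d>0. \<forall>s\<in>{a..b}. dist s t < d \<longrightarrow> p s \<in> U \<longrightarrow> g ** h (p s) = g ** h (p t) ** adj2 (h' (p t)) ** h' (p s))"
    using F by (intro exI[of _ U] exI[of _ h] conjI exI[of _ 1]) auto
qed

text \<open>In a common frame the varying factors cancel, so the ratio of two horizontal lifts is
  locally constant on a connected interval.\<close>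

lemma par_ratio:
  assumes p: "ppath p a b" and G: "par p a b G" "par p a b G'" and t: "t \<in> {a..b}"
  shows "G' t ** adj2 (G t) = G' a ** adj2 (G a)"
proof (rule connected_local_const[where A="{a..b}" and f="\<lambda>t. G' t ** adj2 (G t)"])
  show "\<forall>t\<in>{a..b}. \<forall>\<^sub>F s in at t within {a..b}. G' t ** adj2 (G t) = G' s ** adj2 (G s)"
  proof
    fix t assume t: "t \<in> {a..b}"
    then have "p t \<in> N" using p by (auto simp: ppath_def)
    then obtain U h where F: "Fr U h" "p t \<in> U" using Fr_cover by blast
    obtain d where d: "d > 0" "\<And>s. s \<in> {a..b} \<Longrightarrow> dist s t < d \<Longrightarrow> p s \<in> U \<and> G s = G t ** adj2 (h (p t)) ** h (p s)"
      using G(1) t F unfolding par_def by blast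
    obtain e where e: "e > 0" "\<And>s. s \<in> {a..b} \<Longrightarrow> dist s t < e \<Longrightarrow> p s \<in> U \<and> G' s = G' t ** adj2 (h (p t)) ** h (p s)"
      using G(2) t F unfolding par_def by blast
    have "G' t ** adj2 (G t) = G' s ** adj2 (G s)" if s: "s \<in> {a..b}" "dist s t < min d e" for s
    proof -
      have "p s \<in> U" "G s = G t ** adj2 (h (p t)) ** h (p s)" "G' s = G' t ** adj2 (h (p t)) ** h (p s)"
        using d(2)[OF s(1)] e(2)[OF s(1)] s(2) by auto
      moreover have "h (p s) \<in> SL2" "h (p t) \<in> SL2" using Fr_SL2 F calculation by auto
      ultimately show ?thesis by (simp add: adj2_mm mm_assoc)
    qed
    then show "\<forall>\<^sub>F s in at t within {a..b}. G' t ** adj2 (G t) = G' s ** adj2 (G s)"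
      unfolding eventually_at using d e by (intro exI[of _ "min d e"]) auto
  qed
qed (use t in auto)

lemma par_unique:
  assumes p: "ppath p a b" and G: "par p a b G" "par p a b G'" and t: "t \<in> {a..b}" and eq: "G a = G' a"
  shows "G t = G' t"
proof -
  have s: "G t \<in> SL2" "G a \<in> SL2" using G t by (auto simp: par_def)
  have "G' t ** adj2 (G t) = mat 1" using par_ratio[OF p G t] s by (simp add: eq[symmetric])
  then have "G' t ** adj2 (G t) ** G t = G t" by simp
  then show ?thesis using s by simp
qed

lemma par_in_frame:
  assumes p: "ppath p a b" and G: "par p a b G" and F: "Fr U h" "p ` {a..b} \<subseteq> U" and st: "s \<in> {a..b}" "t \<in> {a..b}"
  shows "G t = G s ** adj2 (h (p s)) ** h (p t)"
proof -
  have "p t \<in> U" "p s \<in> U" using F st by auto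
  then have SL: "h (p t) \<in> SL2" "h (p s) \<in> SL2" "G s \<in> SL2" "G t \<in> SL2"
    using Fr_SL2[OF F(1)] st G by (auto simp: par_def)
  have "mat 1 ** h (p s) ** adj2 (G s) = mat 1 ** h (p t) ** adj2 (G t)"
    using par_ratio[OF p G par_frame[OF p F SL2_simps(1)]] st by metis
  then have "h (p s) ** adj2 (G s) ** G t = h (p t) ** adj2 (G t) ** G t" by simp
  then have "h (p s) ** adj2 (G s) ** G t = h (p t)" using SL by simp
  then have "G s ** adj2 (h (p s)) ** (h (p s) ** adj2 (G s) ** G t) = G s ** adj2 (h (p s)) ** h (p t)" by simp
  then show ?thesis using SL by (simp add: mm_assoc)
qed

lemma par_left: "par p a b G \<Longrightarrow> g \<in> SL2 \<Longrightarrow> par p a b (\<lambda>t. g ** G t)"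
proof -
  assume G: "par p a b G" and g: "g \<in> SL2"
  have "\<exists>d>0. \<forall>s\<in>{a..b}. dist s t < d \<longrightarrow> p s \<in> U \<and> g ** G s = g ** G t ** adj2 (h (p t)) ** h (p s)"
    if t: "t \<in> {a..b}" and F: "Fr U h" "p t \<in> U" for t U h
  proof -
    obtain d where "d > 0" "\<And>s. s \<in> {a..b} \<Longrightarrow> dist s t < d \<Longrightarrow> p s \<in> U \<and> G s = G t ** adj2 (h (p t)) ** h (p s)"
      using G t F unfolding par_def by blast
    then show ?thesis by (intro exI[of _ d]) (simp add: mm_assoc)
  qed
  then show ?thesis using G g unfolding par_def by auto
qed

lemma par_concat:
  assumes p: "ppath p a c" and b: "a \<le> b" "b \<le> c" and G: "par p a b G" "par p b c G'" and eq: "G b = G' b"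
  shows "par p a c (\<lambda>t. if t \<le> b then G t else G' t)"
proof (rule par_one[OF p])
  show "\<forall>t\<in>{a..c}. (if t \<le> b then G t else G' t) \<in> SL2" using G by (auto simp: par_def)
  fix t assume t: "t \<in> {a..c}"
  then have "p t \<in> N" using p by (auto simp: ppath_def)
  then obtain U h where F: "Fr U h" "p t \<in> U" using Fr_cover by blast
  have L: "\<exists>d>0. \<forall>s\<in>{a..b}. dist s t < d \<longrightarrow> G s = G t ** adj2 (h (p t)) ** h (p s)" if "t \<le> b"
    using G(1) t F that unfolding par_def by (smt (verit) atLeastAtMost_iff)
  have R: "\<exists>d>0. \<forall>s\<in>{b..c}. dist s t < d \<longrightarrow> G' s = G' t ** adj2 (h (p t)) ** h (p s)" if "t \<ge> b"
    using G(2) t F that unfolding par_def by (smt (verit) atLeastAtMost_iff)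
  let ?G = "\<lambda>t. if t \<le> b then G t else G' t"
  consider "t < b" | "t = b" | "t > b" by linarith
  then have "\<exists>d>0. \<forall>s\<in>{a..c}. dist s t < d \<longrightarrow> ?G s = ?G t ** adj2 (h (p t)) ** h (p s)"
  proof cases
    case 1
    then obtain d where "d > 0" "\<forall>s\<in>{a..b}. dist s t < d \<longrightarrow> G s = G t ** adj2 (h (p t)) ** h (p s)" using L by (auto simp: less_imp_le)
    then show ?thesis using 1 by (intro exI[of _ "min d (b - t)"]) (auto simp: dist_real_def)
  next
    case 3
    then obtain d where "d > 0" "\<forall>s\<in>{b..c}. dist s t < d \<longrightarrow> G' s = G' t ** adj2 (h (p t)) ** h (p s)" using R by (auto simp: less_imp_le)
    then show ?thesis using 3 by (intro exI[of _ "min d (t - b)"]) (auto simp: dist_real_def)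
  next
    case 2
    obtain d where d: "d > 0" "\<And>s. s \<in> {a..b} \<Longrightarrow> dist s t < d \<Longrightarrow> G s = G t ** adj2 (h (p t)) ** h (p s)"
      using L[OF eq_refl[OF 2]] by blast
    obtain e where e: "e > 0" "\<And>s. s \<in> {b..c} \<Longrightarrow> dist s t < e \<Longrightarrow> G' s = G' t ** adj2 (h (p t)) ** h (p s)"
      using R[OF eq_refl[OF 2[symmetric]]] by blast
    have tt: "?G t = G t" "G t = G' t" using 2 eq by auto
    show ?thesis
    proof (intro exI[of _ "min d e"] conjI ballI impI)
      fix s assume s: "s \<in> {a..c}" "dist s t < min d e"
      show "?G s = ?G t ** adj2 (h (p t)) ** h (p s)"
      proof (cases "s \<le> b")
        case True then show ?thesis unfolding tt(1) using d(2)[of s] s by simp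
      next
        case False then show ?thesis unfolding tt using e(2)[of s] s by simp
      qed
    qed (use d e in simp)
  qed
  then show "\<exists>U h. Fr U h \<and> p t \<in> U \<and> (\<exists>d>0. \<forall>s\<in>{a..c}. dist s t < d \<longrightarrow> p s \<in> U \<longrightarrow> ?G s = ?G t ** adj2 (h (p t)) ** h (p s))"
    using F by blast
qed

text \<open>Bolzano's subdivision principle: short pieces of the path lie in a single frame, and two
  adjacent lifts are matched by multiplying the second one from the left.\<close>

lemma par_exists:
  assumes p: "ppath p a b" and ab: "a \<le> b"
  shows "\<exists>G. par p a b G \<and> G a = mat 1"
proof -
  have "a \<le> a \<and> b \<le> b \<longrightarrow> (\<exists>G. par p a b G \<and> G a = mat 1)"
  proof (rule Bolzano[OF ab, of "\<lambda>u v. a \<le> u \<and> v \<le> b \<longrightarrow> (\<exists>G. par p u v G \<and> G u = mat 1)"])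
    fix u v w assume *: "a \<le> u \<and> v \<le> b \<longrightarrow> (\<exists>G. par p u v G \<and> G u = mat 1)" "a \<le> v \<and> w \<le> b \<longrightarrow> (\<exists>G. par p v w G \<and> G v = mat 1)" "u \<le> v" "v \<le> w"
    show "a \<le> u \<and> w \<le> b \<longrightarrow> (\<exists>G. par p u w G \<and> G u = mat 1)"
    proof
      assume uw: "a \<le> u \<and> w \<le> b"
      then obtain G1 G2 where G: "par p u v G1" "G1 u = mat 1" "par p v w G2" "G2 v = mat 1" using * by auto
      have "par p u w (\<lambda>t. if t \<le> v then G1 t else G1 v ** G2 t)"
        by (rule par_concat[OF ppath_sub[OF p] *(3,4) G(1) par_left[OF G(3)]])
          (use uw G * in \<open>auto simp: par_def\<close>)
      then show "\<exists>G. par p u w G \<and> G u = mat 1" using G(2) *(3) by (intro exI conjI) (assumption, simp)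
    qed
  next
    fix x assume x: "a \<le> x" "x \<le> b"
    then have "p x \<in> N" using p by (auto simp: ppath_def)
    then obtain U h where F: "Fr U h" "p x \<in> U" using Fr_cover by blast
    obtain d where d: "d > 0" "\<forall>s\<in>{a..b}. dist s x < d \<longrightarrow> p s \<in> U"
      using near[of "{a..b}" p U x] p F Fr_open x unfolding ppath_def by auto
    show "\<exists>d>0. \<forall>u v. u \<le> x \<and> x \<le> v \<and> v - u < d \<longrightarrow> (a \<le> u \<and> v \<le> b \<longrightarrow> (\<exists>G. par p u v G \<and> G u = mat 1))"
    proof (intro exI[of _ d] conjI allI impI d(1))
      fix u v assume uv: "u \<le> x \<and> x \<le> v \<and> v - u < d" "a \<le> u \<and> v \<le> b"
      have i: "p ` {u..v} \<subseteq> U" using d uv by (auto simp: dist_real_def)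
      have g: "h (p u) \<in> SL2" using i uv Fr_SL2[OF F(1)] by (auto simp: image_subset_iff)
      have "par p u v (\<lambda>s. adj2 (h (p u)) ** h (p s))"
        by (rule par_frame[OF ppath_sub[OF p] F(1) i]) (use uv g in auto)
      then show "\<exists>G. par p u v G \<and> G u = mat 1" using g by (intro exI conjI) (assumption, simp)
    qed
  qed
  then show ?thesis by simp
qed

lemma par_compose:
  assumes p: "ppath p a b" and G: "par p a b G" and f: "continuous_on {c..d} f" "f ` {c..d} \<subseteq> {a..b}"
  shows "par (\<lambda>t. p (f t)) c d (\<lambda>t. G (f t))"
  unfolding par_def
proof (intro conjI ballI allI impI)
  fix t assume t: "t \<in> {c..d}"
  then have ft: "f t \<in> {a..b}" using f by (simp only: image_subset_iff)
  then show "G (f t) \<in> SL2" using G by (auto simp: par_def)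
  fix U h assume "Fr U h" "p (f t) \<in> U"
  then obtain e where e: "e > 0" "\<And>s. s \<in> {a..b} \<Longrightarrow> dist s (f t) < e \<Longrightarrow> p s \<in> U \<and> G s = G (f t) ** adj2 (h (p (f t))) ** h (p s)"
    using G ft unfolding par_def by blast
  obtain d' where d': "d' > 0" "\<forall>s\<in>{c..d}. dist s t < d' \<longrightarrow> dist (f s) (f t) < e"
    using f(1) t e(1) unfolding continuous_on_iff by blast
  then show "\<exists>d'>0. \<forall>s\<in>{c..d}. dist s t < d' \<longrightarrow> p (f s) \<in> U \<and> G (f s) = G (f t) ** adj2 (h (p (f t))) ** h (p (f s))"
    using e(2) f(2) by (intro exI[of _ d']) (auto simp: image_subset_iff)
qed

lemma par_cong:
  assumes "par p a b G" "\<And>t. t \<in> {a..b} \<Longrightarrow> p t = p' t" "\<And>t. t \<in> {a..b} \<Longrightarrow> G t = G' t"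
  shows "par p' a b G'"
  using assms unfolding par_def by (smt (verit, best))

section \<open>Transport along the stages of a homotopy\<close>

context
  fixes k :: "real \<Rightarrow> real \<Rightarrow> 'a" and G :: "real \<Rightarrow> real \<Rightarrow> real^2^2" and x0 :: 'a
  assumes k: "continuous_on ({0..1} \<times> {0..1}) (\<lambda>z. k (fst z) (snd z))"
    and kN: "\<And>s t. s \<in> {0..1} \<Longrightarrow> t \<in> {0..1} \<Longrightarrow> k s t \<in> N"
    and k0: "\<And>s. s \<in> {0..1} \<Longrightarrow> k s 0 = x0"
    and G: "\<And>s. s \<in> {0..1} \<Longrightarrow> par (k s) 0 1 (G s)"
    and G0: "\<And>s. s \<in> {0..1} \<Longrightarrow> G s 0 = mat 1"
begin

lemma k_path: "s \<in> {0..1} \<Longrightarrow> ppath (k s) 0 1"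
  unfolding ppath_def using kN continuous_on_compose2[OF k, of "{0..1}" "\<lambda>t. (s, t)"]
  by (auto simp: continuous_on_Pair continuous_on_const continuous_on_id image_subset_iff)

lemma k_near:
  assumes "s0 \<in> {0..1}" "t0 \<in> {0..1}" "openin (top_of_set N) U" "k s0 t0 \<in> U"
  shows "\<exists>d>0. \<forall>s\<in>{0..1}. \<forall>t\<in>{0..1}. dist s s0 < d \<longrightarrow> dist t t0 < d \<longrightarrow> k s t \<in> U"
proof -
  obtain d where d: "d > 0" "\<forall>z\<in>{0..1} \<times> {0..1}. dist z (s0, t0) < d \<longrightarrow> k (fst z) (snd z) \<in> U"
    using near[OF k _ assms(3), of "(s0, t0)"] assms kN by (auto simp: image_subset_iff)
  show ?thesis
  proof (intro exI[of _ "d / 2"] conjI ballI impI)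
    fix s t assume st: "s \<in> {0..1}" "t \<in> {0..1}" "dist s s0 < d / 2" "dist t t0 < d / 2"
    have "dist (s, t) (s0, t0) \<le> dist s s0 + dist t t0"
      unfolding dist_Pair_Pair by (rule sqrt_sum_squares_le_sum) auto
    then show "k s t \<in> U" using d(2)[rule_format, of "(s, t)"] st by simp
  qed (use d in auto)
qed

text \<open>Across the stages \<open>s\<close>, at a fixed time, the transport follows the same rule
  as along a path. At time 0 this holds because all stages start at \<open>x0\<close>, and it is
  carried on in steps so short that a strip of the homotopy lies in one frame.\<close>

lemma homotopy_transport:
  assumes s0: "s0 \<in> {0..1}" and t0: "t0 \<in> {0..1}" and F: "Fr U h" "k s0 t0 \<in> U"
  shows "\<exists>d>0. \<forall>s\<in>{0..1}. dist s s0 < d \<longrightarrow> k s t0 \<in> U \<and> G s t0 = G s0 t0 ** adj2 (h (k s0 t0)) ** h (k s t0)"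
proof -
  \<comment> \<open>Quantifying over all frames at the point allows the frame to change from one
    step to the next.\<close>
  define A where "A = (\<lambda>t. \<forall>U h. Fr U h \<longrightarrow> k s0 t \<in> U \<longrightarrow>
     (\<exists>d>0. \<forall>s\<in>{0..1}. dist s s0 < d \<longrightarrow> k s t \<in> U \<and> G s t = G s0 t ** adj2 (h (k s0 t)) ** h (k s t)))"
  have A1: "A t" if t: "t \<in> {0..1}" and F: "Fr U h" "k s0 t \<in> U" and
    d: "d > 0" "\<And>s. s \<in> {0..1} \<Longrightarrow> dist s s0 < d \<Longrightarrow> G s t = G s0 t ** adj2 (h (k s0 t)) ** h (k s t)" for t U h d
    unfolding A_def
  proof (intro allI impI)
    fix U' h' assume F': "Fr U' h'" "k s0 t \<in> U'"
    obtain V where V: "openin (top_of_set N) V" "k s0 t \<in> V" "V \<subseteq> U \<inter> U'"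
      "\<forall>y\<in>V. adj2 (h' (k s0 t)) ** h' y = adj2 (h (k s0 t)) ** h y"
      using Fr_compat[OF F(1) F'(1) F(2) F'(2)] by blast
    obtain e where e: "e > 0" "\<forall>s\<in>{0..1}. \<forall>t'\<in>{0..1}. dist s s0 < e \<longrightarrow> dist t' t < e \<longrightarrow> k s t' \<in> V"
      using k_near[OF s0 t V(1,2)] by blast
    show "\<exists>d>0. \<forall>s\<in>{0..1}. dist s s0 < d \<longrightarrow> k s t \<in> U' \<and> G s t = G s0 t ** adj2 (h' (k s0 t)) ** h' (k s t)"
    proof (intro exI[of _ "min d e"] conjI ballI impI)
      fix s :: real assume s: "s \<in> {0..1}" "dist s s0 < min d e"
      then have v: "k s t \<in> V" using e t by auto
      then show "k s t \<in> U'" using V by auto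
      show "G s t = G s0 t ** adj2 (h' (k s0 t)) ** h' (k s t)"
        using V(4) v d(2)[OF s(1)] s(2) by (simp add: mm_assoc)
    qed (use d e in auto)
  qed
  have "0 \<le> (0::real) \<and> t0 \<le> 1 \<longrightarrow> A 0 \<longrightarrow> A t0"
  proof (rule Bolzano[of 0 t0 "\<lambda>u v. 0 \<le> u \<and> v \<le> 1 \<longrightarrow> A u \<longrightarrow> A v"])
    fix x assume x: "0 \<le> x" "x \<le> t0"
    then have x1: "x \<in> {0..1}" using t0 by auto
    obtain U h where F: "Fr U h" "k s0 x \<in> U" using Fr_cover kN[OF s0 x1] by blast
    obtain e where e: "e > 0" "\<And>s t. s \<in> {0..1} \<Longrightarrow> t\<in>{0..1} \<Longrightarrow> dist s s0 < e \<Longrightarrow> dist t x < e \<Longrightarrow> k s t \<in> U"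
      using k_near[OF s0 x1 Fr_open[OF F(1)] F(2)] by blast
    show "\<exists>d>0. \<forall>u v. u \<le> x \<and> x \<le> v \<and> v - u < d \<longrightarrow> (0 \<le> u \<and> v \<le> 1 \<longrightarrow> A u \<longrightarrow> A v)"
    proof (intro exI[of _ e] conjI allI impI e(1))
      fix u v assume uv: "u \<le> x \<and> x \<le> v \<and> v - u < e" "0 \<le> u \<and> v \<le> 1" and Au: "A u"
      have uv1: "u \<in> {0..1}" "v \<in> {0..1}" "u \<le> v" using uv by auto
      have im: "k s ` {u..v} \<subseteq> U" if "s \<in> {0..1}" "dist s s0 < e" for s
        using e(2)[OF that(1)] that(2) uv by (auto simp: dist_real_def)
      have ku: "k s0 u \<in> U" "k s0 v \<in> U" using im[OF s0] e(1) uv1 by auto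
      obtain d where d: "d > 0" "\<And>s. s \<in> {0..1} \<Longrightarrow> dist s s0 < d \<Longrightarrow> G s u = G s0 u ** adj2 (h (k s0 u)) ** h (k s u)"
        using Au F(1) ku unfolding A_def by blast
      have st: "G s v = G s u ** adj2 (h (k s u)) ** h (k s v)" if "s \<in> {0..1}" "dist s s0 < e" for s
        by (rule par_in_frame[OF ppath_sub[OF k_path] par_sub[OF G] F(1) im]) (use that uv1 in auto)
      show "A v"
      proof (rule A1[OF uv1(2) F(1) ku(2), of "min d e"])
        fix s :: real assume s: "s \<in> {0..1}" "dist s s0 < min d e"
        have SL: "h (k s u) \<in> SL2" "h (k s0 u) \<in> SL2" "h (k s0 v) \<in> SL2" using im[OF s(1)] s(2) ku uv1 Fr_SL2[OF F(1)] by (auto simp: image_subset_iff)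
        have 1: "G s v = G s u ** adj2 (h (k s u)) ** h (k s v)" using st s by auto
        have 2: "G s u = G s0 u ** adj2 (h (k s0 u)) ** h (k s u)" using d s by auto
        have 3: "G s0 v = G s0 u ** adj2 (h (k s0 u)) ** h (k s0 v)" using st[OF s0] e(1) by simp
        show "G s v = G s0 v ** adj2 (h (k s0 v)) ** h (k s v)"
          unfolding 1 2 3 using SL by simp
      qed (use d e in auto)
    qed
  qed (use t0 in auto)
  moreover have "A 0"
  proof -
    obtain U h where F: "Fr U h" "k s0 0 \<in> U" using Fr_cover[of "k s0 0"] kN[OF s0] by auto
    show ?thesis
      by (rule A1[OF _ F, of 1]) (use F Fr_SL2[OF F] k0 G0 s0 in auto)
  qed
  ultimately have "A t0" using t0 by auto
  then show ?thesis using F unfolding A_def by blast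
qed

lemma homotopy_transport_continuous: "continuous_on ({0..1} \<times> {0..1}) (\<lambda>z. G (fst z) (snd z))"
  unfolding continuous_on_eq_continuous_within
proof
  fix z :: "real \<times> real" assume z: "z \<in> {0..1} \<times> {0..1}"
  obtain s0 t0 where st0: "z = (s0, t0)" "s0 \<in> {0..1}" "t0 \<in> {0..1}" using z by (cases z) auto
  obtain U h where F: "Fr U h" "k s0 t0 \<in> U" using Fr_cover kN[OF st0(2,3)] by blast
  obtain e where e: "e > 0" "\<And>s t. s \<in> {0..1} \<Longrightarrow> t\<in>{0..1} \<Longrightarrow> dist s s0 < e \<Longrightarrow> dist t t0 < e \<Longrightarrow> k s t \<in> U"
    using k_near[OF st0(2,3) Fr_open[OF F(1)] F(2)] by blast
  obtain d where d: "d > 0" "\<And>s. s \<in> {0..1} \<Longrightarrow> dist s s0 < d \<Longrightarrow> G s t0 = G s0 t0 ** adj2 (h (k s0 t0)) ** h (k s t0)"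
    using homotopy_transport[OF st0(2,3) F] by blast
  have eq: "G s t = G s0 t0 ** adj2 (h (k s0 t0)) ** h (k s t)" if "s \<in> {0..1}" "t \<in> {0..1}" "dist s s0 < min d e" "dist t t0 < e" for s t
  proof -
    have im: "k s ` {min t t0..max t t0} \<subseteq> U" using e(2)[OF that(1)] that st0 by (auto simp: dist_real_def abs_if split: if_splits)
    have 1: "G s t = G s t0 ** adj2 (h (k s t0)) ** h (k s t)"
      by (rule par_in_frame[OF ppath_sub[OF k_path] par_sub[OF G] F(1) im]) (use that st0 in auto)
    have "h (k s t0) \<in> SL2" using Fr_SL2[OF F(1)] im by (auto simp: image_subset_iff)
    then show ?thesis unfolding 1 using d(2)[OF that(1)] that(3) by simp
  qed
  have "continuous_on ({0..1} \<times> {0..1} \<inter> (ball s0 (min d e) \<times> ball t0 e)) (\<lambda>z. h (k (fst z) (snd z)))"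
    by (rule continuous_on_compose2[OF Fr_cont[OF F(1)] continuous_on_subset[OF k]])
      (use e(2) in \<open>auto simp: dist_commute\<close>)
  then have "continuous_on ({0..1} \<times> {0..1} \<inter> (ball s0 (min d e) \<times> ball t0 e)) (\<lambda>z. G s0 t0 ** adj2 (h (k s0 t0)) ** h (k (fst z) (snd z)))"
    by (intro continuous_intros)
  then have "continuous_on ({0..1} \<times> {0..1} \<inter> (ball s0 (min d e) \<times> ball t0 e)) (\<lambda>z. G (fst z) (snd z))"
    by (rule continuous_on_eq) (use eq in \<open>auto simp: dist_commute\<close>)
  moreover have "z \<in> ball s0 (min d e) \<times> ball t0 e" using st0 d e by auto
  ultimately have "continuous (at z within {0..1} \<times> {0..1} \<inter> (ball s0 (min d e) \<times> ball t0 e)) (\<lambda>z. G (fst z) (snd z))"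
    using z by (simp add: continuous_on_eq_continuous_within)
  moreover have "at z within {0..1} \<times> {0..1} \<inter> (ball s0 (min d e) \<times> ball t0 e) = at z within {0..1} \<times> {0..1}"
    by (rule at_within_nhd[of _ "ball s0 (min d e) \<times> ball t0 e"]) (use \<open>z \<in> ball s0 (min d e) \<times> ball t0 e\<close> in \<open>auto intro: open_Times\<close>)
  ultimately show "continuous (at z within {0..1} \<times> {0..1}) (\<lambda>z. G (fst z) (snd z))" by simp
qed

text \<open>With a common end point the rule of \<open>homotopy_transport\<close> says that the end
  value is locally constant in \<open>s\<close>.\<close>

lemma homotopy_transport_end:
  assumes "\<And>s. s \<in> {0..1} \<Longrightarrow> k s 1 = x1" "s \<in> {0..1}" "s' \<in> {0..1}"
  shows "G s 1 = G s' 1"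
proof (rule connected_local_const[of "{0..1}" s s' "\<lambda>s. G s 1"])
  show "\<forall>s\<in>{0..1}. \<forall>\<^sub>F s' in at s within {0..1}. G s 1 = G s' 1"
  proof
    fix s0 :: real assume s0: "s0 \<in> {0..1}"
    obtain U h where F: "Fr U h" "k s0 1 \<in> U" using Fr_cover[OF kN[OF s0, of 1]] by auto
    obtain d where d: "d > 0" "\<And>s. s \<in> {0..1} \<Longrightarrow> dist s s0 < d \<Longrightarrow> G s 1 = G s0 1 ** adj2 (h (k s0 1)) ** h (k s 1)"
      using homotopy_transport[OF s0 _ F] by auto
    show "\<forall>\<^sub>F s' in at s0 within {0..1}. G s0 1 = G s' 1"
      unfolding eventually_at
    proof (intro exI[of _ d] conjI ballI impI d(1))
      fix s assume s: "s \<in> {0..1}" "s \<noteq> s0 \<and> dist s s0 < d"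
      have "G s 1 = G s0 1 ** adj2 (h (k s0 1)) ** h (k s0 1)"
        using d(2)[OF s(1)] s(2) assms(1)[OF s(1)] assms(1)[OF s0] by simp
      then show "G s0 1 = G s 1" using Fr_SL2[OF F] by simp
    qed
  qed
qed (use assms in auto)

end

definition transport :: "(real \<Rightarrow> 'a) \<Rightarrow> real \<Rightarrow> real^2^2" where
  "transport p = (SOME G. par p 0 1 G \<and> G 0 = mat 1)"

lemma ppath_iff: "ppath p 0 1 \<longleftrightarrow> path p \<and> path_image p \<subseteq> N"
  by (simp add: ppath_def path_def path_image_def)

lemma transport: "ppath p 0 1 \<Longrightarrow> par p 0 1 (transport p) \<and> transport p 0 = mat 1"
  unfolding transport_def using someI_ex[OF par_exists[of p 0 1]] by simp

lemma transport_eq: "ppath p 0 1 \<Longrightarrow> par p 0 1 G \<Longrightarrow> G 0 = mat 1 \<Longrightarrow> t \<in> {0..1} \<Longrightarrow> transport p t = G t"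
  using transport par_unique[of p 0 1 "transport p" G t] by auto

text \<open>The transports along the stages themselves form a homotopy in \<open>SL2\<close> with
  fixed ends. So the class of the path, and not only the matrix at its end, depends on the homotopy
  class alone.\<close>

lemma transport_homotopic:
  assumes "homotopic_paths N p q"
  shows "homotopic_paths SL2 (transport p) (transport q)"
proof -
  obtain h where h: "continuous_on ({0..1} \<times> {0..1}) h" "h \<in> ({0..1} \<times> {0..1}) \<rightarrow> N"
    "\<forall>x \<in> {0..1}. h(0,x) = p x" "\<forall>x \<in> {0..1}. h(1,x) = q x"
    "\<forall>t \<in> {0..1::real}. pathstart(h \<circ> Pair t) = pathstart p \<and> pathfinish(h \<circ> Pair t) = pathfinish p"
    using assms unfolding homotopic_paths by blast
  have pq: "ppath p 0 1" "ppath q 0 1"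
    using homotopic_paths_imp_path[OF assms] homotopic_paths_imp_subset[OF assms] by (simp_all add: ppath_iff)
  define k where "k = (\<lambda>s t. h (s, t))"
  define G where "G = (\<lambda>s. transport (k s))"
  have k: "continuous_on ({0..1} \<times> {0..1}) (\<lambda>z. k (fst z) (snd z))" using h(1) by (simp add: k_def)
  have kN: "\<And>s t. s \<in> {0..1} \<Longrightarrow> t \<in> {0..1} \<Longrightarrow> k s t \<in> N" using h(2) by (auto simp: k_def)
  have ends: "\<And>s. s \<in> {0..1} \<Longrightarrow> k s 0 = pathstart p" "\<And>s. s \<in> {0..1} \<Longrightarrow> k s 1 = pathfinish p"
    using h(5) by (auto simp: k_def pathstart_def pathfinish_def)
  have kp: "ppath (k s) 0 1" if "s \<in> {0..1}" for s
    unfolding ppath_def using kN that continuous_on_compose2[OF k, of "{0..1}" "\<lambda>t. (s, t)"]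
    by (auto simp: continuous_on_Pair continuous_on_const continuous_on_id image_subset_iff)
  have G: "\<And>s. s \<in> {0..1} \<Longrightarrow> par (k s) 0 1 (G s)" "\<And>s. s \<in> {0..1} \<Longrightarrow> G s 0 = mat 1"
    using transport[OF kp] by (auto simp: G_def)
  note hc = homotopy_transport_continuous[OF k kN ends(1) G]
  have he: "G s 1 = G 0 1" if "s \<in> {0..1}" for s
    by (rule homotopy_transport_end[OF k kN ends(1) G ends(2)]) (use that in auto)
  have e: "G 0 t = transport p t" "G 1 t = transport q t" if "t \<in> {0..1}" for t
    using transport_eq[OF pq(1) par_cong[OF G(1)[of 0]] _ that] transport_eq[OF pq(2) par_cong[OF G(1)[of 1]] _ that] G(2) h(3,4)
    by (auto simp: k_def)
  show ?thesis unfolding homotopic_paths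
  proof (intro exI[of _ "\<lambda>z. G (fst z) (snd z)"] conjI ballI hc)
    show "(\<lambda>z. G (fst z) (snd z)) \<in> {0..1} \<times> {0..1} \<rightarrow> SL2" using G(1) by (auto simp: par_def)
    fix s :: real assume s: "s \<in> {0..1}"
    show "pathstart ((\<lambda>z. G (fst z) (snd z)) \<circ> Pair s) = pathstart (transport p)"
      using G(2)[OF s] transport[OF pq(1)] by (simp add: pathstart_def)
    show "pathfinish ((\<lambda>z. G (fst z) (snd z)) \<circ> Pair s) = pathfinish (transport p)"
      using he[OF s] e(1)[of 1] by (simp add: pathfinish_def)
  qed (use e in auto)
qed

lemma transport_path:
  assumes p: "ppath p 0 1"
  shows "path (transport p)" "path_image (transport p) \<subseteq> SL2" "pathstart (transport p) = mat 1"
proof -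
  have "homotopic_paths N p p" using p by (simp add: ppath_iff)
  from transport_homotopic[OF this] show "path (transport p)" "path_image (transport p) \<subseteq> SL2" by auto
  show "pathstart (transport p) = mat 1" using transport[OF p] by (simp add: pathstart_def)
qed

lemma transport_join:
  assumes p: "ppath p 0 1" and q: "ppath q 0 1" "pathfinish p = pathstart q"
  shows "path_class SL2 (transport (p +++ q)) = path_class SL2 (transport p +++ (\<lambda>t. pathfinish (transport p) ** transport q t))"
proof -
  have pq: "ppath (p +++ q) 0 1" using p q by (auto simp: ppath_iff intro: subset_path_image_join[THEN subsetD])
  let ?G = "\<lambda>t. if t \<le> 1/2 then transport p (2 * t) else pathfinish (transport p) ** transport q (2 * t - 1)"
  have f: "pathfinish (transport p) \<in> SL2" using transport[OF p] by (simp add: par_def pathfinish_def)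
  have "par (p +++ q) 0 1 ?G"
  proof (rule par_concat[OF pq])
    show "par (p +++ q) 0 (1/2) (\<lambda>t. transport p (2 * t))"
      by (rule par_cong[OF par_compose[OF p, of "transport p" 0 "1/2" "\<lambda>t. 2 * t"]])
        (use transport[OF p] in \<open>auto simp: joinpaths_def intro!: continuous_intros\<close>)
    show "par (p +++ q) (1/2) 1 (\<lambda>t. pathfinish (transport p) ** transport q (2 * t - 1))"
    proof (rule par_left[OF par_cong[OF par_compose[OF q(1), of "transport q" "1/2" 1 "\<lambda>t. 2 * t - 1"]] f])
      fix t :: real assume "t \<in> {1/2..1}"
      then show "q (2 * t - 1) = (p +++ q) t"
      proof (cases "t = 1/2")
        case True show ?thesis unfolding True using q(2) by (simp add: joinpaths_def pathfinish_def pathstart_def)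
      qed (simp add: joinpaths_def)
    qed (use transport[OF q(1)] in \<open>auto intro!: continuous_intros\<close>)
    show "transport p (2 * (1/2)) = pathfinish (transport p) ** transport q (2 * (1/2) - 1)"
      using transport[OF q(1)] by (simp add: pathfinish_def)
  qed auto
  then have "transport (p +++ q) t = ?G t" if "t \<in> {0..1}" for t
    using transport_eq[OF pq _ _ that, of ?G] transport[OF p] by auto
  then have "homotopic_paths SL2 (transport (p +++ q)) (transport p +++ (\<lambda>t. pathfinish (transport p) ** transport q t))"
    by (intro homotopic_paths_eq transport_path[OF pq]) (auto simp: joinpaths_def)
  then show ?thesis by (rule path_class_cong)
qed

lemma transport_in_frame:
  assumes q: "ppath q 0 1" and F: "Fr U h" "path_image q \<subseteq> U" and t: "t \<in> {0..1}"
  shows "transport q t = adj2 (h (pathstart q)) ** h (q t)"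
  using par_in_frame[OF q, of "transport q" U h 0 t] transport[OF q] F t
  by (auto simp: path_image_def pathstart_def)

text \<open>The developing map of the flat connection. Keeping the whole transport path instead of
  its end point gives a value in the covering group.\<close>

definition develop :: "(real \<Rightarrow> 'a) set \<Rightarrow> (real \<Rightarrow> real^2^2) set" where
  "develop c = path_class SL2 (transport (SOME p. p \<in> c))"

lemma develop_class:
  assumes p: "ppath p 0 1"
  shows "develop (path_class N p) = path_class SL2 (transport p)"
proof -
  have "(SOME q. q \<in> path_class N p) \<in> path_class N p"
    by (rule someI[of _ p]) (use p in \<open>simp add: path_class_def ppath_iff\<close>)
  then have "homotopic_paths N p (SOME q. q \<in> path_class N p)" by (simp add: path_class_def)
  then show ?thesis unfolding develop_def by (rule path_class_cong[OF transport_homotopic, symmetric])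
qed

lemma develop_in: "c \<in> ucover N a \<Longrightarrow> develop c \<in> carrier SL2_cover"
  unfolding SL2_cover_simps by (erule ucoverE) (simp add: develop_class ppath_iff transport_path path_class_in_ucover)

lemma develop_extend:
  assumes c: "c \<in> ucover N a" and q: "q \<in> paths_from N (cover_proj c)"
  shows "develop (extend N c q) = develop c \<odot> path_class SL2 (transport q)"
    and "develop (extend N c q) = extend SL2 (develop c) (\<lambda>t. cover_proj (develop c) ** transport q t)"
proof -
  obtain p where p: "c = path_class N p" "path p" "path_image p \<subseteq> N" "cover_proj c = pathfinish p"
    using ucoverE[OF c] .
  have pp: "ppath p 0 1" "ppath q 0 1" "pathfinish p = pathstart q" using p q by (auto simp: ppath_iff paths_from_def)
  have pq: "ppath (p +++ q) 0 1" using pp by (auto simp: ppath_iff intro: subset_path_image_join[THEN subsetD])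
  have tp: "path (transport p)" "path_image (transport p) \<subseteq> SL2" "pathstart (transport p) = mat 1" by (fact transport_path[OF pp(1)])+
  have tq: "path (transport q)" "path_image (transport q) \<subseteq> SL2" "pathstart (transport q) = mat 1" by (fact transport_path[OF pp(2)])+
  have d: "develop c = path_class SL2 (transport p)" unfolding p(1) by (rule develop_class[OF pp(1)])
  have pr: "cover_proj (develop c) = pathfinish (transport p)" unfolding d by (rule cover_proj_class[OF tp(1,2)])
  have "extend N c q = path_class N (p +++ q)" unfolding p(1) by (rule extend_class) (use p q in auto)
  then have e: "develop (extend N c q) = path_class SL2 (transport p +++ (\<lambda>t. pathfinish (transport p) ** transport q t))"
    using develop_class[OF pq] transport_join[OF pp] by simp
  have SL: "pathfinish (transport p) \<in> SL2" using tp pathfinish_in_path_image by blast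
  have pf: "(\<lambda>t. pathfinish (transport p) ** transport q t) \<in> paths_from SL2 (pathfinish (transport p))"
    using paths_from_mm[of "\<lambda>t. pathfinish (transport p)" "pathfinish (transport p)" "transport q" "mat 1"] tq SL
    by (simp add: paths_from_def)
  show "develop (extend N c q) = develop c \<odot> path_class SL2 (transport q)"
    unfolding e d SL2_cover_mult[OF tp(1,2) tq(1,2)]
    using path_class_cong[OF homotopic_mm_join(1)[OF tp(1,2) tq(1,2)]] tq by simp
  show "develop (extend N c q) = extend SL2 (develop c) (\<lambda>t. cover_proj (develop c) ** transport q t)"
    unfolding e pr unfolding d by (rule extend_class[OF tp(1,2) pf, symmetric])
qed

text \<open>The quasiperiodicity required in (Q): transport beyond a loop starts from the end value
  of the loop, and in the covering group this concatenation is a product.\<close>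

lemma develop_hom:
  assumes "c \<in> ucover N a" "cover_proj c = a" "d \<in> ucover N a"
  shows "develop (class_join N c d) = develop c \<odot> develop d"
proof -
  obtain q where q: "d = path_class N q" "q \<in> paths_from N a"
    using ucoverE[OF assms(3)] .
  have "ppath q 0 1" using q by (auto simp: ppath_iff paths_from_def)
  then show ?thesis using develop_extend(1)[OF assms(1), of q] q assms(2) by (simp add: extend_def develop_class)
qed

lemma develop_frame:
  assumes c: "c \<in> ucover N a" and q: "q \<in> paths_from N (cover_proj c)" and F: "Fr U h" "path_image q \<subseteq> U"
  shows "cover_proj (develop (extend N c q)) = cover_proj (develop c) ** adj2 (h (cover_proj c)) ** h (pathfinish q)"
proof -
  have pq: "ppath q 0 1" using q by (auto simp: ppath_iff paths_from_def)
  note tq = transport_path[OF pq]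
  have i: "path_class SL2 (transport q) \<in> carrier SL2_cover"
    unfolding SL2_cover_simps by (rule path_class_in_ucover) (use tq in auto)
  have s: "pathstart q = cover_proj c" using q by (simp add: paths_from_def)
  show ?thesis
    unfolding develop_extend(1)[OF c q] cover_proj_SL2(2)[OF develop_in[OF c] i] cover_proj_class[OF tq(1,2)]
    using transport_in_frame[OF pq F, of 1] s by (simp add: pathfinish_def mm_assoc)
qed

lemma develop_continuous: "continuous_map (ucover_topology N a) SL2_ucover_topology develop"
  unfolding continuous_map_ucover_iff topspace_ucover_topology
proof (intro conjI ballI allI impI)
  show "develop \<in> ucover N a \<rightarrow> ucover SL2 (mat 1)" using develop_in by (auto simp: SL2_cover_simps)
  fix c V assume c: "c \<in> ucover N a" and V: "open V" "cover_proj (develop c) \<in> V"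
  obtain U h where F: "Fr U h" "cover_proj c \<in> U" using Fr_cover cover_proj_in[OF c] by blast
  \<comment> \<open>On the frame domain this function gives the transported matrix at
    \<open>y\<close>. Paths inside its preimage of \<open>V\<close> are therefore transported by
    paths inside \<open>V\<close>.\<close>
  let ?f = "\<lambda>y. cover_proj (develop c) ** adj2 (h (cover_proj c)) ** h y"
  have "continuous_on U ?f" by (intro continuous_intros Fr_cont[OF F(1)])
  then have "openin (top_of_set U) (U \<inter> ?f -` V)" using V(1) by (rule continuous_openin_preimage_gen)
  then have "openin (top_of_set N) (U \<inter> ?f -` V)" using Fr_open[OF F(1)] openin_trans by blast
  then obtain W where W: "open W" "U \<inter> ?f -` V = N \<inter> W" by (auto simp: openin_open)
  have SLh: "h (cover_proj c) \<in> SL2" by (rule Fr_SL2[OF F])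
  have "cover_proj c \<in> U \<inter> ?f -` V" using F(2) V(2) SLh by simp
  then have cW: "cover_proj c \<in> W" unfolding W(2) by simp
  show "\<exists>Om. openin (ucover_topology N a) Om \<and> c \<in> Om \<and> develop ` Om \<subseteq> prolongations SL2 (develop c) V"
  proof (intro exI conjI)
    show "openin (ucover_topology N a) (prolongations N c W)" by (rule openin_prolongations[OF c W(1)])
    show "c \<in> prolongations N c W" by (rule prolongations_self[OF c cW])
    show "develop ` prolongations N c W \<subseteq> prolongations SL2 (develop c) V"
    proof
      fix d assume "d \<in> develop ` prolongations N c W"
      then obtain q where q: "q \<in> paths_from N (cover_proj c)" "path_image q \<subseteq> W" "d = develop (extend N c q)"
        by (auto simp: prolongations_eq)
      have pq: "ppath q 0 1" using q by (auto simp: ppath_iff paths_from_def)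
      have im: "path_image q \<subseteq> U \<inter> ?f -` V" unfolding W(2) using q by (auto simp: paths_from_def)
      let ?v = "\<lambda>t. cover_proj (develop c) ** transport q t"
      have v: "?v t = ?f (q t)" if "t \<in> {0..1}" for t
        using transport_in_frame[OF pq F(1) _ that] im q(1) by (auto simp: paths_from_def mm_assoc)
      have "?v t \<in> V" if "t \<in> {0..1}" for t
        unfolding v[OF that] using im that by (auto simp: path_image_def image_subset_iff)
      then have "path_image ?v \<subseteq> V" by (auto simp: path_image_def)
      moreover have "?v \<in> paths_from SL2 (cover_proj (develop c))"
        using paths_from_mm[of "\<lambda>t. cover_proj (develop c)" "cover_proj (develop c)" "transport q" "mat 1"]
          transport_path[OF pq] cover_proj_SL2(1)[OF develop_in[OF c]] by (simp add: paths_from_def)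
      ultimately show "d \<in> prolongations SL2 (develop c) V"
        unfolding q(3) develop_extend(2)[OF c q(1)] by (auto simp: prolongations_eq)
    qed
  qed
qed

end

section \<open>Flat forms and their local horizontal sections\<close>

context surf begin

lemma sm_at_continuous:
  assumes k: "k \<in> charts S" "q \<in> fst k" and f: "sm_at k f q"
  shows "continuous (at q within N) f"
proof -
  obtain V g where g: "snd k q \<in> V" "ext k V g f" using f by (auto simp: sm_at_def)
  let ?P = "{q' \<in> fst k. snd k q' \<in> V}"
  have P: "openin (top_of_set N) ?P" using openin_chart_preimage[OF k(1)] g by (auto simp: ext_def)
  have "continuous_on ?P (\<lambda>q'. g (snd k q'))"
    by (rule continuous_on_compose2[OF smooth_on_continuous continuous_on_subset[OF chart_continuous[OF k(1)]]])
      (use g in \<open>auto simp: ext_def\<close>)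
  then have "continuous_on ?P f" by (rule continuous_on_eq) (use g in \<open>auto simp: ext_def\<close>)
  then have c: "continuous (at q within ?P) f" using k g by (auto simp: continuous_on_eq_continuous_within)
  obtain O' where O': "open O'" "?P = N \<inter> O'" using P by (auto simp: openin_open)
  have "at q within ?P = at q within N"
    by (rule at_within_nhd[of _ O']) (use O' k g in auto)
  then show ?thesis using c by simp
qed

definition flat :: "'a form \<Rightarrow> bool" where
  "flat \<omega> \<longleftrightarrow> (\<forall>k\<in>charts S. \<forall>q\<in>fst k. curvature \<omega> k q 1 2 = 0)"

definition frame :: "'a form \<Rightarrow> 'a set \<Rightarrow> ('a \<Rightarrow> real^2^2) \<Rightarrow> bool" where
  "frame \<omega> U h \<longleftrightarrow> openin (top_of_set N) U \<and> (\<forall>q\<in>U. h q \<in> SL2) \<and>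
     (\<forall>k\<in>charts S. \<forall>q\<in>U \<inter> fst k. sm_at k h q \<and> (\<forall>i. \<omega> k q i = adj2 (h q) ** partial k i h q))"

text \<open>One chart around each point suffices, since the form and the partial derivatives of
  \<open>h\<close> change by the same Jacobian.\<close>

lemma frameI:
  assumes \<omega>: "\<omega> \<in> sl2_forms S" and U: "openin (top_of_set N) U" "\<And>q. q \<in> U \<Longrightarrow> h q \<in> SL2"
    and ex: "\<And>q. q \<in> U \<Longrightarrow> \<exists>k\<in>charts S. q \<in> fst k \<and> sm_at k h q \<and> (\<forall>i. \<omega> k q i = adj2 (h q) ** partial k i h q)"
  shows "frame \<omega> U h"
  unfolding frame_def
proof (intro conjI ballI U allI)
  fix k q assume k: "k \<in> charts S" and q: "q \<in> U \<inter> fst k"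
  then obtain k' where k': "k' \<in> charts S" "q \<in> fst k'" "sm_at k' h q" "\<And>i. \<omega> k' q i = adj2 (h q) ** partial k' i h q"
    using ex by blast
  have qk: "q \<in> fst k" using q by blast
  note cc = chart_change[OF k k'(1) qk k'(2,3)]
  show "sm_at k h q" by (rule cc(1))
  fix i show "\<omega> k q i = adj2 (h q) ** partial k i h q"
    unfolding cc(2) form_change[OF \<omega> k k'(1) qk k'(2)] k'(4) by (simp add: mm_sum_right)
qed

lemma frame_partial:
  assumes "frame \<omega> U h" "k \<in> charts S" "q \<in> U" "q \<in> fst k"
  shows "sm_at k h q" "h q \<in> SL2" "partial k i h q = h q ** \<omega> k q i" "\<omega> k q i \<in> sl2"
proof -
  show s: "sm_at k h q" and h: "h q \<in> SL2" using assms by (auto simp: frame_def)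
  have w: "\<omega> k q i = adj2 (h q) ** partial k i h q" using assms by (auto simp: frame_def)
  then show "partial k i h q = h q ** \<omega> k q i" using h by simp
  have o: "openin (top_of_set N) U" using assms by (simp add: frame_def)
  obtain V where V: "open V" "snd k q \<in> V" "\<forall>q'\<in>fst k. snd k q' \<in> V \<longrightarrow> q' \<in> U"
    using chart_nbhd[OF assms(2) o assms(4,3)] by blast
  show "\<omega> k q i \<in> sl2" unfolding w
    by (rule partial_SL2_traceless[OF chart_gchart[OF assms(2)] assms(4) s V(1,2)]) (use V assms(1) in \<open>auto simp: frame_def\<close>)
qed

lemma coord_ball:
  assumes k: "k \<in> charts S" "q \<in> fst k" and U: "openin (top_of_set N) U" "q \<in> U" and V: "open V" "snd k q \<in> V"
  obtains r where "r > 0" "ball (snd k q) r \<subseteq> V" "ball (snd k q) r \<inter> half_plane \<subseteq> snd k ` fst k"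
    "\<And>q'. q' \<in> fst k \<Longrightarrow> snd k q' \<in> ball (snd k q) r \<Longrightarrow> q' \<in> U"
proof -
  obtain V0 where V0: "open V0" "snd k q \<in> V0" "\<forall>q'\<in>fst k. snd k q' \<in> V0 \<longrightarrow> q' \<in> U"
    using chart_nbhd[OF k(1) U(1) k(2) U(2)] by blast
  obtain r0 where r0: "r0 > 0" "ball (snd k q) r0 \<inter> half_plane \<subseteq> snd k ` fst k" using half_ball[OF k] by blast
  have "open (V \<inter> V0)" "snd k q \<in> V \<inter> V0" using V V0 by auto
  then obtain r1 where r1: "r1 > 0" "ball (snd k q) r1 \<subseteq> V \<inter> V0" using open_contains_ball by blast
  show thesis
  proof (rule that[of "min r0 r1"])
    have sub: "ball (snd k q) (min r0 r1) \<subseteq> ball (snd k q) r0 \<inter> ball (snd k q) r1" by auto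
    show "ball (snd k q) (min r0 r1) \<subseteq> V" using sub r1 by blast
    show "ball (snd k q) (min r0 r1) \<inter> half_plane \<subseteq> snd k ` fst k" using sub r0 by blast
    show "q' \<in> U" if "q' \<in> fst k" "snd k q' \<in> ball (snd k q) (min r0 r1)" for q'
      using that sub r1 V0 by blast
  qed (use r0 r1 in simp)
qed

text \<open>Both sections satisfy dh = h \<omega> with a traceless form, so the derivative of h'
  h^-1 vanishes. In coordinates a half ball is convex, hence the quotient is constant on it.\<close>

lemma frame_compat:
  assumes F: "frame \<omega> U h" and F': "frame \<omega> U' h'" and x: "x \<in> U" "x \<in> U'"
  shows "\<exists>V. openin (top_of_set N) V \<and> x \<in> V \<and> V \<subseteq> U \<inter> U' \<and> (\<forall>y\<in>V. adj2 (h' x) ** h' y = adj2 (h x) ** h y)"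
proof -
  have o: "openin (top_of_set N) (U \<inter> U')" using F F' by (auto simp: frame_def)
  then have "x \<in> N" using x openin_imp_subset by blast
  then obtain k where k: "k \<in> charts S" "x \<in> fst k" using charts_cover by blast
  let ?m = "\<lambda>q. h' q ** adj2 (h q)"
  have "sm_at k ?m x" by (intro sm_at_mm sm_at_adj2 frame_partial(1)[OF F k(1) x(1) k(2)] frame_partial(1)[OF F' k(1) x(2) k(2)])
  then obtain V g where g: "snd k x \<in> V" "ext k V g ?m" by (auto simp: sm_at_def)
  have V: "open V" "smooth_on V g" using g by (auto simp: ext_def)
  obtain r where r: "r > 0" "ball (snd k x) r \<subseteq> V" "ball (snd k x) r \<inter> half_plane \<subseteq> snd k ` fst k"
    "\<And>q'. q' \<in> fst k \<Longrightarrow> snd k q' \<in> ball (snd k x) r \<Longrightarrow> q' \<in> U \<inter> U'"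
    by (rule coord_ball[OF k o _ V(1) g(1)]) (use x in auto)
  have "\<exists>c. \<forall>p\<in>ball (snd k x) r \<inter> half_plane. g p = c"
  proof (rule has_derivative_zero_constant)
    show "convex (ball (snd k x) r \<inter> half_plane)" by (intro convex_Int convex_half_plane) simp
    fix p assume p: "p \<in> ball (snd k x) r \<inter> half_plane"
    then obtain q where q: "q \<in> fst k" "p = snd k q" using r(3) by auto
    have qU: "q \<in> U" "q \<in> U'" using r(4)[of q] q p by auto
    note f = frame_partial[OF F k(1) qU(1) q(1)] and f' = frame_partial[OF F' k(1) qU(2) q(1)]
    have "partial k i ?m q = h' q ** adj2 (partial k i h q) + partial k i h' q ** adj2 (h q)" for i
      using partial_mm[OF f'(1) sm_at_adj2[OF f(1)] chart_gchart[OF k(1)] q(1)] partial_adj2[OF f(1) chart_gchart[OF k(1)] q(1)] by simp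
    then have 0: "partial k i ?m q = 0" for i
      unfolding f(3) f'(3) using f(4)[of i] by (simp add: adj2_mm adj2_traceless sl2_iff matrix_mul_assoc)
    have pV: "snd k q \<in> V" using p q r(2) by auto
    have "fderiv g p v = 0" for v
      using partial_ext_vec[OF chart_gchart[OF k(1)] g(2) q(1) pV] 0 q(2) by simp
    then have "(g has_derivative (\<lambda>v. 0)) (at p)"
      using ext_derivative[OF g(2) pV] q(2) by (metis ext)
    then show "(g has_derivative (\<lambda>h. 0)) (at p within ball (snd k x) r \<inter> half_plane)" by (rule has_derivative_at_withinI)
  qed
  then obtain c where c: "\<And>p. p \<in> ball (snd k x) r \<inter> half_plane \<Longrightarrow> g p = c" by blast
  have hp: "snd k q \<in> half_plane" if "q \<in> fst k" for q
    using chart_gchart[OF k(1)] that openin_subset[of "top_of_set half_plane" "snd k ` fst k"] by (auto simp: gchart_def)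
  have m: "?m q = c" if "q \<in> fst k" "snd k q \<in> ball (snd k x) r" for q
    using c[of "snd k q"] hp[OF that(1)] that g(2) r(2) by (auto simp: ext_def)
  show ?thesis
  proof (intro exI[of _ "{q \<in> fst k. snd k q \<in> ball (snd k x) r}"] conjI ballI)
    show "openin (top_of_set N) {q \<in> fst k. snd k q \<in> ball (snd k x) r}" by (rule openin_chart_preimage[OF k(1)]) simp
    fix y assume y: "y \<in> {q \<in> fst k. snd k q \<in> ball (snd k x) r}"
    have yU: "y \<in> U" "y \<in> U'" using r(4)[of y] y by auto
    have SL: "h x \<in> SL2" "h' x \<in> SL2" "h y \<in> SL2" "h' y \<in> SL2" using F F' x yU by (auto simp: frame_def)
    have e: "h' y ** adj2 (h y) = h' x ** adj2 (h x)" using m[of x] m[of y] y k r(1) by simp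
    have "adj2 (h' x) ** (h' y ** adj2 (h y)) ** h y = adj2 (h' x) ** (h' x ** adj2 (h x)) ** h y" unfolding e ..
    then show "adj2 (h' x) ** h' y = adj2 (h x) ** h y" using SL by (simp add: mm_assoc)
  qed (use k r in auto)
qed

text \<open>For \<omega> = h^-1 dh the second derivatives of \<open>h\<close> cancel by symmetry,
  and the derivative of h^-1 contributes the negative of the commutator term.\<close>

lemma frame_curvature:
  assumes F: "frame \<omega> U h" and k: "k \<in> charts S" "q \<in> fst k" and q: "q \<in> U"
  shows "curvature \<omega> k q 1 2 = 0"
proof -
  have o: "openin (top_of_set N) U" using F by (auto simp: frame_def)
  have gk: "gchart k" by (rule chart_gchart[OF k(1)])
  obtain V u where u: "snd k q \<in> V" "ext k V u h" using frame_partial(1)[OF F k(1) q k(2)] by (auto simp: sm_at_def)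
  have V: "open V" "smooth_on V u" using u by (auto simp: ext_def)
  obtain V0 where V0: "open V0" "snd k q \<in> V0" "\<forall>q'\<in>fst k. snd k q' \<in> V0 \<longrightarrow> q' \<in> U"
    using chart_nbhd[OF k(1) o k(2) q] by blast
  define W where "W = V \<inter> V0"
  have W: "open W" "snd k q \<in> W" "smooth_on W u" using V V0 u smooth_on_subset[OF V(2), of W] by (auto simp: W_def)
  let ?D = "\<lambda>i p. fderiv u p (axis i 1)"
  have e: "ext k W (\<lambda>p. adj2 (u p) ** ?D i p) (\<lambda>q. \<omega> k q i)" for i
    unfolding ext_def
  proof (intro conjI W ballI impI smooth_on_mm smooth_on_adj2 smooth_on_frechet_derivative)
    fix q' assume q': "q' \<in> fst k" "snd k q' \<in> W"
    then have "q' \<in> U" "snd k q' \<in> V" using V0 by (auto simp: W_def)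
    then show "\<omega> k q' i = adj2 (u (snd k q')) ** ?D i (snd k q')"
      using F k(1) q'(1) partial_ext[OF gk u(2) q'(1)] u(2) by (auto simp: frame_def ext_def)
  qed
  let ?p = "snd k q"
  have d: "((\<lambda>p. adj2 (u p) ** ?D i p) has_derivative
      (\<lambda>v. adj2 (u ?p) ** fderiv (?D i) (?p) v + adj2 (fderiv u (?p) v) ** ?D i ?p)) (at ?p)" for i
    by (intro bounded_bilinear.FDERIV[OF bilinear_mm] bounded_linear.has_derivative[OF bounded_linear_adj2]
        smooth_on_has_derivative[OF W(3,2)] smooth_on_has_derivative[OF smooth_on_frechet_derivative[OF W(3)] W(2)])
  have sym: "fderiv (?D 2) (?p) (axis 1 1) = fderiv (?D 1) (?p) (axis 2 1)"
    by (rule second_derivative_symmetric[OF W(3,1,2)])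
  note f = frame_partial[OF F k(1) q k(2)]
  have D: "?D i ?p = h q ** \<omega> k q i" for i using partial_ext[OF gk u(2) k(2) u(1)] f(3) by simp
  have A: "adj2 (h q ** \<omega> k q i) ** (h q ** \<omega> k q j) = - (\<omega> k q i ** \<omega> k q j)" for i j
    using f(2) f(4)[of i] by (simp add: adj2_mm adj2_traceless sl2_iff mm_assoc)
  show ?thesis
    unfolding curvature_def partial_eqI[OF gk e k(2) W(2) d] sym D A by simp
qed

text \<open>Radial transport, centred at the given point, of a smooth extension of the form. The
  extension need not be flat outside the half plane, but rays from the centre to points of the half
  ball remain in the half plane by convexity.\<close>

lemma frame_exists:
  assumes \<omega>: "\<omega> \<in> sl2_forms S" and fl: "flat \<omega>" and q: "q \<in> N"
  shows "\<exists>U h. frame \<omega> U h \<and> q \<in> U"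
proof -
  obtain k where k: "k \<in> charts S" "q \<in> fst k" using charts_cover[OF q] by blast
  have gk: "gchart k" by (rule chart_gchart[OF k(1)])
  let ?p = "snd k q"
  \<comment> \<open>Projection to the traceless matrices. It leaves the form unchanged and makes its
    extension traceless beyond the half plane too, as the transport equation requires.\<close>
  define P where "P = (\<lambda>B::real^2^2. B - (trace B / 2) *\<^sub>R mat 1)"
  have P: "bounded_linear P" unfolding P_def linear_conv_bounded_linear[symmetric]
    by (rule linearI) (simp_all add: trace_add trace_scaleR algebra_simps add_divide_distrib)
  have P2: "trace (P B) = 0" "B \<in> sl2 \<Longrightarrow> P B = B" for B
    by (simp_all add: P_def trace_sub trace_scaleR trace_I sl2_iff)
  have "\<exists>V u. ?p \<in> V \<and> ext k V u (\<lambda>q. \<omega> k q i)" for i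
    using form_smooth[OF \<omega> k] by (auto simp: sm_at_def)
  then obtain V u where u: "\<And>i. ?p \<in> V i" "\<And>i. ext k (V i) (u i) (\<lambda>q. \<omega> k q i)" by metis
  define W where "W = V 1 \<inter> V 2"
  have WV: "W \<subseteq> V i" for i using exhaust_2[of i] by (auto simp: W_def)
  have W: "open W" "?p \<in> W" using u by (auto simp: W_def ext_def)
  have su: "smooth_on W (\<lambda>p. P (u i p))" for i
    by (intro smooth_on_linear_comp[OF P W(1)] smooth_on_subset[OF _ WV]) (use u(2)[of i] in \<open>auto simp: ext_def\<close>)
  have eu: "ext k W (\<lambda>p. P (u i p)) (\<lambda>q. \<omega> k q i)" for i
    unfolding ext_def
  proof (intro conjI W su ballI impI)
    fix q' assume q': "q' \<in> fst k" "snd k q' \<in> W"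
    then have "\<omega> k q' i = u i (snd k q')" using u(2)[of i] WV[of i] by (auto simp: ext_def)
    then show "\<omega> k q' i = P (u i (snd k q'))" using P2(2)[OF form_sl2[OF \<omega> k(1) q'(1), of i]] by simp
  qed
  define a where "a = (\<lambda>i p. P (u i (?p + p)))"
  define U0 where "U0 = (\<lambda>p. ?p + p) -` W"
  have U0: "open U0" "0 \<in> U0" using W unfolding U0_def by (auto intro!: open_vimage continuous_intros)
  have sp: "smooth_on U0 (\<lambda>p. ?p + p)" by (intro smooth_on_add smooth_on_const smooth_on_bounded_linear U0) auto
  have sa: "smooth_on U0 (a i)" for i unfolding a_def
    by (rule smooth_on_compose[OF U0(1) W(1) _ su sp]) (auto simp: U0_def)
  have NN: "openin (top_of_set N) N" "q \<in> N" using q by auto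
  obtain r1 where r1: "r1 > 0" "ball ?p r1 \<subseteq> W" "ball ?p r1 \<inter> half_plane \<subseteq> snd k ` fst k"
    by (rule coord_ball[OF k NN W])
  obtain r0 where r0: "r0 > 0" "cball 0 r0 \<subseteq> U0" using U0 open_contains_cball by blast
  have "\<exists>M. \<forall>p\<in>cball 0 r0. norm (a i p) \<le> M" for i
    using compact_imp_bounded[OF compact_continuous_image[OF continuous_on_subset[OF smooth_on_continuous[OF sa] r0(2)] compact_cball], of i]
    by (auto simp: bounded_iff)
  then obtain M where M: "\<And>i p. p \<in> cball 0 r0 \<Longrightarrow> norm (a i p) \<le> M i" by metis
  define M' where "M' = \<bar>M 1\<bar> + \<bar>M 2\<bar> + 1"
  have M': "norm (a i p) \<le> M'" if "p \<in> cball 0 r0" for i p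
    using M[OF that, of i] exhaust_2[of i] unfolding M'_def by (auto intro: order_trans)
  have M'0: "M' > 0" by (simp add: M'_def)
  obtain K where K: "\<And>(X::real^2^2) (Y::real^2^2). norm (X ** Y) \<le> norm X * norm Y * K" "K > 0"
    using bounded_bilinear.pos_bounded[OF bilinear_mm] by blast
  \<comment> \<open>Small enough to remain in the ball where the extension is bounded by
    \<open>M'\<close> and within the image of the chart. Two components and the matrix product give
    the factor \<open>2 * r * M' * K\<close>, which the last bound makes at most 1/2.\<close>
  define r where "r = min (min (r0 / 2) (r1 / 2)) (1 / (4 * M' * K))"
  have r: "r > 0" "r < r0" "r < r1" "r \<le> 1 / (4 * M' * K)" using r0 r1 K M'0 unfolding r_def by auto
  have r4: "r * (4 * M' * K) \<le> 1" using r(4) K M'0 by (simp add: pos_le_divide_eq)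
  have rt: "ray_transport a U0 r"
  proof
    show "cball 0 r \<subseteq> U0" using r0 r by (meson cball_subset_cball_iff less_imp_le order_trans subset_cball)
    show "trace (a i p) = 0" for i p by (simp add: a_def P2)
    fix X :: "real^2^2" and p s :: "real^2" assume ps: "p \<in> cball 0 r" "s \<in> cball 0 r"
    have pr: "p \<in> cball 0 r0" using ps r by auto
    have "norm (\<Sum>i\<in>UNIV. s $ i *\<^sub>R a i p) \<le> (\<Sum>i\<in>(UNIV::2 set). r * M')"
    proof (rule order_trans[OF norm_sum sum_mono])
      fix i :: 2
      have "\<bar>s $ i\<bar> \<le> r" using component_le_norm_cart[of s i] ps by simp
      then show "norm (s $ i *\<^sub>R a i p) \<le> r * M'" using M'[OF pr, of i] r by (simp add: mult_mono)
    qed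
    then have "norm (X ** (\<Sum>i\<in>UNIV. s $ i *\<^sub>R a i p)) \<le> norm X * (2 * (r * M')) * K"
      by (intro order_trans[OF K(1)] mult_right_mono mult_left_mono) (use K in auto)
    also have "\<dots> = norm X * (r * (4 * M' * K)) / 2" by simp
    also have "\<dots> \<le> norm X / 2" by (intro divide_right_mono order_trans[OF mult_left_mono[OF r4]]) auto
    finally show "norm (X ** (\<Sum>i\<in>UNIV. s $ i *\<^sub>R a i p)) \<le> norm X / 2" .
  qed (use U0 r sa in auto)
  interpret R: ray_transport a U0 r by (rule rt)
  define h where "h = (\<lambda>q'. R.H (snd k q' - ?p))"
  define U where "U = {q' \<in> fst k. snd k q' \<in> ball ?p r}"
  have oU: "openin (top_of_set N) U" unfolding U_def by (rule openin_chart_preimage[OF k(1)]) simp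
  have inb: "p - ?p \<in> ball 0 r \<longleftrightarrow> p \<in> ball ?p r" for p by (simp add: dist_norm norm_minus_commute)
  have eh: "ext k (ball ?p r) (\<lambda>p. R.H (p - ?p)) h"
    unfolding ext_def
  proof (intro conjI)
    have "smooth_on (ball ?p r) (\<lambda>p. p - ?p)"
      by (intro smooth_on_diff smooth_on_const smooth_on_bounded_linear) auto
    then show "smooth_on (ball ?p r) (\<lambda>p. R.H (p - ?p))"
      by (intro smooth_on_compose[OF open_ball open_ball[of 0 r] _ R.smooth_H]) (use inb in blast)
  qed (auto simp: h_def)
  have hp: "snd k q' \<in> half_plane" if "q' \<in> fst k" for q'
    using gk that openin_subset[of "top_of_set half_plane" "snd k ` fst k"] by (auto simp: gchart_def)
  have aw: "a i (snd k q' - ?p) = \<omega> k q' i" if "q' \<in> fst k" "snd k q' \<in> W" for q' i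
    using eu[of i] that by (auto simp: ext_def a_def)
  have Da: "R.Da i (snd k q' - ?p) (axis j 1) = partial k j (\<lambda>q. \<omega> k q i) q'" if q': "q' \<in> fst k" "snd k q' \<in> W" for q' i j
  proof -
    have "((\<lambda>p. P (u i p)) has_derivative fderiv (\<lambda>p. P (u i p)) (snd k q')) (at (?p + (snd k q' - ?p)))"
      using ext_derivative[OF eu q'(2)] by simp
    then have "(a i has_derivative fderiv (\<lambda>p. P (u i p)) (snd k q')) (at (snd k q' - ?p))"
      unfolding a_def
      using has_derivative_compose[of "\<lambda>p. ?p + p" "\<lambda>v. v" "snd k q' - ?p" UNIV "\<lambda>p. P (u i p)"]
        has_derivative_add[OF has_derivative_const has_derivative_ident, of ?p "at (snd k q' - ?p)"] by simp
    then have "R.Da i (snd k q' - ?p) = fderiv (\<lambda>p. P (u i p)) (snd k q')"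
      unfolding R.Da_def using frechet_derivative_at by metis
    then show ?thesis using partial_ext[OF gk eu q'] by simp
  qed
  have "frame \<omega> U h"
  proof (rule frameI[OF \<omega> oU])
    fix q' assume q': "q' \<in> U"
    then have q2: "q' \<in> fst k" "snd k q' \<in> ball ?p r" by (auto simp: U_def)
    have pb: "snd k q' - ?p \<in> ball 0 r" using inb q2 by blast
    then show "h q' \<in> SL2" unfolding h_def by (intro R.H_SL2) auto
    have "((\<lambda>p. R.H (p - ?p)) has_derivative frechet_derivative R.H (at (snd k q' - ?p))) (at (snd k q'))"
      using has_derivative_compose[of "\<lambda>p. p - ?p" "\<lambda>v. v" "snd k q'" UNIV R.H] smooth_on_has_derivative[OF R.smooth_H pb]
        has_derivative_diff[OF has_derivative_ident has_derivative_const, of ?p "at (snd k q')"] by simp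
    from partial_eqI[OF gk eh q2 this]
    have 1: "partial k i h q' = frechet_derivative R.H (at (snd k q' - ?p)) (axis i 1)" for i .
    have 2: "frechet_derivative R.H (at (snd k q' - ?p)) v = h q' ** R.A (snd k q' - ?p) v" for v
      unfolding h_def
    proof (rule R.H_derivative_flat[OF pb])
      fix t :: real assume t: "t \<in> {0..1}"
      let ?z = "?p + t *\<^sub>R (snd k q' - ?p)"
      have "?z = (1 - t) *\<^sub>R ?p + t *\<^sub>R snd k q'" by (simp add: algebra_simps)
      then have zh: "?z \<in> half_plane" using convexD_alt[OF convex_half_plane hp[OF k(2)] hp[OF q2(1)], of t] t by auto
      have "norm (t *\<^sub>R (snd k q' - ?p)) \<le> norm (snd k q' - ?p)" using t by (simp add: mult_left_le_one_le)
      also have "\<dots> < r" using pb by simp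
      finally have zb: "?z \<in> ball ?p r1" using r by (simp add: dist_norm)
      then obtain y where y: "y \<in> fst k" "?z = snd k y" using r1(3) zh by auto
      have yW: "snd k y \<in> W" using zb r1(2) y by auto
      have ty: "t *\<^sub>R (snd k q' - ?p) = snd k y - ?p" using y(2) by (simp add: algebra_simps)
      show "R.Da 2 (t *\<^sub>R (snd k q' - ?p)) (axis 1 1) - R.Da 1 (t *\<^sub>R (snd k q' - ?p)) (axis 2 1) +
        (a 1 (t *\<^sub>R (snd k q' - ?p)) ** a 2 (t *\<^sub>R (snd k q' - ?p)) - a 2 (t *\<^sub>R (snd k q' - ?p)) ** a 1 (t *\<^sub>R (snd k q' - ?p))) = 0"
        unfolding ty Da[OF y(1) yW] aw[OF y(1) yW] using fl k(1) y(1) by (simp add: flat_def curvature_def)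
    qed
    have W': "snd k q' \<in> W" using q2(2) r r1(2) by auto
    have "R.A (snd k q' - ?p) (axis i 1) = \<omega> k q' i" for i
      unfolding R.A_def aw[OF q2(1) W'] using exhaust_2[of i] by (auto simp: sum_2 axis_def)
    then have 3: "partial k i h q' = h q' ** \<omega> k q' i" for i using 1 2 by simp
    show "\<exists>k\<in>charts S. q' \<in> fst k \<and> sm_at k h q' \<and> (\<forall>i. \<omega> k q' i = adj2 (h q') ** partial k i h q')"
      using k(1) q2 \<open>h q' \<in> SL2\<close> sm_atI[OF q2(2) eh] 3 by (intro bexI[of _ k]) auto
  qed
  moreover have "q \<in> U" using k r by (simp add: U_def)
  ultimately show ?thesis by blast
qed

lemma frames_locale:
  assumes "\<omega> \<in> sl2_forms S" "flat \<omega>"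
  shows "frames N (frame \<omega>)"
proof
  fix U h assume F: "frame \<omega> U h"
  show "openin (top_of_set N) U" using F by (simp add: frame_def)
  show "continuous_on U h" unfolding continuous_on_eq_continuous_within
  proof
    fix q assume q: "q \<in> U"
    have UN: "U \<subseteq> N" using F openin_subset[of "top_of_set N" U] by (simp add: frame_def)
    then obtain k where k: "k \<in> charts S" "q \<in> fst k" using charts_cover q by blast
    show "continuous (at q within U) h"
      by (rule continuous_within_subset[OF sm_at_continuous[OF k frame_partial(1)[OF F k(1) q k(2)]] UN])
  qed
next
  fix U h U' h' x assume "frame \<omega> U h" "frame \<omega> U' h'" "x \<in> U" "x \<in> U'"
  then show "\<exists>V. openin (top_of_set N) V \<and> x \<in> V \<and> V \<subseteq> U \<inter> U' \<and> (\<forall>y\<in>V. adj2 (h' x) ** h' y = adj2 (h x) ** h y)"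
    by (rule frame_compat)
qed (use frame_exists[OF assms] in \<open>auto simp: frame_def\<close>)

end

context surf begin

subsection \<open>Sheets of the universal cover\<close>

abbreviation kball :: "'a chart \<Rightarrow> real^2 \<Rightarrow> real \<Rightarrow> 'a set" where
  "kball k p r \<equiv> {q' \<in> fst k. snd k q' \<in> ball p r}"

lemma kball_openin: "k \<in> charts S \<Longrightarrow> openin (top_of_set N) (kball k p r)"
  by (rule openin_chart_preimage) auto

lemma chart_half_plane: "k \<in> charts S \<Longrightarrow> q \<in> fst k \<Longrightarrow> snd k q \<in> half_plane"
  using chart_gchart[of k] openin_subset[of "top_of_set half_plane" "snd k ` fst k"] by (auto simp: gchart_def)

lemma kball_inv:
  assumes k: "k \<in> charts S" and r: "ball p r \<inter> half_plane \<subseteq> snd k ` fst k"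
  shows "continuous_on (ball p r \<inter> half_plane) (inv_into (fst k) (snd k))"
    "\<And>x. x \<in> ball p r \<inter> half_plane \<Longrightarrow> inv_into (fst k) (snd k) x \<in> kball k p r"
    "\<And>q. q \<in> fst k \<Longrightarrow> inv_into (fst k) (snd k) (snd k q) = q"
proof -
  show "continuous_on (ball p r \<inter> half_plane) (inv_into (fst k) (snd k))"
    by (rule continuous_on_subset[OF chart_inv_continuous[OF k] r])
  show "inv_into (fst k) (snd k) x \<in> kball k p r" if x: "x \<in> ball p r \<inter> half_plane" for x
  proof -
    have "x \<in> snd k ` fst k" using x r by blast
    then show ?thesis using x by (simp add: inv_into_into f_inv_into_f)
  qed
qed (use chart_inj[OF k] in simp)

lemma convex_half_ball: "convex (ball p r \<inter> half_plane)"
  by (intro convex_Int convex_half_plane) simp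

lemma kball_path:
  assumes k: "k \<in> charts S" and r: "ball p r \<inter> half_plane \<subseteq> snd k ` fst k"
    and x: "x \<in> kball k p r" and y: "y \<in> kball k p r"
  shows "\<exists>q\<in>paths_from N x. path_image q \<subseteq> kball k p r \<and> pathfinish q = y"
proof -
  let ?i = "inv_into (fst k) (snd k)"
  let ?l = "linepath (snd k x) (snd k y)"
  note i = kball_inv[OF k r]
  have im: "path_image ?l \<subseteq> ball p r \<inter> half_plane"
    using closed_segment_subset[OF _ _ convex_half_ball, of "snd k x" p r "snd k y"] x y chart_half_plane[OF k] by auto
  have 1: "path (?i \<circ> ?l)"
    by (rule path_continuous_image) (use continuous_on_subset[OF i(1) im] in auto)
  have 2: "path_image (?i \<circ> ?l) \<subseteq> kball k p r" unfolding path_image_compose using im i(2) by blast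
  have 3: "pathstart (?i \<circ> ?l) = x" "pathfinish (?i \<circ> ?l) = y"
    using i(3) x y by (simp_all add: pathstart_compose pathfinish_compose)
  have "kball k p r \<subseteq> N" using kball_openin[OF k] openin_imp_subset by blast
  then show ?thesis using 1 2 3 by (intro bexI[of _ "?i \<circ> ?l"]) (auto simp: paths_from_def)
qed

text \<open>In coordinates a half ball is convex, so the straight line homotopy is available there.
  This is what makes the projection injective on small sets of prolongations.\<close>

lemma kball_homotopic:
  assumes k: "k \<in> charts S" and r: "ball p r \<inter> half_plane \<subseteq> snd k ` fst k"
    and q: "path q" "path_image q \<subseteq> kball k p r" and q': "path q'" "path_image q' \<subseteq> kball k p r"
    and ends: "pathstart q' = pathstart q" "pathfinish q' = pathfinish q"
  shows "homotopic_paths N q q'"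
proof -
  let ?i = "inv_into (fst k) (snd k)"
  let ?D = "ball p r \<inter> half_plane"
  note i = kball_inv[OF k r]
  have pc: "path (snd k \<circ> q)" "path_image (snd k \<circ> q) \<subseteq> ?D" if "path q" "path_image q \<subseteq> kball k p r" for q
  proof -
    show "path (snd k \<circ> q)"
      by (rule path_continuous_image[OF that(1) continuous_on_subset[OF chart_continuous[OF k]]]) (use that in auto)
    show "path_image (snd k \<circ> q) \<subseteq> ?D" unfolding path_image_compose using that chart_half_plane[OF k] by auto
  qed
  have "homotopic_paths ?D (snd k \<circ> q) (snd k \<circ> q')"
  proof (rule homotopic_paths_linear)
    fix t :: real assume "t \<in> {0..1}"
    then have "(snd k \<circ> q) t \<in> ?D" "(snd k \<circ> q') t \<in> ?D"
      using pc(2)[OF q] pc(2)[OF q'] unfolding path_image_def by blast+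
    then show "closed_segment ((snd k \<circ> q) t) ((snd k \<circ> q') t) \<subseteq> ?D" using convex_half_ball by (rule closed_segment_subset)
  qed (use pc q q' ends in \<open>auto simp: pathstart_compose pathfinish_compose\<close>)
  then have h: "homotopic_paths (kball k p r) (?i \<circ> (snd k \<circ> q)) (?i \<circ> (snd k \<circ> q'))"
    by (rule homotopic_paths_continuous_image[OF _ i(1)]) (use i(2) in auto)
  have e: "homotopic_paths (kball k p r) q (?i \<circ> (snd k \<circ> q))" if "path q" "path_image q \<subseteq> kball k p r" for q
  proof (rule homotopic_paths_eq[OF that])
    fix t :: real assume "t \<in> {0..1}"
    then have "q t \<in> fst k" using that(2) unfolding path_image_def by blast
    then show "q t = (?i \<circ> (snd k \<circ> q)) t" using i(3) by simp
  qed
  have "homotopic_paths (kball k p r) q q'"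
    using homotopic_paths_trans[OF e[OF q] homotopic_paths_trans[OF h homotopic_paths_sym[OF e[OF q']]]] .
  then show ?thesis by (rule homotopic_paths_subset) (use kball_openin[OF k] openin_imp_subset in blast)
qed

text \<open>The covering manifold consists of classes of paths, so its projection being onto is path
  connectedness. This follows from connectedness because points of a coordinate half ball can be
  joined.\<close>

lemma class_over:
  assumes "q \<in> N"
  shows "\<exists>c\<in>ucover N xbar. cover_proj c = q"
proof (rule connected_induction_simple[OF connected xbar assms])
  show "\<exists>c\<in>ucover N xbar. cover_proj c = xbar"
    using xbar by (intro bexI[of _ "path_class N (\<lambda>t. xbar)"]) (auto simp: cover_proj_class intro!: path_class_in_ucover)
  fix a assume a: "a \<in> N"
  then obtain k where k: "k \<in> charts S" "a \<in> fst k" using charts_cover by blast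
  obtain r where r: "r > 0" "ball (snd k a) r \<inter> half_plane \<subseteq> snd k ` fst k" using half_ball[OF k] by blast
  show "\<exists>T. openin (top_of_set N) T \<and> a \<in> T \<and>
    (\<forall>x\<in>T. \<forall>y\<in>T. (\<exists>c\<in>ucover N xbar. cover_proj c = x) \<longrightarrow> (\<exists>c\<in>ucover N xbar. cover_proj c = y))"
  proof (intro exI[of _ "kball k (snd k a) r"] conjI ballI impI kball_openin[OF k(1)])
    fix x y assume xy: "x \<in> kball k (snd k a) r" "y \<in> kball k (snd k a) r" and "\<exists>c\<in>ucover N xbar. cover_proj c = x"
    then obtain c where c: "c \<in> ucover N xbar" "cover_proj c = x" by blast
    obtain q where q: "q \<in> paths_from N x" "pathfinish q = y" using kball_path[OF k(1) r(2) xy] by blast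
    show "\<exists>c\<in>ucover N xbar. cover_proj c = y"
      using extend_in[OF c(1), of q] q c by (intro bexI[of _ "extend N c q"]) auto
  qed (use k r in auto)
qed

text \<open>The prolongations of \<open>c\<close> inside a half ball form the sheet; two of them
  with the same end point agree because the half ball is simply connected.\<close>

lemma sheet_exists:
  assumes c: "c \<in> ucover N xbar" and k: "k \<in> charts S" "cover_proj c \<in> fst k"
  shows "\<exists>W. sheet_over N xbar (fst k) W \<and> c \<in> W"
proof -
  obtain r where r: "r > 0" "ball (snd k (cover_proj c)) r \<inter> half_plane \<subseteq> snd k ` fst k" using half_ball[OF k] by blast
  let ?B = "kball k (snd k (cover_proj c)) r"
  obtain T where T: "open T" "?B = N \<inter> T"
    using kball_openin[OF k(1), of "snd k (cover_proj c)" r] unfolding openin_open by blast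
  have cT: "cover_proj c \<in> T" using T k r chart_subset[OF k(1)] by auto
  let ?W = "prolongations N c T"
  have rep: "\<exists>q. q \<in> paths_from N (cover_proj c) \<and> path_image q \<subseteq> ?B \<and> d = extend N c q \<and> cover_proj d = pathfinish q" if "d \<in> ?W" for d
    using that extend_in(2)[OF c] unfolding prolongations_eq T(2) by (auto simp: paths_from_def)
  have "inj_on cover_proj ?W"
  proof (rule inj_onI)
    fix d d' assume d: "d \<in> ?W" "d' \<in> ?W" "cover_proj d = cover_proj d'"
    obtain q where q: "q \<in> paths_from N (cover_proj c)" "path_image q \<subseteq> ?B" "d = extend N c q" "cover_proj d = pathfinish q"
      using rep[OF d(1)] by blast
    obtain q' where q': "q' \<in> paths_from N (cover_proj c)" "path_image q' \<subseteq> ?B" "d' = extend N c q'" "cover_proj d' = pathfinish q'"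
      using rep[OF d(2)] by blast
    have "homotopic_paths N q q'"
      by (rule kball_homotopic[OF k(1) r(2)]) (use q q' d(3) in \<open>auto simp: paths_from_def\<close>)
    then show "d = d'" unfolding q(3) q'(3) extend_def by (simp add: path_class_cong)
  qed
  moreover have "cover_proj ` ?W \<subseteq> fst k"
  proof
    fix x assume "x \<in> cover_proj ` ?W"
    then obtain d where "d \<in> ?W" "x = cover_proj d" by blast
    then show "x \<in> fst k" using rep[of d] pathfinish_in_path_image by fastforce
  qed
  ultimately have "sheet_over N xbar (fst k) ?W" unfolding sheet_over_def using openin_prolongations[OF c T(1)] by blast
  then show ?thesis using prolongations_self[OF c cT] by blast
qed

lemma sheetD:
  assumes "sheet_over N xbar (fst k) W" "c \<in> W"
  shows "c \<in> ucover N xbar" "cover_proj c \<in> fst k" "inj_on cover_proj W"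
  using assms unfolding sheet_over_def openin_ucover_topology by auto

text \<open>Sheets are given abstractly as open sets with injective projection. Near
  \<open>c\<close> their classes are nevertheless prolongations of \<open>c\<close> by short paths,
  and in this form they meet parallel transport.\<close>

lemma sheet_local:
  assumes k: "k \<in> charts S" and W: "sheet_over N xbar (fst k) W" and c: "c \<in> W"
    and Om: "openin (top_of_set N) Om" "cover_proj c \<in> Om" and V: "open V" "snd k (cover_proj c) \<in> V"
  obtains r where "r > 0" "ball (snd k (cover_proj c)) r \<subseteq> V" "ball (snd k (cover_proj c)) r \<inter> half_plane \<subseteq> snd k ` fst k"
    "kball k (snd k (cover_proj c)) r \<subseteq> Om"
    "\<And>c'. c' \<in> W \<Longrightarrow> snd k (cover_proj c') \<in> ball (snd k (cover_proj c)) r \<Longrightarrow>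
       \<exists>q\<in>paths_from N (cover_proj c). path_image q \<subseteq> kball k (snd k (cover_proj c)) r \<and> c' = extend N c q \<and> pathfinish q = cover_proj c'"
    "kball k (snd k (cover_proj c)) r \<subseteq> cover_proj ` W"
proof -
  note s = sheetD[OF W c]
  obtain T where T: "open T" "cover_proj c \<in> T" "prolongations N c T \<subseteq> W"
    using W c unfolding sheet_over_def openin_ucover_topology by blast
  have o: "openin (top_of_set N) (Om \<inter> T)" using Om T(1) by (simp add: openin_Int_open)
  obtain r where r: "r > 0" "ball (snd k (cover_proj c)) r \<subseteq> V" "ball (snd k (cover_proj c)) r \<inter> half_plane \<subseteq> snd k ` fst k"
    "\<And>q'. q' \<in> fst k \<Longrightarrow> snd k q' \<in> ball (snd k (cover_proj c)) r \<Longrightarrow> q' \<in> Om \<inter> T"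
    by (rule coord_ball[OF k s(2) o _ V]) (use Om T in auto)
  let ?B = "kball k (snd k (cover_proj c)) r"
  have cB: "cover_proj c \<in> ?B" using s r by auto
  have BT: "?B \<subseteq> T" using r(4) by blast
  have pt: "\<exists>q\<in>paths_from N (cover_proj c). path_image q \<subseteq> ?B \<and> extend N c q \<in> W \<and> cover_proj (extend N c q) = y \<and> pathfinish q = y" if y: "y \<in> ?B" for y
  proof -
    obtain q where q: "q \<in> paths_from N (cover_proj c)" "path_image q \<subseteq> ?B" "pathfinish q = y"
      using kball_path[OF k r(3) cB y] by blast
    have "path_image q \<subseteq> T" using q(2) BT by (rule order_trans)
    then have "extend N c q \<in> prolongations N c T" using q(1) by (auto simp: prolongations_eq)
    then show ?thesis using q T(3) extend_in(2)[OF s(1) q(1)] by blast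
  qed
  show thesis
  proof (rule that[OF r(1-3)])
    show "?B \<subseteq> Om" using r(4) by blast
    show "?B \<subseteq> cover_proj ` W" using pt by (metis (no_types, lifting) imageI subsetI)
    fix c' assume c': "c' \<in> W" "snd k (cover_proj c') \<in> ball (snd k (cover_proj c)) r"
    then have "cover_proj c' \<in> ?B" using sheetD(2)[OF W] by simp
    then obtain q where q: "q \<in> paths_from N (cover_proj c)" "path_image q \<subseteq> ?B" "extend N c q \<in> W" "cover_proj (extend N c q) = cover_proj c'" "pathfinish q = cover_proj c'"
      using pt by blast
    then have "c' = extend N c q" using s(3) c' by (metis inj_onD)
    then show "\<exists>q\<in>paths_from N (cover_proj c). path_image q \<subseteq> ?B \<and> c' = extend N c q \<and> pathfinish q = cover_proj c'" using q by blast
  qed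
qed

lemma lift_simps [simp]: "fst (lift_chart k W) = W" "snd (lift_chart k W) c = snd k (cover_proj c)"
  by (simp_all add: lift_chart_def)

lemma sheet_proj_open:
  assumes k: "k \<in> charts S" and W: "sheet_over N xbar (fst k) W"
  shows "openin (top_of_set N) (cover_proj ` W)"
proof (subst openin_subopen, intro ballI)
  fix x assume "x \<in> cover_proj ` W"
  then obtain c where c: "c \<in> W" "x = cover_proj c" by blast
  have NN: "openin (top_of_set N) N" "cover_proj c \<in> N" using sheetD(2)[OF W c(1)] chart_subset[OF k] by auto
  obtain r where r: "r > 0" "kball k (snd k (cover_proj c)) r \<subseteq> cover_proj ` W"
    by (rule sheet_local[OF k W c(1) NN open_UNIV UNIV_I])
  then show "\<exists>T. openin (top_of_set N) T \<and> x \<in> T \<and> T \<subseteq> cover_proj ` W"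
    using kball_openin[OF k, of "snd k (cover_proj c)" r] sheetD(2)[OF W c(1)] c(2)
    by (intro exI[of _ "kball k (snd k (cover_proj c)) r"]) auto
qed

lemma lift_gchart:
  assumes k: "k \<in> charts S" and W: "sheet_over N xbar (fst k) W"
  shows "gchart (lift_chart k W)"
  unfolding gchart_def
proof
  have sub: "cover_proj ` W \<subseteq> fst k" using W by (simp add: sheet_over_def)
  have "inj_on (snd k) (cover_proj ` W)" using chart_inj[OF k] sub by (rule inj_on_subset)
  then show "inj_on (snd (lift_chart k W)) (fst (lift_chart k W))"
    using W by (auto simp: lift_chart_def sheet_over_def intro!: comp_inj_on)
  show "hopen (snd (lift_chart k W) ` fst (lift_chart k W))"
  proof (subst openin_subopen, intro ballI)
    fix x assume "x \<in> snd (lift_chart k W) ` fst (lift_chart k W)"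
    then obtain c where c: "c \<in> W" "x = snd k (cover_proj c)" by auto
    have NN: "openin (top_of_set N) N" "cover_proj c \<in> N" using sheetD(2)[OF W c(1)] chart_subset[OF k] by auto
    obtain r where r: "r > 0" "ball x r \<inter> half_plane \<subseteq> snd k ` fst k" "kball k x r \<subseteq> cover_proj ` W"
      unfolding c(2) by (rule sheet_local[OF k W c(1) NN open_UNIV UNIV_I])
    have "ball x r \<inter> half_plane \<subseteq> snd (lift_chart k W) ` fst (lift_chart k W)"
    proof
      fix y assume y: "y \<in> ball x r \<inter> half_plane"
      then obtain q where "q \<in> fst k" "y = snd k q" using r(2) by blast
      then have "q \<in> kball k x r" using y by simp
      then obtain d where "d \<in> W" "q = cover_proj d" using r(3) by blast
      then show "y \<in> snd (lift_chart k W) ` fst (lift_chart k W)" using \<open>y = snd k q\<close> by auto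
    qed
    moreover have "hopen (ball x r \<inter> half_plane)" by (metis inf_commute open_ball openin_open_Int)
    moreover have "x \<in> ball x r \<inter> half_plane" using r(1) c(2) chart_half_plane[OF k sheetD(2)[OF W c(1)]] by simp
    ultimately show "\<exists>T. hopen T \<and> x \<in> T \<and> T \<subseteq> snd (lift_chart k W) ` fst (lift_chart k W)" by blast
  qed
qed

lemma lift_ext:
  assumes "cover_proj ` W \<subseteq> fst k" "ext k V g f"
  shows "ext (lift_chart k W) V g (\<lambda>c. f (cover_proj c))"
  using assms by (auto simp: ext_def)

lemma lift_sm_at:
  assumes k: "k \<in> charts S" and W: "sheet_over N xbar (fst k) W" and c: "c \<in> W" and f: "sm_at k f (cover_proj c)"
  shows "sm_at (lift_chart k W) (\<lambda>c. f (cover_proj c)) c"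
    "partial (lift_chart k W) i (\<lambda>c. f (cover_proj c)) c = partial k i f (cover_proj c)"
proof -
  obtain V g where g: "snd k (cover_proj c) \<in> V" "ext k V g f" using f by (auto simp: sm_at_def)
  have sub: "cover_proj ` W \<subseteq> fst k" using W by (simp add: sheet_over_def)
  note e = lift_ext[OF sub g(2)]
  show "sm_at (lift_chart k W) (\<lambda>c. f (cover_proj c)) c" by (rule sm_atI[OF _ e]) (use g in simp)
  show "partial (lift_chart k W) i (\<lambda>c. f (cover_proj c)) c = partial k i f (cover_proj c)"
    using partial_ext[OF lift_gchart[OF k W] e] partial_ext[OF chart_gchart[OF k] g(2) sheetD(2)[OF W c] g(1)] c g(1) by simp
qed

lemma smooth_wrt_cover:
  "smooth_wrt (cover_charts S xbar) F \<longleftrightarrow>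
     (\<forall>k\<in>charts S. \<forall>W. sheet_over N xbar (fst k) W \<longrightarrow> (\<forall>c\<in>W. sm_at (lift_chart k W) F c))"
proof -
  have "smooth_upto (snd (lift_chart k W) ` fst (lift_chart k W)) (in_coords (lift_chart k W) F) \<longleftrightarrow> (\<forall>c\<in>W. sm_at (lift_chart k W) F c)"
    if "k \<in> charts S" "sheet_over N xbar (fst k) W" for k W
    using smooth_upto_sm_at[of "lift_chart k W" F] lift_gchart[OF that] by (simp add: gchart_def)
  then show ?thesis unfolding smooth_wrt_def cover_charts_def by blast
qed

abbreviation cpg where "cpg g c \<equiv> cover_proj (g c :: (real \<Rightarrow> real^2^2) set)"

text \<open>The part of (Q) that concerns the form, with \<open>adj2\<close> for the inverse.
  Continuity into the covering group, quasiperiodicity and the boundary values are treated apart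
  from it.\<close>

definition solves :: "((real \<Rightarrow> 'a) set \<Rightarrow> (real \<Rightarrow> real^2^2) set) \<Rightarrow> 'a form \<Rightarrow> bool" where
  "solves g \<omega> \<longleftrightarrow> (\<forall>c\<in>ucover N xbar. g c \<in> carrier SL2_cover) \<and>
     (\<forall>k\<in>charts S. \<forall>W. sheet_over N xbar (fst k) W \<longrightarrow> (\<forall>c\<in>W. sm_at (lift_chart k W) (cpg g) c \<and>
        (\<forall>i. \<omega> k (cover_proj c) i = adj2 (cpg g c) ** partial (lift_chart k W) i (cpg g) c)))"

text \<open>A solution on the covering manifold, read through the inverse of the projection of a
  sheet, is a local horizontal section on the surface; flatness and smoothness questions can then be
  settled there.\<close>

lemma solves_frame:
  assumes g: "solves g \<omega>" and \<omega>: "\<omega> \<in> sl2_forms S" and k: "k \<in> charts S" and W: "sheet_over N xbar (fst k) W"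
  shows "frame \<omega> (cover_proj ` W) (\<lambda>q. cpg g (inv_into W cover_proj q))"
proof (rule frameI[OF \<omega> sheet_proj_open[OF k W]])
  let ?h = "\<lambda>q. cpg g (inv_into W cover_proj q)"
  fix q assume "q \<in> cover_proj ` W"
  then obtain c where c: "c \<in> W" "q = cover_proj c" by blast
  note s = sheetD[OF W c(1)]
  have h: "?h (cover_proj d) = cpg g d" if "d \<in> W" for d using that s(3) by simp
  show "?h q \<in> SL2" unfolding c(2) h[OF c(1)] using g s(1) cover_proj_SL2(1) by (auto simp: solves_def)
  have "sm_at (lift_chart k W) (cpg g) c" using g k W c(1) by (auto simp: solves_def)
  then obtain V u where u: "snd k q \<in> V" "ext (lift_chart k W) V u (cpg g)" using c(2) by (auto simp: sm_at_def)
  obtain V0 where V0: "open V0" "snd k q \<in> V0" "\<forall>q'\<in>fst k. snd k q' \<in> V0 \<longrightarrow> q' \<in> cover_proj ` W"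
    using chart_nbhd[OF k sheet_proj_open[OF k W], of q] s(2) c by blast
  have e: "ext k (V \<inter> V0) u ?h"
    unfolding ext_def
  proof (intro conjI ballI impI)
    show "open (V \<inter> V0)" "smooth_on (V \<inter> V0) u" using u V0(1) by (auto simp: ext_def intro: smooth_on_subset)
    fix q' assume q': "q' \<in> fst k" "snd k q' \<in> V \<inter> V0"
    then obtain d where d: "d \<in> W" "q' = cover_proj d" using V0 by blast
    show "?h q' = u (snd k q')" unfolding d(2) h[OF d(1)] using u(2) d q' by (auto simp: ext_def)
  qed
  have qV: "snd k q \<in> V \<inter> V0" "q \<in> fst k" using u V0 s(2) c(2) by auto
  have p: "partial k i ?h q = partial (lift_chart k W) i (cpg g) c" for i
    using partial_ext[OF chart_gchart[OF k] e qV(2,1)] partial_ext[OF lift_gchart[OF k W] u(2), of c] c u(1) by simp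
  have "\<omega> k q i = adj2 (?h q) ** partial k i ?h q" for i
    unfolding p unfolding c(2) h[OF c(1)] using g k W c(1) by (auto simp: solves_def)
  then show "\<exists>k\<in>charts S. q \<in> fst k \<and> sm_at k ?h q \<and> (\<forall>i. \<omega> k q i = adj2 (?h q) ** partial k i ?h q)"
    using k qV sm_atI[OF qV(1) e] by blast
qed

lemma solves_flat:
  assumes g: "solves g \<omega>" and \<omega>: "\<omega> \<in> sl2_forms S"
  shows "flat \<omega>"
  unfolding flat_def
proof (intro ballI)
  fix k q assume k: "k \<in> charts S" "q \<in> fst k"
  then obtain c where c: "c \<in> ucover N xbar" "cover_proj c = q" using class_over chart_subset by blast
  obtain W where W: "sheet_over N xbar (fst k) W" "c \<in> W" using sheet_exists[OF c(1) k(1)] c k by blast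
  show "curvature \<omega> k q 1 2 = 0" by (rule frame_curvature[OF solves_frame[OF g \<omega> k(1) W(1)] k]) (use W c in blast)
qed

lemma develop_solves:
  assumes \<omega>: "\<omega> \<in> sl2_forms S" and fl: "flat \<omega>"
  shows "solves (frames.develop (frame \<omega>)) \<omega>"
proof -
  interpret F: frames N "frame \<omega>" by (rule frames_locale[OF assms])
  show ?thesis unfolding solves_def
  proof (intro conjI ballI allI impI)
    show "F.develop c \<in> carrier SL2_cover" if "c \<in> ucover N xbar" for c by (rule F.develop_in[OF that])
    fix k W c assume k: "k \<in> charts S" and W: "sheet_over N xbar (fst k) W" and c: "c \<in> W"
    note s = sheetD[OF W c]
    obtain U h where U: "frame \<omega> U h" "cover_proj c \<in> U" using frame_exists[OF assms cover_proj_in[OF s(1)]] by blast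
    have oU: "openin (top_of_set N) U" using U by (simp add: frame_def)
    let ?p = "snd k (cover_proj c)"
    obtain r where r: "r > 0" "kball k ?p r \<subseteq> U"
      "\<And>c'. c' \<in> W \<Longrightarrow> snd k (cover_proj c') \<in> ball ?p r \<Longrightarrow>
         \<exists>q\<in>paths_from N (cover_proj c). path_image q \<subseteq> kball k ?p r \<and> c' = extend N c q \<and> pathfinish q = cover_proj c'"
      by (rule sheet_local[OF k W c oU U(2) open_UNIV UNIV_I]) blast
    \<comment> \<open>Near \<open>c\<close> the development is the section \<open>h\<close> below,
      multiplied by this constant matrix.\<close>
    define M where "M = cpg F.develop c ** adj2 (h (cover_proj c))"
    have dev: "M ** h (cover_proj c') = cpg F.develop c'" if c': "c' \<in> W" "snd k (cover_proj c') \<in> ball ?p r" for c'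
    proof -
      obtain q where q: "q \<in> paths_from N (cover_proj c)" "path_image q \<subseteq> kball k ?p r" "c' = extend N c q" "pathfinish q = cover_proj c'"
        using r(3)[OF c'] by blast
      show ?thesis unfolding q(3) M_def
        using F.develop_frame[OF s(1) q(1) U(1) order_trans[OF q(2) r(2)]] q by simp
    qed
    note f = frame_partial[OF U(1) k U(2) s(2)]
    have g: "gchart (lift_chart k W)" by (rule lift_gchart[OF k W])
    have l: "sm_at (lift_chart k W) (\<lambda>c'. h (cover_proj c')) c" by (rule lift_sm_at(1)[OF k W c f(1)])
    have sM: "sm_at (lift_chart k W) (\<lambda>c'. M ** h (cover_proj c')) c" by (intro sm_at_mm sm_at_const l)
    show "sm_at (lift_chart k W) (cpg F.develop) c"
      by (rule sm_at_cong[OF sM, of "ball ?p r"]) (use r(1) dev in auto)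
    fix i
    have "partial (lift_chart k W) i (cpg F.develop) c = partial (lift_chart k W) i (\<lambda>c'. M ** h (cover_proj c')) c"
      by (rule partial_cong[OF g _ sM, of "ball ?p r"]) (use r(1) c dev in auto)
    also have "\<dots> = M ** partial k i h (cover_proj c)"
      using partial_mm[OF sm_at_const[where c=M] l g] lift_sm_at(2)[OF k W c f(1)] partial_const[OF g, where c=M] c by simp
    also have "\<dots> = cpg F.develop c ** \<omega> k (cover_proj c) i"
      unfolding f(3) M_def using f(2) by (simp add: mm_assoc)
    finally show "\<omega> k (cover_proj c) i = adj2 (cpg F.develop c) ** partial (lift_chart k W) i (cpg F.develop) c"
      using cover_proj_SL2(1)[OF F.develop_in[OF s(1)]] by simp
  qed
qed

subsection \<open>The boundary circles\<close>

lemma circle_in: "l \<in> labels S \<Longrightarrow> circle S l \<phi> \<in> N"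
proof -
  assume l: "l \<in> labels S"
  have "(\<Union>l\<in>labels S. range (circle S l)) = boundary_points S" using circles by (simp add: boundary_circles_def)
  then have "circle S l \<phi> \<in> boundary_points S" using l by blast
  then show ?thesis using chart_subset by (auto simp: boundary_points_def)
qed

lemma circle_cont: "l \<in> labels S \<Longrightarrow> continuous_on UNIV (circle S l)"
  using circles by (auto simp: boundary_circles_def)

lemma circle_periodic: "l \<in> labels S \<Longrightarrow> circle S l (\<phi> + 2 * pi) = circle S l \<phi>"
  using circles by (auto simp: boundary_circles_def)

lemma circle_preimage_open:
  assumes "l \<in> labels S" "openin (top_of_set N) U"
  shows "open (circle S l -` U)"
proof -
  obtain T where T: "open T" "U = N \<inter> T" using assms by (auto simp: openin_open)
  have "circle S l -` U = circle S l -` T" using T circle_in[OF assms(1)] by auto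
  then show ?thesis using open_vimage[OF T(1) circle_cont[OF assms(1)]] by simp
qed

lemma circle_chart_open: "l \<in> labels S \<Longrightarrow> k \<in> charts S \<Longrightarrow> open (circle S l -` fst k)"
  by (rule circle_preimage_open) (use chart in \<open>auto simp: chart_of_def\<close>)

lemma circle_smooth: "l \<in> labels S \<Longrightarrow> k \<in> charts S \<Longrightarrow> smooth_on (circle S l -` fst k) (\<lambda>\<phi>. snd k (circle S l \<phi>))"
  using circles by (auto simp: boundary_circles_def o_def)

abbreviation cvel :: "'l \<Rightarrow> 'a chart \<Rightarrow> real \<Rightarrow> real^2" where
  "cvel l k \<phi> \<equiv> vector_derivative (snd k \<circ> circle S l) (at \<phi>)"

lemma circle_velocity:
  assumes "l \<in> labels S" "k \<in> charts S" "circle S l \<phi> \<in> fst k"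
  shows "((\<lambda>\<phi>. snd k (circle S l \<phi>)) has_vector_derivative cvel l k \<phi>) (at \<phi>)"
    "cvel l k \<phi> = fderiv (\<lambda>\<phi>. snd k (circle S l \<phi>)) \<phi> 1"
proof -
  have d: "((\<lambda>\<phi>. snd k (circle S l \<phi>)) has_vector_derivative fderiv (\<lambda>\<phi>. snd k (circle S l \<phi>)) \<phi> 1) (at \<phi>)"
    by (rule smooth_on_vector_derivative[OF circle_smooth[OF assms(1,2)]]) (use assms in auto)
  then show "cvel l k \<phi> = fderiv (\<lambda>\<phi>. snd k (circle S l \<phi>)) \<phi> 1"
    by (simp add: o_def vector_derivative_at)
  then show "((\<lambda>\<phi>. snd k (circle S l \<phi>)) has_vector_derivative cvel l k \<phi>) (at \<phi>)" using d by simp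
qed

lemma circle_ext:
  assumes l: "l \<in> labels S" and k: "k \<in> charts S" "circle S l \<phi> \<in> fst k" and h: "sm_at k h (circle S l \<phi>)"
  obtains P V g where "open P" "\<phi> \<in> P" "ext k V g h" "snd k (circle S l \<phi>) \<in> V"
    "\<And>\<phi>'. \<phi>' \<in> P \<Longrightarrow> circle S l \<phi>' \<in> fst k" "\<And>\<phi>'. \<phi>' \<in> P \<Longrightarrow> snd k (circle S l \<phi>') \<in> V" "\<And>\<phi>'. \<phi>' \<in> P \<Longrightarrow> h (circle S l \<phi>') = g (snd k (circle S l \<phi>'))"
proof -
  obtain V g where g: "snd k (circle S l \<phi>) \<in> V" "ext k V g h" using h by (auto simp: sm_at_def)
  let ?P = "circle S l -` fst k \<inter> (\<lambda>\<phi>. snd k (circle S l \<phi>)) -` V"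
  have "open ?P"
    by (rule continuous_open_preimage[OF smooth_on_continuous[OF circle_smooth[OF l k(1)]] circle_chart_open[OF l k(1)]])
      (use g in \<open>simp add: ext_def\<close>)
  then show thesis by (rule that[OF _ _ g(2,1)]) (use k g in \<open>auto simp: ext_def\<close>)
qed

lemma circle_derivative:
  assumes l: "l \<in> labels S" and k: "k \<in> charts S" "circle S l \<phi> \<in> fst k" and h: "sm_at k h (circle S l \<phi>)"
  shows "((\<lambda>\<phi>. h (circle S l \<phi>)) has_vector_derivative (\<Sum>i\<in>UNIV. cvel l k \<phi> $ i *\<^sub>R partial k i h (circle S l \<phi>))) (at \<phi>)"
proof -
  obtain P V g where P: "open P" "\<phi> \<in> P" "ext k V g h" "snd k (circle S l \<phi>) \<in> V"
    "\<And>\<phi>'. \<phi>' \<in> P \<Longrightarrow> h (circle S l \<phi>') = g (snd k (circle S l \<phi>'))"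
    by (rule circle_ext[OF assms]) blast
  let ?p = "snd k (circle S l \<phi>)"
  have "((\<lambda>\<phi>. g (snd k (circle S l \<phi>))) has_derivative (\<lambda>t. fderiv g (?p) (t *\<^sub>R cvel l k \<phi>))) (at \<phi>)"
    by (rule has_derivative_compose[OF circle_velocity(1)[OF l k, unfolded has_vector_derivative_def] ext_derivative[OF P(3,4)]])
  moreover have "linear (fderiv g (?p))" using ext_derivative[OF P(3,4)] has_derivative_linear by blast
  ultimately have "((\<lambda>\<phi>. g (snd k (circle S l \<phi>))) has_vector_derivative fderiv g (?p) (cvel l k \<phi>)) (at \<phi>)"
    unfolding has_vector_derivative_def by (simp add: linear_scale)
  then have "((\<lambda>\<phi>. h (circle S l \<phi>)) has_vector_derivative fderiv g (?p) (cvel l k \<phi>)) (at \<phi>)"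
    by (rule has_vector_derivative_transform_within_open[OF _ P(1,2)]) (use P(5) in simp)
  then show ?thesis unfolding partial_ext_vec[OF chart_gchart[OF k(1)] P(3) k(2) P(4)] .
qed

lemma circle_compose_smooth:
  assumes l: "l \<in> labels S" and h: "smooth_wrt (charts S) h"
  shows "smooth_on UNIV (\<lambda>\<phi>. h (circle S l \<phi>))"
proof (rule smooth_on_local)
  fix \<phi> :: real
  obtain k where k: "k \<in> charts S" "circle S l \<phi> \<in> fst k" using charts_cover circle_in[OF l] by blast
  have "sm_at k h (circle S l \<phi>)" using h k by (simp add: smooth_wrt_iff)
  then obtain P V g where P: "open P" "\<phi> \<in> P" "ext k V g h"
    "\<And>\<phi>'. \<phi>' \<in> P \<Longrightarrow> circle S l \<phi>' \<in> fst k" "\<And>\<phi>'. \<phi>' \<in> P \<Longrightarrow> snd k (circle S l \<phi>') \<in> V" "\<And>\<phi>'. \<phi>' \<in> P \<Longrightarrow> h (circle S l \<phi>') = g (snd k (circle S l \<phi>'))"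
    by (rule circle_ext[OF l k]) blast
  have "smooth_on P (\<lambda>\<phi>. g (snd k (circle S l \<phi>)))"
    by (rule smooth_on_compose[OF P(1), of V]) (use P(3-5) in \<open>auto simp: ext_def intro: smooth_on_subset[OF circle_smooth[OF l k(1)]]\<close>)
  then have "smooth_on P (\<lambda>\<phi>. h (circle S l \<phi>))" by (rule smooth_on_cong[OF _ P(1)]) (use P(6) in simp)
  then show "\<exists>V. open V \<and> \<phi> \<in> V \<and> smooth_on V (\<lambda>\<phi>. h (circle S l \<phi>))" using P by blast
qed

lemma cvel_change:
  assumes l: "l \<in> labels S" and k: "k \<in> charts S" "circle S l \<phi> \<in> fst k" and k': "k' \<in> charts S" "circle S l \<phi> \<in> fst k'"
  shows "cvel l k' \<phi> $ j = (\<Sum>i\<in>UNIV. cvel l k \<phi> $ i * jacobian k k' (circle S l \<phi>) $ j $ i)"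
proof -
  let ?q = "circle S l \<phi>"
  have s: "sm_at k' (snd k') ?q" by (rule sm_at_coord)
  have ec: "ext k' UNIV (\<lambda>p. p) (snd k')" by (auto simp: ext_def intro: smooth_on_bounded_linear)
  have pj: "partial k' j (snd k') ?q = axis j 1" for j
    by (rule partial_eqI[OF chart_gchart[OF k'(1)] ec k'(2)]) auto
  note cc = chart_change[OF k(1) k'(1) k(2) k'(2) s]
  have "((\<lambda>\<phi>. snd k' (circle S l \<phi>)) has_vector_derivative (\<Sum>i\<in>UNIV. cvel l k \<phi> $ i *\<^sub>R partial k i (snd k') ?q)) (at \<phi>)"
    by (rule circle_derivative[OF l k cc(1)])
  from vector_derivative_unique_at[OF circle_velocity(1)[OF l k'] this]
  have "cvel l k' \<phi> = (\<Sum>i\<in>UNIV. cvel l k \<phi> $ i *\<^sub>R (\<Sum>m\<in>UNIV. jacobian k k' ?q $ m $ i *\<^sub>R axis m 1))"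
    by (simp add: cc(2) pj)
  then show ?thesis using exhaust_2[of j] by (auto simp: sum_2 axis_def)
qed

lemma tangential_eq:
  assumes \<omega>: "\<omega> \<in> sl2_forms S" and l: "l \<in> labels S" and k: "k \<in> charts S" "circle S l \<phi> \<in> fst k"
  shows "tangential S \<omega> l \<phi> = (\<Sum>i\<in>UNIV. cvel l k \<phi> $ i *\<^sub>R \<omega> k (circle S l \<phi>) i)"
proof -
  define k' where "k' = (SOME k. k \<in> charts S \<and> circle S l \<phi> \<in> fst k)"
  have k': "k' \<in> charts S" "circle S l \<phi> \<in> fst k'"
    unfolding k'_def using someI[of "\<lambda>k. k \<in> charts S \<and> circle S l \<phi> \<in> fst k" k] k by auto
  have "tangential S \<omega> l \<phi> = (\<Sum>i\<in>UNIV. cvel l k' \<phi> $ i *\<^sub>R \<omega> k' (circle S l \<phi>) i)"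
    by (simp add: tangential_def k'_def[symmetric])
  also have "\<dots> = (\<Sum>i\<in>UNIV. cvel l k \<phi> $ i *\<^sub>R \<omega> k (circle S l \<phi>) i)"
    unfolding cvel_change[OF l k k'] form_change[OF \<omega> k(1) k'(1) k(2) k'(2)]
    by (simp add: sum_2 algebra_simps)
  finally show ?thesis .
qed

lemma tangential_sl2:
  assumes "\<omega> \<in> sl2_forms S" "l \<in> labels S"
  shows "tangential S \<omega> l \<phi> \<in> sl2"
proof -
  obtain k where k: "k \<in> charts S" "circle S l \<phi> \<in> fst k" using charts_cover circle_in[OF assms(2)] by blast
  show ?thesis unfolding tangential_eq[OF assms k] by (intro sl2_sum sl2_scaleR form_sl2[OF assms(1) k])
qed

lemma frame_circle:
  assumes F: "frame \<omega> U h" and \<omega>: "\<omega> \<in> sl2_forms S" and l: "l \<in> labels S" and U: "circle S l \<phi> \<in> U"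
  shows "((\<lambda>\<phi>. h (circle S l \<phi>)) has_vector_derivative h (circle S l \<phi>) ** tangential S \<omega> l \<phi>) (at \<phi>)"
proof -
  obtain k where k: "k \<in> charts S" "circle S l \<phi> \<in> fst k" using charts_cover circle_in[OF l] by blast
  note f = frame_partial[OF F k(1) U k(2)]
  show ?thesis
    using circle_derivative[OF l k f(1)] unfolding f(3) tangential_eq[OF \<omega> l k] by (simp add: mm_sum_right)
qed

text \<open>The boundary term of the Hamilton constraint with the test function removed.\<close>

definition bdry :: "'a form \<Rightarrow> ('l \<Rightarrow> real \<Rightarrow> real^2^2) \<Rightarrow> bool" where
  "bdry \<omega> u \<longleftrightarrow> (\<forall>l\<in>labels S. \<forall>\<phi>. adj2 (u l \<phi>) ** vector_derivative (u l) (at \<phi>) = tangential S \<omega> l \<phi>)"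

end

section \<open>Condition (Q) as flatness together with the boundary equation\<close>

locale surf_family = surf S xbar for S :: "('a::t2_space, 'l) surface" and xbar +
  fixes \<alpha> :: "'l \<Rightarrow> real \<Rightarrow> (real \<Rightarrow> 'a) set"
  assumes fam: "boundary_families S xbar \<alpha>"
begin

lemma fam_proj: "l \<in> labels S \<Longrightarrow> cover_proj (\<alpha> l \<phi>) = circle S l \<phi>"
  using fam by (auto simp: boundary_families_def)

lemma fam_in: "l \<in> labels S \<Longrightarrow> \<alpha> l \<phi> \<in> ucover N xbar"
  using fam by (auto simp: boundary_families_def continuous_map_def Pi_iff)

lemma fam_open: "l \<in> labels S \<Longrightarrow> openin (ucover_topology N xbar) W \<Longrightarrow> open (\<alpha> l -` W)"
  using fam unfolding boundary_families_def continuous_map_def by (auto simp: vimage_def)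

abbreviation condQ where "condQ \<equiv> condition_Q S xbar \<alpha>"

lemma Q_iff:
  "condQ (\<omega>, u) g b \<longleftrightarrow> continuous_map (ucover_topology N xbar) SL2_ucover_topology g \<and> solves g \<omega> \<and>
     normalized_quasiperiodic S xbar g \<and> (\<forall>l\<in>labels S. b l \<in> SL2) \<and>
     (\<forall>l\<in>labels S. \<forall>\<phi>. u l \<phi> = adj2 (b l) ** cpg g (\<alpha> l \<phi>))"
proof -
  have car: "g c \<in> carrier SL2_cover" if "continuous_map (ucover_topology N xbar) SL2_ucover_topology g" "c \<in> ucover N xbar" for c
    using that by (auto simp: continuous_map_def SL2_cover_simps)
  have inv: "matrix_inv (cpg g c) = adj2 (cpg g c)"
    if "continuous_map (ucover_topology N xbar) SL2_ucover_topology g" "k \<in> charts S" "sheet_over N xbar (fst k) W" "c \<in> W" for c k W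
    using cover_proj_SL2(1)[OF car[OF that(1) sheetD(1)[OF that(3,4)]]] by simp
  show ?thesis
    unfolding condition_Q_def case_prod_conv smooth_to_SL2_cover_def smooth_wrt_cover solves_def
    using car inv by (auto 0 3)
qed

text \<open>By continuity the boundary family stays in one sheet for angles near \<phi>. There the
  composite with \<open>g\<close> is a local horizontal section along the circle.\<close>

lemma solves_boundary:
  assumes g: "solves g \<omega>" and \<omega>: "\<omega> \<in> sl2_forms S" and l: "l \<in> labels S"
  shows "((\<lambda>\<phi>. cpg g (\<alpha> l \<phi>)) has_vector_derivative cpg g (\<alpha> l \<phi>) ** tangential S \<omega> l \<phi>) (at \<phi>)"
proof -
  obtain k where k: "k \<in> charts S" "circle S l \<phi> \<in> fst k" using charts_cover circle_in[OF l] by blast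
  obtain W where W: "sheet_over N xbar (fst k) W" "\<alpha> l \<phi> \<in> W"
    using sheet_exists[OF fam_in[OF l] k(1)] k fam_proj[OF l] by auto
  let ?h = "\<lambda>q. cpg g (inv_into W cover_proj q)"
  have o: "open (\<alpha> l -` W)" by (rule fam_open[OF l]) (use W in \<open>simp add: sheet_over_def\<close>)
  have e: "?h (circle S l \<phi>') = cpg g (\<alpha> l \<phi>')" if "\<alpha> l \<phi>' \<in> W" for \<phi>'
    using that W(1) unfolding fam_proj[OF l, symmetric] by (simp add: sheet_over_def)
  have "circle S l \<phi> \<in> cover_proj ` W" using W(2) fam_proj[OF l] by (metis imageI)
  from frame_circle[OF solves_frame[OF g \<omega> k(1) W(1)] \<omega> l this]
  have "((\<lambda>\<phi>. ?h (circle S l \<phi>)) has_vector_derivative cpg g (\<alpha> l \<phi>) ** tangential S \<omega> l \<phi>) (at \<phi>)"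
    unfolding e[OF W(2)] .
  then show ?thesis
    by (rule has_vector_derivative_transform_within_open[OF _ o]) (use W e in auto)
qed

lemma Q_imp_flat_bdry:
  assumes X: "(\<omega>, u) \<in> configs S" and Q: "condQ (\<omega>, u) g b"
  shows "flat \<omega>" "bdry \<omega> u"
proof -
  have \<omega>: "\<omega> \<in> sl2_forms S" using X by (simp add: configs_def)
  have g: "solves g \<omega>" and b: "\<And>l. l \<in> labels S \<Longrightarrow> b l \<in> SL2" and u: "\<And>l \<phi>. l \<in> labels S \<Longrightarrow> u l \<phi> = adj2 (b l) ** cpg g (\<alpha> l \<phi>)"
    using Q by (auto simp: Q_iff)
  show "flat \<omega>" by (rule solves_flat[OF g \<omega>])
  show "bdry \<omega> u" unfolding bdry_def
  proof (intro ballI allI)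
    fix l \<phi> assume l: "l \<in> labels S"
    have "((\<lambda>\<phi>. adj2 (b l) ** cpg g (\<alpha> l \<phi>)) has_vector_derivative adj2 (b l) ** (cpg g (\<alpha> l \<phi>) ** tangential S \<omega> l \<phi>)) (at \<phi>)"
      by (rule bounded_linear.has_vector_derivative[OF bounded_bilinear.bounded_linear_right[OF bilinear_mm] solves_boundary[OF g \<omega> l]])
    moreover have "u l = (\<lambda>\<phi>. adj2 (b l) ** cpg g (\<alpha> l \<phi>))" using u[OF l] by auto
    ultimately have "vector_derivative (u l) (at \<phi>) = u l \<phi> ** tangential S \<omega> l \<phi>"
      by (simp add: vector_derivative_at mm_assoc)
    moreover have "u l \<phi> \<in> SL2" unfolding u[OF l] using b[OF l] cover_proj_SL2(1) fam_in[OF l] g by (auto simp: solves_def)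
    ultimately show "adj2 (u l \<phi>) ** vector_derivative (u l) (at \<phi>) = tangential S \<omega> l \<phi>" by simp
  qed
qed

text \<open>The development along the boundary family and \<open>u\<close> satisfy the same linear
  equation with coefficient \<open>tangential S \<omega> l\<close>, so their quotient does not
  depend on the angle and can serve as b.\<close>

lemma flat_bdry_imp_Q:
  assumes X: "(\<omega>, u) \<in> configs S" and fl: "flat \<omega>" and bd: "bdry \<omega> u"
  shows "\<exists>g b. condQ (\<omega>, u) g b"
proof -
  have \<omega>: "\<omega> \<in> sl2_forms S" and u: "u \<in> boundary_variables S" using X by (auto simp: configs_def)
  interpret F: frames N "frame \<omega>" by (rule frames_locale[OF \<omega> fl])
  have g: "solves F.develop \<omega>" by (rule develop_solves[OF \<omega> fl])
  let ?P = "\<lambda>l \<phi>. cpg F.develop (\<alpha> l \<phi>)"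
  \<comment> \<open>Evaluated at angle 0; by the constancy shown next any other angle would give the
    same matrix.\<close>
  define b where "b = (\<lambda>l. ?P l 0 ** adj2 (u l 0))"
  have uSL: "u l \<phi> \<in> SL2" if "l \<in> labels S" for l \<phi> using u that unfolding boundary_variables_def by blast
  have PSL: "?P l \<phi> \<in> SL2" if "l \<in> labels S" for l \<phi> using F.develop_in[OF fam_in[OF that]] cover_proj_SL2(1) by blast
  have c: "?P l \<phi> ** adj2 (u l \<phi>) = b l" if l: "l \<in> labels S" for l \<phi>
  proof -
    have d: "((\<lambda>\<phi>. ?P l \<phi> ** adj2 (u l \<phi>)) has_vector_derivative 0) (at t within UNIV)" for t
    proof -
      have "smooth_on UNIV (u l)" using u l by (auto simp: boundary_variables_def)
      then have "u l differentiable (at t)" using smooth_on_has_derivative[of UNIV "u l" t] by (auto simp: differentiable_def)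
      then have "(u l has_vector_derivative vector_derivative (u l) (at t)) (at t)" by (simp add: vector_derivative_works)
      moreover have "vector_derivative (u l) (at t) = u l t ** tangential S \<omega> l t"
        using bd l uSL[OF l, of t] unfolding bdry_def by (metis SL2_adj2(6))
      ultimately have du: "((\<lambda>t. adj2 (u l t)) has_vector_derivative adj2 (u l t ** tangential S \<omega> l t)) (at t)"
        using bounded_linear.has_vector_derivative[OF bounded_linear_adj2] by metis
      show ?thesis
        using bounded_bilinear.has_vector_derivative[OF bilinear_mm solves_boundary[OF g \<omega> l] du]
          tangential_sl2[OF \<omega> l, of t] by (simp add: adj2_mm adj2_traceless sl2_iff mm_assoc)
    qed
    obtain C where "\<And>\<phi>. ?P l \<phi> ** adj2 (u l \<phi>) = C"
      using has_vector_derivative_zero_constant[OF convex_UNIV d] by auto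
    then show ?thesis by (simp add: b_def)
  qed
  have "condQ (\<omega>, u) F.develop b"
    unfolding Q_iff
  proof (intro conjI F.develop_continuous g ballI allI)
    show "normalized_quasiperiodic S xbar F.develop"
      unfolding normalized_quasiperiodic_def using F.develop_hom by auto
    fix l assume l: "l \<in> labels S"
    show "b l \<in> SL2" using uSL[OF l] PSL[OF l] by (simp add: b_def)
    fix \<phi>
    have "b l ** u l \<phi> = ?P l \<phi>" unfolding c[OF l, of \<phi>, symmetric] using uSL[OF l] by simp
    then have "adj2 (b l) ** (b l ** u l \<phi>) = adj2 (b l) ** ?P l \<phi>" by simp
    then show "u l \<phi> = adj2 (b l) ** ?P l \<phi>" using \<open>b l \<in> SL2\<close> by simp
  qed
  then show ?thesis by blast
qed

end

subsection \<open>A logarithm on the universal covering group\<close>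

text \<open>The first column of a matrix in \<open>SL2\<close>, read as a nonzero complex number, has a continuous
  logarithm along paths; \<open>lz\<close> is the value of this logarithm at the end of the path.\<close>

definition fcol :: "real^2^2 \<Rightarrow> complex" where "fcol A = Complex (A $ 1 $ 1) (A $ 2 $ 1)"

lemma bounded_linear_fcol: "bounded_linear fcol"
  unfolding linear_conv_bounded_linear[symmetric]
  by (rule linearI) (simp_all add: fcol_def complex_eq_iff)

lemma fcol_nonzero: "A \<in> SL2 \<Longrightarrow> fcol A \<noteq> 0"
  by (auto simp: fcol_def SL2_iff det_2 complex_eq_iff)

lemma continuous_on_fcol [continuous_intros]: "continuous_on T f \<Longrightarrow> continuous_on T (\<lambda>x. fcol (f x))"
  by (rule bounded_linear.continuous_on[OF bounded_linear_fcol])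

lemma fcol_1 [simp]: "fcol (mat 1) = 1"
  by (simp add: fcol_def mat_def complex_eq_iff)

definition lz_lift :: "(real \<Rightarrow> real^2^2) \<Rightarrow> (real \<Rightarrow> complex) \<Rightarrow> bool" where
  "lz_lift p h \<longleftrightarrow> path h \<and> h 0 = 0 \<and> (\<forall>t\<in>{0..1}. exp (h t) = fcol (p t))"

definition lz :: "(real \<Rightarrow> real^2^2) set \<Rightarrow> complex" where
  "lz c = (SOME z. \<exists>p h. c = path_class SL2 p \<and> p \<in> paths_from SL2 (mat 1) \<and> lz_lift p h \<and> z = h 1)"

lemma lz_lift_exists:
  assumes "p \<in> paths_from SL2 (mat 1)"
  shows "\<exists>h. lz_lift p h"
proof -
  have "path (fcol \<circ> p)" using assms unfolding paths_from_def by (intro path_continuous_image) (auto intro!: continuous_intros)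
  moreover have "path_image (fcol \<circ> p) \<subseteq> - {0}" using assms fcol_nonzero by (auto simp: paths_from_def path_image_def)
  moreover have "pathstart (fcol \<circ> p) = exp 0" using assms by (simp add: paths_from_def pathstart_compose)
  ultimately obtain h where "path h" "pathstart h = 0" "\<And>t. t \<in> {0..1} \<Longrightarrow> exp (h t) = (fcol \<circ> p) t"
    by (rule covering_space_lift_path_strong[OF covering_space_exp_punctured_plane UNIV_I, of "fcol \<circ> p" 0]) blast
  then show ?thesis by (intro exI[of _ h]) (simp add: lz_lift_def pathstart_def)
qed

text \<open>Homotopic paths in \<open>SL2\<close> have homotopic first columns in the punctured
  plane, and by monodromy for the covering exp their logarithms end at the same value. So the choice
  in \<open>lz\<close> is immaterial.\<close>

lemma lz_eq:
  assumes p: "p \<in> paths_from SL2 (mat 1)" and h: "lz_lift p h"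
  shows "lz (path_class SL2 p) = h 1"
  unfolding lz_def
proof (rule some_equality)
  show "\<exists>p' h'. path_class SL2 p = path_class SL2 p' \<and> p' \<in> paths_from SL2 (mat 1) \<and> lz_lift p' h' \<and> h 1 = h' 1"
    using p h by blast
  fix z assume "\<exists>p' h'. path_class SL2 p = path_class SL2 p' \<and> p' \<in> paths_from SL2 (mat 1) \<and> lz_lift p' h' \<and> z = h' 1"
  then obtain p' h' where p': "path_class SL2 p = path_class SL2 p'" "p' \<in> paths_from SL2 (mat 1)" "lz_lift p' h'" "z = h' 1" by blast
  have "homotopic_paths SL2 p p'" using p'(1) p path_class_eq[of p SL2 p'] by (simp add: paths_from_def)
  then have hom: "homotopic_paths (- {0}) (fcol \<circ> p) (fcol \<circ> p')"
    by (rule homotopic_paths_continuous_image) (auto intro!: continuous_intros dest: fcol_nonzero)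
  have "pathfinish h = pathfinish h'"
    by (rule covering_space_monodromy[OF covering_space_exp_punctured_plane _ _ _ _ hom])
      (use hom h p' homotopic_paths_imp_path[OF hom] homotopic_paths_imp_subset[OF hom] in \<open>auto simp: lz_lift_def pathstart_def\<close>)
  then show "z = h 1" using p'(4) by (simp add: pathfinish_def)
qed

lemma lz_exp:
  assumes "c \<in> carrier SL2_cover"
  shows "exp (lz c) = fcol (cover_proj c)"
proof -
  obtain p where p: "c = path_class SL2 p" "p \<in> paths_from SL2 (mat 1)" "cover_proj c = pathfinish p"
    using ucoverE[of c SL2 "mat 1"] assms by (metis SL2_cover_simps(1))
  obtain h where h: "lz_lift p h" using lz_lift_exists[OF p(2)] by blast
  show ?thesis unfolding p(3) unfolding p(1) lz_eq[OF p(2) h] using h by (simp add: lz_lift_def pathfinish_def)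
qed

text \<open>As long as the first column, divided by its initial value, stays in the right half
  plane, the principal logarithm continues the lift. Near a given element \<open>lz\<close> is thus
  an explicit function of the projected matrix.\<close>

lemma lz_extend:
  assumes c: "c \<in> carrier SL2_cover" and q: "q \<in> paths_from SL2 (cover_proj c)"
    and re: "\<And>t. t \<in> {0..1} \<Longrightarrow> 0 < Re (fcol (q t) / fcol (cover_proj c))"
  shows "lz (extend SL2 c q) = lz c + Ln (fcol (pathfinish q) / fcol (cover_proj c))"
proof -
  obtain p where p: "c = path_class SL2 p" "p \<in> paths_from SL2 (mat 1)" "cover_proj c = pathfinish p"
    using ucoverE[of c SL2 "mat 1"] c by (metis SL2_cover_simps(1))
  obtain h where h: "lz_lift p h" using lz_lift_exists[OF p(2)] by blast
  let ?w = "fcol (cover_proj c)"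
  let ?h = "\<lambda>t. lz c + Ln (fcol (q t) / ?w)"
  have w: "?w \<noteq> 0" using fcol_nonzero cover_proj_SL2(1)[OF c] by blast
  have pp: "path p" "path_image p \<subseteq> SL2" and qq: "q \<in> paths_from SL2 (pathfinish p)" "path q" using p q by (auto simp: paths_from_def)
  have e: "extend SL2 c q = path_class SL2 (p +++ q)" unfolding p(1) by (rule extend_class[OF pp qq(1)])
  have pq: "p +++ q \<in> paths_from SL2 (mat 1)"
    using p(2) qq(1) by (auto simp: paths_from_def intro: subset_path_image_join[THEN subsetD])
  have h1: "h 1 = lz c" unfolding p(1) using lz_eq[OF p(2) h] by simp
  have q0: "q 0 = cover_proj c" using q by (simp add: paths_from_def pathstart_def)
  have cont: "path ?h" unfolding path_def
  proof (intro continuous_intros continuous_on_Ln)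
    show "continuous_on {0..1} q" using qq(2) by (simp add: path_def)
    fix t :: real assume "t \<in> {0..1}"
    then show "fcol (q t) / ?w \<notin> \<real>\<^sub>\<le>\<^sub>0" using re[of t] complex_nonpos_Reals_iff[of "fcol (q t) / ?w"] by auto
  qed (use w in auto)
  have ex: "exp (?h t) = fcol (q t)" if "t \<in> {0..1}" for t
  proof -
    have "fcol (q t) / ?w \<noteq> 0" using re[OF that] by force
    then show ?thesis using w lz_exp[OF c] by (simp add: exp_add exp_Ln)
  qed
  have "lz_lift (p +++ q) (h +++ ?h)"
    unfolding lz_lift_def
  proof (intro conjI ballI)
    show "path (h +++ ?h)" using h cont h1 q0 w by (intro path_join_imp) (auto simp: lz_lift_def pathfinish_def pathstart_def)
    show "(h +++ ?h) 0 = 0" using h by (simp add: lz_lift_def joinpaths_def)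
    fix t :: real assume t: "t \<in> {0..1}"
    show "exp ((h +++ ?h) t) = fcol ((p +++ q) t)"
      using h t ex[of "2 * t - 1"] by (auto simp: joinpaths_def lz_lift_def)
  qed
  from lz_eq[OF pq this] show ?thesis unfolding e by (simp add: joinpaths_def pathfinish_def)
qed

text \<open>Real formulas for the two parts of the logarithm, from which smoothness is read off
  through ln and arctan.\<close>

lemma Ln_right_half_plane:
  assumes "0 < Re z"
  shows "Re (Ln z) = ln (Re z * Re z + Im z * Im z) / 2" "Im (Ln z) = arctan (Im z * inverse (Re z))"
proof -
  have z: "z \<noteq> 0" using assms by auto
  have p: "0 < Re z * Re z + Im z * Im z" using assms by (simp add: add_pos_nonneg)
  show "Re (Ln z) = ln (Re z * Re z + Im z * Im z) / 2"
    using z p by (simp add: cmod_def power2_eq_square ln_sqrt)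
  show "Im (Ln z) = arctan (Im z * inverse (Re z))"
    using arg_conv_arctan[OF assms] z by (simp add: Arg_def divide_inverse)
qed

lemma sm_at_mk2:
  assumes "sm_at k a q" "sm_at k b q" "sm_at k c q" "sm_at k d q"
  shows "sm_at k (\<lambda>q. mk2 (a q) (b q) (c q) (d q)) q"
proof -
  have "(\<lambda>q. mk2 (a q) (b q) (c q) (d q)) =
    (\<lambda>q. a q *\<^sub>R mk2 1 0 0 0 + b q *\<^sub>R mk2 0 1 0 0 + c q *\<^sub>R mk2 0 0 1 0 + d q *\<^sub>R mk2 0 0 0 1)"
    by (auto simp: vec_eq_iff forall_2)
  then show ?thesis by (simp only:) (intro sm_at_add sm_at_scaleR sm_at_const assms)
qed

text \<open>The two ways along the edges of the square from one corner to the opposite one are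
  homotopic, and one of them begins with the constant edge.\<close>

lemma homotopic_square:
  fixes K :: "real \<times> real \<Rightarrow> 'b::topological_space"
  assumes K: "continuous_on ({0..1} \<times> {0..1}) K" "K ` ({0..1} \<times> {0..1}) \<subseteq> T" and 0: "\<And>s. s \<in> {0..1} \<Longrightarrow> K (s, 0) = a"
  shows "homotopic_paths T ((\<lambda>t. K (0, t)) +++ (\<lambda>s. K (s, 1))) (\<lambda>t. K (1, t))"
proof -
  let ?D = "{0..1} \<times> {0..1} :: (real \<times> real) set"
  let ?A = "linepath (0, 0) (0, 1) +++ linepath (0, 1) (1, 1) :: real \<Rightarrow> real \<times> real"
  let ?B = "linepath (0, 0) (1, 0) +++ linepath (1, 0) (1, 1) :: real \<Rightarrow> real \<times> real"
  have cD: "convex ?D" by (intro convex_Times) auto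
  have im: "path_image ?A \<subseteq> ?D" "path_image ?B \<subseteq> ?D"
    by (intro subset_path_image_join; simp, intro closed_segment_subset[OF _ _ cD]; simp)+
  have "homotopic_paths ?D ?A ?B"
  proof (rule homotopic_paths_linear)
    fix t :: real assume "t \<in> {0..1}"
    then have "?A t \<in> ?D" "?B t \<in> ?D" using im unfolding path_image_def by blast+
    then show "closed_segment (?A t) (?B t) \<subseteq> ?D" using cD by (rule closed_segment_subset)
  qed auto
  then have h: "homotopic_paths T (K \<circ> ?A) (K \<circ> ?B)"
    by (rule homotopic_paths_continuous_image[OF _ K(1)]) (use K(2) in auto)
  have A: "K \<circ> ?A = (\<lambda>t. K (0, t)) +++ (\<lambda>s. K (s, 1))" by (auto simp: joinpaths_def linepath_def)
  have B: "K \<circ> ?B = (\<lambda>s. K (s, 0)) +++ (\<lambda>t. K (1, t))" by (auto simp: joinpaths_def linepath_def)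
  have p1: "path (\<lambda>t. K (1, t))" "path_image (\<lambda>t. K (1, t)) \<subseteq> T"
    unfolding path_def path_image_def using K
    by (auto intro!: continuous_on_compose2[OF K(1)] continuous_intros simp: image_subset_iff)
  have "homotopic_paths T (K \<circ> ?B) ((\<lambda>s. a) +++ (\<lambda>t. K (1, t)))"
  proof (rule homotopic_paths_eq)
    show "path (K \<circ> ?B)" "path_image (K \<circ> ?B) \<subseteq> T"
      using homotopic_paths_imp_path[OF h] homotopic_paths_imp_subset[OF h] by auto
  qed (use 0 in \<open>auto simp: joinpaths_def linepath_def\<close>)
  also have "homotopic_paths T ((\<lambda>s. a) +++ (\<lambda>t. K (1, t))) (\<lambda>t. K (1, t))"
    by (rule homotopic_paths_sym, rule homotopic_paths_const_left[OF p1]) (use 0[of 1] in \<open>simp add: pathstart_def\<close>)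
  finally show ?thesis using homotopic_paths_trans[OF h] A by metis
qed

context surf begin

subsection \<open>Local Lorentz rotations\<close>

definition gauge :: "('a \<Rightarrow> real^2^2) \<Rightarrow> bool" where
  "gauge h \<longleftrightarrow> smooth_wrt (charts S) h \<and> (\<forall>q\<in>N. h q \<in> SL2)"

definition rotf :: "('a \<Rightarrow> real^2^2) \<Rightarrow> 'a form \<Rightarrow> 'a form" where
  "rotf h \<omega> = (\<lambda>k q i. if k \<in> charts S \<and> q \<in> fst k then adj2 (h q) ** partial k i h q + adj2 (h q) ** \<omega> k q i ** h q else 0)"

definition rotu :: "('a \<Rightarrow> real^2^2) \<Rightarrow> ('l \<Rightarrow> real \<Rightarrow> real^2^2) \<Rightarrow> 'l \<Rightarrow> real \<Rightarrow> real^2^2" where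
  "rotu h u = (\<lambda>l\<in>labels S. \<lambda>\<phi>. u l \<phi> ** h (circle S l \<phi>))"

lemma gaugeD:
  assumes "gauge h" "k \<in> charts S" "q \<in> fst k"
  shows "sm_at k h q" "h q \<in> SL2"
  using assms chart_subset[OF assms(2)] by (auto simp: gauge_def smooth_wrt_iff)

lemma gauge_circle: "gauge h \<Longrightarrow> l \<in> labels S \<Longrightarrow> h (circle S l \<phi>) \<in> SL2"
  using circle_in by (auto simp: gauge_def)

lemma rotation_eq:
  assumes "gauge h"
  shows "lorentz_rotation S h (\<omega>, u) = (rotf h \<omega>, rotu h u)"
proof -
  have "matrix_inv (h q) = adj2 (h q)" if "k \<in> charts S \<and> q \<in> fst k" for k q
    using gaugeD(2)[OF assms, of k q] that by simp
  then show ?thesis unfolding lorentz_rotation_def rotf_def rotu_def by (auto intro!: ext)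
qed

lemma gauge_mult:
  assumes "gauge h" "gauge h'"
  shows "gauge (\<lambda>q. h q ** h' q)"
  using assms unfolding gauge_def smooth_wrt_iff by (auto intro: sm_at_mm)

lemma gauge_partial_sl2:
  assumes h: "gauge h" and k: "k \<in> charts S" "q \<in> fst k"
  shows "adj2 (h q) ** partial k i h q \<in> sl2"
  by (rule partial_SL2_traceless[OF chart_gchart[OF k(1)] k(2) gaugeD(1)[OF h k] open_UNIV UNIV_I]) (rule gaugeD(2)[OF h k(1)])

lemma sm_at_partial:
  assumes k: "gchart k" "q \<in> fst k" and f: "sm_at k f q"
  shows "sm_at k (partial k i f) q"
proof -
  obtain V g where g: "snd k q \<in> V" "ext k V g f" using f by (auto simp: sm_at_def)
  have "ext k V (\<lambda>p. fderiv g p (axis i 1)) (partial k i f)"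
    unfolding ext_def
  proof (intro conjI ballI impI)
    show "open V" "smooth_on V (\<lambda>p. fderiv g p (axis i 1))"
      using g by (auto simp: ext_def intro: smooth_on_frechet_derivative)
    fix q' assume "q' \<in> fst k" "snd k q' \<in> V"
    from partial_ext[OF k(1) g(2) this] show "partial k i f q' = fderiv g (snd k q') (axis i 1)" .
  qed
  then show ?thesis using g by (blast intro: sm_atI)
qed

lemma rotf_forms:
  assumes \<omega>: "\<omega> \<in> sl2_forms S" and h: "gauge h"
  shows "rotf h \<omega> \<in> sl2_forms S"
  unfolding sl2_forms_def
proof (intro CollectI conjI ballI allI impI)
  show "\<not> (k \<in> charts S \<and> q \<in> fst k) \<Longrightarrow> rotf h \<omega> k q i = 0" for k q i unfolding rotf_def by (rule if_not_P)
  fix k i assume k: "k \<in> charts S"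
  show "smooth_upto (snd k ` fst k) (in_coords k (\<lambda>q. rotf h \<omega> k q i))"
    unfolding smooth_upto_sm_at[OF chart_inj[OF k]]
  proof
    fix q assume q: "q \<in> fst k"
    have "sm_at k (\<lambda>q. adj2 (h q) ** partial k i h q + adj2 (h q) ** \<omega> k q i ** h q) q"
      by (intro sm_at_add sm_at_mm sm_at_adj2 gaugeD(1)[OF h k q] form_smooth[OF \<omega> k q] sm_at_partial[OF chart_gchart[OF k] q])
    then show "sm_at k (\<lambda>q. rotf h \<omega> k q i) q"
      by (rule sm_at_cong[OF _ open_UNIV UNIV_I]) (simp add: rotf_def k)
  qed
  fix q assume q: "q \<in> fst k"
  show "rotf h \<omega> k q i \<in> sl2"
    using k q gauge_partial_sl2[OF h k q] sl2_conj[OF form_sl2[OF \<omega> k q] gaugeD(2)[OF h k q]]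
    by (simp add: rotf_def sl2_add)
next
  fix k k' q i assume k: "k \<in> charts S" "k' \<in> charts S" and q: "q \<in> fst k \<inter> fst k'"
  then have q1: "q \<in> fst k" "q \<in> fst k'" by auto
  show "rotf h \<omega> k q i = (\<Sum>j\<in>UNIV. jacobian k k' q $ j $ i *\<^sub>R rotf h \<omega> k' q j)"
    unfolding rotf_def using k q1
    by (simp add: chart_change(2)[OF k q1 gaugeD(1)[OF h k(2) q1(2)]] form_change[OF \<omega> k q1]
        sum_2 mm_left_distrib mm_right_distrib scaleR_add_right)
qed

lemma rotu_boundary:
  assumes u: "u \<in> boundary_variables S" and h: "gauge h"
  shows "rotu h u \<in> boundary_variables S"
  unfolding boundary_variables_def
proof (intro CollectI conjI ballI)
  show "rotu h u \<in> extensional (labels S)" by (simp add: rotu_def)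
next
  fix l assume l: "l \<in> labels S"
  have ul: "smooth_on UNIV (u l)" "\<And>\<phi>. u l \<phi> \<in> SL2" "\<exists>m\<in>SL2. \<forall>\<phi>. u l (\<phi> + 2 * pi) = m ** u l \<phi>"
    using u l unfolding boundary_variables_def by blast+
  have "smooth_on UNIV (\<lambda>\<phi>. u l \<phi> ** h (circle S l \<phi>))"
    by (intro smooth_on_mm ul circle_compose_smooth[OF l]) (use h in \<open>auto simp: gauge_def\<close>)
  then show "smooth_on UNIV (rotu h u l)" using l by (simp add: rotu_def)
  show "range (rotu h u l) \<subseteq> SL2" using l ul(2) gauge_circle[OF h l] by (auto simp: rotu_def)
  show "\<exists>m\<in>SL2. \<forall>\<phi>. rotu h u l (\<phi> + 2 * pi) = m ** rotu h u l \<phi>"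
    using ul(3) l by (auto simp: rotu_def circle_periodic[OF l] mm_assoc)
qed

lemma rotation_configs:
  assumes "X \<in> configs S" "gauge h"
  shows "lorentz_rotation S h X \<in> configs S"
  using assms rotf_forms rotu_boundary by (cases X) (auto simp: rotation_eq configs_def)

lemma rotation_rotation:
  assumes h: "gauge h" "gauge h'"
  shows "lorentz_rotation S h' (lorentz_rotation S h X) = lorentz_rotation S (\<lambda>q. h q ** h' q) X"
proof -
  obtain \<omega> u where X: "X = (\<omega>, u)" by (cases X)
  have "rotf h' (rotf h \<omega>) = rotf (\<lambda>q. h q ** h' q) \<omega>"
  proof (intro ext)
    fix k q i
    show "rotf h' (rotf h \<omega>) k q i = rotf (\<lambda>q. h q ** h' q) \<omega> k q i"
    proof (cases "k \<in> charts S \<and> q \<in> fst k")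
      case True
      then have k: "k \<in> charts S" "q \<in> fst k" by auto
      have "partial k i (\<lambda>q. h q ** h' q) q = h q ** partial k i h' q + partial k i h q ** h' q"
        by (rule partial_mm[OF gaugeD(1)[OF h(1) k] gaugeD(1)[OF h(2) k] chart_gchart[OF k(1)] k(2)])
      then show ?thesis
        using k gaugeD(2)[OF h(1) k] by (simp add: rotf_def adj2_mm mm_left_distrib mm_right_distrib mm_assoc)
    next
      case False
      then have "rotf g \<omega>' k q i = 0" for g \<omega>' unfolding rotf_def by (rule if_not_P)
      then show ?thesis by simp
    qed
  qed
  moreover have "rotu h' (rotu h u) = rotu (\<lambda>q. h q ** h' q) u"
    by (auto simp: rotu_def mm_assoc intro!: ext)
  ultimately show ?thesis using X h gauge_mult[OF h] by (simp add: rotation_eq)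
qed

lemma gauge_cong:
  assumes "gauge h" "\<And>q. q \<in> N \<Longrightarrow> h q = h' q"
  shows "gauge h'" "lorentz_rotation S h X = lorentz_rotation S h' X"
proof -
  have s: "sm_at k h' q" "partial k i h' q = partial k i h q" if "k \<in> charts S" "q \<in> fst k" for k q i
    using sm_at_cong[OF gaugeD(1)[OF assms(1) that] open_UNIV UNIV_I, of h']
      partial_cong[OF chart_gchart[OF that(1)] that(2) gaugeD(1)[OF assms(1) that] open_UNIV UNIV_I, of h']
      assms(2) chart_subset[OF that(1)] by auto
  show g: "gauge h'" using assms s unfolding gauge_def smooth_wrt_iff by auto
  obtain \<omega> u where X: "X = (\<omega>, u)" by (cases X)
  have "rotf h \<omega> = rotf h' \<omega>"
    using s(2) assms(2) chart_subset by (auto simp: rotf_def subset_iff intro!: ext)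
  moreover have "rotu h u = rotu h' u" using assms(2) circle_in by (auto simp: rotu_def intro!: ext)
  ultimately show "lorentz_rotation S h X = lorentz_rotation S h' X" by (simp add: X rotation_eq assms(1) g)
qed

lemma rotation_one:
  assumes "X \<in> configs S"
  shows "lorentz_rotation S (\<lambda>q. mat 1) X = X"
proof -
  obtain \<omega> u where X: "X = (\<omega>, u)" by (cases X)
  have g: "gauge (\<lambda>q. mat 1)" by (simp add: gauge_def smooth_wrt_iff)
  have "\<omega> \<in> sl2_forms S" "u \<in> extensional (labels S)" using assms X by (auto simp: configs_def boundary_variables_def)
  then have "rotf (\<lambda>q. mat 1) \<omega> = \<omega>" "rotu (\<lambda>q. mat 1) u = u"
    by (auto simp: rotf_def rotu_def sl2_forms_def chart_gchart extensional_def intro!: ext)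
  then show ?thesis by (simp add: X rotation_eq[OF g])
qed

lemma sl2_functionsD:
  assumes "m \<in> sl2_functions S"
  shows "k \<in> charts S \<Longrightarrow> q \<in> fst k \<Longrightarrow> sm_at k m q" "q \<in> N \<Longrightarrow> m q \<in> sl2"
  using assms by (auto simp: sl2_functions_def smooth_wrt_iff)

lemma sl2_functions_scale:
  assumes "m \<in> sl2_functions S"
  shows "(\<lambda>q. s *\<^sub>R m q) \<in> sl2_functions S"
  using assms by (auto simp: sl2_functions_def smooth_wrt_iff sl2_scaleR intro: sm_at_scaleR)

lemma gauge_exp:
  assumes "m \<in> sl2_functions S"
  shows "gauge (\<lambda>q. mexp (m q))"
  unfolding gauge_def smooth_wrt_iff
proof (intro conjI ballI)
  fix k q assume k: "k \<in> charts S" "q \<in> fst k"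
  have "sm_at k (\<lambda>q. mexp_sl2 (m q)) q"
    by (rule sm_at_compose[OF smooth_mexp_sl2 open_UNIV sl2_functionsD(1)[OF assms k] k(2)]) simp
  then show "sm_at k (\<lambda>q. mexp (m q)) q"
    by (rule sm_at_cong[OF _ open_UNIV UNIV_I])
      (use chart_subset[OF k(1)] sl2_functionsD(2)[OF assms] in \<open>auto simp: mexp_eq subset_iff\<close>)
qed (use mexp_SL2 sl2_functionsD(2)[OF assms] in blast)

section \<open>Invariance under gauge functions that lift to the covering group\<close>

definition lorentz_invariant :: "(('a, 'l) config \<Rightarrow> complex) \<Rightarrow> bool" where
  "lorentz_invariant \<Psi> \<longleftrightarrow> (\<forall>X\<in>configs S. \<forall>m\<in>sl2_functions S. lorentz_has S m \<Psi> X 0)"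

text \<open>The rotations by \<open>mexp (s *\<^sub>R m q)\<close> compose additively in
  \<open>s\<close>. The derivative at an arbitrary \<open>s\<close> is therefore the derivative at 0
  for the rotated configuration, which vanishes, and the state is constant in
  \<open>s\<close>.\<close>

lemma invariant_exp:
  assumes inv: "lorentz_invariant \<Psi>" and X: "X \<in> configs S" and m: "m \<in> sl2_functions S"
  shows "\<Psi> (lorentz_rotation S (\<lambda>q. mexp (m q)) X) = \<Psi> X"
proof -
  let ?R = "\<lambda>s X. lorentz_rotation S (\<lambda>q. mexp (s *\<^sub>R m q)) X"
  have g: "gauge (\<lambda>q. mexp (s *\<^sub>R m q))" for s by (rule gauge_exp[OF sl2_functions_scale[OF m]])
  have add: "?R t (?R s X) = ?R (s + t) X" for s t
    unfolding rotation_rotation[OF g g]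
    by (rule gauge_cong(2)[OF gauge_mult[OF g g]]) (simp add: mexp_add sl2_functionsD(2)[OF m])
  have "((\<lambda>s. \<Psi> (?R s X)) has_vector_derivative 0) (at s within UNIV)" for s
  proof -
    have "((\<lambda>t. \<Psi> (?R t (?R s X))) has_vector_derivative 0) (at 0)"
      using inv rotation_configs[OF X g] m by (auto simp: lorentz_invariant_def lorentz_has_def)
    then have "((\<lambda>t. \<Psi> (?R (s + t) X)) has_derivative (\<lambda>h. 0)) (at (s - s))" by (simp add: add has_vector_derivative_def)
    from has_derivative_compose[OF has_derivative_diff[OF has_derivative_ident has_derivative_const] this]
    show ?thesis by (simp add: has_vector_derivative_def)
  qed
  from has_vector_derivative_zero_constant[OF convex_UNIV this]
  obtain c where c: "\<And>s. \<Psi> (?R s X) = c" by auto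
  have "?R 0 X = X" using rotation_one[OF X] by simp
  then show ?thesis using c[of 0] c[of 1] by simp
qed

text \<open>The lift is part of the data, since a smooth map into SL(2) need not have a continuous
  one.\<close>

definition lifts :: "('a \<Rightarrow> (real \<Rightarrow> real^2^2) set) \<Rightarrow> bool" where
  "lifts \<kappa> \<longleftrightarrow> continuous_map (top_of_set N) SL2_ucover_topology \<kappa> \<and> smooth_wrt (charts S) (\<lambda>q. cover_proj (\<kappa> q))"

abbreviation rot where "rot \<kappa> \<equiv> lorentz_rotation S (\<lambda>q. cover_proj (\<kappa> q))"

lemma liftsD:
  assumes "lifts \<kappa>"
  shows "q \<in> N \<Longrightarrow> \<kappa> q \<in> carrier SL2_cover" "gauge (\<lambda>q. cover_proj (\<kappa> q))"
proof -
  show c: "\<kappa> q \<in> carrier SL2_cover" if "q \<in> N" for q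
    using assms that by (auto simp: lifts_def continuous_map_def SL2_cover_simps)
  show "gauge (\<lambda>q. cover_proj (\<kappa> q))" using assms cover_proj_SL2(1)[OF c] by (auto simp: lifts_def gauge_def)
qed

text \<open>The path t -> exp (t m) is a canonical lift of exp m. For continuity, moving the point
  along \<open>g\<close> sweeps out a square with one constant edge, so the new class is the old one
  prolonged by the moving end point.\<close>

lemma lifts_exp:
  assumes m: "m \<in> sl2_functions S"
  shows "lifts (\<lambda>q. path_class SL2 (\<lambda>t. mexp (t *\<^sub>R m q)))" "q \<in> N \<Longrightarrow> cover_proj (path_class SL2 (\<lambda>t. mexp (t *\<^sub>R m q))) = mexp (m q)"
proof -
  let ?\<kappa> = "\<lambda>q. path_class SL2 (\<lambda>t. mexp (t *\<^sub>R m q))"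
  have cm: "continuous_on N m" unfolding continuous_on_eq_continuous_within
  proof
    fix q assume "q \<in> N"
    then obtain k where k: "k \<in> charts S" "q \<in> fst k" using charts_cover by blast
    show "continuous (at q within N) m" by (rule sm_at_continuous[OF k sl2_functionsD(1)[OF m k]])
  qed
  have p: "(\<lambda>t. mexp (t *\<^sub>R m q)) \<in> paths_from SL2 (mat 1)" "pathfinish (\<lambda>t. mexp (t *\<^sub>R m q)) = mexp (m q)" if "q \<in> N" for q
  proof -
    note mq = sl2_functionsD(2)[OF m that]
    have "continuous_on {0..1} (\<lambda>t. mexp (t *\<^sub>R m q))"
      by (rule continuous_on_compose2[OF continuous_on_mexp]) (auto intro!: continuous_intros sl2_scaleR mq)
    then show "(\<lambda>t. mexp (t *\<^sub>R m q)) \<in> paths_from SL2 (mat 1)"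
      by (auto simp: paths_from_def path_def path_image_def pathstart_def intro!: mexp_SL2 sl2_scaleR mq)
  qed (simp add: pathfinish_def)
  show pr: "cover_proj (?\<kappa> q) = mexp (m q)" if "q \<in> N" for q
    using p[OF that] by (simp add: cover_proj_class paths_from_def)
  show "lifts ?\<kappa>" unfolding lifts_def
  proof
    show "smooth_wrt (charts S) (\<lambda>q. cover_proj (?\<kappa> q))"
      using gauge_cong(1)[OF gauge_exp[OF m], of "\<lambda>q. cover_proj (?\<kappa> q)"] pr by (simp add: gauge_def)
    show "continuous_map (top_of_set N) SL2_ucover_topology ?\<kappa>"
      unfolding continuous_map_ucover_iff topspace_euclidean_subtopology
    proof (intro conjI ballI allI impI)
      show "?\<kappa> \<in> N \<rightarrow> ucover SL2 (mat 1)" using p by (auto simp: ucover_eq)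
      fix q V assume q: "q \<in> N" and V: "open V" "cover_proj (?\<kappa> q) \<in> V"
      have "continuous_on N (\<lambda>q. mexp (m q))"
        by (rule continuous_on_compose2[OF continuous_on_mexp cm]) (use sl2_functionsD(2)[OF m] in auto)
      then have o: "openin (top_of_set N) (N \<inter> (\<lambda>q. mexp (m q)) -` V)" using V(1) by (rule continuous_openin_preimage_gen)
      obtain k where k: "k \<in> charts S" "q \<in> fst k" using charts_cover[OF q] by blast
      have qo: "q \<in> N \<inter> (\<lambda>q. mexp (m q)) -` V" using q V pr[OF q] by simp
      obtain r where r: "r > 0" "ball (snd k q) r \<inter> half_plane \<subseteq> snd k ` fst k"
        "\<And>q'. q' \<in> fst k \<Longrightarrow> snd k q' \<in> ball (snd k q) r \<Longrightarrow> q' \<in> N \<inter> (\<lambda>q. mexp (m q)) -` V"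
        by (rule coord_ball[OF k o qo open_UNIV UNIV_I]) blast
      let ?B = "kball k (snd k q) r"
      have qB: "q \<in> ?B" using k r by simp
      have "?\<kappa> q' \<in> prolongations SL2 (?\<kappa> q) V" if q': "q' \<in> ?B" for q'
      proof -
        obtain g where g: "g \<in> paths_from N q" "path_image g \<subseteq> ?B" "pathfinish g = q'" using kball_path[OF k(1) r(2) qB q'] by blast
        have gN: "g s \<in> N" "g s \<in> ?B" if "s \<in> {0..1}" for s using g that unfolding paths_from_def path_image_def by blast+
        have ge: "g 0 = q" "g 1 = q'" using g by (auto simp: paths_from_def pathstart_def pathfinish_def)
        \<comment> \<open>The first coordinate moves the point along \<open>g\<close>, the second
          scales the exponent; the edge where the exponent is 0 is constant.\<close>
        let ?K = "\<lambda>z::real\<times>real. mexp (snd z *\<^sub>R m (g (fst z)))"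
        have "path g" using g by (simp add: paths_from_def)
        then have "continuous_on {0..1} (\<lambda>s. m (g s))"
          by (intro continuous_on_compose2[OF cm]) (use gN in \<open>auto simp: path_def\<close>)
        then have "continuous_on ({0..1} \<times> {0..1}) (\<lambda>z::real\<times>real. m (g (fst z)))"
          by (rule continuous_on_compose2[OF _ continuous_on_fst[OF continuous_on_id]]) auto
        then have "continuous_on ({0..1} \<times> {0..1}) ?K"
          by (intro continuous_on_compose2[OF continuous_on_mexp]) (use gN sl2_functionsD(2)[OF m] in \<open>auto intro!: continuous_intros sl2_scaleR\<close>)
        moreover have "?K ` ({0..1} \<times> {0..1}) \<subseteq> SL2" using gN sl2_functionsD(2)[OF m] by (auto intro!: mexp_SL2 sl2_scaleR)
        ultimately have "homotopic_paths SL2 ((\<lambda>t. ?K (0, t)) +++ (\<lambda>s. ?K (s, 1))) (\<lambda>t. ?K (1, t))"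
          by (rule homotopic_square) simp
        then have e: "?\<kappa> q' = path_class SL2 ((\<lambda>t. mexp (t *\<^sub>R m q)) +++ (\<lambda>s. mexp (m (g s))))"
          using path_class_cong[of SL2] ge by (simp add: homotopic_paths_sym_eq)
        have "continuous_on {0..1} (\<lambda>s. mexp (m (g s)))"
          by (rule continuous_on_compose2[OF continuous_on_mexp continuous_on_compose2[OF cm]])
            (use \<open>path g\<close> gN sl2_functionsD(2)[OF m] in \<open>auto simp: path_def\<close>)
        then have v: "(\<lambda>s. mexp (m (g s))) \<in> paths_from SL2 (mexp (m q))"
          using gN sl2_functionsD(2)[OF m] ge by (auto simp: paths_from_def path_def path_image_def pathstart_def intro!: mexp_SL2)
        have "path_image (\<lambda>s. mexp (m (g s))) \<subseteq> V" using gN(2) r(3) by (auto simp: path_image_def)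
        moreover have "?\<kappa> q' = extend SL2 (?\<kappa> q) (\<lambda>s. mexp (m (g s)))"
          unfolding e by (rule extend_class[symmetric]) (use p[OF q] v in \<open>auto simp: paths_from_def\<close>)
        ultimately show ?thesis using v pr[OF q] by (auto simp: prolongations_eq)
      qed
      then show "\<exists>Om. openin (top_of_set N) Om \<and> q \<in> Om \<and> ?\<kappa> ` Om \<subseteq> prolongations SL2 (?\<kappa> q) V"
        using kball_openin[OF k(1), of "snd k q" r] qB by (intro exI[of _ ?B]) auto
    qed
  qed
qed

text \<open>Near \<open>q\<close> the logarithm of the lift differs from its value at
  \<open>q\<close> by the principal logarithm of a quotient of first columns. Restricting to the
  matrices where that quotient lies in the right half plane makes both parts smooth functions of the
  matrix.\<close>

lemma lifts_lz_smooth: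
  assumes \<kappa>: "lifts \<kappa>" and k: "k \<in> charts S" "q \<in> fst k"
  shows "sm_at k (\<lambda>q. Re (lz (\<kappa> q))) q" "sm_at k (\<lambda>q. Im (lz (\<kappa> q))) q"
proof -
  have q: "q \<in> N" using k chart_subset by blast
  let ?w = "fcol (cover_proj (\<kappa> q))"
  have w: "?w \<noteq> 0" using fcol_nonzero cover_proj_SL2(1)[OF liftsD(1)[OF \<kappa> q]] by blast
  let ?L = "\<lambda>A. fcol A / ?w"
  define T where "T = (\<lambda>A. Re (?L A)) -` {0<..}"
  have bl: "bounded_linear (\<lambda>A. Re (?L A))" "bounded_linear (\<lambda>A. Im (?L A))"
    by (intro bounded_linear_compose[OF bounded_linear_Re] bounded_linear_compose[OF bounded_linear_Im]
        bounded_linear_compose[OF bounded_linear_divide] bounded_linear_fcol)+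
  have T: "open T" unfolding T_def by (rule open_vimage) (use linear_continuous_on[OF bl(1)] in auto)
  have qT: "cover_proj (\<kappa> q) \<in> T" using w by (simp add: T_def)
  obtain Om where Om: "openin (top_of_set N) Om" "q \<in> Om" "\<kappa> ` Om \<subseteq> prolongations SL2 (\<kappa> q) T"
    using \<kappa> q T qT unfolding lifts_def continuous_map_ucover_iff by force
  have eq: "lz (\<kappa> q') = lz (\<kappa> q) + Ln (?L (cover_proj (\<kappa> q')))" and inT: "cover_proj (\<kappa> q') \<in> T" if q': "q' \<in> Om" for q'
  proof -
    have "\<kappa> q' \<in> prolongations SL2 (\<kappa> q) T" using Om q' by blast
    then obtain v where v: "v \<in> paths_from SL2 (cover_proj (\<kappa> q))" "path_image v \<subseteq> T" "\<kappa> q' = extend SL2 (\<kappa> q) v"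
      by (auto simp: prolongations_eq)
    have c: "\<kappa> q \<in> carrier SL2_cover" by (rule liftsD(1)[OF \<kappa> q])
    have f: "cover_proj (\<kappa> q') = pathfinish v" unfolding v(3) by (rule extend_in(2)) (use c v(1) in \<open>auto simp: SL2_cover_simps\<close>)
    show "cover_proj (\<kappa> q') \<in> T" unfolding f using v(2) pathfinish_in_path_image by blast
    have "0 < Re (?L (v t))" if "t \<in> {0..1}" for t using v(2) that by (auto simp: path_image_def T_def image_subset_iff)
    then show "lz (\<kappa> q') = lz (\<kappa> q) + Ln (?L (cover_proj (\<kappa> q')))" unfolding f unfolding v(3) by (intro lz_extend c v(1))
  qed
  obtain V where V: "open V" "snd k q \<in> V" "\<forall>q'\<in>fst k. snd k q' \<in> V \<longrightarrow> q' \<in> Om"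
    using chart_nbhd[OF k(1) Om(1) k(2) Om(2)] by blast
  let ?x = "\<lambda>A. Re (?L A)" and ?y = "\<lambda>A. Im (?L A)"
  have sx: "smooth_on T ?x" and sy: "smooth_on T ?y" using bl T by (auto intro: smooth_on_bounded_linear)
  have "smooth_on T (\<lambda>A. ln (?x A * ?x A + ?y A * ?y A))"
    by (rule smooth_on_compose[OF T _ _ smooth_on_ln])
      (auto simp: T_def add_pos_nonneg intro!: smooth_on_add smooth_on_mult T sx[unfolded T_def] sy[unfolded T_def] T[unfolded T_def])
  then have F1: "smooth_on T (\<lambda>A. ln (?x A * ?x A + ?y A * ?y A) / 2)"
    by (rule smooth_on_linear_comp[OF bounded_linear_divide T])
  have "smooth_on T (\<lambda>A. inverse (?x A))"
    by (rule smooth_on_compose[OF T _ _ smooth_on_inverse sx]) (auto simp: T_def)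
  then have F2: "smooth_on T (\<lambda>A. arctan (?y A * inverse (?x A)))"
    by (intro smooth_on_compose[OF T _ _ smooth_on_arctan] smooth_on_mult T sy) auto
  have sk: "sm_at k (\<lambda>q. cover_proj (\<kappa> q)) q" by (rule gaugeD(1)[OF liftsD(2)[OF \<kappa>] k])
  let ?k = "\<lambda>q'. cover_proj (\<kappa> q')"
  have "sm_at k (\<lambda>q'. Re (lz (\<kappa> q)) + ln (?x (?k q') * ?x (?k q') + ?y (?k q') * ?y (?k q')) / 2) q"
    by (intro sm_at_add sm_at_const sm_at_compose[OF F1 T sk k(2) qT])
  then show "sm_at k (\<lambda>q. Re (lz (\<kappa> q))) q"
    by (rule sm_at_cong[OF _ V(1,2)]) (use V(3) eq inT Ln_right_half_plane(1) in \<open>auto simp: T_def\<close>)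
  have "sm_at k (\<lambda>q'. Im (lz (\<kappa> q)) + arctan (?y (?k q') * inverse (?x (?k q')))) q"
    by (intro sm_at_add sm_at_const sm_at_compose[OF F2 T sk k(2) qT])
  then show "sm_at k (\<lambda>q. Im (lz (\<kappa> q))) q"
    by (rule sm_at_cong[OF _ V(1,2)]) (use V(3) eq inT Ln_right_half_plane(2) in \<open>auto simp: T_def\<close>)
qed

text \<open>The Iwasawa decomposition; the lift makes the rotation angle a single valued function.\<close>
lemma lifts_factor:
  assumes \<kappa>: "lifts \<kappa>"
  shows "\<exists>m1\<in>sl2_functions S. \<exists>m2\<in>sl2_functions S. \<exists>m3\<in>sl2_functions S.
    \<forall>q\<in>N. cover_proj (\<kappa> q) = mexp (m1 q) ** mexp (m2 q) ** mexp (m3 q)"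
proof -
  let ?k = "\<lambda>q. cover_proj (\<kappa> q)"
  define \<rho> where "\<rho> = (\<lambda>q. Re (lz (\<kappa> q)))"
  define \<theta> where "\<theta> = (\<lambda>q. Im (lz (\<kappa> q)))"
  define m1 where "m1 = (\<lambda>q. mk2 0 (- \<theta> q) (\<theta> q) 0)"
  define m2 where "m2 = (\<lambda>q. mk2 (\<rho> q) 0 0 (- \<rho> q))"
  define m3 where "m3 = (\<lambda>q. mk2 0 (exp (- 2 * \<rho> q) * (?k q $ 1 $ 1 * ?k q $ 1 $ 2 + ?k q $ 2 $ 1 * ?k q $ 2 $ 2)) 0 0)"
  have s: "sm_at k \<rho> q" "sm_at k \<theta> q" "sm_at k (\<lambda>q. ?k q $ i $ j) q" if "k \<in> charts S" "q \<in> fst k" for k q i j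
    using lifts_lz_smooth[OF \<kappa> that] sm_at_component[OF sm_at_component[OF gaugeD(1)[OF liftsD(2)[OF \<kappa>] that]]]
    by (auto simp: \<rho>_def \<theta>_def)
  have "sm_at k (\<lambda>q. exp (- 2 * \<rho> q)) q" if "k \<in> charts S" "q \<in> fst k" for k q
    by (rule sm_at_compose[OF smooth_on_exp open_UNIV _ that(2) UNIV_I]) (intro sm_at_mult sm_at_const s that)
  then have "m1 \<in> sl2_functions S" "m2 \<in> sl2_functions S" "m3 \<in> sl2_functions S"
    unfolding sl2_functions_def smooth_wrt_iff m1_def m2_def m3_def
    by (auto intro!: sm_at_mk2 sm_at_minus sm_at_mult sm_at_add s simp: mk2_sl2)
  moreover have "?k q = mexp (m1 q) ** mexp (m2 q) ** mexp (m3 q)" if q: "q \<in> N" for q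
    unfolding m1_def m2_def m3_def
  proof (rule iwasawa)
    show "?k q \<in> SL2" using cover_proj_SL2(1)[OF liftsD(1)[OF \<kappa> q]] .
    have "exp (lz (\<kappa> q)) = fcol (?k q)" by (rule lz_exp[OF liftsD(1)[OF \<kappa> q]])
    then show "?k q $ 1 $ 1 = exp (\<rho> q) * cos (\<theta> q)" "?k q $ 2 $ 1 = exp (\<rho> q) * sin (\<theta> q)"
      by (auto simp: fcol_def \<rho>_def \<theta>_def complex_eq_iff Re_exp Im_exp)
  qed
  ultimately show ?thesis by blast
qed

lemma invariant_lifts:
  assumes inv: "lorentz_invariant \<Psi>" and X: "X \<in> configs S" and \<kappa>: "lifts \<kappa>"
  shows "\<Psi> (rot \<kappa> X) = \<Psi> X"
proof -
  obtain m1 m2 m3 where m: "m1 \<in> sl2_functions S" "m2 \<in> sl2_functions S" "m3 \<in> sl2_functions S"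
    and e: "\<And>q. q \<in> N \<Longrightarrow> cover_proj (\<kappa> q) = mexp (m1 q) ** mexp (m2 q) ** mexp (m3 q)"
    using lifts_factor[OF \<kappa>] by blast
  note g = gauge_exp[OF m(1)] gauge_exp[OF m(2)] gauge_exp[OF m(3)]
  have "rot \<kappa> X =
    lorentz_rotation S (\<lambda>q. mexp (m1 q) ** mexp (m2 q) ** mexp (m3 q)) X"
    by (rule gauge_cong(2)[OF liftsD(2)[OF \<kappa>] e])
  also have "\<dots> = lorentz_rotation S (\<lambda>q. mexp (m3 q)) (lorentz_rotation S (\<lambda>q. mexp (m2 q)) (lorentz_rotation S (\<lambda>q. mexp (m1 q)) X))"
    by (simp add: rotation_rotation g gauge_mult)
  finally show ?thesis by (simp add: invariant_exp[OF inv _ m(1)] invariant_exp[OF inv _ m(2)] invariant_exp[OF inv _ m(3)] X rotation_configs g)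
qed

end

subsection \<open>The Hamilton constraint\<close>

lemma integral_pos_if_pos_on_open:
  fixes f :: "'a::euclidean_space \<Rightarrow> real"
  assumes f: "integrable lborel f" "\<And>x. 0 \<le> f x" and B: "open B" "B \<noteq> {}" "\<And>x. x \<in> B \<Longrightarrow> 0 < f x"
  shows "0 < integral\<^sup>L lborel f"
proof (rule ccontr)
  assume "\<not> ?thesis"
  then have "integral\<^sup>L lborel f = 0" using integral_nonneg_AE[of f lborel] f(2) by (simp add: antisym)
  then have "AE x in lborel. f x = 0" using integral_nonneg_eq_0_iff_AE[OF f(1)] f(2) by simp
  then obtain M where M: "M \<in> null_sets lborel" "\<And>x. x \<notin> M \<Longrightarrow> f x = 0" by (auto elim!: AE_E3)
  then have "negligible M" by (simp add: negligible_iff_null_sets null_sets_completionI)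
  moreover have "B \<subseteq> M" using M(2) B(3) by fastforce
  ultimately show False using open_not_negligible[OF B(1,2)] negligible_subset by blast
qed

lemma trace_transpose_mult_pos:
  fixes A :: "real^2^2"
  assumes "A \<noteq> 0"
  shows "0 < trace (transpose A ** A)"
proof -
  have "A $ 1 $ 1 \<noteq> 0 \<or> A $ 1 $ 2 \<noteq> 0 \<or> A $ 2 $ 1 \<noteq> 0 \<or> A $ 2 $ 2 \<noteq> 0" using assms by (auto simp: vec_eq_iff forall_2)
  then have "0 < (A $ 1 $ 1)\<^sup>2 + (A $ 1 $ 2)\<^sup>2 + ((A $ 2 $ 1)\<^sup>2 + (A $ 2 $ 2)\<^sup>2)"
    by (metis add_nonneg_pos add_pos_nonneg sum_power2_ge_zero sum_power2_gt_zero_iff)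
  then show ?thesis by (simp add: trace_def transpose_def matrix_matrix_mult_def sum_2 power2_eq_square algebra_simps)
qed

lemma periodic_reduce:
  fixes f :: "real \<Rightarrow> 'b"
  assumes p: "\<And>x. f (x + 2 * pi) = f x"
  shows "\<exists>t\<in>{0..<2 * pi}. f x = f t"
proof -
  define n where "n = \<lfloor>x / (2 * pi)\<rfloor>"
  have shift: "f (x + of_nat m * (2 * pi)) = f x" for x m
  proof (induction m)
    case (Suc m)
    have "f (x + of_nat (Suc m) * (2 * pi)) = f ((x + of_nat m * (2 * pi)) + 2 * pi)" by (simp add: algebra_simps)
    then show ?case by (simp only: p Suc)
  qed simp
  have shift': "f (x + of_int m * (2 * pi)) = f x" for x and m :: int
  proof (cases "m \<ge> 0")
    case True then show ?thesis using shift[of x "nat m"] by simp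
  next
    case False
    then have "of_nat (nat (- m)) = - (of_int m :: real)" by simp
    then show ?thesis using shift[of "x + of_int m * (2 * pi)" "nat (- m)"] by simp
  qed
  have "0 \<le> x / (2 * pi) - of_int n" "x / (2 * pi) - of_int n < 1" unfolding n_def by linarith+
  then have "0 \<le> (x / (2 * pi) - of_int n) * (2 * pi)" "(x / (2 * pi) - of_int n) * (2 * pi) < 1 * (2 * pi)"
    by (intro mult_nonneg_nonneg mult_strict_right_mono; simp)+
  moreover have "(x / (2 * pi) - of_int n) * (2 * pi) = x + of_int (- n) * (2 * pi)" by (simp add: algebra_simps)
  ultimately show ?thesis using shift'[of x "- n"] by (intro bexI[of _ "x + of_int (- n) * (2 * pi)"]) auto
qed

lemma has_vector_derivative_shift:
  assumes "(f has_vector_derivative D) (at (x + a))"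
  shows "((\<lambda>t. f (t + a)) has_vector_derivative D) (at x)"
proof -
  have "((\<lambda>t. t + a) has_vector_derivative 1) (at x)" by (auto intro!: derivative_eq_intros)
  from vector_diff_chain_at[OF this] assms show ?thesis by (simp add: o_def)
qed

lemma SL2_derivative_traceless:
  fixes u :: "real \<Rightarrow> real^2^2"
  assumes d: "(u has_vector_derivative D) (at t)" and u: "\<And>t. u t \<in> SL2"
  shows "adj2 (u t) ** D \<in> sl2"
proof -
  have "((\<lambda>t. adj2 (u t) ** u t) has_vector_derivative adj2 (u t) ** D + adj2 D ** u t) (at t)"
    by (rule bounded_bilinear.has_vector_derivative[OF bilinear_mm bounded_linear.has_vector_derivative[OF bounded_linear_adj2 d] d])
  then have "((\<lambda>t. mat 1 :: real^2^2) has_vector_derivative adj2 (u t) ** D + adj2 D ** u t) (at t)" using u by simp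
  then have "adj2 (u t) ** D + adj2 D ** u t = 0" using has_vector_derivative_const vector_derivative_unique_at by blast
  then have "trace (adj2 (u t) ** D) + trace (adj2 (adj2 (u t) ** D)) = trace (0 :: real^2^2)" by (simp add: adj2_mm flip: trace_add)
  moreover have "trace (adj2 A) = trace A" for A by (simp add: adj2_def trace_def sum_2 mat_def)
  moreover have "trace (0 :: real^2^2) = 0" by (simp add: trace_def)
  ultimately show ?thesis by (simp add: sl2_iff)
qed

section \<open>Bump functions, partitions of unity and the surface integral\<close>

context surf begin

lemma smooth_wrt_continuous: "smooth_wrt (charts S) f \<Longrightarrow> continuous_on N f"
  unfolding continuous_on_eq_continuous_within
proof
  fix q assume f: "smooth_wrt (charts S) f" and "q \<in> N"
  then obtain k where k: "k \<in> charts S" "q \<in> fst k" using charts_cover by blast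
  show "continuous (at q within N) f" by (rule sm_at_continuous[OF k]) (use f k in \<open>auto simp: smooth_wrt_iff\<close>)
qed

text \<open>A coordinate bump function continued by 0. The compact carrier \<open>C\<close> is
  recorded because closedness makes the continuation smooth and compactness later gives
  integrability.\<close>

lemma bump_exists:
  assumes k: "k \<in> charts S" "q \<in> fst k" and U: "openin (top_of_set N) U" "q \<in> U"
  shows "\<exists>\<beta> C. smooth_wrt (charts S) \<beta> \<and> (\<forall>x. 0 \<le> (\<beta> x :: real)) \<and> 0 < \<beta> q \<and> compact C \<and> C \<subseteq> fst k \<inter> U \<and> (\<forall>x. \<beta> x \<noteq> 0 \<longrightarrow> x \<in> C)"
proof -
  let ?p = "snd k q"
  obtain r0 where r0: "r0 > 0" "ball ?p r0 \<inter> half_plane \<subseteq> snd k ` fst k"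
    "\<And>q'. q' \<in> fst k \<Longrightarrow> snd k q' \<in> ball ?p r0 \<Longrightarrow> q' \<in> U"
    by (rule coord_ball[OF k U open_UNIV UNIV_I]) blast
  define r where "r = r0 / 2"
  have r: "r > 0" "cball ?p r \<subseteq> ball ?p r0" using r0 by (auto simp: r_def)
  note i = kball_inv[OF k(1) r0(2)]
  define C where "C = inv_into (fst k) (snd k) ` (cball ?p r \<inter> half_plane)"
  have sub: "cball ?p r \<inter> half_plane \<subseteq> ball ?p r0 \<inter> half_plane" using r by blast
  have C: "compact C" unfolding C_def
    by (rule compact_continuous_image[OF continuous_on_subset[OF i(1) sub]]) (intro compact_Int_closed compact_cball closed_half_plane)
  have CU: "C \<subseteq> fst k \<inter> U"
  proof
    fix x assume "x \<in> C"
    then obtain y where y: "y \<in> cball ?p r \<inter> half_plane" "x = inv_into (fst k) (snd k) y" by (auto simp: C_def)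
    then have "x \<in> kball k ?p r0" using i(2)[of y] sub by blast
    then show "x \<in> fst k \<inter> U" using r0(3) by blast
  qed
  define \<beta> where "\<beta> = (\<lambda>x. if x \<in> fst k then bump ?p r (snd k x) else 0)"
  have \<beta>C: "x \<in> C" if "\<beta> x \<noteq> 0" for x
  proof -
    have x: "x \<in> fst k" "snd k x \<in> ball ?p r" using that bump_eq_0_iff[OF r(1)] by (auto simp: \<beta>_def split: if_splits)
    then show ?thesis unfolding C_def using i(3)[OF x(1)] chart_half_plane[OF k(1) x(1)] by (metis IntI ball_subset_cball imageI subsetD)
  qed
  have "smooth_wrt (charts S) \<beta>"
  proof (rule smooth_wrtI)
    fix x assume x: "x \<in> N"
    show "\<exists>k\<in>charts S. x \<in> fst k \<and> sm_at k \<beta> x"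
    proof (cases "x \<in> fst k")
      case True
      have "ext k UNIV (bump ?p r) \<beta>" by (auto simp: ext_def \<beta>_def smooth_bump)
      then show ?thesis using True k(1) by (auto intro: sm_atI)
    next
      case False
      obtain k' where k': "k' \<in> charts S" "x \<in> fst k'" using charts_cover[OF x] by blast
      \<comment> \<open>Outside the chart the function vanishes near \<open>x\<close>: the carrier
        is compact in a Hausdorff space, hence closed.\<close>
      have "openin (top_of_set N) (N \<inter> - C)" using compact_imp_closed[OF C] by (simp add: openin_open_Int open_Compl)
      moreover have "x \<in> N \<inter> - C" using x False CU by blast
      ultimately obtain V where V: "open V" "snd k' x \<in> V" "\<forall>q'\<in>fst k'. snd k' q' \<in> V \<longrightarrow> q' \<in> N \<inter> - C"
        using chart_nbhd[OF k'(1) _ k'(2)] by blast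
      have "sm_at k' \<beta> x" by (rule sm_at_cong[OF sm_at_const[of _ 0] V(1,2)]) (use V(3) \<beta>C in force)
      then show ?thesis using k' by blast
    qed
  qed
  moreover have "0 < \<beta> q" using k(2) bump_pos_iff[OF r(1), of ?p ?p] r(1) by (simp add: \<beta>_def)
  moreover have "0 \<le> \<beta> x" for x by (simp add: \<beta>_def bump_nonneg)
  ultimately show ?thesis using C CU \<beta>C by blast
qed

text \<open>\<open>surface_integral\<close> selects some partition of unity, so nothing can be said
  about its value before one is known to exist. Finitely many bump functions are positive somewhere
  at each point, and are divided by their sum.\<close>

lemma partition_of_unity_exists: "\<exists>K \<rho>. partition_of_unity S K \<rho>"
proof -
  define P where "P = (\<lambda>q k (\<beta> :: 'a \<Rightarrow> real) C. k \<in> charts S \<and> smooth_wrt (charts S) \<beta> \<and> (\<forall>x. 0 \<le> \<beta> x) \<and> 0 < \<beta> q \<and> compact C \<and> C \<subseteq> fst k \<and> (\<forall>x. \<beta> x \<noteq> 0 \<longrightarrow> x \<in> C))"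
  have "\<exists>k \<beta> C. P q k \<beta> C" if q: "q \<in> N" for q
  proof -
    obtain k where k: "k \<in> charts S" "q \<in> fst k" using charts_cover[OF q] by blast
    have "openin (top_of_set N) N" by simp
    from bump_exists[OF k this q] show ?thesis using k(1) unfolding P_def by blast
  qed
  then obtain kk \<beta> C where "\<And>q. q \<in> N \<Longrightarrow> P q (kk q) (\<beta> q) (C q)" by metis
  then have b: "\<And>q. q \<in> N \<Longrightarrow> kk q \<in> charts S" "\<And>q. q \<in> N \<Longrightarrow> smooth_wrt (charts S) (\<beta> q)"
    "\<And>q x. q \<in> N \<Longrightarrow> 0 \<le> (\<beta> q x :: real)" "\<And>q. q \<in> N \<Longrightarrow> 0 < \<beta> q q" "\<And>q. q \<in> N \<Longrightarrow> compact (C q)"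
    "\<And>q. q \<in> N \<Longrightarrow> C q \<subseteq> fst (kk q)" "\<And>q x. q \<in> N \<Longrightarrow> \<beta> q x \<noteq> 0 \<Longrightarrow> x \<in> C q"
    unfolding P_def by blast+
  have "\<exists>T. open T \<and> N \<inter> \<beta> q -` {0<..} = N \<inter> T" if "q \<in> N" for q
    using continuous_openin_preimage_gen[OF smooth_wrt_continuous[OF b(2)[OF that]], of "{0<..}"] by (auto simp: openin_open)
  then obtain T where T: "\<And>q. q \<in> N \<Longrightarrow> open (T q)" "\<And>q. q \<in> N \<Longrightarrow> N \<inter> \<beta> q -` {0<..} = N \<inter> T q" by metis
  have "N \<subseteq> (\<Union>q\<in>N. T q)" using T(2) b(4) by blast
  from compactE_image[OF compact T(1) this]
  obtain F where F: "F \<subseteq> N" "finite F" "N \<subseteq> (\<Union>q\<in>F. T q)" by blast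
  define \<tau> where "\<tau> = (\<lambda>x. \<Sum>q\<in>F. \<beta> q x)"
  have \<tau>: "0 < \<tau> x" if x: "x \<in> N" for x
  proof -
    obtain q where q: "q \<in> F" "x \<in> T q" using F x by blast
    then have "0 < \<beta> q x" using T(2)[of q] F x by blast
    then show ?thesis unfolding \<tau>_def using q F b(3) by (intro sum_pos2[of F q]) auto
  qed
  \<comment> \<open>Several of the selected points may have the same chart, while a partition is
    indexed by charts; their bump functions are added up.\<close>
  define \<rho> where "\<rho> = (\<lambda>k x. (\<Sum>q\<in>{q \<in> F. kk q = k}. \<beta> q x) / \<tau> x)"
  have "partition_of_unity S (kk ` F) \<rho>"
    unfolding partition_of_unity_def
  proof (intro conjI ballI)
    show "finite (kk ` F)" using F by simp
    show "kk ` F \<subseteq> charts S" using F b(1) by blast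
    show "continuous_on N (\<rho> k)" for k unfolding \<rho>_def \<tau>_def
      by (intro continuous_intros smooth_wrt_continuous b) (use F \<tau> in \<open>auto simp: \<tau>_def less_imp_neq[symmetric] subset_iff\<close>)
    show "0 \<le> \<rho> k x" if "x \<in> N" for k x unfolding \<rho>_def using F b(3) \<tau>[OF that]
      by (intro divide_nonneg_pos sum_nonneg) auto
    show "N \<inter> closure {q \<in> N. \<rho> k q \<noteq> 0} \<subseteq> fst k" for k
    proof -
      let ?F = "{q \<in> F. kk q = k}"
      have "{q \<in> N. \<rho> k q \<noteq> 0} \<subseteq> (\<Union>q\<in>?F. C q)"
      proof clarify
        fix x assume "\<rho> k x \<noteq> 0"
        then have "(\<Sum>q\<in>?F. \<beta> q x) \<noteq> 0" by (auto simp: \<rho>_def)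
        then obtain q where "q \<in> ?F" "\<beta> q x \<noteq> 0" by (meson sum.not_neutral_contains_not_neutral)
        then show "x \<in> (\<Union>q\<in>?F. C q)" using b(7)[of q x] F by blast
      qed
      moreover have "closed (\<Union>q\<in>?F. C q)" using F b(5) compact_imp_closed by (intro closed_UN) auto
      ultimately have "closure {q \<in> N. \<rho> k q \<noteq> 0} \<subseteq> (\<Union>q\<in>?F. C q)" by (rule closure_minimal)
      also have "\<dots> \<subseteq> fst k" using b(6) F by blast
      finally show ?thesis by blast
    qed
    fix x assume x: "x \<in> N"
    have "(\<Sum>k\<in>kk ` F. \<Sum>q\<in>{q \<in> F. kk q = k}. \<beta> q x) = \<tau> x"
      unfolding \<tau>_def by (rule sum.group) (use F in auto)
    then show "(\<Sum>k\<in>kk ` F. \<rho> k x) = 1" using \<tau>[OF x] by (simp add: \<rho>_def flip: sum_divide_distrib)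
  qed
  then show ?thesis by blast
qed

lemma surface_integral_eq:
  obtains K \<rho> where "partition_of_unity S K \<rho>"
    "\<And>\<mu>. surface_integral S \<mu> = (\<Sum>k\<in>K. LINT p:snd k ` fst k|lborel. in_coords k (\<lambda>q. \<rho> k q * \<mu> k q) p)"
proof -
  define P where "P = (SOME (K, \<rho>). partition_of_unity S K \<rho>)"
  obtain K \<rho> where P: "P = (K, \<rho>)" by (cases P)
  have "case P of (K, \<rho>) \<Rightarrow> partition_of_unity S K \<rho>"
    unfolding P_def by (rule someI_ex) (use partition_of_unity_exists in auto)
  then show thesis by (intro that[of K \<rho>]) (auto simp: P surface_integral_def P_def[symmetric])
qed

lemma hamilton_eq:
  "hamilton hbar S n (\<omega>, u) = \<i> / of_real hbar * of_real (surface_integral S (\<lambda>k q. trace (n q ** curvature \<omega> k q 1 2)) +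
     (\<Sum>l\<in>labels S. LINT \<phi>:{0..2 * pi}|lborel.
        trace (n (circle S l \<phi>) ** (matrix_inv (u l \<phi>) ** vector_derivative (u l) (at \<phi>) - tangential S \<omega> l \<phi>))))"
proof -
  have "(\<Sum>i\<in>UNIV. \<Sum>j\<in>UNIV. 1 / 2 * levi_civita i j * trace (n q ** curvature \<omega> k q i j)) = trace (n q ** curvature \<omega> k q 1 2)" for k q
    using curvature_antisym(1)[of \<omega> k q 2 1] trace_scaleR[of "-1" "n q ** curvature \<omega> k q 1 2"]
    by (simp add: sum_2 levi_civita_def)
  then show ?thesis by (simp add: hamilton_def algebra_simps)
qed

lemma curvature_sm_at:
  assumes \<omega>: "\<omega> \<in> sl2_forms S" and k: "k \<in> charts S" "q \<in> fst k"
  shows "sm_at k (\<lambda>q. curvature \<omega> k q i j) q"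
  unfolding curvature_def
  by (intro sm_at_add sm_at_diff sm_at_mm form_smooth[OF \<omega> k] sm_at_partial[OF chart_gchart[OF k(1)] k(2)])

lemma curvature_sl2:
  assumes \<omega>: "\<omega> \<in> sl2_forms S" and k: "k \<in> charts S" "q \<in> fst k"
  shows "curvature \<omega> k q i j \<in> sl2"
proof -
  have p: "partial k i (\<lambda>q. \<omega> k q j) q \<in> sl2" for i j
  proof -
    note s = form_smooth[OF \<omega> k, of j]
    have "trace (partial k i (\<lambda>q. \<omega> k q j) q) = partial k i (\<lambda>q. trace (\<omega> k q j)) q"
      using sm_at_linear(2)[OF bounded_linear_trace s chart_gchart[OF k(1)] k(2)] by simp
    also have "\<dots> = partial k i (\<lambda>q. 0) q"
      by (rule partial_cong[OF chart_gchart[OF k(1)] k(2) sm_at_const open_UNIV UNIV_I])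
        (use form_sl2[OF \<omega> k(1)] in \<open>auto simp: sl2_iff\<close>)
    finally show ?thesis by (simp add: sl2_iff chart_gchart[OF k(1)] k(2))
  qed
  have c: "A ** B - B ** A \<in> sl2" for A B :: "real^2^2" by (simp add: sl2_iff trace_sub trace_mul_sym[of B A])
  show ?thesis unfolding curvature_def by (intro sl2_add sl2_diff p c)
qed

lemma flat_surface_integral:
  assumes fl: "flat \<omega>"
  shows "surface_integral S (\<lambda>k q. trace (n q ** curvature \<omega> k q 1 2)) = 0"
proof -
  obtain K \<rho> where K: "partition_of_unity S K \<rho>"
    "\<And>\<mu>. surface_integral S \<mu> = (\<Sum>k\<in>K. LINT p:snd k ` fst k|lborel. in_coords k (\<lambda>q. \<rho> k q * \<mu> k q) p)"
    by (rule surface_integral_eq) blast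
  have "(LINT p:snd k ` fst k|lborel. in_coords k (\<lambda>q. \<rho> k q * trace (n q ** curvature \<omega> k q 1 2)) p) = 0" if k: "k \<in> K" for k
  proof -
    have kc: "k \<in> charts S" using k K(1) by (auto simp: partition_of_unity_def)
    have "curvature \<omega> k (inv_into (fst k) (snd k) p) 1 2 = 0" if "p \<in> snd k ` fst k" for p
      using fl kc inv_into_into[OF that] by (auto simp: flat_def)
    then have "(\<lambda>p. indicator (snd k ` fst k) p *\<^sub>R in_coords k (\<lambda>q. \<rho> k q * trace (n q ** curvature \<omega> k q 1 2)) p) = (\<lambda>p. 0 :: real)"
      by (auto simp: in_coords_def indicator_def trace_def fun_eq_iff)
    then show ?thesis unfolding set_lebesgue_integral_def by simp
  qed
  then show ?thesis unfolding K(2) by (rule sum.neutral[rule_format])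
qed

lemma flat_bdry_imp_hamilton:
  assumes X: "(\<omega>, u) \<in> configs S" and fl: "flat \<omega>" and bd: "bdry \<omega> u"
  shows "hamilton hbar S n (\<omega>, u) = 0"
proof -
  have "matrix_inv (u l \<phi>) ** vector_derivative (u l) (at \<phi>) - tangential S \<omega> l \<phi> = 0" if l: "l \<in> labels S" for l \<phi>
  proof -
    have "u l \<phi> \<in> SL2" using X l unfolding configs_def boundary_variables_def by blast
    then show ?thesis using bd l by (simp add: bdry_def)
  qed
  then show ?thesis unfolding hamilton_eq flat_surface_integral[OF fl] by (simp add: trace_def set_lebesgue_integral_def)
qed

text \<open>A coordinate that vanishes at a point of a chart with interior coordinates would have a local
  minimum there, which contradicts the invertibility of the Jacobian.\<close>
lemma interior_point:
  assumes k: "k \<in> charts S" "q \<in> fst k" and pos: "0 < snd k q $ 2"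
  shows "q \<notin> boundary_points S"
proof
  assume "q \<in> boundary_points S"
  then obtain k' where k': "k' \<in> charts S" "q \<in> fst k'" "snd k' q $ 2 = 0" by (auto simp: boundary_points_def)
  obtain V T where T: "open V" "snd k q \<in> V" "smooth_on V T"
    "\<And>q'. q' \<in> fst k \<Longrightarrow> snd k q' \<in> V \<Longrightarrow> q' \<in> fst k'"
    "\<And>q'. q' \<in> fst k \<Longrightarrow> snd k q' \<in> V \<Longrightarrow> snd k' q' = T (snd k q')"
    "\<And>q' i j. q' \<in> fst k \<Longrightarrow> snd k q' \<in> V \<Longrightarrow> jacobian k k' q' $ j $ i = fderiv T (snd k q') (axis i 1) $ j"
    by (rule transition[OF k(1) k'(1) k(2) k'(2)]) blast
  have NN: "openin (top_of_set N) N" "q \<in> N" using chart_subset[OF k(1)] k(2) by auto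
  have oV: "open (V \<inter> {p. 0 < p $ 2})" using T(1) open_vimage[of "{0<..}" "\<lambda>p::real^2. p $ 2"] linear_continuous_on[OF bounded_linear_vec_nth, of UNIV 2]
    by (auto simp: vimage_def)
  obtain r where r: "r > 0" "ball (snd k q) r \<subseteq> V \<inter> {p. 0 < p $ 2}" "ball (snd k q) r \<inter> half_plane \<subseteq> snd k ` fst k"
    by (rule coord_ball[OF k NN oV]) (use T(2) pos in auto)
  have d: "((\<lambda>p. T p $ 2) has_derivative (\<lambda>v. fderiv T (snd k q) v $ 2)) (at (snd k q))"
    by (rule bounded_linear.has_derivative[OF bounded_linear_vec_nth smooth_on_has_derivative[OF T(3,2)]])
  have "(\<lambda>v. fderiv T (snd k q) v $ 2) = (\<lambda>v. 0)"
  proof (rule differential_zero_maxmin[OF _ open_ball[of "snd k q" r] d])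
    show "(\<forall>p\<in>ball (snd k q) r. T p $ 2 \<le> T (snd k q) $ 2) \<or> (\<forall>p\<in>ball (snd k q) r. T (snd k q) $ 2 \<le> T p $ 2)"
    proof (intro disjI2 ballI)
      fix p assume p: "p \<in> ball (snd k q) r"
      then have "p \<in> half_plane" using r(2) by (auto simp: half_plane_def subset_iff less_imp_le)
      then obtain x where x: "x \<in> fst k" "p = snd k x" using r(3) p by blast
      have "x \<in> fst k'" "T p = snd k' x" using T(4,5)[of x] x p r(2) by auto
      then have "0 \<le> T p $ 2" using chart_half_plane[OF k'(1)] by (simp add: half_plane_def)
      moreover have "T (snd k q) $ 2 = 0" using T(5)[OF k(2) T(2)] k'(3) by simp
      ultimately show "T (snd k q) $ 2 \<le> T p $ 2" by simp
    qed
  qed (use r in simp)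
  then have "jacobian k k' q $ 2 $ i = 0" for i unfolding T(6)[OF k(2) T(2)] by metis
  then have "det (jacobian k k' q) = 0" by (simp add: det_2)
  then show False using jacobian_det_pos[OF k(1) k'(1) k(2) k'(2)] by simp
qed

lemma circle_reduce: "l \<in> labels S \<Longrightarrow> \<exists>t\<in>{0..<2 * pi}. circle S l \<phi> = circle S l t"
  using circle_periodic by (intro periodic_reduce) blast

lemma circle_range_compact: "l \<in> labels S \<Longrightarrow> compact (range (circle S l))"
proof -
  assume l: "l \<in> labels S"
  have "range (circle S l) = circle S l ` {0..2 * pi}" using circle_reduce[OF l] by force
  moreover have "compact (circle S l ` {0..2 * pi})"
    by (intro compact_continuous_image continuous_on_subset[OF circle_cont[OF l]]) auto
  ultimately show ?thesis by simp
qed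

lemma boundary_eq: "(\<Union>l\<in>labels S. range (circle S l)) = boundary_points S" and finite_labels: "finite (labels S)"
  using circles by (auto simp: boundary_circles_def)

text \<open>The test function \<beta> A is chosen to give a positive trace in the chart
  \<open>k0\<close>. In another chart the curvature is multiplied by a Jacobian determinant, which
  the orientation makes positive, so no two contributions to the surface integral can
  cancel.\<close>

lemma density_integral:
  assumes \<omega>: "\<omega> \<in> sl2_forms S" and k0: "k0 \<in> charts S" and K: "partition_of_unity S K \<rho>" and k: "k \<in> K"
    and \<beta>: "smooth_wrt (charts S) \<beta>" "\<And>x. 0 \<le> \<beta> x" "\<forall>x. \<beta> x \<noteq> 0 \<longrightarrow> x \<in> C" and C: "compact C" "C \<subseteq> fst k0"
    and pos: "\<forall>x\<in>C. 0 < trace (A ** curvature \<omega> k0 x 1 2)"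
  defines "f \<equiv> \<lambda>p. indicator (snd k ` fst k) p *\<^sub>R in_coords k (\<lambda>q. \<rho> k q * trace ((\<beta> q *\<^sub>R A) ** curvature \<omega> k q 1 2)) p"
  shows "integrable lborel f" "\<And>p. 0 \<le> f p"
    "\<And>q. q \<in> fst k \<Longrightarrow> f (snd k q) = \<rho> k q * trace ((\<beta> q *\<^sub>R A) ** curvature \<omega> k q 1 2)"
    "\<And>q. q \<in> fst k \<Longrightarrow> 0 < \<rho> k q \<Longrightarrow> 0 < \<beta> q \<Longrightarrow> 0 < f (snd k q)"
proof -
  note \<beta> = \<beta>(1,2) \<beta>(3)[rule_format] and pos = pos[rule_format]
  have kc: "k \<in> charts S" using k K by (auto simp: partition_of_unity_def)
  have \<rho>: "continuous_on N (\<rho> k)" "\<And>q. q \<in> N \<Longrightarrow> 0 \<le> \<rho> k q" "N \<inter> closure {q \<in> N. \<rho> k q \<noteq> 0} \<subseteq> fst k"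
    using K k by (auto simp: partition_of_unity_def)
  let ?g = "\<lambda>q. \<rho> k q * trace ((\<beta> q *\<^sub>R A) ** curvature \<omega> k q 1 2)"
  have tr: "trace ((\<beta> q *\<^sub>R A) ** curvature \<omega> k q 1 2) = \<beta> q * (det (jacobian k k0 q) * trace (A ** curvature \<omega> k0 q 1 2))"
    if "q \<in> fst k" "q \<in> C" for q
    using curvature_change[OF \<omega> kc k0 that(1)] that(2) C(2) by (auto simp: trace_scaleR)
  have tr0: "trace ((\<beta> q *\<^sub>R A) ** curvature \<omega> k q 1 2) = 0" if "\<beta> q = 0" for q using that by (simp add: trace_def)
  have g0: "0 \<le> ?g q" if q: "q \<in> fst k" for q
  proof (cases "\<beta> q = 0")
    case False
    then have c: "q \<in> C" by (rule \<beta>(3))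
    have "0 < det (jacobian k k0 q)" using jacobian_det_pos[OF kc k0 q] c C(2) by blast
    then show ?thesis unfolding tr[OF q c] using \<beta>(2)[of q] pos[OF c] \<rho>(2)[of q] chart_subset[OF kc] q
      by (intro mult_nonneg_nonneg) (auto simp: less_imp_le)
  qed (simp add: trace_def)
  have fq: "f (snd k q) = ?g q" if "q \<in> fst k" for q
    using that chart_inj[OF kc] by (simp add: f_def in_coords_def)
  have f0: "f p = 0" if "p \<notin> snd k ` fst k" for p using that by (simp add: f_def)
  show "0 \<le> f p" for p using f0[of p] fq g0 by (cases "p \<in> snd k ` fst k") auto
  show "f (snd k q) = ?g q" if "q \<in> fst k" for q using fq[OF that] .
  show "0 < f (snd k q)" if q: "q \<in> fst k" "0 < \<rho> k q" "0 < \<beta> q" for q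
  proof -
    have c: "q \<in> C" using \<beta>(3)[of q] q(3) by simp
    have "0 < det (jacobian k k0 q)" using jacobian_det_pos[OF kc k0 q(1)] c C(2) by blast
    then show ?thesis unfolding fq[OF q(1)] tr[OF q(1) c] using q pos[OF c] by simp
  qed
  \<comment> \<open>By the support condition of the partition this is a compact subset of the chart
    \<open>k\<close>, and the density vanishes off its image; a continuous function on a compact set
    is integrable.\<close>
  define Z where "Z = N \<inter> closure {q \<in> N. \<rho> k q \<noteq> 0} \<inter> C"
  have Z: "compact Z" unfolding Z_def using compact C by (intro compact_Int compact_Int_closed) auto
  have Zk: "Z \<subseteq> fst k" using \<rho>(3) by (auto simp: Z_def)
  have cZ: "compact (snd k ` Z)" by (rule compact_continuous_image[OF continuous_on_subset[OF chart_continuous[OF kc] Zk] Z])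
  have gz: "q \<in> Z" if "q \<in> fst k" "?g q \<noteq> 0" for q
  proof -
    have qN: "q \<in> N" using that chart_subset[OF kc] by blast
    have "\<rho> k q \<noteq> 0" "\<beta> q \<noteq> 0" using that tr0 by auto
    then show ?thesis using qN \<beta>(3)[of q] closure_subset[of "{q \<in> N. \<rho> k q \<noteq> 0}"] by (auto simp: Z_def)
  qed
  have cg: "continuous_on (fst k) ?g"
  proof -
    have s: "continuous_on (fst k) h" if "\<And>q. q \<in> fst k \<Longrightarrow> sm_at k h q" for h :: "'a \<Rightarrow> real"
      unfolding continuous_on_eq_continuous_within
      using continuous_within_subset[OF sm_at_continuous[OF kc _ that] chart_subset[OF kc]] by blast
    have "sm_at k (\<lambda>q. trace ((\<beta> q *\<^sub>R A) ** curvature \<omega> k q 1 2)) q" if q: "q \<in> fst k" for q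
      by (intro sm_at_linear(1)[OF bounded_linear_trace] sm_at_mm sm_at_scaleR sm_at_const curvature_sm_at[OF \<omega> kc q])
        (use \<beta>(1) kc q in \<open>simp add: smooth_wrt_iff\<close>)
    then have "continuous_on (fst k) (\<lambda>q. trace ((\<beta> q *\<^sub>R A) ** curvature \<omega> k q 1 2))" by (rule s)
    then show ?thesis by (intro continuous_on_mult continuous_on_subset[OF \<rho>(1) chart_subset[OF kc]])
  qed
  have "continuous_on (snd k ` Z) (\<lambda>p. ?g (inv_into (fst k) (snd k) p))"
    by (rule continuous_on_compose2[OF cg continuous_on_subset[OF chart_inv_continuous[OF kc]]])
      (use Zk chart_inj[OF kc] in \<open>auto simp: subset_iff\<close>)
  then have "integrable lborel (\<lambda>p. indicator (snd k ` Z) p *\<^sub>R ?g (inv_into (fst k) (snd k) p))"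
    by (rule borel_integrable_compact[OF cZ])
  moreover have "f = (\<lambda>p. indicator (snd k ` Z) p *\<^sub>R ?g (inv_into (fst k) (snd k) p))"
  proof
    fix p show "f p = indicator (snd k ` Z) p *\<^sub>R ?g (inv_into (fst k) (snd k) p)"
    proof (cases "p \<in> snd k ` fst k")
      case True
      then obtain q where q: "q \<in> fst k" "p = snd k q" by blast
      have i: "inv_into (fst k) (snd k) p = q" using q chart_inj[OF kc] by simp
      have "p \<in> snd k ` Z \<longleftrightarrow> q \<in> Z" using q Zk chart_inj[OF kc] by (auto dest: inj_onD)
      then show ?thesis unfolding i using fq[OF q(1)] gz[OF q(1)] q(2) by (auto simp: indicator_def)
    next
      case False
      then have "p \<notin> snd k ` Z" using Zk by blast
      then show ?thesis using f0[OF False] by simp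
    qed
  qed
  ultimately show "integrable lborel f" by (simp only:)
qed

lemma hamilton_imp_flat:
  assumes X: "(\<omega>, u) \<in> configs S" and hb: "hbar > 0" and H: "\<And>n. n \<in> sl2_functions S \<Longrightarrow> hamilton hbar S n (\<omega>, u) = 0"
  shows "flat \<omega>"
proof (rule ccontr)
  have \<omega>: "\<omega> \<in> sl2_forms S" using X by (simp add: configs_def)
  assume "\<not> flat \<omega>"
  then obtain k0 q0 where k0: "k0 \<in> charts S" "q0 \<in> fst k0" and F0: "curvature \<omega> k0 q0 1 2 \<noteq> 0" by (auto simp: flat_def)
  \<comment> \<open>The trace form on \<open>sl2\<close> is indefinite. Transposition keeps
    \<open>sl2\<close> and turns the trace at \<open>q0\<close> into a sum of squares.\<close>
  define A where "A = transpose (curvature \<omega> k0 q0 1 2)"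
  have A: "A \<in> sl2" unfolding A_def by (intro transpose_sl2 curvature_sl2[OF \<omega> k0])
  let ?t = "\<lambda>q. trace (A ** curvature \<omega> k0 q 1 2)"
  have t0: "0 < ?t q0" unfolding A_def by (rule trace_transpose_mult_pos[OF F0])
  have "sm_at k0 ?t q0" by (intro sm_at_linear(1)[OF bounded_linear_trace] sm_at_mm sm_at_const curvature_sm_at[OF \<omega> k0])
  then obtain V g where g: "snd k0 q0 \<in> V" "ext k0 V g ?t" by (auto simp: sm_at_def)
  have oV: "open (V \<inter> g -` {0<..})"
    by (rule continuous_open_preimage) (use g in \<open>auto simp: ext_def intro: smooth_on_continuous\<close>)
  have inV: "snd k0 q0 \<in> V \<inter> g -` {0<..}" using g k0 t0 by (auto simp: ext_def)
  have NN: "openin (top_of_set N) N" "q0 \<in> N" using chart_subset[OF k0(1)] k0(2) by auto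
  obtain r where r: "r > 0" "ball (snd k0 q0) r \<subseteq> V \<inter> g -` {0<..}" "ball (snd k0 q0) r \<inter> half_plane \<subseteq> snd k0 ` fst k0"
    by (rule coord_ball[OF k0 NN oV inV]) blast
  \<comment> \<open>\<open>q0\<close> may lie on the boundary. Half a radius upwards is an interior
    point where the trace is still positive; a bump there can avoid the boundary, so that no
    boundary term appears.\<close>
  define p1 where "p1 = snd k0 q0 + (r / 2) *\<^sub>R axis 2 1"
  have p1: "p1 \<in> ball (snd k0 q0) r" "0 < p1 $ 2"
    using r(1) chart_half_plane[OF k0] by (auto simp: p1_def dist_norm norm_axis_1 half_plane_def add_nonneg_pos)
  then have "p1 \<in> half_plane" by (simp add: half_plane_def)
  then obtain q1 where q1: "q1 \<in> fst k0" "p1 = snd k0 q1" using r(3) p1 by blast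
  have q1N: "q1 \<in> N" using q1 chart_subset[OF k0(1)] by blast
  have tpos: "0 < ?t q" if "q \<in> kball k0 (snd k0 q0) r" for q using that r(2) g(2) by (auto simp: ext_def subset_iff)
  have nb: "q1 \<notin> boundary_points S" by (rule interior_point[OF k0(1) q1(1)]) (use p1 q1 in simp)
  have "compact (boundary_points S)"
    unfolding boundary_eq[symmetric] using finite_labels circle_range_compact by (intro compact_UN) auto
  then have oB: "openin (top_of_set N) (N \<inter> - boundary_points S)"
    by (intro openin_open_Int open_Compl compact_imp_closed)
  define U where "U = kball k0 (snd k0 q0) r \<inter> (N \<inter> - boundary_points S)"
  have U: "openin (top_of_set N) U" "q1 \<in> U"
    unfolding U_def using kball_openin[OF k0(1)] oB q1 p1 q1N nb by auto
  obtain \<beta> C where \<beta>: "smooth_wrt (charts S) \<beta>" "\<And>x. 0 \<le> (\<beta> x :: real)" "0 < \<beta> q1" "compact C" "C \<subseteq> fst k0 \<inter> U" "\<forall>x. \<beta> x \<noteq> 0 \<longrightarrow> x \<in> C"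
    using bump_exists[OF k0(1) q1(1) U] by blast
  define n where "n = (\<lambda>q. \<beta> q *\<^sub>R A)"
  have n: "n \<in> sl2_functions S"
    unfolding sl2_functions_def smooth_wrt_iff n_def using \<beta>(1) by (auto intro!: sm_at_scaleR sl2_scaleR A simp: smooth_wrt_iff)
  obtain K \<rho> where K: "partition_of_unity S K \<rho>"
    "\<And>\<mu>. surface_integral S \<mu> = (\<Sum>k\<in>K. LINT p:snd k ` fst k|lborel. in_coords k (\<lambda>q. \<rho> k q * \<mu> k q) p)"
    by (rule surface_integral_eq) blast
  let ?f = "\<lambda>k p. indicator (snd k ` fst k) p *\<^sub>R in_coords k (\<lambda>q. \<rho> k q * trace ((\<beta> q *\<^sub>R A) ** curvature \<omega> k q 1 2)) p"
  have Ck0: "C \<subseteq> fst k0" and Cpos: "\<forall>x\<in>C. 0 < ?t x" using \<beta>(5) tpos by (auto simp: U_def)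
  note di = density_integral[OF \<omega> k0(1) K(1) _ \<beta>(1,2,6,4) Ck0 Cpos]
  have "(\<Sum>k\<in>K. \<rho> k q1) = 1" using K(1) q1N by (auto simp: partition_of_unity_def)
  \<comment> \<open>All summands are nonnegative, so one chart with positive weight at
    \<open>q1\<close> makes the sum strictly positive.\<close>
  then obtain k where k: "k \<in> K" "\<rho> k q1 \<noteq> 0" by (metis sum.neutral zero_neq_one)
  have kc: "k \<in> charts S" "0 \<le> \<rho> k q1" "N \<inter> closure {q \<in> N. \<rho> k q \<noteq> 0} \<subseteq> fst k" "continuous_on N (\<rho> k)"
    using K(1) k(1) q1N by (auto simp: partition_of_unity_def)
  have q1k: "q1 \<in> fst k" using kc(3) k(2) q1N closure_subset[of "{q \<in> N. \<rho> k q \<noteq> 0}"] by blast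
  have s2: "0 < snd k q1 $ 2"
    using nb chart_half_plane[OF kc(1) q1k] kc(1) q1k by (force simp: boundary_points_def half_plane_def)
  have "openin (top_of_set N) (N \<inter> \<rho> k -` {0<..})" "openin (top_of_set N) (N \<inter> \<beta> -` {0<..})"
    by (rule continuous_openin_preimage_gen[OF kc(4)] continuous_openin_preimage_gen[OF smooth_wrt_continuous[OF \<beta>(1)]]; simp)+
  then have oW: "openin (top_of_set N) ((N \<inter> \<rho> k -` {0<..}) \<inter> (N \<inter> \<beta> -` {0<..}))" by (rule openin_Int)
  have o2: "open {p::real^2. 0 < p $ 2}"
    using open_vimage[of "{0<..}" "\<lambda>p::real^2. p $ 2"] linear_continuous_on[OF bounded_linear_vec_nth, of UNIV 2] by (auto simp: vimage_def)
  obtain e where e: "e > 0" "ball (snd k q1) e \<subseteq> {p. 0 < p $ 2}" "ball (snd k q1) e \<inter> half_plane \<subseteq> snd k ` fst k"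
    "\<And>q'. q' \<in> fst k \<Longrightarrow> snd k q' \<in> ball (snd k q1) e \<Longrightarrow> q' \<in> (N \<inter> \<rho> k -` {0<..}) \<inter> (N \<inter> \<beta> -` {0<..})"
    by (rule coord_ball[OF kc(1) q1k oW _ o2]) (use q1N k(2) kc(2) \<beta>(3) s2 in auto)
  have "0 < ?f k p" if p: "p \<in> ball (snd k q1) e" for p
  proof -
    have "p \<in> half_plane" using p e(2) by (auto simp: half_plane_def subset_iff less_imp_le)
    then obtain x where x: "x \<in> fst k" "p = snd k x" using e(3) p by blast
    then show ?thesis using di(4)[OF k(1) x(1)] e(4)[OF x(1)] p by simp
  qed
  then have "0 < integral\<^sup>L lborel (?f k)"
    by (intro integral_pos_if_pos_on_open[OF di(1,2)[OF k(1)] open_ball[of "snd k q1" e]]) (use e(1) in auto)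
  moreover have "0 \<le> integral\<^sup>L lborel (?f k)" if "k \<in> K" for k by (rule integral_nonneg_AE) (use di(2)[OF that] in simp)
  ultimately have "0 < (\<Sum>k\<in>K. integral\<^sup>L lborel (?f k))"
    using K(1) k(1) by (intro sum_pos2[of K k]) (auto simp: partition_of_unity_def)
  then have sp: "0 < surface_integral S (\<lambda>k q. trace (n q ** curvature \<omega> k q 1 2))"
    unfolding K(2) set_lebesgue_integral_def n_def .
  have "n (circle S l \<phi>) = 0" if l: "l \<in> labels S" for l \<phi>
  proof -
    have "circle S l \<phi> \<in> boundary_points S" using boundary_eq l by blast
    then have "circle S l \<phi> \<notin> C" using \<beta>(5) by (auto simp: U_def)
    then show ?thesis using \<beta>(6) by (auto simp: n_def)
  qed
  then have "hamilton hbar S n (\<omega>, u) = \<i> / of_real hbar * of_real (surface_integral S (\<lambda>k q. trace (n q ** curvature \<omega> k q 1 2)))"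
    unfolding hamilton_eq by (simp add: trace_def set_lebesgue_integral_def)
  then show False using H[OF n] sp hb by simp
qed

lemma tangential_continuous:
  assumes \<omega>: "\<omega> \<in> sl2_forms S" and l: "l \<in> labels S"
  shows "continuous_on UNIV (tangential S \<omega> l)"
proof (rule continuous_at_imp_continuous_on, rule ballI)
  fix \<phi> :: real
  obtain k where k: "k \<in> charts S" "circle S l \<phi> \<in> fst k" using charts_cover circle_in[OF l] by blast
  let ?P = "circle S l -` fst k"
  have "continuous_on ?P (\<lambda>\<phi>. fderiv (\<lambda>\<phi>. snd k (circle S l \<phi>)) \<phi> 1)"
    by (rule smooth_on_continuous[OF smooth_on_frechet_derivative[OF circle_smooth[OF l k(1)]]])
  then have 1: "continuous_on ?P (cvel l k)"
    using circle_velocity(2)[OF l k(1)] by (subst continuous_on_cong[OF refl, of _ _ "\<lambda>\<phi>. fderiv (\<lambda>\<phi>. snd k (circle S l \<phi>)) \<phi> 1"]) auto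
  have "continuous_on (fst k) (\<lambda>q. \<omega> k q i)" for i
    unfolding continuous_on_eq_continuous_within
    using continuous_within_subset[OF sm_at_continuous[OF k(1) _ form_smooth[OF \<omega> k(1)]] chart_subset[OF k(1)]] by blast
  then have 2: "continuous_on ?P (\<lambda>\<phi>. \<omega> k (circle S l \<phi>) i)" for i
    by (rule continuous_on_compose2[OF _ continuous_on_subset[OF circle_cont[OF l]]]) auto
  have "continuous_on ?P (\<lambda>\<phi>. \<Sum>i\<in>UNIV. cvel l k \<phi> $ i *\<^sub>R \<omega> k (circle S l \<phi>) i)"
    by (intro continuous_intros 1 2)
  then have "continuous_on ?P (tangential S \<omega> l)"
    using tangential_eq[OF \<omega> l k(1)] by (subst continuous_on_cong[OF refl, of _ _ "\<lambda>\<phi>. \<Sum>i\<in>UNIV. cvel l k \<phi> $ i *\<^sub>R \<omega> k (circle S l \<phi>) i"]) auto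
  then show "isCont (tangential S \<omega> l) \<phi>"
    using k(2) circle_chart_open[OF l k(1)] continuous_on_eq_continuous_at by blast
qed

lemma tangential_periodic:
  assumes \<omega>: "\<omega> \<in> sl2_forms S" and l: "l \<in> labels S"
  shows "tangential S \<omega> l (\<phi> + 2 * pi) = tangential S \<omega> l \<phi>"
proof -
  obtain k where k: "k \<in> charts S" "circle S l \<phi> \<in> fst k" using charts_cover circle_in[OF l] by blast
  then have k': "circle S l (\<phi> + 2 * pi) \<in> fst k" by (simp only: circle_periodic[OF l])
  have "((\<lambda>\<phi>. snd k (circle S l \<phi>)) has_vector_derivative cvel l k (\<phi> + 2 * pi)) (at \<phi>)"
    using has_vector_derivative_shift[OF circle_velocity(1)[OF l k(1) k']] by (simp only: circle_periodic[OF l])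
  then have "cvel l k (\<phi> + 2 * pi) = cvel l k \<phi>" using circle_velocity(1)[OF l k] by (rule vector_derivative_unique_at)
  then show ?thesis unfolding tangential_eq[OF \<omega> l k] tangential_eq[OF \<omega> l k(1) k'] circle_periodic[OF l] by simp
qed

text \<open>Flatness already removes the surface integral, so the test function has to be controlled
  only on the boundary, where it is made to live on a short arc of one circle. Inside the surface
  its values do not affect the constraint.\<close>

lemma hamilton_imp_bdry:
  assumes X: "(\<omega>, u) \<in> configs S" and hb: "hbar > 0" and fl: "flat \<omega>"
    and H: "\<And>n. n \<in> sl2_functions S \<Longrightarrow> hamilton hbar S n (\<omega>, u) = 0"
  shows "bdry \<omega> u"
proof (rule ccontr)
  define v where "v = (\<lambda>l \<phi>. adj2 (u l \<phi>) ** vector_derivative (u l) (at \<phi>) - tangential S \<omega> l \<phi>)"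
  assume "\<not> bdry \<omega> u"
  then obtain l0 \<phi>0 where l0: "l0 \<in> labels S" and v0: "v l0 \<phi>0 \<noteq> 0" by (auto simp: bdry_def v_def)
  have \<omega>: "\<omega> \<in> sl2_forms S" using X by (simp add: configs_def)
  have ul: "smooth_on UNIV (u l)" "\<And>\<phi>. u l \<phi> \<in> SL2" "\<exists>m\<in>SL2. \<forall>\<phi>. u l (\<phi> + 2 * pi) = m ** u l \<phi>" if "l \<in> labels S" for l
    using X that unfolding configs_def boundary_variables_def by blast+
  have du: "(u l has_vector_derivative vector_derivative (u l) (at \<phi>)) (at \<phi>)"
    "vector_derivative (u l) (at \<phi>) = fderiv (u l) \<phi> 1" if "l \<in> labels S" for l \<phi>
    using smooth_on_vector_derivative[OF ul(1)[OF that] UNIV_I, of \<phi>] by (auto simp: vector_derivative_at)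
  have cv: "continuous_on UNIV (v l0)"
    unfolding v_def du(2)[OF l0]
    by (intro continuous_on_diff tangential_continuous[OF \<omega> l0] smooth_on_continuous smooth_on_mm smooth_on_linear_comp[OF bounded_linear_adj2]
        smooth_on_frechet_derivative ul[OF l0]) auto
  obtain m where m: "m \<in> SL2" "\<And>\<phi>. u l0 (\<phi> + 2 * pi) = m ** u l0 \<phi>" using ul(3)[OF l0] by blast
  have "v l0 (\<phi> + 2 * pi) = v l0 \<phi>" for \<phi>
  proof -
    have "((\<lambda>\<phi>. m ** u l0 \<phi>) has_vector_derivative m ** vector_derivative (u l0) (at \<phi>)) (at \<phi>)"
      by (rule bounded_linear.has_vector_derivative[OF bounded_bilinear.bounded_linear_right[OF bilinear_mm] du(1)[OF l0]])
    moreover have "((\<lambda>\<phi>. m ** u l0 \<phi>) has_vector_derivative vector_derivative (u l0) (at (\<phi> + 2 * pi))) (at \<phi>)"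
      using has_vector_derivative_shift[where x = \<phi> and a = "2 * pi", OF du(1)[OF l0]] by (simp only: m)
    ultimately have "vector_derivative (u l0) (at (\<phi> + 2 * pi)) = m ** vector_derivative (u l0) (at \<phi>)"
      using vector_derivative_unique_at by blast
    then show ?thesis using m(1) by (simp add: v_def m(2) tangential_periodic[OF \<omega> l0] adj2_mm mm_assoc)
  qed
  then obtain t0 where t0: "t0 \<in> {0..<2 * pi}" "v l0 \<phi>0 = v l0 t0" using periodic_reduce by blast
  define A where "A = transpose (v l0 t0)"
  let ?t = "\<lambda>t. trace (A ** v l0 t)"
  have u': "adj2 (u l0 t0) ** vector_derivative (u l0) (at t0) \<in> sl2"
    by (rule SL2_derivative_traceless[OF du(1)[OF l0] ul(2)[OF l0]])
  have A: "A \<in> sl2" unfolding A_def v_def by (intro transpose_sl2 sl2_diff u' tangential_sl2[OF \<omega> l0])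
  have tp: "0 < ?t t0" unfolding A_def using trace_transpose_mult_pos v0 t0(2) by metis
  have ct: "continuous_on UNIV ?t"
    by (intro continuous_on_compose2[OF linear_continuous_on[OF bounded_linear_trace, of UNIV]]
        bounded_bilinear.continuous_on[OF bilinear_mm] continuous_on_const cv) auto
  have oT: "open (?t -` {0<..})" using ct by (intro open_vimage) auto
  moreover have "t0 \<in> ?t -` {0<..}" using tp by simp
  ultimately obtain e where e: "e > 0" "ball t0 e \<subseteq> ?t -` {0<..}" using openE by blast
  define J where "J = ball t0 e \<inter> {0<..<2 * pi}"
  \<comment> \<open>\<open>t0\<close> may be 0, where the parametrization of the circle closes up. A
    small step forward leads into the open interval and remains where the trace is positive.\<close>
  obtain d where d: "0 < d" "d < e" "d < 2 * pi - t0"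
    using field_lbound_gt_zero[of e "2 * pi - t0"] e(1) t0(1) by auto
  define \<phi>1 where "\<phi>1 = t0 + d"
  have J: "open J" "\<phi>1 \<in> J" "J \<subseteq> {0<..<2 * pi}" "\<And>t. t \<in> J \<Longrightarrow> 0 < ?t t"
    using e d t0(1) by (auto simp: J_def \<phi>1_def dist_real_def subset_iff)
  \<comment> \<open>All boundary points at which the test function has to vanish: the other circles
    and the part of this circle outside the arc \<open>J\<close>. The set is compact, so a bump at
    \<open>q1\<close> can avoid it.\<close>
  define B where "B = (\<Union>l\<in>labels S - {l0}. range (circle S l)) \<union> circle S l0 ` ({0..2 * pi} - J)"
  have "compact ({0..2 * pi} - J)" using J(1) by (intro compact_diff) auto
  then have "compact (circle S l0 ` ({0..2 * pi} - J))"
    by (rule compact_continuous_image[OF continuous_on_subset[OF circle_cont[OF l0] subset_UNIV]])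
  then have cB: "compact B" unfolding B_def using finite_labels circle_range_compact by (intro compact_Un compact_UN) auto
  define q1 where "q1 = circle S l0 \<phi>1"
  have q1N: "q1 \<in> N" unfolding q1_def by (rule circle_in[OF l0])
  have dis: "disjoint_family_on (\<lambda>l. range (circle S l)) (labels S)" and inj: "inj_on (circle S l0) {0..<2 * pi}"
    using circles l0 by (auto simp: boundary_circles_def)
  have q1B: "q1 \<notin> B"
  proof
    assume "q1 \<in> B"
    then consider l where "l \<in> labels S" "l \<noteq> l0" "q1 \<in> range (circle S l)" | t where "t \<in> {0..2 * pi} - J" "q1 = circle S l0 t"
      by (auto simp: B_def)
    then show False
    proof cases
      case 1
      moreover have "q1 \<in> range (circle S l0)" by (simp add: q1_def)
      ultimately show False using dis l0 unfolding disjoint_family_on_def by blast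
    next
      case 2
      \<comment> \<open>Injectivity is given on the half-open interval; the parameter
        \<open>2 * pi\<close> describes the same point as 0.\<close>
      define s where "s = (if t = 2 * pi then 0 else t)"
      have s: "s \<in> {0..<2 * pi}" "s \<notin> J" using 2(1) J(3) by (auto simp: s_def)
      have "circle S l0 s = circle S l0 \<phi>1" using 2(2) circle_periodic[OF l0, of 0] by (auto simp: s_def q1_def)
      moreover have "\<phi>1 \<in> {0..<2 * pi}" using J(2,3) by fastforce
      ultimately have "s = \<phi>1" using inj s(1) by (auto dest: inj_onD)
      then show False using s(2) J(2) by simp
    qed
  qed
  obtain k where k: "k \<in> charts S" "q1 \<in> fst k" using charts_cover[OF q1N] by blast
  have "openin (top_of_set N) (N \<inter> - B)" using cB by (intro openin_open_Int open_Compl compact_imp_closed)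
  from bump_exists[OF k this] q1N q1B
  obtain \<beta> C where \<beta>: "smooth_wrt (charts S) \<beta>" "\<And>x. 0 \<le> (\<beta> x :: real)" "0 < \<beta> q1" "C \<subseteq> fst k \<inter> (N \<inter> - B)" "\<And>x. \<beta> x \<noteq> 0 \<Longrightarrow> x \<in> C"
    by blast
  have \<beta>B: "\<beta> x = 0" if "x \<in> B" for x using \<beta>(4,5) that by blast
  define n where "n = (\<lambda>q. \<beta> q *\<^sub>R A)"
  have n: "n \<in> sl2_functions S"
    unfolding sl2_functions_def smooth_wrt_iff n_def using \<beta>(1) by (auto intro!: sm_at_scaleR sl2_scaleR A simp: smooth_wrt_iff)
  let ?I = "\<lambda>l. LINT \<phi>:{0..2 * pi}|lborel. trace (n (circle S l \<phi>) ** (matrix_inv (u l \<phi>) ** vector_derivative (u l) (at \<phi>) - tangential S \<omega> l \<phi>))"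
  have "n (circle S l \<phi>) = 0" if "l \<in> labels S" "l \<noteq> l0" for l \<phi> using \<beta>B that by (auto simp: n_def B_def)
  then have I0: "?I l = 0" if "l \<in> labels S" "l \<noteq> l0" for l using that by (simp add: trace_def set_lebesgue_integral_def)
  let ?f = "\<lambda>t. indicator {0..2 * pi} t *\<^sub>R (\<beta> (circle S l0 t) * ?t t)"
  have "trace (n (circle S l0 t) ** (matrix_inv (u l0 t) ** vector_derivative (u l0) (at t) - tangential S \<omega> l0 t)) = \<beta> (circle S l0 t) * ?t t" for t
    using ul(2)[OF l0] by (simp add: n_def v_def trace_scaleR)
  then have I1: "?I l0 = integral\<^sup>L lborel ?f" unfolding set_lebesgue_integral_def by simp
  have c\<beta>: "continuous_on UNIV (\<lambda>t. \<beta> (circle S l0 t))"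
    by (rule continuous_on_compose2[OF smooth_wrt_continuous[OF \<beta>(1)] circle_cont[OF l0]]) (use circle_in[OF l0] in auto)
  have "0 < integral\<^sup>L lborel ?f"
  proof (rule integral_pos_if_pos_on_open)
    show "integrable lborel ?f"
      by (rule borel_integrable_compact) (auto intro!: continuous_intros continuous_on_subset[OF c\<beta>] continuous_on_subset[OF ct])
    show "open (J \<inter> (\<lambda>t. \<beta> (circle S l0 t)) -` {0<..})" using J(1) c\<beta> by (intro open_Int open_vimage) auto
    show "J \<inter> (\<lambda>t. \<beta> (circle S l0 t)) -` {0<..} \<noteq> {}" using J(2) \<beta>(3) by (auto simp: q1_def)
    show "0 < ?f t" if "t \<in> J \<inter> (\<lambda>t. \<beta> (circle S l0 t)) -` {0<..}" for t
      using that J(3) J(4)[of t] by (auto simp: indicator_def subset_iff)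
    show "0 \<le> ?f t" for t
    proof (cases "t \<in> J")
      case True then show ?thesis using J(4)[of t] \<beta>(2) by (auto intro!: mult_nonneg_nonneg simp: less_imp_le)
    next
      case False
      then have "t \<in> {0..2 * pi} \<Longrightarrow> \<beta> (circle S l0 t) = 0" using \<beta>B by (auto simp: B_def)
      then show ?thesis by (cases "t \<in> {0..2 * pi}") auto
    qed
  qed
  then have "0 < (\<Sum>l\<in>labels S. ?I l)"
    using I0 I1 by (intro sum_pos2[OF finite_labels l0]) (fastforce simp: less_imp_le)+
  moreover have "hamilton hbar S n (\<omega>, u) = \<i> / of_real hbar * of_real (\<Sum>l\<in>labels S. ?I l)"
    unfolding hamilton_eq flat_surface_integral[OF fl] by simp
  ultimately show False using H[OF n] hb by (simp del: of_real_sum)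
qed

end

context surf_family begin

lemma hamilton_iff:
  assumes X: "X \<in> configs S" and hb: "hbar > 0"
  shows "(\<forall>n\<in>sl2_functions S. hamilton hbar S n X = 0) \<longleftrightarrow> (\<exists>g b. condQ X g b)"
proof -
  obtain \<omega> u where e: "X = (\<omega>, u)" by (cases X)
  show ?thesis
    using X Q_imp_flat_bdry flat_bdry_imp_Q flat_bdry_imp_hamilton hamilton_imp_flat[OF _ hb] hamilton_imp_bdry[OF _ hb]
    unfolding e by meson
qed

end

subsection \<open>Rotating solutions of condition (Q)\<close>

lemma cover_cancel [simp]:
  assumes "c \<in> carrier SL2_cover" "d \<in> carrier SL2_cover"
  shows "c \<odot> (sinv c \<odot> d) = d" "sinv c \<odot> (c \<odot> d) = d"
  using assms by (simp_all flip: G.m_assoc)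

lemma hom_eq_on_generate:
  assumes H: "group H" "group K" and f: "f \<in> hom H K" "f' \<in> hom H K" and Y: "Y \<subseteq> carrier H" "\<And>y. y \<in> Y \<Longrightarrow> f y = f' y"
    and x: "x \<in> generate H Y"
  shows "f x = f' x"
proof -
  interpret f: group_hom H K f using H f(1) by (simp add: group_hom_def group_hom_axioms_def)
  interpret f': group_hom H K f' using H f(2) by (simp add: group_hom_def group_hom_axioms_def)
  show ?thesis using x
  proof (induction rule: generate.induct)
    case (inv h) then show ?case using Y by (metis f.hom_inv f'.hom_inv subsetD)
  next
    case (eng h1 h2)
    then show ?case using group.generate_in_carrier[OF H(1) Y(1)] by (simp add: f.hom_mult f'.hom_mult)
  qed (use Y in \<open>auto simp: f.hom_one f'.hom_one\<close>)
qed

lemma word_value_hom: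
  assumes H: "group H" "group K" and f: "f \<in> hom H K" and Y: "Y \<subseteq> carrier H" "\<And>y. y \<in> Y \<Longrightarrow> r y = f y"
    and w: "w \<in> lists (Y \<times> UNIV)"
  shows "word_value K r w = f (word_value H (\<lambda>y. y) w)" "word_value H (\<lambda>y. y) w \<in> carrier H"
proof -
  interpret f: group_hom H K f using H f by (simp add: group_hom_def group_hom_axioms_def)
  have "word_value K r w = f (word_value H (\<lambda>y. y) w) \<and> word_value H (\<lambda>y. y) w \<in> carrier H"
    using w
  proof (induction rule: lists.induct)
    case Nil then show ?case by (simp add: word_value_def)
  next
    case (Cons a l)
    obtain y e where a: "a = (y, e)" "y \<in> Y" using Cons by (cases a) auto
    then have "y \<in> carrier H" using Y by blast
    then show ?case using Cons a Y(2)[OF a(2)] by (auto simp: word_value_def)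
  qed
  then show "word_value K r w = f (word_value H (\<lambda>y. y) w)" "word_value H (\<lambda>y. y) w \<in> carrier H" by auto
qed

context surf begin

text \<open>Multiplying a solution by \<open>h\<close> from the right rotates its form, while a
  constant factor \<open>B\<close> on the left drops out of g^-1 dg. That freedom is used to
  normalize the solution.\<close>

lemma solves_rotf:
  assumes g: "solves g \<omega>" and h: "gauge h" and B: "B \<in> SL2"
    and g': "\<And>c. c \<in> ucover N xbar \<Longrightarrow> g' c \<in> carrier SL2_cover"
      "\<And>c. c \<in> ucover N xbar \<Longrightarrow> cpg g' c = B ** cpg g c ** h (cover_proj c)"
  shows "solves g' (rotf h \<omega>)"
  unfolding solves_def
proof (intro conjI ballI allI impI g'(1))
  fix k W c assume k: "k \<in> charts S" and W: "sheet_over N xbar (fst k) W" and c: "c \<in> W"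
  let ?F = "\<lambda>c. B ** cpg g c ** h (cover_proj c)" and ?L = "lift_chart k W"
  note s = sheetD[OF W c]
  have eq: "?F d = cpg g' d" if "d \<in> fst ?L" for d using g'(2)[OF sheetD(1)[OF W]] that by simp
  have sg: "sm_at ?L (cpg g) c" and og: "\<And>i. \<omega> k (cover_proj c) i = adj2 (cpg g c) ** partial ?L i (cpg g) c"
    and gc: "cpg g c \<in> SL2"
    using g k W c s(1) cover_proj_SL2(1) unfolding solves_def by blast+
  note hq = gaugeD[OF h k s(2)]
  note sh = lift_sm_at[OF k W c hq(1)]
  have cL: "c \<in> fst ?L" using c by simp
  note gL = lift_gchart[OF k W]
  have sB: "sm_at ?L (\<lambda>c. B ** cpg g c) c" by (intro sm_at_mm sm_at_const sg)
  have sF: "sm_at ?L ?F c" by (intro sm_at_mm sB sh(1))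
  show "sm_at ?L (cpg g') c" by (rule sm_at_cong[OF sF open_UNIV UNIV_I eq])
  fix i
  have "partial ?L i (\<lambda>c. B ** cpg g c) c = B ** partial ?L i (cpg g) c"
    unfolding partial_mm[OF sm_at_const sg gL cL] using gL cL by simp
  then have "partial ?L i ?F c = B ** cpg g c ** partial k i h (cover_proj c) + B ** partial ?L i (cpg g) c ** h (cover_proj c)"
    unfolding partial_mm[OF sB sh(1) gL cL] sh(2) by simp
  then have "partial ?L i (cpg g') c = B ** cpg g c ** partial k i h (cover_proj c) + B ** partial ?L i (cpg g) c ** h (cover_proj c)"
    using partial_cong[OF gL cL sF open_UNIV UNIV_I eq] by simp
  then show "rotf h \<omega> k (cover_proj c) i = adj2 (cpg g' c) ** partial ?L i (cpg g') c"
    using k s(2) gc hq(2) B by (simp add: rotf_def g'(2)[OF s(1)] og adj2_mm mm_left_distrib mm_right_distrib mm_assoc)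
qed

lemma solves_unique_form:
  assumes "solves g \<omega>" "solves g \<omega>'" "\<omega> \<in> sl2_forms S" "\<omega>' \<in> sl2_forms S"
  shows "\<omega> = \<omega>'"
proof (intro ext)
  fix k q i
  show "\<omega> k q i = \<omega>' k q i"
  proof (cases "k \<in> charts S \<and> q \<in> fst k")
    case True
    then have k: "k \<in> charts S" "q \<in> fst k" by auto
    then obtain c where c: "c \<in> ucover N xbar" "cover_proj c = q" using class_over chart_subset by blast
    then obtain W where "sheet_over N xbar (fst k) W" "c \<in> W" using sheet_exists k by blast
    then show ?thesis using assms(1,2) k c(2) unfolding solves_def by metis
  next
    case False
    have "\<omega> k q i = 0" if "\<omega> \<in> sl2_forms S" for \<omega> using that False unfolding sl2_forms_def by blast
    from this[OF assms(3)] this[OF assms(4)] show ?thesis by simp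
  qed
qed

lemma lifts_const: "c \<in> carrier SL2_cover \<Longrightarrow> lifts (\<lambda>q. c)"
  by (simp add: lifts_def smooth_wrt_iff SL2_cover_simps)

text \<open>On loops, normalized quasiperiodicity is the homomorphism property, and conjugation by a
  fixed element preserves it.\<close>

lemma quasiperiodic_hom:
  assumes "normalized_quasiperiodic S xbar g" "\<And>c. c \<in> ucover N xbar \<Longrightarrow> g c \<in> carrier SL2_cover" and \<beta>: "\<beta> \<in> carrier SL2_cover"
  shows "(\<lambda>c. sinv \<beta> \<odot> g c \<odot> \<beta>) \<in> hom (loop_group N xbar) SL2_cover"
  using assms by (auto simp: hom_def normalized_quasiperiodic_def G.m_assoc)

end

context surf_family begin

lemma QD:
  assumes "condQ (\<omega>, u) g b"
  shows "continuous_map (ucover_topology N xbar) SL2_ucover_topology g" "solves g \<omega>" "normalized_quasiperiodic S xbar g"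
    "l \<in> labels S \<Longrightarrow> b l \<in> SL2" "l \<in> labels S \<Longrightarrow> u l \<phi> = adj2 (b l) ** cpg g (\<alpha> l \<phi>)"
    "c \<in> ucover N xbar \<Longrightarrow> g c \<in> carrier SL2_cover"
  using assms by (auto simp: Q_iff solves_def)

text \<open>The factor on the right realizes the rotation. The constant factor on the left is needed
  for the result to be multiplicative on loops, and it is compensated in b.\<close>

lemma rotation_Q:
  assumes X: "X \<in> configs S" and Q: "condQ X g b" and \<kappa>: "lifts \<kappa>"
  shows "condQ (rot \<kappa> X)
    (\<lambda>c. sinv (\<kappa> xbar) \<odot> g c \<odot> \<kappa> (cover_proj c)) (\<lambda>l. adj2 (cover_proj (\<kappa> xbar)) ** b l)"
proof -
  obtain \<omega> u where e: "X = (\<omega>, u)" by (cases X)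
  note q = QD[OF Q[unfolded e]] and kc = liftsD(1)[OF \<kappa>] and h = liftsD(2)[OF \<kappa>]
  let ?g = "\<lambda>c. sinv (\<kappa> xbar) \<odot> g c \<odot> \<kappa> (cover_proj c)"
  have k0: "\<kappa> xbar \<in> carrier SL2_cover" by (rule kc[OF xbar])
  have pN: "cover_proj c \<in> N" if "c \<in> ucover N xbar" for c using that cover_proj_in by blast
  have car: "?g c \<in> carrier SL2_cover" if "c \<in> ucover N xbar" for c using k0 q(6)[OF that] kc[OF pN[OF that]] by simp
  have pr: "cpg ?g c = adj2 (cover_proj (\<kappa> xbar)) ** cpg g c ** cover_proj (\<kappa> (cover_proj c))" if "c \<in> ucover N xbar" for c
    using k0 q(6)[OF that] kc[OF pN[OF that]] by (simp add: cover_proj_SL2)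
  show ?thesis unfolding e rotation_eq[OF h] Q_iff
  proof (intro conjI ballI allI)
    have "continuous_map (ucover_topology N xbar) SL2_ucover_topology (\<lambda>c. \<kappa> (cover_proj c))"
      using continuous_map_compose[OF continuous_map_cover_proj[of N xbar], of SL2_ucover_topology \<kappa>] \<kappa> by (simp add: lifts_def o_def)
    then show "continuous_map (ucover_topology N xbar) SL2_ucover_topology ?g"
      by (intro continuous_map_SL2_mult q(1)) (use k0 in \<open>simp_all flip: SL2_cover_simps\<close>)
    show "solves ?g (rotf (\<lambda>q. cover_proj (\<kappa> q)) \<omega>)"
      by (rule solves_rotf[OF q(2) h _ car pr]) (use k0 cover_proj_SL2(1) in auto)
    show "normalized_quasiperiodic S xbar ?g"
      unfolding normalized_quasiperiodic_def
    proof (intro ballI)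
      fix c d assume c: "c \<in> carrier (loop_group N xbar)" and d: "d \<in> ucover N xbar"
      have "g (class_join N c d) = g c \<odot> g d" using q(3) c d by (auto simp: normalized_quasiperiodic_def)
      moreover have "cover_proj (class_join N c d) = cover_proj d" using class_join_in(2) c d by auto
      ultimately show "?g (class_join N c d) = ?g c \<odot> ?g d"
        using c k0 q(6)[of c] q(6)[OF d] kc[OF pN[OF d]] by (simp add: G.m_assoc)
    qed
    fix l assume l: "l \<in> labels S"
    show "adj2 (cover_proj (\<kappa> xbar)) ** b l \<in> SL2" using q(4)[OF l] cover_proj_SL2(1)[OF k0] by simp
    fix \<phi>
    show "rotu (\<lambda>q. cover_proj (\<kappa> q)) u l \<phi> = adj2 (adj2 (cover_proj (\<kappa> xbar)) ** b l) ** cpg ?g (\<alpha> l \<phi>)"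
      using cover_proj_SL2(1)[OF k0] unfolding pr[OF fam_in[OF l]] unfolding fam_proj[OF l]
      by (simp add: rotu_def l q(5)[OF l] adj2_mm mm_assoc)
  qed
qed

text \<open>The gauge function is first defined on the covering manifold, where conjugacy of the holonomies
  makes it invariant under loops.\<close>
lemma Q_related:
  assumes X: "(\<omega>, u) \<in> configs S" "(\<omega>', u') \<in> configs S"
    and Q: "condQ (\<omega>, u) g b" "condQ (\<omega>', u') g' b'"
    and \<beta>: "\<beta> \<in> carrier SL2_cover" "\<beta>' \<in> carrier SL2_cover"
    and hol: "\<And>c. c \<in> carrier (loop_group N xbar) \<Longrightarrow> sinv \<beta> \<odot> g c \<odot> \<beta> = sinv \<beta>' \<odot> g' c \<odot> \<beta>'"
    and bd: "\<And>l. l \<in> labels S \<Longrightarrow> adj2 (cover_proj \<beta>) ** b l = adj2 (cover_proj \<beta>') ** b' l"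
  shows "\<exists>\<kappa>. lifts \<kappa> \<and> (\<omega>', u') = rot \<kappa> (\<omega>, u)"
proof -
  note q = QD[OF Q(1)] and q' = QD[OF Q(2)]
  \<comment> \<open>By \<open>hol\<close> this element intertwines the two holonomies: \<gamma>
    g'(l) = g(l) \<gamma> for every loop l. Hence g^-1 \<gamma> g' takes the same value on all
    classes over one point.\<close>
  define \<gamma> where "\<gamma> = \<beta> \<odot> sinv \<beta>'"
  have \<gamma>: "\<gamma> \<in> carrier SL2_cover" using \<beta> by (simp add: \<gamma>_def)
  define K where "K = (\<lambda>c. sinv (g c) \<odot> \<gamma> \<odot> g' c)"
  \<comment> \<open>An arbitrary class over \<open>q\<close> is selected; \<open>Kinv\<close> shows
    that the value does not depend on it.\<close>
  define \<kappa> where "\<kappa> = (\<lambda>q. K (SOME c. c \<in> ucover N xbar \<and> cover_proj c = q))"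
  have Kc: "K c \<in> carrier SL2_cover" if "c \<in> ucover N xbar" for c using q(6)[OF that] q'(6)[OF that] \<gamma> by (simp add: K_def)
  have loop: "sinv (g c) \<odot> (\<gamma> \<odot> g' c) = \<gamma>" if c: "c \<in> carrier (loop_group N xbar)" for c
  proof -
    have gc: "g c \<in> carrier SL2_cover" "g' c \<in> carrier SL2_cover" using c q(6) q'(6) by auto
    have "\<gamma> \<odot> g' c = \<beta> \<odot> (sinv \<beta>' \<odot> g' c \<odot> \<beta>') \<odot> sinv \<beta>'" using gc \<beta> by (simp add: \<gamma>_def G.m_assoc)
    also have "\<dots> = g c \<odot> \<gamma>" unfolding hol[OF c, symmetric] using gc \<beta> by (simp add: \<gamma>_def G.m_assoc)
    finally show ?thesis using gc \<gamma> by simp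
  qed
  have Kinv: "K d = K c" if cd: "c \<in> ucover N xbar" "d \<in> ucover N xbar" "cover_proj c = cover_proj d" for c d
  proof -
    obtain l where l: "l \<in> carrier (loop_group N xbar)" "d = class_join N l c" using loop_difference[OF cd] by blast
    have gd: "g d = g l \<odot> g c" "g' d = g' l \<odot> g' c"
      using q(3) q'(3) l cd(1) unfolding normalized_quasiperiodic_def by blast+
    have car: "g l \<in> carrier SL2_cover" "g' l \<in> carrier SL2_cover" "g c \<in> carrier SL2_cover" "g' c \<in> carrier SL2_cover"
      using l(1) cd q(6) q'(6) by auto
    have "K d = sinv (g c) \<odot> (sinv (g l) \<odot> (\<gamma> \<odot> g' l)) \<odot> g' c"
      using car \<gamma> by (simp add: K_def gd G.m_assoc G.inv_mult_group)
    then show ?thesis unfolding loop[OF l(1)] K_def .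
  qed
  have \<kappa>K: "\<kappa> (cover_proj c) = K c" if c: "c \<in> ucover N xbar" for c
  proof -
    let ?d = "SOME d. d \<in> ucover N xbar \<and> cover_proj d = cover_proj c"
    have "?d \<in> ucover N xbar \<and> cover_proj ?d = cover_proj c" by (rule someI[of _ c]) (use c in simp)
    then show ?thesis unfolding \<kappa>_def using Kinv[of c ?d] c by simp
  qed
  have cK: "continuous_map (ucover_topology N xbar) SL2_ucover_topology K"
    unfolding K_def by (intro continuous_map_SL2_mult continuous_map_SL2_inv q(1) q'(1)) (use \<gamma> in \<open>simp_all flip: SL2_cover_simps\<close>)
  have c\<kappa>: "continuous_map (top_of_set N) SL2_ucover_topology \<kappa>"
    unfolding continuous_map_ucover_iff topspace_euclidean_subtopology
  proof (intro conjI ballI allI impI)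
    show "\<kappa> \<in> N \<rightarrow> ucover SL2 (mat 1)"
    proof
      fix x assume "x \<in> N"
      then obtain c where c: "c \<in> ucover N xbar" "cover_proj c = x" using class_over by blast
      then show "\<kappa> x \<in> ucover SL2 (mat 1)" using \<kappa>K[OF c(1)] Kc[OF c(1)] by (simp add: SL2_cover_simps)
    qed
    fix x V assume x: "x \<in> N" and V: "open V" "cover_proj (\<kappa> x) \<in> V"
    obtain c where c: "c \<in> ucover N xbar" "cover_proj c = x" using class_over[OF x] by blast
    obtain Om where Om: "openin (ucover_topology N xbar) Om" "c \<in> Om" "K ` Om \<subseteq> prolongations SL2 (K c) V"
      using cK V c unfolding continuous_map_ucover_iff using \<kappa>K[OF c(1)] by force
    obtain k where k: "k \<in> charts S" "x \<in> fst k" using charts_cover[OF x] by blast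
    obtain W where W: "sheet_over N xbar (fst k) W" "c \<in> W" using sheet_exists[OF c(1) k(1)] k(2) c(2) by blast
    \<comment> \<open>An open part of a sheet is a sheet, and sheets have open projections; this
      transfers continuity from the covering manifold to the surface.\<close>
    have W': "sheet_over N xbar (fst k) (W \<inter> Om)"
      using W(1) Om(1) unfolding sheet_over_def by (auto intro: inj_on_subset)
    have "\<kappa> ` cover_proj ` (W \<inter> Om) \<subseteq> prolongations SL2 (\<kappa> x) V"
    proof clarify
      fix d assume d: "d \<in> W" "d \<in> Om"
      then have "d \<in> ucover N xbar" using sheetD(1)[OF W(1)] by blast
      then show "\<kappa> (cover_proj d) \<in> prolongations SL2 (\<kappa> x) V"
        using \<kappa>K[of d] \<kappa>K[OF c(1)] c(2) Om(3) d(2) by auto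
    qed
    then show "\<exists>Om. openin (top_of_set N) Om \<and> x \<in> Om \<and> \<kappa> ` Om \<subseteq> prolongations SL2 (\<kappa> x) V"
      using sheet_proj_open[OF k(1) W'] W(2) Om(2) c(2) by blast
  qed
  have pK: "cover_proj (K c) = adj2 (cpg g c) ** cover_proj \<gamma> ** cpg g' c" if "c \<in> ucover N xbar" for c
    using q(6)[OF that] q'(6)[OF that] \<gamma> by (simp add: K_def cover_proj_SL2)
  have \<omega>: "\<omega> \<in> sl2_forms S" "\<omega>' \<in> sl2_forms S" using X by (auto simp: configs_def)
  have "smooth_wrt (charts S) (\<lambda>q. cover_proj (\<kappa> q))"
  proof (rule smooth_wrtI)
    fix x assume x: "x \<in> N"
    obtain c where c: "c \<in> ucover N xbar" "cover_proj c = x" using class_over[OF x] by blast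
    obtain k where k: "k \<in> charts S" "x \<in> fst k" using charts_cover[OF x] by blast
    obtain W where W: "sheet_over N xbar (fst k) W" "c \<in> W" using sheet_exists[OF c(1) k(1)] k(2) c(2) by blast
    have xW: "x \<in> cover_proj ` W" using W(2) c(2) by blast
    let ?h = "\<lambda>q. cpg g (inv_into W cover_proj q)" and ?h' = "\<lambda>q. cpg g' (inv_into W cover_proj q)"
    note f = frame_partial(1)[OF solves_frame[OF q(2) \<omega>(1) k(1) W(1)] k(1) xW k(2)]
      and f' = frame_partial(1)[OF solves_frame[OF q'(2) \<omega>(2) k(1) W(1)] k(1) xW k(2)]
    have s: "sm_at k (\<lambda>q. adj2 (?h q) ** cover_proj \<gamma> ** ?h' q) x" by (intro sm_at_mm sm_at_adj2 sm_at_const f f')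
    obtain V where V: "open V" "snd k x \<in> V" "\<forall>q'\<in>fst k. snd k q' \<in> V \<longrightarrow> q' \<in> cover_proj ` W"
      using chart_nbhd[OF k(1) sheet_proj_open[OF k(1) W(1)] k(2) xW] by blast
    have "sm_at k (\<lambda>q. cover_proj (\<kappa> q)) x"
    proof (rule sm_at_cong[OF s V(1,2)])
      fix q' assume "q' \<in> fst k" "snd k q' \<in> V"
      then obtain d where d: "d \<in> W" "q' = cover_proj d" using V(3) by blast
      have dN: "d \<in> ucover N xbar" by (rule sheetD(1)[OF W(1) d(1)])
      have "inv_into W cover_proj q' = d" using d sheetD(3)[OF W(1) d(1)] by simp
      then show "adj2 (?h q') ** cover_proj \<gamma> ** ?h' q' = cover_proj (\<kappa> q')" using pK[OF dN] \<kappa>K[OF dN] d(2) by simp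
    qed
    then show "\<exists>k\<in>charts S. x \<in> fst k \<and> sm_at k (\<lambda>q. cover_proj (\<kappa> q)) x" using k by blast
  qed
  then have l: "lifts \<kappa>" using c\<kappa> by (simp add: lifts_def)
  note h = liftsD(2)[OF l]
  have \<gamma>S: "cover_proj \<gamma> \<in> SL2" by (rule cover_proj_SL2(1)[OF \<gamma>])
  have "cpg g' c = adj2 (cover_proj \<gamma>) ** cpg g c ** cover_proj (\<kappa> (cover_proj c))" if c: "c \<in> ucover N xbar" for c
    using \<gamma>S cover_proj_SL2(1)[OF q(6)[OF c]] unfolding \<kappa>K[OF c] pK[OF c] by (simp add: mm_assoc)
  then have "solves g' (rotf (\<lambda>q. cover_proj (\<kappa> q)) \<omega>)"
    by (intro solves_rotf[OF q(2) h _ q'(6), of "adj2 (cover_proj \<gamma>)"]) (use \<gamma>S in auto)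
  then have 1: "\<omega>' = rotf (\<lambda>q. cover_proj (\<kappa> q)) \<omega>"
    using solves_unique_form q'(2) \<omega>(2) rotf_forms[OF \<omega>(1) h] by blast
  have "u' l \<phi> = u l \<phi> ** cover_proj (\<kappa> (circle S l \<phi>))" if l: "l \<in> labels S" for l \<phi>
  proof -
    note a = fam_in[OF l, of \<phi>]
    note gS = cover_proj_SL2(1)[OF q(6)[OF a]]
    have "adj2 (adj2 (cover_proj \<beta>) ** b l) = adj2 (adj2 (cover_proj \<beta>') ** b' l)" using bd[OF l] by simp
    then have "adj2 (b l) ** cover_proj \<beta> ** adj2 (cover_proj \<beta>') = adj2 (b' l)"
      using cover_proj_SL2(1)[OF \<beta>(2)] by (simp add: adj2_mm)
    then have "adj2 (b l) ** cover_proj \<gamma> = adj2 (b' l)" using \<beta> by (simp add: \<gamma>_def cover_proj_SL2 mm_assoc)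
    moreover have "u l \<phi> ** cover_proj (\<kappa> (circle S l \<phi>)) = adj2 (b l) ** cover_proj \<gamma> ** cpg g' (\<alpha> l \<phi>)"
      unfolding fam_proj[OF l, symmetric] \<kappa>K[OF a] pK[OF a] q(5)[OF l] using gS by (simp add: mm_assoc)
    ultimately show ?thesis unfolding q'(5)[OF l] by simp
  qed
  moreover have "u' \<in> extensional (labels S)" using X(2) by (simp add: configs_def boundary_variables_def)
  ultimately have "u' = rotu (\<lambda>q. cover_proj (\<kappa> q)) u" by (auto simp: rotu_def extensional_def fun_eq_iff)
  then show ?thesis using l 1 by (intro exI[of _ \<kappa>]) (simp add: rotation_eq[OF h])
qed

end

subsection \<open>Physical states\<close>

context surf_family begin

lemma physical_states_iff:
  assumes "hbar > 0"
  shows "\<Psi> \<in> physical_states hbar S \<longleftrightarrow>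
    (\<forall>X\<in>configs S. (\<nexists>g b. condQ X g b) \<longrightarrow> \<Psi> X = 0) \<and> lorentz_invariant \<Psi>"
proof -
  have "(\<forall>n\<in>sl2_functions S. hamilton hbar S n X * \<Psi> X = 0) \<longleftrightarrow> ((\<nexists>g b. condQ X g b) \<longrightarrow> \<Psi> X = 0)"
    if "X \<in> configs S" for X
    unfolding hamilton_iff[OF that assms, symmetric] by auto
  then show ?thesis unfolding physical_states_def lorentz_invariant_def by auto
qed

text \<open>The difference quotients vanish because the state is constant along each flow. For
  solutions of (Q) this is the invariance under lifted gauge functions; the remaining configurations
  never reach (Q) along the flow, and there the state is 0.\<close>

lemma lorentz_invariantI:
  assumes 0: "\<And>X. X \<in> configs S \<Longrightarrow> \<nexists>g b. condQ X g b \<Longrightarrow> \<Psi> X = 0"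
    and 1: "\<And>X g b \<kappa>. X \<in> configs S \<Longrightarrow> condQ X g b \<Longrightarrow> lifts \<kappa> \<Longrightarrow>
      \<Psi> (rot \<kappa> X) = \<Psi> X"
  shows "lorentz_invariant \<Psi>"
  unfolding lorentz_invariant_def lorentz_has_def
proof (intro ballI)
  fix X m assume X: "X \<in> configs S" and m: "m \<in> sl2_functions S"
  let ?R = "\<lambda>s. lorentz_rotation S (\<lambda>q. mexp (s *\<^sub>R m q))"
  note sm = sl2_functions_scale[OF m] and g = gauge_exp[OF sl2_functions_scale[OF m]]
  have R: "\<exists>\<kappa>. lifts \<kappa> \<and> rot \<kappa> = ?R s" for s
  proof -
    let ?\<kappa> = "\<lambda>q. path_class SL2 (\<lambda>t. mexp (t *\<^sub>R (s *\<^sub>R m q)))"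
    have l: "lifts ?\<kappa>" by (rule lifts_exp(1)[OF sm])
    have "lorentz_rotation S (\<lambda>q. cover_proj (?\<kappa> q)) Z = ?R s Z" for Z
      by (rule gauge_cong(2)[OF liftsD(2)[OF l]]) (rule lifts_exp(2)[OF sm])
    then have "lorentz_rotation S (\<lambda>q. cover_proj (?\<kappa> q)) = ?R s" by (rule ext)
    then show ?thesis using l by blast
  qed
  have Q: "\<exists>g b. condQ (?R s Z) g b" if "Z \<in> configs S" "condQ Z g b" for s Z g b
  proof -
    obtain \<kappa> where \<kappa>: "lifts \<kappa>" "rot \<kappa> = ?R s" using R by blast
    from rotation_Q[OF that \<kappa>(1)] show ?thesis unfolding \<kappa>(2) by blast
  qed
  have "\<Psi> (?R s X) = \<Psi> X" for s
  proof (cases "\<exists>g b. condQ X g b")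
    case True
    then obtain g b where Q: "condQ X g b" by blast
    obtain \<kappa> where \<kappa>: "lifts \<kappa>" "rot \<kappa> = ?R s" using R by blast
    from 1[OF X Q \<kappa>(1)] show ?thesis unfolding \<kappa>(2) .
  next
    case False
    have c: "?R s X \<in> configs S" by (rule rotation_configs[OF X g])
    \<comment> \<open>Rotating back shows that a configuration without (Q) cannot be rotated into
      one with (Q).\<close>
    have "?R (- s) (?R s X) = lorentz_rotation S (\<lambda>q. mat 1) X"
      unfolding rotation_rotation[OF g g]
      by (rule gauge_cong(2)[OF gauge_mult[OF g g]])
        (use mexp_add[where s = s and t = "- s", OF sl2_functionsD(2)[OF m]] in simp)
    then have "?R (- s) (?R s X) = X" by (simp only: rotation_one[OF X])
    then have "\<nexists>g b. condQ (?R s X) g b" using False Q[OF c, of _ _ "- s"] by auto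
    then show ?thesis using 0[OF c] 0[OF X False] by simp
  qed
  then show "((\<lambda>s. \<Psi> (?R s X)) has_vector_derivative 0) (at 0)" by simp
qed

text \<open>Both conjugated holonomies are homomorphisms on the loop group, so their agreement on
  the primitive loops extends to all loops. Then the two configurations are related by a rotation
  whose gauge function lifts.\<close>

lemma Q_invariants:
  assumes Y: "primitive_loops S xbar Y" and X: "X \<in> configs S" "X' \<in> configs S"
    and Q: "condQ X g b" "condQ X' g' b'"
    and \<beta>: "\<beta> \<in> carrier SL2_cover" "\<beta>' \<in> carrier SL2_cover"
    and hol: "\<And>c. c \<in> Y \<Longrightarrow> conj_by (cover_proj \<beta>) (g c) = conj_by (cover_proj \<beta>') (g' c)"
    and bd: "\<And>l. l \<in> labels S \<Longrightarrow> adj2 (cover_proj \<beta>) ** b l = adj2 (cover_proj \<beta>') ** b' l"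
    and inv: "lorentz_invariant \<Psi>"
  shows "\<Psi> X = \<Psi> X'"
proof -
  obtain \<omega> u \<omega>' u' where e: "X = (\<omega>, u)" "X' = (\<omega>', u')" by (cases X, cases X')
  note q = QD[OF Q(1)[unfolded e]] and q' = QD[OF Q(2)[unfolded e]]
  have Yc: "Y \<subseteq> carrier (loop_group N xbar)" "generate (loop_group N xbar) Y = carrier (loop_group N xbar)"
    using Y by (auto simp: primitive_loops_def)
  have "sinv \<beta> \<odot> g c \<odot> \<beta> = sinv \<beta>' \<odot> g' c \<odot> \<beta>'" if c: "c \<in> carrier (loop_group N xbar)" for c
  proof (rule hom_eq_on_generate[OF group_loop_group[OF xbar] group_SL2_cover quasiperiodic_hom[OF q(3,6) \<beta>(1)] quasiperiodic_hom[OF q'(3,6) \<beta>(2)] Yc(1)])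
    show "c \<in> generate (loop_group N xbar) Y" using c Yc(2) by simp
    fix y assume y: "y \<in> Y"
    then have "y \<in> ucover N xbar" using Yc(1) by auto
    then show "sinv \<beta> \<odot> g y \<odot> \<beta> = sinv \<beta>' \<odot> g' y \<odot> \<beta>'"
      using hol[OF y] conj_by_eq[OF \<beta>(1) refl q(6)] conj_by_eq[OF \<beta>(2) refl q'(6)] by simp
  qed
  from Q_related[OF X[unfolded e] Q[unfolded e] \<beta> this bd]
  obtain \<kappa> where "lifts \<kappa>" "X' = rot \<kappa> X" unfolding e by blast
  then show ?thesis using invariant_lifts[OF inv X(1)] by simp
qed

text \<open>Any lift of \<open>b l0\<close> turns the variables of \<open>F\<close> into the data
  required by \<open>Q_invariants\<close>; at the distinguished boundary both sides of the condition
  on b are the unit matrix. These variables do not change under rotations, so \<open>F\<close> is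
  unrestricted.\<close>

lemma physical_states_boundary:
  assumes hb: "hbar > 0" and Y: "primitive_loops S xbar Y" and l0: "l0 \<in> labels S"
  shows "physical_states hbar S = {\<Psi>.
    \<exists>F. \<forall>X\<in>configs S. (\<forall>g b. condQ X g b \<longrightarrow>
         \<Psi> X = F (\<lambda>c\<in>Y. conj_by (b l0) (g c)) (\<lambda>l\<in>labels S - {l0}. matrix_inv (b l0) ** b l)) \<and>
       ((\<nexists>g b. condQ X g b) \<longrightarrow> \<Psi> X = 0)}" (is "_ = {\<Psi>. \<exists>F. ?P \<Psi> F}")
proof (intro Set.set_eqI iffI; unfold mem_Collect_eq)
  fix \<Psi>
  let ?A = "\<lambda>g b. \<lambda>c\<in>Y. conj_by (b l0) (g c)" and ?B = "\<lambda>b. \<lambda>l\<in>labels S - {l0}. matrix_inv (b l0) ** b l"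
  have bS: "b l \<in> SL2" if "condQ X g b" "l \<in> labels S" for X g b l
    using that by (cases X) (auto simp: Q_iff)
  {
    assume "\<Psi> \<in> physical_states hbar S"
    then have 0: "\<And>X. X \<in> configs S \<Longrightarrow> \<nexists>g b. condQ X g b \<Longrightarrow> \<Psi> X = 0" and inv: "lorentz_invariant \<Psi>"
      using physical_states_iff[OF hb] by auto
    define T where "T = (\<lambda>f e X. X \<in> configs S \<and> (\<exists>g b. condQ X g b \<and> f = ?A g b \<and> e = ?B b))"
    \<comment> \<open>The value at any configuration with these invariants; \<open>uni\<close> shows
      that the choice does not matter. On arguments that no configuration attains the value is
      arbitrary.\<close>
    define F where "F = (\<lambda>f e. \<Psi> (SOME X. T f e X))"
    have uni: "\<Psi> X = \<Psi> X'" if T: "T f e X" "T f e X'" for f e X X'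
    proof -
      obtain g b where X: "X \<in> configs S" "condQ X g b" "f = ?A g b" "e = ?B b" using T(1) T_def by blast
      obtain g' b' where X': "X' \<in> configs S" "condQ X' g' b'" "f = ?A g' b'" "e = ?B b'" using T(2) T_def by blast
      obtain \<beta> where \<beta>: "\<beta> \<in> carrier SL2_cover" "cover_proj \<beta> = b l0" using SL2_path_connected[OF bS[OF X(2) l0]] by blast
      obtain \<beta>' where \<beta>': "\<beta>' \<in> carrier SL2_cover" "cover_proj \<beta>' = b' l0" using SL2_path_connected[OF bS[OF X'(2) l0]] by blast
      show ?thesis
      proof (rule Q_invariants[OF Y X(1) X'(1) X(2) X'(2) \<beta>(1) \<beta>'(1) _ _ inv])
        show "conj_by (cover_proj \<beta>) (g c) = conj_by (cover_proj \<beta>') (g' c)" if "c \<in> Y" for c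
          using fun_cong[OF X(3)[unfolded X'(3)], of c] that by (simp add: \<beta> \<beta>')
        show "adj2 (cover_proj \<beta>) ** b l = adj2 (cover_proj \<beta>') ** b' l" if "l \<in> labels S" for l
        proof (cases "l = l0")
          case True then show ?thesis using bS[OF X(2) l0] bS[OF X'(2) l0] by (simp add: \<beta> \<beta>')
        next
          case False then show ?thesis
            using fun_cong[OF X(4)[unfolded X'(4)], of l] that bS[OF X(2) l0] bS[OF X'(2) l0] by (simp add: \<beta> \<beta>')
        qed
      qed
    qed
    have "\<Psi> X = F (?A g b) (?B b)" if "X \<in> configs S" "condQ X g b" for X g b
    proof -
      have T: "T (?A g b) (?B b) X" using that T_def by blast
      show ?thesis unfolding F_def by (rule uni[OF T someI[of "T (?A g b) (?B b)", OF T]])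
    qed
    then show "\<exists>F. ?P \<Psi> F" using 0 by blast
  }
  assume "\<exists>F. ?P \<Psi> F"
  then obtain F where F: "\<And>X g b. X \<in> configs S \<Longrightarrow> condQ X g b \<Longrightarrow> \<Psi> X = F (?A g b) (?B b)"
    and 0: "\<And>X. X \<in> configs S \<Longrightarrow> \<nexists>g b. condQ X g b \<Longrightarrow> \<Psi> X = 0" by blast
  have "lorentz_invariant \<Psi>"
  proof (rule lorentz_invariantI[OF 0])
    fix X g b \<kappa> assume X: "X \<in> configs S" and Q: "condQ X g b" and \<kappa>: "lifts \<kappa>"
    let ?g = "\<lambda>c. sinv (\<kappa> xbar) \<odot> g c \<odot> \<kappa> (cover_proj c)" and ?b = "\<lambda>l. adj2 (cover_proj (\<kappa> xbar)) ** b l"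
    note Q' = rotation_Q[OF X Q \<kappa>]
    have k: "\<kappa> xbar \<in> carrier SL2_cover" by (rule liftsD(1)[OF \<kappa> xbar])
    obtain \<beta> where \<beta>: "\<beta> \<in> carrier SL2_cover" "cover_proj \<beta> = b l0" using SL2_path_connected[OF bS[OF Q l0]] by blast
    \<comment> \<open>A lift of the rotated b: the element at the base point, which also conjugates
      the holonomies, then cancels in the conjugation.\<close>
    have \<beta>': "sinv (\<kappa> xbar) \<odot> \<beta> \<in> carrier SL2_cover" "cover_proj (sinv (\<kappa> xbar) \<odot> \<beta>) = ?b l0"
      using k \<beta> by (simp_all add: cover_proj_SL2)
    have "conj_by (?b l0) (?g c) = conj_by (b l0) (g c)" if "c \<in> Y" for c
    proof -
      have c: "c \<in> ucover N xbar" "cover_proj c = xbar" using Y that by (auto simp: primitive_loops_def)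
      have gc: "g c \<in> carrier SL2_cover" using Q c(1) by (cases X) (auto dest: QD(6))
      show ?thesis
        using conj_by_eq[OF \<beta>' , of "?g c"] conj_by_eq[OF \<beta> gc] c(2) k gc \<beta>(1) by (simp add: G.m_assoc G.inv_mult_group)
    qed
    then have "?A ?g ?b = ?A g b" by (auto intro!: restrict_ext)
    moreover have "?B ?b = ?B b"
      using bS[OF Q l0] bS[OF Q' l0] cover_proj_SL2(1)[OF k] by (auto intro!: restrict_ext simp: adj2_mm mm_assoc)
    ultimately show "\<Psi> (rot \<kappa> X) = \<Psi> X"
      using F[OF X Q] F[OF rotation_configs[OF X liftsD(2)[OF \<kappa>]] Q'] by simp
  qed
  then show "\<Psi> \<in> physical_states hbar S" using physical_states_iff[OF hb] 0 by blast
qed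

text \<open>Without a boundary no b is available to absorb the value of the gauge function at the
  base point. It acts on the holonomies by a common conjugation, under which \<open>F\<close> has to
  be invariant.\<close>

lemma physical_states_closed:
  assumes hb: "hbar > 0" and Y: "primitive_loops S xbar Y" and closed: "labels S = {}"
  shows "physical_states hbar S = {\<Psi>.
    \<exists>F. (\<forall>f\<in>Y \<rightarrow>\<^sub>E carrier SL2_cover. \<forall>h\<in>SL2. F f = F (\<lambda>c\<in>Y. conj_by h (f c))) \<and>
       (\<forall>f\<in>Y \<rightarrow>\<^sub>E carrier SL2_cover. \<not> satisfies_relations S xbar Y f \<longrightarrow> F f = 0) \<and>
       (\<forall>X\<in>configs S. (\<forall>g b. condQ X g b \<longrightarrow> \<Psi> X = F (\<lambda>c\<in>Y. g c)) \<and>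
       ((\<nexists>g b. condQ X g b) \<longrightarrow> \<Psi> X = 0))}" (is "_ = {\<Psi>. \<exists>F. ?P \<Psi> F}")
proof (intro Set.set_eqI iffI; unfold mem_Collect_eq)
  fix \<Psi>
  let ?A = "\<lambda>g. \<lambda>c\<in>Y. g c"
  have Yc: "y \<in> ucover N xbar" "cover_proj y = xbar" if "y \<in> Y" for y using Y that by (auto simp: primitive_loops_def)
  have car: "g c \<in> carrier SL2_cover" if "condQ X g b" "c \<in> Y" for X g b c
    using that(1) Yc(1)[OF that(2)] by (cases X) (auto dest: QD(6))
  {
    assume "\<Psi> \<in> physical_states hbar S"
    then have 0: "\<And>X. X \<in> configs S \<Longrightarrow> \<nexists>g b. condQ X g b \<Longrightarrow> \<Psi> X = 0" and inv: "lorentz_invariant \<Psi>"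
      using physical_states_iff[OF hb] by auto
    define T where "T = (\<lambda>f X. X \<in> configs S \<and> (\<exists>g b. condQ X g b \<and> f = ?A g))"
    \<comment> \<open>The default value 0 matters. It gives the support condition, since attained
      families satisfy all relations, and conjugation invariance also on unattained families, since
      these are carried to unattained ones.\<close>
    define F where "F = (\<lambda>f. if \<exists>X. T f X then \<Psi> (SOME X. T f X) else 0)"
    have uni: "\<Psi> X = \<Psi> X'" if T: "T f X" "T f X'" for f X X'
    proof -
      obtain g b where X: "X \<in> configs S" "condQ X g b" "f = ?A g" using T(1) T_def by blast
      obtain g' b' where X': "X' \<in> configs S" "condQ X' g' b'" "f = ?A g'" using T(2) T_def by blast
      have "g c = g' c" if "c \<in> Y" for c using fun_cong[OF X(3)[unfolded X'(3)], of c] that by simp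
      then show ?thesis
        by (intro Q_invariants[OF Y X(1) X'(1) X(2) X'(2) G.one_closed G.one_closed _ _ inv]) (auto simp: closed)
    qed
    have FT: "F f = \<Psi> X" if T: "T f X" for f X
    proof -
      have ex: "\<exists>X. T f X" using T by blast
      show ?thesis unfolding F_def if_P[OF ex] by (rule uni[OF someI[of "T f", OF T] T])
    qed
    \<comment> \<open>Rotation by a constant with lift \<open>k\<close> conjugates every holonomy by
      \<open>k\<close> and keeps the value of the state.\<close>
    have conj_T: "\<exists>X'. T (\<lambda>c\<in>Y. conj_by h (f c)) X' \<and> \<Psi> X' = \<Psi> X" if T: "T f X" and h: "h \<in> SL2" for f X h
    proof -
      obtain g b where X: "X \<in> configs S" "condQ X g b" "f = ?A g" using T T_def by blast
      obtain k where k: "k \<in> carrier SL2_cover" "cover_proj k = h" using SL2_path_connected[OF h] by blast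
      note l = lifts_const[OF k(1)]
      let ?X = "lorentz_rotation S (\<lambda>q. cover_proj k) X"
      have "(\<lambda>c\<in>Y. conj_by h (f c)) = ?A (\<lambda>c. sinv k \<odot> g c \<odot> k)"
        using conj_by_eq[OF k car[OF X(2)]] by (auto intro!: restrict_ext simp: X(3))
      then have "T (\<lambda>c\<in>Y. conj_by h (f c)) ?X"
        using rotation_Q[OF X(1,2) l] rotation_configs[OF X(1) liftsD(2)[OF l]] unfolding T_def by blast
      moreover have "\<Psi> ?X = \<Psi> X" by (rule invariant_lifts[OF inv X(1) l])
      ultimately show ?thesis by blast
    qed
    have "?P \<Psi> F"
    proof (intro conjI ballI impI allI)
      fix X assume X: "X \<in> configs S"
      show "\<Psi> X = F (?A g)" if "condQ X g b" for g b
        by (rule FT[symmetric]) (use X that T_def in blast)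
      show "\<nexists>g b. condQ X g b \<Longrightarrow> \<Psi> X = 0" by (rule 0[OF X])
    next
      fix f assume f: "f \<in> Y \<rightarrow>\<^sub>E carrier SL2_cover"
      show "F f = F (\<lambda>c\<in>Y. conj_by h (f c))" if h: "h \<in> SL2" for h
      proof (cases "\<exists>X. T f X")
        case True
        then obtain X X' where "T f X" "T (\<lambda>c\<in>Y. conj_by h (f c)) X'" "\<Psi> X' = \<Psi> X" using conj_T[OF _ h] by blast
        then show ?thesis using FT by simp
      next
        case False
        let ?f = "\<lambda>c\<in>Y. conj_by h (f c)"
        obtain k where k: "k \<in> carrier SL2_cover" "cover_proj k = h" using SL2_path_connected[OF h] by blast
        have k': "sinv k \<in> carrier SL2_cover" "cover_proj (sinv k) = adj2 h" using k by (auto simp: cover_proj_SL2)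
        \<comment> \<open>Conjugation by the inverse recovers the family, also outside
          \<open>Y\<close>, where both sides are \<open>undefined\<close>. So a family is attained
          if its conjugate is.\<close>
        have "(\<lambda>c\<in>Y. conj_by (adj2 h) (?f c)) = f"
        proof
          fix c show "(\<lambda>c\<in>Y. conj_by (adj2 h) (?f c)) c = f c"
          proof (cases "c \<in> Y")
            case True
            then have fc: "f c \<in> carrier SL2_cover" using PiE_mem[OF f] by blast
            show ?thesis using True conj_by_eq[OF k fc] conj_by_eq[OF k', of "conj_by h (f c)"] k(1) fc
              by (simp add: G.m_assoc)
          next
            case False
            have "f c = undefined" by (rule PiE_arb[OF f False])
            then show ?thesis using False by simp
          qed
        qed
        note eq_f = this
        have "\<nexists>X. T ?f X"
        proof
          assume "\<exists>X. T ?f X"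
          then obtain X where X: "T ?f X" by blast
          have "adj2 h \<in> SL2" using h by simp
          from conj_T[OF X this] show False unfolding eq_f using False by blast
        qed
        then show ?thesis using False by (simp add: F_def)
      qed
      assume nr: "\<not> satisfies_relations S xbar Y f"
      have "\<nexists>X. T f X"
      proof
        assume "\<exists>X. T f X"
        then obtain X g b where X: "condQ X g b" "f = ?A g" using T_def by blast
        obtain \<omega> u where e: "X = (\<omega>, u)" by (cases X)
        note q = QD[OF X(1)[unfolded e]]
        note gr = group_loop_group[OF xbar] group_SL2_cover
        \<comment> \<open>Conjugation by the unit changes nothing, but it brings the holonomy into
          the form for which the homomorphism property is stated.\<close>
        let ?g = "\<lambda>c. sinv \<one>\<^bsub>SL2_cover\<^esub> \<odot> g c \<odot> \<one>\<^bsub>SL2_cover\<^esub>"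
        have hom: "?g \<in> hom (loop_group N xbar) SL2_cover" by (rule quasiperiodic_hom[OF q(3,6) G.one_closed])
        have Yl: "Y \<subseteq> carrier (loop_group N xbar)" using Y by (simp add: primitive_loops_def)
        have fg: "f y = ?g y" if "y \<in> Y" for y using that q(6)[OF Yc(1)[OF that]] by (simp add: X(2))
        have "word_value SL2_cover f w = \<one>\<^bsub>SL2_cover\<^esub>"
          if w: "w \<in> lists (Y \<times> UNIV)" "word_value (loop_group N xbar) (\<lambda>y. y) w = \<one>\<^bsub>loop_group N xbar\<^esub>" for w
          using word_value_hom(1)[OF gr hom Yl fg w(1)] hom_one[OF hom gr] w(2) by metis
        then show False using nr unfolding satisfies_relations_def by blast
      qed
      then show "F f = 0" by (simp add: F_def)
    qed
    then show "\<exists>F. ?P \<Psi> F" by blast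
  }
  assume "\<exists>F. ?P \<Psi> F"
  then obtain F where cF: "\<And>f h. f \<in> Y \<rightarrow>\<^sub>E carrier SL2_cover \<Longrightarrow> h \<in> SL2 \<Longrightarrow> F f = F (\<lambda>c\<in>Y. conj_by h (f c))"
    and F: "\<And>X g b. X \<in> configs S \<Longrightarrow> condQ X g b \<Longrightarrow> \<Psi> X = F (?A g)"
    and 0: "\<And>X. X \<in> configs S \<Longrightarrow> \<nexists>g b. condQ X g b \<Longrightarrow> \<Psi> X = 0" by blast
  have "lorentz_invariant \<Psi>"
  proof (rule lorentz_invariantI[OF 0])
    fix X g b \<kappa> assume X: "X \<in> configs S" and Q: "condQ X g b" and \<kappa>: "lifts \<kappa>"
    let ?g = "\<lambda>c. sinv (\<kappa> xbar) \<odot> g c \<odot> \<kappa> (cover_proj c)" and ?h = "cover_proj (\<kappa> xbar)"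
    note Q' = rotation_Q[OF X Q \<kappa>]
    have k: "\<kappa> xbar \<in> carrier SL2_cover" by (rule liftsD(1)[OF \<kappa> xbar])
    have "(\<lambda>c\<in>Y. conj_by ?h (?A g c)) = ?A ?g"
      using conj_by_eq[OF k refl car[OF Q]] Yc(2) by (auto intro!: restrict_ext)
    moreover have "?A g \<in> Y \<rightarrow>\<^sub>E carrier SL2_cover" using car[OF Q] by auto
    ultimately have "F (?A g) = F (?A ?g)" using cF[of "?A g" ?h] cover_proj_SL2(1)[OF k] by simp
    then show "\<Psi> (rot \<kappa> X) = \<Psi> X"
      using F[OF X Q] F[OF rotation_configs[OF X liftsD(2)[OF \<kappa>]] Q'] by simp
  qed
  then show "\<Psi> \<in> physical_states hbar S" using physical_states_iff[OF hb] 0 by blast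
qed

end

theorem theorem4p1:
  fixes S :: "('a::t2_space, 'l) surface"
    and xbar :: 'a
    and \<alpha> :: "'l \<Rightarrow> real \<Rightarrow> (real \<Rightarrow> 'a) set"
    and Y :: "(real \<Rightarrow> 'a) set set"
    and hbar :: real
  assumes "hbar > 0"
    and "smooth_surface S" and "oriented_surface S" and "trivial_tangent_bundle S"
    and "compact (points S)" and "connected (points S)"
    and "boundary_circles S"
    and "xbar \<in> points S"
    and "boundary_families S xbar \<alpha>"
    and "primitive_loops S xbar Y"
  shows "(\<forall>l0\<in>labels S. physical_states hbar S = {\<Psi>.
            \<exists>F :: ((real \<Rightarrow> 'a) set \<Rightarrow> (real \<Rightarrow> real^2^2) set) \<Rightarrow> ('l \<Rightarrow> real^2^2) \<Rightarrow> complex.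
              \<forall>X\<in>configs S.
                (\<forall>g b. condition_Q S xbar \<alpha> X g b \<longrightarrow>
                   \<Psi> X = F (\<lambda>c\<in>Y. conj_by (b l0) (g c))
                          (\<lambda>l\<in>labels S - {l0}. matrix_inv (b l0) ** b l)) \<and>
                ((\<nexists>g b. condition_Q S xbar \<alpha> X g b) \<longrightarrow> \<Psi> X = 0)}) \<and>
         (labels S = {} \<longrightarrow> physical_states hbar S = {\<Psi>.
            \<exists>F :: ((real \<Rightarrow> 'a) set \<Rightarrow> (real \<Rightarrow> real^2^2) set) \<Rightarrow> complex.
              (\<forall>f\<in>Y \<rightarrow>\<^sub>E carrier SL2_cover. \<forall>h\<in>SL2. F f = F (\<lambda>c\<in>Y. conj_by h (f c))) \<and>
              (\<forall>f\<in>Y \<rightarrow>\<^sub>E carrier SL2_cover. \<not> satisfies_relations S xbar Y f \<longrightarrow> F f = 0) \<and>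
              (\<forall>X\<in>configs S.
                (\<forall>g b. condition_Q S xbar \<alpha> X g b \<longrightarrow> \<Psi> X = F (\<lambda>c\<in>Y. g c)) \<and>
                ((\<nexists>g b. condition_Q S xbar \<alpha> X g b) \<longrightarrow> \<Psi> X = 0))})"
proof -
  interpret surf_family S xbar \<alpha>
    using assms by unfold_locales
  show ?thesis
    by (intro conjI ballI impI physical_states_boundary[OF assms(1,10)] physical_states_closed[OF assms(1,10)])
qed

end
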